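(* (a) Let $(H,\mathbb{A},E)$ be a Dirac Lie group. Then the total space of $\mathbb{A}$ has naturally the structure of a $\mathcal{VB}$-groupoid $\mathbb{A}\rightrightarrows \mathbb{A}^{(0)}$ over the group $H\rightrightarrows \mathrm{pt}$, with space of units $\mathbb{A}^{(0)}=E_e$ (the fiber of $E$ at the group unit $e\in H$), in such a way that $\mathrm{Mult}_{\mathbb{A}}$ becomes the groupoid multiplication, i.e. $(x_1,x_2)\sim_{\mathrm{Mult}_{\mathbb{A}}}x$ if and only if $x_1,x_2$ are composable and $x=x_1\circ x_2$. The subbundle $E$ is a vacant $\mathcal{VB}$-subgroupoid, with the same space of units $E^{(0)}=E_e$. (b) Given a Dirac action $\mathcal{A}_{\mathbb{P}}$ of $(H,\mathbb{A},E)$ on a Dirac manifold $(M,\mathbb{P},L)$, the bundle $\mathbb{P}$ is naturally a $\mathcal{VB}$-module over the $\mathcal{VB}$-groupoid $\mathbb{A}$, in such a way that $\mathcal{A}_{\mathbb{P}}$ becomes the groupoid action, i.e. $(x,y)\sim_{\mathcal{A}_{\mathbb{P}}}y'$ if and only if $x,y$ are composable and $y'=x\circ y$. The subbundle $L\subseteq\mathbb{P}$ is a submodule over the subgroupoid $E\subseteq\mathbb{A}$.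
   Context: Courant algebroid: a vector bundle $\mathbb{A}\to M$ with a nondegenerate symmetric fiberwise bilinear form $\langle\cdot,\cdot\rangle$ (metric), an anchor $\mathsf{a}:\mathbb{A}\to TM$, and a bilinear bracket $[\![\cdot,\cdot]\!]$ on $\Gamma(\mathbb{A})$ with (1) $[\![\sigma_1,[\![\sigma_2,\sigma_3]\!]]\!]=[\![[\![\sigma_1,\sigma_2]\!],\sigma_3]\!]+[\![\sigma_2,[\![\sigma_1,\sigma_3]\!]]\!]$, (2) $\mathsf{a}(\sigma_1)\langle\sigma_2,\sigma_3\rangle=\langle[\![\sigma_1,\sigma_2]\!],\sigma_3\rangle+\langle\sigma_2,[\![\sigma_1,\sigma_3]\!]\rangle$, (3) $[\![\sigma_1,\sigma_2]\!]+[\![\sigma_2,\sigma_1]\!]=\mathsf{a}^*d\langle\sigma_1,\sigma_2\rangle$ (with $\mathbb{A}^*\cong\mathbb{A}$ by the metric). $\overline{\mathbb{A}}$ is $\mathbb{A}$ with the opposite metric. A Dirac structure $(\mathbb{A},E)$ on $M$ is a Courant algebroid $\mathbb{A}\to M$ with a Lagrangian subbundle $E$ whose sections are closed under the bracket; $(M,\mathbb{A},E)$ is then a Dirac manifold. Courant morphism $R:\mathbb{A}_1\dashrightarrow\mathbb{A}_2$ over $\Phi:M_1\to M_2$: a Lagrangian subbundle $R\subseteq\mathbb{A}_2\times\overline{\mathbb{A}}_1$ along $\mathrm{Gr}(\Phi)$ with $(\mathsf{a}_2\times\mathsf{a}_1)(R)\subseteq \mathrm{Gr}(T\Phi)$,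 such that if two sections of $\mathbb{A}_2\times\overline{\mathbb{A}}_1$ restrict to sections of $R$ so does their bracket. Write $x_1\sim_R x_2$ if $(x_2,x_1)\in R$. A Dirac morphism $(M_1,\mathbb{A}_1,E_1)\dashrightarrow(M_2,\mathbb{A}_2,E_2)$ is a Courant morphism such that for all $m\in M_1$ and $x_2\in(E_2)_{\Phi(m)}$ there is a unique $x_1\in(E_1)_m$ with $x_1\sim_R x_2$. Dirac morphisms compose as relations. Dirac Lie group: a Lie group $H$ with a Dirac structure $(\mathbb{A},E)$ and Dirac morphisms $\mathrm{Mult}_{\mathbb{A}}:(H,\mathbb{A},E)\times(H,\mathbb{A},E)\dashrightarrow(H,\mathbb{A},E)$ and $\epsilon_{\mathbb{A}}:(\mathrm{pt},0,0)\dashrightarrow(H,\mathbb{A},E)$ over the group multiplication and the inclusion of $e$, such that $\mathrm{Mult}_{\mathbb{A}}\circ(\mathrm{Mult}_{\mathbb{A}}\times\mathrm{id})=\mathrm{Mult}_{\mathbb{A}}\circ(\mathrm{id}\times\mathrm{Mult}_{\mathbb{A}})$ and $\mathrm{Mult}_{\mathbb{A}}\circ(\epsilon_{\mathbb{A}}\times\mathrm{id})=\mathrm{id}=\mathrm{Mult}_{\mathbb{A}}\circ(\mathrm{id}\times\epsilon_{\mathbb{A}})$. Dirac action of $(H,\mathbb{A},E)$ on $(M,\mathbb{P},L)$: a Dirac morphism $\mathcal{A}_{\mathbb{P}}:(H,\mathbb{A},E)\times(M,\mathbb{P},L)\dashrightarrow(M,\mathbb{P},L)$ whose base map is an $H$-action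 on $M$, with $\mathcal{A}_{\mathbb{P}}\circ(\mathrm{id}\times\mathcal{A}_{\mathbb{P}})=\mathcal{A}_{\mathbb{P}}\circ(\mathrm{Mult}_{\mathbb{A}}\times\mathrm{id})$ and $\mathcal{A}_{\mathbb{P}}\circ(\epsilon_{\mathbb{A}}\times\mathrm{id})=\mathrm{id}$. A $\mathcal{VB}$-groupoid over a Lie group $H$ is a Lie groupoid $V\rightrightarrows V^{(0)}$ such that $V\to H$ is a vector bundle and the graph $\{(x_1\circ x_2,x_1,x_2)\}$ of its multiplication is a vector subbundle of $V\times V\times V$ along the graph of the multiplication of $H$; then $V^{(0)}$ is a subspace of $V_e$ and source and target $\mathsf{s},\mathsf{t}:V\to V^{(0)}$ are fiberwise linear. It is vacant if $V^{(0)}=V_e$ (equivalently $\mathsf{s},\mathsf{t}$ are fiberwise isomorphisms). A $\mathcal{VB}$-module over $V$ is a vector bundle $P\to M$ with a groupoid action of $V$, with moment map $\mathsf{u}_P:P\to V^{(0)}$ ($x\circ y$ is defined iff $\mathsf{s}(x)=\mathsf{u}_P(y)$), such that the graph $\{(x\circ y,x,y)\}$ is a vector subbundle of $P\times V\times P$ along the graph of an $H$-action on $M$. *)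

theory Defs
  imports "HOL-Analysis.Analysis" "HOL-Algebra.Group_Action"
begin

section \<open>Smooth maps between subsets of Euclidean spaces\<close>

text \<open>On open sets \<open>N\<close> this is the class \<open>C\<^sup>k\<close>: a map is \<open>C\<^sup>k\<^sup>+\<^sup>1\<close> iff it is differentiable and
  all its directional derivatives are \<open>C\<^sup>k\<close>.\<close>

primrec Ck_on :: "nat \<Rightarrow> 'b::euclidean_space set \<Rightarrow> ('b \<Rightarrow> 'c::euclidean_space) \<Rightarrow> bool" where
  "Ck_on 0 N f \<longleftrightarrow> continuous_on N f"
| "Ck_on (Suc k) N f \<longleftrightarrow> (\<forall>x\<in>N. f differentiable (at x)) \<and>
     (\<forall>v. Ck_on k N (\<lambda>x. frechet_derivative f (at x) v))"

text \<open>A map on an arbitrary set \<open>S\<close> is smooth if locally it extends to a smooth map on an open set.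
  For relatively open subsets of a linear subspace this is smoothness in linear coordinates.\<close>

definition smooth_on :: "'b::euclidean_space set \<Rightarrow> ('b \<Rightarrow> 'c::euclidean_space) \<Rightarrow> bool" where
  "smooth_on S f \<longleftrightarrow> (\<forall>x\<in>S. \<exists>N g. open N \<and> x \<in> N \<and> (\<forall>k. Ck_on k N g) \<and> (\<forall>y\<in>N \<inter> S. f y = g y))"


section \<open>Manifolds\<close>

text \<open>A manifold is given by its atlas, a set of charts \<open>(U, \<phi>)\<close>; its set of points is the union of the
  chart domains. A \<open>d\<close>-dimensional chart takes values in some \<open>d\<close>-dimensional linear subspace
  (a copy of \<open>\<real>\<^sup>d\<close>) of the Euclidean space \<open>'b\<close>, in which its image is open. Thus dimension \<open>0\<close> is
  included, and a submanifold is a manifold modelled on the same type.\<close>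

type_synonym ('m, 'b) atlas = "('m set \<times> ('m \<Rightarrow> 'b)) set"

definition points :: "('m, 'b) atlas \<Rightarrow> 'm set" where
  "points \<A> = (\<Union>(U, \<phi>)\<in>\<A>. U)"

definition is_chart :: "nat \<Rightarrow> 'm set \<times> ('m \<Rightarrow> 'b::euclidean_space) \<Rightarrow> bool" where
  "is_chart d = (\<lambda>(U, \<phi>). inj_on \<phi> U \<and>
     (\<exists>W. subspace W \<and> dim W = d \<and> openin (top_of_set W) (\<phi> ` U)))"

definition compatible ::
  "'m set \<times> ('m \<Rightarrow> 'b::euclidean_space) \<Rightarrow> 'm set \<times> ('m \<Rightarrow> 'b) \<Rightarrow> bool" where
  "compatible = (\<lambda>(U, \<phi>) (V, \<psi>).
     openin (top_of_set (\<phi> ` U)) (\<phi> ` (U \<inter> V)) \<and> smooth_on (\<phi> ` (U \<inter> V)) (\<psi> \<circ> inv_into U \<phi>) \<and>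
     openin (top_of_set (\<psi> ` V)) (\<psi> ` (U \<inter> V)) \<and> smooth_on (\<psi> ` (U \<inter> V)) (\<phi> \<circ> inv_into V \<psi>))"

definition smooth_atlas :: "('m, 'b::euclidean_space) atlas \<Rightarrow> bool" where
  "smooth_atlas \<A> \<longleftrightarrow> (\<exists>d. \<forall>c\<in>\<A>. is_chart d c) \<and> (\<forall>c\<in>\<A>. \<forall>c'\<in>\<A>. compatible c c')"

definition manifold_topology :: "('m, 'b::euclidean_space) atlas \<Rightarrow> 'm topology" where
  "manifold_topology \<A> = topology_generated_by {U \<inter> \<phi> -` N | U \<phi> N. (U, \<phi>) \<in> \<A> \<and> open N}"

definition smooth_manifold :: "('m, 'b::euclidean_space) atlas \<Rightarrow> bool" where
  "smooth_manifold \<A> \<longleftrightarrow> smooth_atlas \<A> \<and>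
     Hausdorff_space (manifold_topology \<A>) \<and> second_countable (manifold_topology \<A>)"

definition max_atlas :: "('m, 'b::euclidean_space) atlas \<Rightarrow> ('m, 'b) atlas" where
  "max_atlas \<A> = {c. fst c \<subseteq> points \<A> \<and> smooth_atlas (insert c \<A>)}"

definition prod_atlas :: "('m, 'b) atlas \<Rightarrow> ('n, 'c) atlas \<Rightarrow> ('m \<times> 'n, 'b \<times> 'c) atlas" where
  "prod_atlas \<A> \<B> = {(U \<times> V, map_prod \<phi> \<psi>) | U \<phi> V \<psi>. (U, \<phi>) \<in> \<A> \<and> (V, \<psi>) \<in> \<B>}"

definition pt_atlas :: "(unit, real) atlas" where
  "pt_atlas = {({()}, \<lambda>_. 0)}"

definition real_atlas :: "(real, real) atlas" where
  "real_atlas = {(UNIV, \<lambda>x. x)}"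

text \<open>The submanifold \<open>S\<close> inherits the restrictions of the slice charts.\<close>

definition restrict_atlas :: "('m, 'b::euclidean_space) atlas \<Rightarrow> 'm set \<Rightarrow> ('m, 'b) atlas" where
  "restrict_atlas \<A> S = {(U \<inter> S, \<phi>) | U \<phi>. (U, \<phi>) \<in> max_atlas \<A> \<and>
     (\<exists>W. subspace W \<and> \<phi> ` (U \<inter> S) = \<phi> ` U \<inter> W)}"

definition embedded_submanifold :: "('m, 'b::euclidean_space) atlas \<Rightarrow> 'm set \<Rightarrow> bool" where
  "embedded_submanifold \<A> S \<longleftrightarrow>
     S \<subseteq> points \<A> \<and> points (restrict_atlas \<A> S) = S \<and> smooth_atlas (restrict_atlas \<A> S)"

text \<open>Smoothness of a map defined on an arbitrary subset \<open>S\<close> of a manifold, in the sense of local smooth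
  extensions; on an embedded submanifold this is the intrinsic notion.\<close>

definition smooth_map_on :: "('m, 'b::euclidean_space) atlas \<Rightarrow> 'm set \<Rightarrow>
    ('n, 'c::euclidean_space) atlas \<Rightarrow> ('m \<Rightarrow> 'n) \<Rightarrow> bool" where
  "smooth_map_on \<A> S \<B> f \<longleftrightarrow> S \<subseteq> points \<A> \<and> f ` S \<subseteq> points \<B> \<and>
     (\<forall>p\<in>S. \<forall>(U, \<phi>)\<in>\<A>. \<forall>(V, \<psi>)\<in>\<B>. p \<in> U \<longrightarrow> f p \<in> V \<longrightarrow>
       (\<exists>N. openin (manifold_topology \<A>) N \<and> p \<in> N \<and> N \<subseteq> U \<and> f ` (N \<inter> S) \<subseteq> V \<and>
          smooth_on (\<phi> ` (N \<inter> S)) (\<psi> \<circ> f \<circ> inv_into U \<phi>)))"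

abbreviation smooth_map :: "('m, 'b::euclidean_space) atlas \<Rightarrow>
    ('n, 'c::euclidean_space) atlas \<Rightarrow> ('m \<Rightarrow> 'n) \<Rightarrow> bool" where
  "smooth_map \<A> \<equiv> smooth_map_on \<A> (points \<A>)"

definition smooth_functions :: "('m, 'b::euclidean_space) atlas \<Rightarrow> ('m \<Rightarrow> real) set" where
  "smooth_functions \<A> = {f. smooth_map \<A> real_atlas f}"

text \<open>Tangent vectors are derivations of the algebra of smooth functions, given the value \<open>0\<close> on
  functions that are not smooth. The values of \<open>f\<close> off \<open>points \<A>\<close> do not matter: by the Leibniz rule a
  derivation kills every function that vanishes on \<open>points \<A>\<close>.\<close>

type_synonym 'm tangent = "('m \<Rightarrow> real) \<Rightarrow> real"

definition tangent_space :: "('m, 'b::euclidean_space) atlas \<Rightarrow> 'm \<Rightarrow> 'm tangent set" where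
  "tangent_space \<A> p = {v.
     (\<forall>f\<in>smooth_functions \<A>. \<forall>g\<in>smooth_functions \<A>.
        v (\<lambda>x. f x + g x) = v f + v g \<and> v (\<lambda>x. f x * g x) = f p * v g + g p * v f) \<and>
     (\<forall>f\<in>smooth_functions \<A>. \<forall>c. v (\<lambda>x. c * f x) = c * v f) \<and>
     (\<forall>f. f \<notin> smooth_functions \<A> \<longrightarrow> v f = 0)}"

definition tangent_map :: "('n, 'c::euclidean_space) atlas \<Rightarrow> ('m \<Rightarrow> 'n) \<Rightarrow> 'm tangent \<Rightarrow> 'n tangent" where
  "tangent_map \<B> \<Phi> v = (\<lambda>f. if f \<in> smooth_functions \<B> then v (f \<circ> \<Phi>) else 0)"

definition submersion :: "('m, 'b::euclidean_space) atlas \<Rightarrow> ('n, 'c::euclidean_space) atlas \<Rightarrow>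
    ('m \<Rightarrow> 'n) \<Rightarrow> bool" where
  "submersion \<A> \<B> f \<longleftrightarrow> smooth_map \<A> \<B> f \<and>
     (\<forall>p\<in>points \<A>. tangent_map \<B> f ` tangent_space \<A> p = tangent_space \<B> (f p))"

definition lie_group :: "('h, 'z) monoid_scheme \<Rightarrow> ('h, 'b::euclidean_space) atlas \<Rightarrow> bool" where
  "lie_group H \<A> \<longleftrightarrow> smooth_manifold \<A> \<and> group H \<and> carrier H = points \<A> \<and>
     smooth_map (prod_atlas \<A> \<A>) \<A> (\<lambda>(g, h). g \<otimes>\<^bsub>H\<^esub> h) \<and> smooth_map \<A> \<A> (\<lambda>g. inv\<^bsub>H\<^esub> g)"

definition smooth_action :: "('h, 'z) monoid_scheme \<Rightarrow> ('h, 'b::euclidean_space) atlas \<Rightarrow>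
    ('m, 'c::euclidean_space) atlas \<Rightarrow> ('h \<times> 'm \<Rightarrow> 'm) \<Rightarrow> bool" where
  "smooth_action H \<A> \<B> act \<longleftrightarrow>
     group_action H (points \<B>) (\<lambda>h. \<lambda>m\<in>points \<B>. act (h, m)) \<and>
     smooth_map (prod_atlas \<A> \<B>) \<B> act"


section \<open>Vector bundles\<close>

text \<open>\<open>triv\<close> is a set of local trivializations \<open>(U, \<tau>)\<close>; here \<open>\<tau>\<close> is only the fiber coordinate, i.e.\
  \<open>x \<mapsto> (proj x, \<tau> x)\<close> identifies the part of the bundle over \<open>U\<close> with \<open>U \<times> W\<close>, for a linear subspace
  \<open>W\<close> of \<open>'f\<close> whose dimension is the rank.\<close>

record ('m, 'b, 'a, 'f) vbundle =
  base :: "('m, 'b) atlas"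
  total :: "'a set"
  proj :: "'a \<Rightarrow> 'm"
  vadd :: "'a \<Rightarrow> 'a \<Rightarrow> 'a"
  vscale :: "real \<Rightarrow> 'a \<Rightarrow> 'a"
  triv :: "('m set \<times> ('a \<Rightarrow> 'f)) set"

definition fiber :: "('m, 'b, 'a, 'f, 'z) vbundle_scheme \<Rightarrow> 'm \<Rightarrow> 'a set" where
  "fiber V m = {x \<in> total V. proj V x = m}"

definition trivialization :: "('m, 'b::euclidean_space, 'a, 'f::euclidean_space, 'z) vbundle_scheme \<Rightarrow>
    nat \<Rightarrow> 'm set \<times> ('a \<Rightarrow> 'f) \<Rightarrow> bool" where
  "trivialization V r = (\<lambda>(U, \<tau>). openin (manifold_topology (base V)) U \<and>
     (\<exists>W. subspace W \<and> dim W = r \<and> (\<forall>m\<in>U. bij_betw \<tau> (fiber V m) W)) \<and>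
     (\<forall>m\<in>U. \<forall>x\<in>fiber V m. \<forall>y\<in>fiber V m.
        vadd V x y \<in> fiber V m \<and> \<tau> (vadd V x y) = \<tau> x + \<tau> y) \<and>
     (\<forall>m\<in>U. \<forall>x\<in>fiber V m. \<forall>c.
        vscale V c x \<in> fiber V m \<and> \<tau> (vscale V c x) = c *\<^sub>R \<tau> x))"

definition total_atlas :: "('m, 'b::euclidean_space, 'a, 'f::euclidean_space, 'z) vbundle_scheme \<Rightarrow>
    ('a, 'b \<times> 'f) atlas" where
  "total_atlas V = {({x \<in> total V. proj V x \<in> U \<inter> U'}, \<lambda>x. (\<phi> (proj V x), \<tau> x)) | U \<phi> U' \<tau>.
     (U, \<phi>) \<in> base V \<and> (U', \<tau>) \<in> triv V}"

text \<open>Smoothness of the transition functions amounts to compatibility of the charts of the total space.\<close>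

definition vector_bundle ::
    "('m, 'b::euclidean_space, 'a, 'f::euclidean_space, 'z) vbundle_scheme \<Rightarrow> bool" where
  "vector_bundle V \<longleftrightarrow> smooth_manifold (base V) \<and> proj V ` total V \<subseteq> points (base V) \<and>
     (\<exists>r. \<forall>t\<in>triv V. trivialization V r t) \<and> (\<Union>(U, \<tau>)\<in>triv V. U) = points (base V) \<and>
     smooth_atlas (total_atlas V)"

definition max_triv :: "('m, 'b::euclidean_space, 'a, 'f::euclidean_space, 'z) vbundle_scheme \<Rightarrow>
    ('m set \<times> ('a \<Rightarrow> 'f)) set" where
  "max_triv V = {t. vector_bundle (V\<lparr>triv := insert t (triv V)\<rparr>)}"

definition prod_bundle :: "('m, 'b, 'a, 'f, 'z) vbundle_scheme \<Rightarrow> ('n, 'c, 'd, 'g, 'y) vbundle_scheme \<Rightarrow>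
    ('m \<times> 'n, 'b \<times> 'c, 'a \<times> 'd, 'f \<times> 'g) vbundle" where
  "prod_bundle V W =
    \<lparr> base = prod_atlas (base V) (base W),
      total = total V \<times> total W,
      proj = map_prod (proj V) (proj W),
      vadd = (\<lambda>(x, y) (x', y'). (vadd V x x', vadd W y y')),
      vscale = (\<lambda>c (x, y). (vscale V c x, vscale W c y)),
      triv = {(U \<times> U', map_prod \<tau> \<tau>') | U \<tau> U' \<tau>'. (U, \<tau>) \<in> triv V \<and> (U', \<tau>') \<in> triv W} \<rparr>"

text \<open>The subset \<open>R\<close> of the total space, as a bundle over the submanifold \<open>S\<close> of the base; its
  trivializations are those trivializations of \<open>V\<close> that take \<open>R\<close> to a constant subspace.\<close>

definition sub_bundle :: "('m, 'b::euclidean_space, 'a, 'f::euclidean_space, 'z) vbundle_scheme \<Rightarrow>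
    'm set \<Rightarrow> 'a set \<Rightarrow> ('m, 'b, 'a, 'f) vbundle" where
  "sub_bundle V S R =
    \<lparr> base = restrict_atlas (base V) S,
      total = R,
      proj = proj V,
      vadd = vadd V,
      vscale = vscale V,
      triv = {(U \<inter> S, \<tau>) | U \<tau>. (U, \<tau>) \<in> max_triv V \<and>
        (\<exists>W. subspace W \<and> (\<forall>m\<in>U \<inter> S. \<tau> ` (R \<inter> fiber V m) = W))} \<rparr>"

definition vector_subbundle :: "('m, 'b::euclidean_space, 'a, 'f::euclidean_space, 'z) vbundle_scheme \<Rightarrow>
    'm set \<Rightarrow> 'a set \<Rightarrow> bool" where
  "vector_subbundle V S R \<longleftrightarrow> embedded_submanifold (base V) S \<and>
     R \<subseteq> total V \<and> vector_bundle (sub_bundle V S R)"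

definition sections :: "('m, 'b::euclidean_space, 'a, 'f::euclidean_space, 'z) vbundle_scheme \<Rightarrow>
    ('m \<Rightarrow> 'a) set" where
  "sections V = {\<sigma> \<in> extensional (points (base V)).
     (\<forall>m\<in>points (base V). \<sigma> m \<in> fiber V m) \<and> smooth_map (base V) (total_atlas V) \<sigma>}"

definition sec_add :: "('m, 'b, 'a, 'f, 'z) vbundle_scheme \<Rightarrow> ('m \<Rightarrow> 'a) \<Rightarrow> ('m \<Rightarrow> 'a) \<Rightarrow> 'm \<Rightarrow> 'a" where
  "sec_add V \<sigma> \<tau> = (\<lambda>m\<in>points (base V). vadd V (\<sigma> m) (\<tau> m))"

definition sec_scale :: "('m, 'b, 'a, 'f, 'z) vbundle_scheme \<Rightarrow> real \<Rightarrow> ('m \<Rightarrow> 'a) \<Rightarrow> 'm \<Rightarrow> 'a" where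
  "sec_scale V c \<sigma> = (\<lambda>m\<in>points (base V). vscale V c (\<sigma> m))"


section \<open>Courant algebroids\<close>

record ('m, 'b, 'a, 'f) courant = "('m, 'b, 'a, 'f) vbundle" +
  metric :: "'a \<Rightarrow> 'a \<Rightarrow> real"
  anchor :: "'a \<Rightarrow> 'm tangent"
  bracket :: "('m \<Rightarrow> 'a) \<Rightarrow> ('m \<Rightarrow> 'a) \<Rightarrow> 'm \<Rightarrow> 'a"

text \<open>The element of the fiber at \<open>m\<close> corresponding to the linear form \<open>l\<close> under the metric, and
  \<open>a\<^sup>* df\<close> at \<open>m\<close>.\<close>

definition sharp :: "('m, 'b, 'a, 'f) courant \<Rightarrow> 'm \<Rightarrow> ('a \<Rightarrow> real) \<Rightarrow> 'a" where
  "sharp A m l = (THE w. w \<in> fiber A m \<and> (\<forall>y\<in>fiber A m. metric A w y = l y))"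

definition anchor_dual_d :: "('m, 'b, 'a, 'f) courant \<Rightarrow> ('m \<Rightarrow> real) \<Rightarrow> 'm \<Rightarrow> 'a" where
  "anchor_dual_d A f = (\<lambda>m\<in>points (base A). sharp A m (\<lambda>y. anchor A y f))"

definition bundle_metric :: "('m, 'b::euclidean_space, 'a, 'f::euclidean_space) courant \<Rightarrow> bool" where
  "bundle_metric A \<longleftrightarrow>
     (\<forall>m\<in>points (base A). \<forall>x\<in>fiber A m. \<forall>y\<in>fiber A m.
        metric A x y = metric A y x \<and>
        (\<forall>z\<in>fiber A m. metric A (vadd A x y) z = metric A x z + metric A y z) \<and>
        (\<forall>c. metric A (vscale A c x) y = c * metric A x y)) \<and>
     (\<forall>m\<in>points (base A). \<forall>x\<in>fiber A m.
        (\<forall>y\<in>fiber A m. metric A x y = 0) \<longrightarrow> x = vscale A 0 x) \<and>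
     smooth_map_on (prod_atlas (total_atlas A) (total_atlas A))
       {(x, y). x \<in> total A \<and> y \<in> total A \<and> proj A x = proj A y} real_atlas (\<lambda>(x, y). metric A x y)"

definition bundle_anchor :: "('m, 'b::euclidean_space, 'a, 'f::euclidean_space) courant \<Rightarrow> bool" where
  "bundle_anchor A \<longleftrightarrow>
     (\<forall>m\<in>points (base A). \<forall>x\<in>fiber A m. anchor A x \<in> tangent_space (base A) m \<and>
        (\<forall>y\<in>fiber A m. \<forall>f. anchor A (vadd A x y) f = anchor A x f + anchor A y f) \<and>
        (\<forall>c f. anchor A (vscale A c x) f = c * anchor A x f)) \<and>
     (\<forall>f\<in>smooth_functions (base A). (\<lambda>x. anchor A x f) \<in> smooth_functions (total_atlas A))"

definition bilinear_bracket :: "('m, 'b::euclidean_space, 'a, 'f::euclidean_space) courant \<Rightarrow> bool" where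
  "bilinear_bracket A \<longleftrightarrow>
     (\<forall>\<sigma>\<in>sections A. \<forall>\<tau>\<in>sections A. bracket A \<sigma> \<tau> \<in> sections A \<and>
        (\<forall>\<rho>\<in>sections A.
           bracket A (sec_add A \<sigma> \<tau>) \<rho> = sec_add A (bracket A \<sigma> \<rho>) (bracket A \<tau> \<rho>) \<and>
           bracket A \<rho> (sec_add A \<sigma> \<tau>) = sec_add A (bracket A \<rho> \<sigma>) (bracket A \<rho> \<tau>)) \<and>
        (\<forall>c. bracket A (sec_scale A c \<sigma>) \<tau> = sec_scale A c (bracket A \<sigma> \<tau>) \<and>
             bracket A \<sigma> (sec_scale A c \<tau>) = sec_scale A c (bracket A \<sigma> \<tau>)))"

definition courant_algebroid :: "('m, 'b::euclidean_space, 'a, 'f::euclidean_space) courant \<Rightarrow> bool" where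
  "courant_algebroid A \<longleftrightarrow>
     vector_bundle A \<and> bundle_metric A \<and> bundle_anchor A \<and> bilinear_bracket A \<and>
     (\<forall>\<sigma>\<^sub>1\<in>sections A. \<forall>\<sigma>\<^sub>2\<in>sections A. \<forall>\<sigma>\<^sub>3\<in>sections A.
        bracket A \<sigma>\<^sub>1 (bracket A \<sigma>\<^sub>2 \<sigma>\<^sub>3) =
          sec_add A (bracket A (bracket A \<sigma>\<^sub>1 \<sigma>\<^sub>2) \<sigma>\<^sub>3) (bracket A \<sigma>\<^sub>2 (bracket A \<sigma>\<^sub>1 \<sigma>\<^sub>3))) \<and>
     (\<forall>\<sigma>\<^sub>1\<in>sections A. \<forall>\<sigma>\<^sub>2\<in>sections A. \<forall>\<sigma>\<^sub>3\<in>sections A. \<forall>m\<in>points (base A).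
        anchor A (\<sigma>\<^sub>1 m) (\<lambda>p. metric A (\<sigma>\<^sub>2 p) (\<sigma>\<^sub>3 p)) =
          metric A (bracket A \<sigma>\<^sub>1 \<sigma>\<^sub>2 m) (\<sigma>\<^sub>3 m) + metric A (\<sigma>\<^sub>2 m) (bracket A \<sigma>\<^sub>1 \<sigma>\<^sub>3 m)) \<and>
     (\<forall>\<sigma>\<^sub>1\<in>sections A. \<forall>\<sigma>\<^sub>2\<in>sections A.
        sec_add A (bracket A \<sigma>\<^sub>1 \<sigma>\<^sub>2) (bracket A \<sigma>\<^sub>2 \<sigma>\<^sub>1) =
          anchor_dual_d A (\<lambda>p. metric A (\<sigma>\<^sub>1 p) (\<sigma>\<^sub>2 p)))"

definition opposite :: "('m, 'b, 'a, 'f) courant \<Rightarrow> ('m, 'b, 'a, 'f) courant" where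
  "opposite A = A\<lparr>metric := \<lambda>x y. - metric A x y\<rparr>"

text \<open>The Courant algebroid over a point with zero fiber.\<close>

definition pt_courant :: "(unit, real, unit, real) courant" where
  "pt_courant =
    \<lparr> base = pt_atlas, total = {()}, proj = (\<lambda>_. ()), vadd = (\<lambda>_ _. ()), vscale = (\<lambda>_ _. ()),
      triv = {({()}, \<lambda>_. 0)}, metric = (\<lambda>_ _. 0), anchor = (\<lambda>_ _. 0), bracket = (\<lambda>_ _ _. ()) \<rparr>"

text \<open>The bracket of the product Courant algebroid \<open>A \<times> B\<close> is the one for which the bracket of sections
  pulled back from the two factors is componentwise. The Leibniz rules
  \<open>[\<sigma>, f \<tau>] = f [\<sigma>, \<tau>] + (a(\<sigma>) f) \<tau>\<close> and \<open>[f \<sigma>, \<tau>] = f [\<sigma>, \<tau>] - (a(\<tau>) f) \<sigma> + \<langle>\<sigma>, \<tau>\<rangle> a\<^sup>* df\<close>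
  then determine it on all sections. For sections \<open>(s, s')\<close> and \<open>(t, t')\<close> of \<open>A \<times> B\<close> the \<open>A\<close>-component of
  the bracket at \<open>(m, n)\<close> comes out as
  \<open>[s(-, n), t(-, n)](m) + a\<^sub>B(s'(m, n)) t(m, -) - a\<^sub>B(t'(m, n)) s(m, -) + a\<^sub>A\<^sup>* d\<langle>s'(-, n), t'(m, n)\<rangle>\<close>.
  It is given here by its pairing with \<open>y\<close> in the fiber of \<open>A\<close> at \<open>m\<close>; in particular \<open>a\<^sub>B(v) t(m, -)\<close> is the
  derivative along \<open>a\<^sub>B(v)\<close> of a map to the fixed fiber at \<open>m\<close>.\<close>

definition bracket_component :: "('m, 'b, 'a, 'f) courant \<Rightarrow> ('n, 'c, 'd, 'g) courant \<Rightarrow>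
    ('m \<Rightarrow> 'n \<Rightarrow> 'a) \<Rightarrow> ('m \<Rightarrow> 'n \<Rightarrow> 'd) \<Rightarrow> ('m \<Rightarrow> 'n \<Rightarrow> 'a) \<Rightarrow> ('m \<Rightarrow> 'n \<Rightarrow> 'd) \<Rightarrow> 'm \<Rightarrow> 'n \<Rightarrow> 'a" where
  "bracket_component A B s s' t t' m n = sharp A m (\<lambda>y.
     metric A (bracket A (\<lambda>p\<in>points (base A). s p n) (\<lambda>p\<in>points (base A). t p n) m) y
     + anchor B (s' m n) (\<lambda>q. metric A (t m q) y)
     - anchor B (t' m n) (\<lambda>q. metric A (s m q) y)
     + anchor A y (\<lambda>p. metric B (s' p n) (t' m n)))"

definition prod_courant :: "('m, 'b::euclidean_space, 'a, 'f) courant \<Rightarrow>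
    ('n, 'c::euclidean_space, 'd, 'g) courant \<Rightarrow> ('m \<times> 'n, 'b \<times> 'c, 'a \<times> 'd, 'f \<times> 'g) courant" where
  "prod_courant A B = vbundle.extend (prod_bundle A B) (courant.fields
     (\<lambda>(x, y) (x', y'). metric A x x' + metric B y y')
     (\<lambda>(x, y) f. if f \<in> smooth_functions (prod_atlas (base A) (base B))
        then anchor A x (\<lambda>m. f (m, proj B y)) + anchor B y (\<lambda>n. f (proj A x, n)) else 0)
     (\<lambda>\<sigma> \<tau>. \<lambda>(m, n)\<in>points (base A) \<times> points (base B).
        (bracket_component A B (\<lambda>p q. fst (\<sigma> (p, q))) (\<lambda>p q. snd (\<sigma> (p, q)))
           (\<lambda>p q. fst (\<tau> (p, q))) (\<lambda>p q. snd (\<tau> (p, q))) m n,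
         bracket_component B A (\<lambda>q p. snd (\<sigma> (p, q))) (\<lambda>q p. fst (\<sigma> (p, q)))
           (\<lambda>q p. snd (\<tau> (p, q))) (\<lambda>q p. fst (\<tau> (p, q))) n m)))"


text \<open>As intended, the bracket is componentwise on sections pulled back from the factors.\<close>

lemma Ck_on_const: "Ck_on k N (\<lambda>_. c)"
  by (induction k arbitrary: c) (auto simp: frechet_derivative_const)

lemma smooth_on_const: "smooth_on S (\<lambda>_. c)"
  unfolding smooth_on_def using Ck_on_const open_UNIV by blast

lemma openin_chart_domain:
  assumes "(U, \<phi>) \<in> \<A>" shows "openin (manifold_topology \<A>) U"
proof -
  have "U = U \<inter> \<phi> -` UNIV" by simp
  then show ?thesis
    unfolding manifold_topology_def openin_topology_generated_by_iff
    using assms by (intro generate_topology_on.Basis) blast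
qed

lemma smooth_functions_const: "(\<lambda>_. c) \<in> smooth_functions \<A>"
  unfolding smooth_functions_def smooth_map_on_def real_atlas_def points_def
  using openin_chart_domain smooth_on_const by (fastforce simp: comp_def)

lemma smooth_on_cong: "smooth_on S f \<Longrightarrow> (\<And>x. x \<in> S \<Longrightarrow> f x = g x) \<Longrightarrow> smooth_on S g"
  unfolding smooth_on_def by (metis IntE)

lemma smooth_functions_cong:
  assumes f: "f \<in> smooth_functions \<A>" and eq: "\<And>x. x \<in> points \<A> \<Longrightarrow> f x = g x"
  shows "g \<in> smooth_functions \<A>"
proof -
  have "\<exists>N. openin (manifold_topology \<A>) N \<and> p \<in> N \<and> N \<subseteq> U \<and>
         smooth_on (\<phi> ` (N \<inter> points \<A>)) (g \<circ> inv_into U \<phi>)"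
    if p: "p \<in> points \<A>" "(U, \<phi>) \<in> \<A>" "p \<in> U" for p U \<phi>
  proof -
    obtain N where N: "openin (manifold_topology \<A>) N" "p \<in> N" "N \<subseteq> U"
      "smooth_on (\<phi> ` (N \<inter> points \<A>)) (f \<circ> inv_into U \<phi>)"
      using f p unfolding smooth_functions_def smooth_map_on_def real_atlas_def
      by (fastforce simp: comp_def)
    have "U \<subseteq> points \<A>" using p(2) by (auto simp: points_def)
    then have "f (inv_into U \<phi> y) = g (inv_into U \<phi> y)" if "y \<in> \<phi> ` (N \<inter> points \<A>)" for y
      using that N(3) by (intro eq) (meson image_mono inf.coboundedI1 inv_into_into subsetD)
    then have "smooth_on (\<phi> ` (N \<inter> points \<A>)) (g \<circ> inv_into U \<phi>)"
      by (intro smooth_on_cong[OF N(4)]) auto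
    then show ?thesis using N by blast
  qed
  then show ?thesis
    unfolding smooth_functions_def smooth_map_on_def real_atlas_def
    by (auto simp: comp_def points_def[of "{(UNIV, \<lambda>x. x)}"])
qed

lemma tangent_const:
  assumes v: "v \<in> tangent_space \<A> p" and p: "p \<in> points \<A>"
    and eq: "\<And>x. x \<in> points \<A> \<Longrightarrow> f x = c"
  shows "v f = 0"
proof -
  define k where "k x = (if x \<in> points \<A> then 0 else 1 :: real)" for x
  define \<delta> where "\<delta> x = f x - c" for x
  have sm: "g \<in> smooth_functions \<A>" if "\<And>x. x \<in> points \<A> \<Longrightarrow> g x = d" for g d
    using smooth_functions_cong[OF smooth_functions_const[of d]] that by metis
  have s: "k \<in> smooth_functions \<A>" "\<delta> \<in> smooth_functions \<A>" "(\<lambda>_. c) \<in> smooth_functions \<A>"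
    "(\<lambda>_. 1) \<in> smooth_functions \<A>"
    using sm[of k 0] sm[of \<delta> 0] eq smooth_functions_const by (auto simp: k_def \<delta>_def)
  have V: "v (\<lambda>x. a x + b x) = v a + v b" "v (\<lambda>x. a x * b x) = a p * v b + b p * v a"
      "v (\<lambda>x. e * a x) = e * v a"
    if "a \<in> smooth_functions \<A>" "b \<in> smooth_functions \<A>" for a b e
    using v that unfolding tangent_space_def by blast+
  have "v (\<lambda>x. \<delta> x * k x) = \<delta> p * v k + k p * v \<delta>" using V(2) s by blast
  moreover have "(\<lambda>x. \<delta> x * k x) = \<delta>" by (auto simp: k_def \<delta>_def eq)
  ultimately have d0: "v \<delta> = 0" using p eq by (simp add: k_def \<delta>_def)
  have "v (\<lambda>x. (\<lambda>_. 1) x * (\<lambda>_. 1) x) = 1 * v (\<lambda>_. 1) + 1 * v (\<lambda>_. 1)"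
    by (rule V(2)[OF s(4,4)])
  then have v1: "v (\<lambda>_. 1) = 0" by simp
  have "v (\<lambda>x. c * (\<lambda>_. 1) x) = c * v (\<lambda>_. 1)"
    by (rule V(3)[OF s(4,4)])
  then have vc: "v (\<lambda>_. c) = 0" using v1 by simp
  have "v (\<lambda>x. \<delta> x + (\<lambda>_. c) x) = v \<delta> + v (\<lambda>_. c)" by (rule V(1)[OF s(2,3)])
  moreover have "(\<lambda>x. \<delta> x + (\<lambda>_. c) x) = f" by (auto simp: \<delta>_def)
  ultimately show ?thesis using d0 vc by simp
qed

lemma sharp_eq:
  assumes A: "courant_algebroid A" and m: "m \<in> points (base A)" and w: "w \<in> fiber A m"
    and l: "\<And>y. y \<in> fiber A m \<Longrightarrow> metric A w y = l y"
  shows "sharp A m l = w"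
  unfolding sharp_def
proof (rule the_equality)
  show "w \<in> fiber A m \<and> (\<forall>y\<in>fiber A m. metric A w y = l y)" using w l by blast
  fix w' assume w': "w' \<in> fiber A m \<and> (\<forall>y\<in>fiber A m. metric A w' y = l y)"
  have vb: "vector_bundle A" and met: "bundle_metric A"
    using A by (auto simp: courant_algebroid_def)
  obtain U \<tau> r where U: "(U, \<tau>) \<in> triv A" "m \<in> U" "trivialization A r (U, \<tau>)"
    using vb m unfolding vector_bundle_def by fastforce
  obtain W where W: "subspace W" "bij_betw \<tau> (fiber A m) W"
    using U unfolding trivialization_def by auto
  have add: "vadd A x y \<in> fiber A m" "\<tau> (vadd A x y) = \<tau> x + \<tau> y"
    if "x \<in> fiber A m" "y \<in> fiber A m" for x y
    using U that unfolding trivialization_def by auto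
  have sc: "vscale A c x \<in> fiber A m" "\<tau> (vscale A c x) = c *\<^sub>R \<tau> x" if "x \<in> fiber A m" for x c
    using U that unfolding trivialization_def by auto
  define d where "d = vadd A w' (vscale A (-1) w)"
  have d: "d \<in> fiber A m" using add sc w w' by (auto simp: d_def)
  have "metric A d y = 0" if y: "y \<in> fiber A m" for y
  proof -
    have "metric A d y = metric A w' y + metric A (vscale A (-1) w) y"
      using met m w w' sc y unfolding bundle_metric_def d_def by blast
    also have "metric A (vscale A (-1) w) y = -1 * metric A w y"
      using met m w y unfolding bundle_metric_def by blast
    finally show ?thesis using w' l y by simp
  qed
  then have "d = vscale A 0 d" using met m d unfolding bundle_metric_def by blast
  then have "\<tau> d = 0" using sc(2)[OF d, of 0] by simp
  then have "\<tau> w' = \<tau> w" using add sc w w' by (simp add: d_def)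
  then show "w' = w" using W(2) w w' by (metis bij_betw_inv_into_left)
qed

lemma bracket_component_pullback:
  assumes A: "courant_algebroid A" and B: "courant_algebroid B"
    and s: "s \<in> sections A" and t: "t \<in> sections A" and s': "s' \<in> sections B" and t': "t' \<in> sections B"
    and m: "m \<in> points (base A)" and n: "n \<in> points (base B)"
    and S: "\<And>p q. p \<in> points (base A) \<Longrightarrow> q \<in> points (base B) \<Longrightarrow> S p q = s p"
    and T: "\<And>p q. p \<in> points (base A) \<Longrightarrow> q \<in> points (base B) \<Longrightarrow> T p q = t p"
    and S': "\<And>p q. p \<in> points (base A) \<Longrightarrow> q \<in> points (base B) \<Longrightarrow> S' p q = s' q"
    and T': "\<And>p q. p \<in> points (base A) \<Longrightarrow> q \<in> points (base B) \<Longrightarrow> T' p q = t' q"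
  shows "bracket_component A B S S' T T' m n = bracket A s t m"
  unfolding bracket_component_def
proof (rule sharp_eq[OF A m])
  have "bracket A s t \<in> sections A"
    using A s t unfolding courant_algebroid_def bilinear_bracket_def by blast
  then show "bracket A s t m \<in> fiber A m" using m by (auto simp: sections_def)
  fix y assume y: "y \<in> fiber A m"
  have r: "(\<lambda>p\<in>points (base A). S p n) = s" "(\<lambda>p\<in>points (base A). T p n) = t"
    using s t S T n by (auto simp: sections_def extensional_def)
  have fibs: "s' n \<in> fiber B n" "t' n \<in> fiber B n"
    using s' t' n by (auto simp: sections_def)
  have tb: "anchor B x \<in> tangent_space (base B) n" if "x \<in> fiber B n" for x
    using B n that unfolding courant_algebroid_def bundle_anchor_def by blast
  have ta: "anchor A y \<in> tangent_space (base A) m"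
    using A m y unfolding courant_algebroid_def bundle_anchor_def by blast
  have "anchor B (S' m n) (\<lambda>q. metric A (T m q) y) = 0"
    using S'[OF m n] T[OF m] tangent_const[OF tb[OF fibs(1)] n] by simp
  moreover have "anchor B (T' m n) (\<lambda>q. metric A (S m q) y) = 0"
    using T'[OF m n] S[OF m] tangent_const[OF tb[OF fibs(2)] n] by simp
  moreover have "anchor A y (\<lambda>p. metric B (S' p n) (T' m n)) = 0"
    using T'[OF m n] S'[OF _ n] tangent_const[OF ta m] by simp
  ultimately show "metric A (bracket A s t m) y =
      metric A (bracket A (\<lambda>p\<in>points (base A). S p n) (\<lambda>p\<in>points (base A). T p n) m) y +
      anchor B (S' m n) (\<lambda>q. metric A (T m q) y) - anchor B (T' m n) (\<lambda>q. metric A (S m q) y) +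
      anchor A y (\<lambda>p. metric B (S' p n) (T' m n))"
    by (simp add: r)
qed

lemma prod_bracket_pullback:
  assumes A: "courant_algebroid A" and B: "courant_algebroid B"
    and "\<sigma> \<in> sections A" "\<tau> \<in> sections A" "\<sigma>' \<in> sections B" "\<tau>' \<in> sections B"
    and m: "m \<in> points (base A)" "n \<in> points (base B)"
  defines "M \<equiv> points (base A) \<times> points (base B)"
  shows "bracket (prod_courant A B) (\<lambda>(p, q)\<in>M. (\<sigma> p, \<sigma>' q)) (\<lambda>(p, q)\<in>M. (\<tau> p, \<tau>' q)) (m, n) =
    (bracket A \<sigma> \<tau> m, bracket B \<sigma>' \<tau>' n)"
proof -
  have "bracket_component A B (\<lambda>p q. fst ((\<lambda>(p, q)\<in>M. (\<sigma> p, \<sigma>' q)) (p, q)))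
      (\<lambda>p q. snd ((\<lambda>(p, q)\<in>M. (\<sigma> p, \<sigma>' q)) (p, q)))
      (\<lambda>p q. fst ((\<lambda>(p, q)\<in>M. (\<tau> p, \<tau>' q)) (p, q)))
      (\<lambda>p q. snd ((\<lambda>(p, q)\<in>M. (\<tau> p, \<tau>' q)) (p, q))) m n = bracket A \<sigma> \<tau> m"
    using assms by (intro bracket_component_pullback) auto
  moreover have "bracket_component B A (\<lambda>q p. snd ((\<lambda>(p, q)\<in>M. (\<sigma> p, \<sigma>' q)) (p, q)))
      (\<lambda>q p. fst ((\<lambda>(p, q)\<in>M. (\<sigma> p, \<sigma>' q)) (p, q)))
      (\<lambda>q p. snd ((\<lambda>(p, q)\<in>M. (\<tau> p, \<tau>' q)) (p, q)))
      (\<lambda>q p. fst ((\<lambda>(p, q)\<in>M. (\<tau> p, \<tau>' q)) (p, q))) n m = bracket B \<sigma>' \<tau>' n"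
    using assms by (intro bracket_component_pullback) auto
  ultimately show ?thesis
    using m by (simp add: prod_courant_def vbundle.extend_def courant.fields_def)
qed


section \<open>Dirac structures and their morphisms\<close>

definition lagrangian_subbundle :: "('m, 'b::euclidean_space, 'a, 'f::euclidean_space) courant \<Rightarrow>
    'm set \<Rightarrow> 'a set \<Rightarrow> bool" where
  "lagrangian_subbundle A S R \<longleftrightarrow> vector_subbundle A S R \<and>
     (\<forall>m\<in>S. R \<inter> fiber A m = {x \<in> fiber A m. \<forall>y\<in>R \<inter> fiber A m. metric A x y = 0})"

definition dirac_structure :: "('m, 'b::euclidean_space, 'a, 'f::euclidean_space) courant \<Rightarrow>
    'a set \<Rightarrow> bool" where
  "dirac_structure A E \<longleftrightarrow> courant_algebroid A \<and> lagrangian_subbundle A (points (base A)) E \<and>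
     (\<forall>\<sigma>\<in>sections A. \<forall>\<tau>\<in>sections A.
        (\<forall>m\<in>points (base A). \<sigma> m \<in> E) \<longrightarrow> (\<forall>m\<in>points (base A). \<tau> m \<in> E) \<longrightarrow>
        (\<forall>m\<in>points (base A). bracket A \<sigma> \<tau> m \<in> E))"

text \<open>Relations from \<open>A\<^sub>1\<close> to \<open>A\<^sub>2\<close> are sets of pairs \<open>(x\<^sub>2, x\<^sub>1)\<close>; hence the composition of relations
  \<open>R'\<close> after \<open>R\<close> is \<open>R' O R\<close>.\<close>

definition courant_morphism :: "('m, 'b::euclidean_space, 'a, 'f::euclidean_space) courant \<Rightarrow>
    ('n, 'c::euclidean_space, 'd, 'g::euclidean_space) courant \<Rightarrow>
    ('m \<Rightarrow> 'n) \<Rightarrow> ('d \<times> 'a) set \<Rightarrow> bool" where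
  "courant_morphism A\<^sub>1 A\<^sub>2 \<Phi> R \<longleftrightarrow>
     (let C = prod_courant A\<^sub>2 (opposite A\<^sub>1);
          Gr = {(\<Phi> m, m) | m. m \<in> points (base A\<^sub>1)} in
      smooth_map (base A\<^sub>1) (base A\<^sub>2) \<Phi> \<and>
      lagrangian_subbundle C Gr R \<and>
      (\<forall>(x\<^sub>2, x\<^sub>1)\<in>R. anchor A\<^sub>2 x\<^sub>2 = tangent_map (base A\<^sub>2) \<Phi> (anchor A\<^sub>1 x\<^sub>1)) \<and>
      (\<forall>\<sigma>\<in>sections C. \<forall>\<tau>\<in>sections C.
         (\<forall>p\<in>Gr. \<sigma> p \<in> R) \<longrightarrow> (\<forall>p\<in>Gr. \<tau> p \<in> R) \<longrightarrow> (\<forall>p\<in>Gr. bracket C \<sigma> \<tau> p \<in> R)))"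

definition dirac_morphism :: "('m, 'b::euclidean_space, 'a, 'f::euclidean_space) courant \<Rightarrow> 'a set \<Rightarrow>
    ('n, 'c::euclidean_space, 'd, 'g::euclidean_space) courant \<Rightarrow> 'd set \<Rightarrow>
    ('m \<Rightarrow> 'n) \<Rightarrow> ('d \<times> 'a) set \<Rightarrow> bool" where
  "dirac_morphism A\<^sub>1 E\<^sub>1 A\<^sub>2 E\<^sub>2 \<Phi> R \<longleftrightarrow> courant_morphism A\<^sub>1 A\<^sub>2 \<Phi> R \<and>
     (\<forall>m\<in>points (base A\<^sub>1). \<forall>x\<^sub>2\<in>E\<^sub>2 \<inter> fiber A\<^sub>2 (\<Phi> m). \<exists>!x\<^sub>1. x\<^sub>1 \<in> E\<^sub>1 \<inter> fiber A\<^sub>1 m \<and> (x\<^sub>2, x\<^sub>1) \<in> R)"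

definition rel_times :: "('d \<times> 'a) set \<Rightarrow> ('d' \<times> 'a') set \<Rightarrow> (('d \<times> 'd') \<times> ('a \<times> 'a')) set" where
  "rel_times R R' = {((x\<^sub>2, y\<^sub>2), (x\<^sub>1, y\<^sub>1)) | x\<^sub>2 y\<^sub>2 x\<^sub>1 y\<^sub>1. (x\<^sub>2, x\<^sub>1) \<in> R \<and> (y\<^sub>2, y\<^sub>1) \<in> R'}"

text \<open>The identifications \<open>(A \<times> B) \<times> C = A \<times> (B \<times> C)\<close>, \<open>pt \<times> A = A\<close> and \<open>A \<times> pt = A\<close>.\<close>

definition assoc_rel :: "(('a \<times> ('b \<times> 'c)) \<times> (('a \<times> 'b) \<times> 'c)) set" where
  "assoc_rel = {((x, (y, z)), ((x, y), z)) | x y z. True}"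

definition lunit_rel :: "('a \<times> (unit \<times> 'a)) set" where
  "lunit_rel = {(x, ((), x)) | x. True}"

definition runit_rel :: "('a \<times> ('a \<times> unit)) set" where
  "runit_rel = {(x, (x, ())) | x. True}"

definition dirac_lie_group :: "('h, 'z) monoid_scheme \<Rightarrow>
    ('h, 'b::euclidean_space, 'a, 'f::euclidean_space) courant \<Rightarrow> 'a set \<Rightarrow>
    ('a \<times> ('a \<times> 'a)) set \<Rightarrow> ('a \<times> unit) set \<Rightarrow> bool" where
  "dirac_lie_group H A E Mul \<epsilon> \<longleftrightarrow>
     lie_group H (base A) \<and> dirac_structure A E \<and>
     dirac_morphism (prod_courant A A) (E \<times> E) A E (\<lambda>(g, h). g \<otimes>\<^bsub>H\<^esub> h) Mul \<and>
     dirac_morphism pt_courant {()} A E (\<lambda>_. \<one>\<^bsub>H\<^esub>) \<epsilon> \<and>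
     Mul O rel_times Mul (Id_on (total A)) = Mul O rel_times (Id_on (total A)) Mul O assoc_rel \<and>
     Mul O rel_times \<epsilon> (Id_on (total A)) = Id_on (total A) O lunit_rel \<and>
     Mul O rel_times (Id_on (total A)) \<epsilon> = Id_on (total A) O runit_rel"

definition dirac_action :: "('h, 'z) monoid_scheme \<Rightarrow>
    ('h, 'b::euclidean_space, 'a, 'f::euclidean_space) courant \<Rightarrow> 'a set \<Rightarrow>
    ('a \<times> ('a \<times> 'a)) set \<Rightarrow> ('a \<times> unit) set \<Rightarrow>
    ('m, 'c::euclidean_space, 'p, 'g::euclidean_space) courant \<Rightarrow> 'p set \<Rightarrow>
    ('h \<times> 'm \<Rightarrow> 'm) \<Rightarrow> ('p \<times> ('a \<times> 'p)) set \<Rightarrow> bool" where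
  "dirac_action H A E Mul \<epsilon> P L act Act \<longleftrightarrow>
     dirac_structure P L \<and> smooth_action H (base A) (base P) act \<and>
     dirac_morphism (prod_courant A P) (E \<times> L) P L act Act \<and>
     Act O rel_times (Id_on (total A)) Act O assoc_rel = Act O rel_times Mul (Id_on (total P)) \<and>
     Act O rel_times \<epsilon> (Id_on (total P)) = Id_on (total P) O lunit_rel"


section \<open>VB-groupoids and their modules\<close>

text \<open>A groupoid is described by its space of arrows \<open>X\<close> and the data below; units are particular arrows,
  and \<open>gmult x y\<close> is meaningful if \<open>gsrc x = gtgt y\<close>.\<close>

record 'v groupoid =
  gunits :: "'v set"
  gsrc :: "'v \<Rightarrow> 'v"
  gtgt :: "'v \<Rightarrow> 'v"
  gmult :: "'v \<Rightarrow> 'v \<Rightarrow> 'v"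
  ginv :: "'v \<Rightarrow> 'v"

definition groupoid :: "'v set \<Rightarrow> 'v groupoid \<Rightarrow> bool" where
  "groupoid X G \<longleftrightarrow> gunits G \<subseteq> X \<and>
     (\<forall>u\<in>gunits G. gsrc G u = u \<and> gtgt G u = u) \<and>
     (\<forall>x\<in>X. gsrc G x \<in> gunits G \<and> gtgt G x \<in> gunits G \<and>
        gmult G (gtgt G x) x = x \<and> gmult G x (gsrc G x) = x) \<and>
     (\<forall>x\<in>X. \<forall>y\<in>X. gsrc G x = gtgt G y \<longrightarrow>
        gmult G x y \<in> X \<and> gsrc G (gmult G x y) = gsrc G y \<and> gtgt G (gmult G x y) = gtgt G x) \<and>
     (\<forall>x\<in>X. \<forall>y\<in>X. \<forall>z\<in>X. gsrc G x = gtgt G y \<longrightarrow> gsrc G y = gtgt G z \<longrightarrow>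
        gmult G (gmult G x y) z = gmult G x (gmult G y z)) \<and>
     (\<forall>x\<in>X. ginv G x \<in> X \<and> gsrc G (ginv G x) = gtgt G x \<and> gtgt G (ginv G x) = gsrc G x \<and>
        gmult G (ginv G x) x = gsrc G x \<and> gmult G x (ginv G x) = gtgt G x)"

definition lie_groupoid :: "('v, 'b::euclidean_space) atlas \<Rightarrow> 'v groupoid \<Rightarrow> bool" where
  "lie_groupoid \<A> G \<longleftrightarrow> smooth_manifold \<A> \<and> groupoid (points \<A>) G \<and>
     embedded_submanifold \<A> (gunits G) \<and>
     submersion \<A> (restrict_atlas \<A> (gunits G)) (gsrc G) \<and>
     submersion \<A> (restrict_atlas \<A> (gunits G)) (gtgt G) \<and>
     smooth_map_on (prod_atlas \<A> \<A>) {(x, y). x \<in> points \<A> \<and> y \<in> points \<A> \<and> gsrc G x = gtgt G y}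
       \<A> (\<lambda>(x, y). gmult G x y) \<and>
     smooth_map \<A> \<A> (ginv G)"

definition vb_groupoid :: "('h, 'z) monoid_scheme \<Rightarrow>
    ('h, 'b::euclidean_space, 'v, 'f::euclidean_space, 'y) vbundle_scheme \<Rightarrow> 'v groupoid \<Rightarrow> bool" where
  "vb_groupoid H V G \<longleftrightarrow> lie_group H (base V) \<and> vector_bundle V \<and> lie_groupoid (total_atlas V) G \<and>
     vector_subbundle (prod_bundle V (prod_bundle V V))
       {(g \<otimes>\<^bsub>H\<^esub> h, (g, h)) | g h. g \<in> carrier H \<and> h \<in> carrier H}
       {(gmult G x y, (x, y)) | x y. x \<in> total V \<and> y \<in> total V \<and> gsrc G x = gtgt G y}"

definition vacant :: "('h, 'z) monoid_scheme \<Rightarrow>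
    ('h, 'b::euclidean_space, 'v, 'f::euclidean_space, 'y) vbundle_scheme \<Rightarrow> 'v groupoid \<Rightarrow> bool" where
  "vacant H V G \<longleftrightarrow> gunits G = fiber V \<one>\<^bsub>H\<^esub>"

definition sub_groupoid :: "'v groupoid \<Rightarrow> 'v set \<Rightarrow> 'v groupoid" where
  "sub_groupoid G E = G\<lparr>gunits := gunits G \<inter> E\<rparr>"

definition vb_subgroupoid :: "('h, 'z) monoid_scheme \<Rightarrow>
    ('h, 'b::euclidean_space, 'v, 'f::euclidean_space, 'y) vbundle_scheme \<Rightarrow> 'v groupoid \<Rightarrow>
    'v set \<Rightarrow> bool" where
  "vb_subgroupoid H V G E \<longleftrightarrow> vector_subbundle V (points (base V)) E \<and>
     vb_groupoid H (sub_bundle V (points (base V)) E) (sub_groupoid G E)"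

text \<open>\<open>u\<close> is the moment map, \<open>op x y\<close> the action of \<open>x\<close> on \<open>y\<close>, and \<open>act\<close> the underlying action on the
  base.\<close>

definition vb_module :: "('h, 'z) monoid_scheme \<Rightarrow>
    ('h, 'b::euclidean_space, 'v, 'f::euclidean_space, 'y) vbundle_scheme \<Rightarrow> 'v groupoid \<Rightarrow>
    ('m, 'c::euclidean_space, 'p, 'g::euclidean_space, 'x) vbundle_scheme \<Rightarrow>
    ('h \<times> 'm \<Rightarrow> 'm) \<Rightarrow> ('p \<Rightarrow> 'v) \<Rightarrow> ('v \<Rightarrow> 'p \<Rightarrow> 'p) \<Rightarrow> bool" where
  "vb_module H V G P act u op \<longleftrightarrow>
     vb_groupoid H V G \<and> vector_bundle P \<and> smooth_action H (base V) (base P) act \<and>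
     smooth_map (total_atlas P) (restrict_atlas (total_atlas V) (gunits G)) u \<and>
     smooth_map_on (prod_atlas (total_atlas V) (total_atlas P))
       {(x, y). x \<in> total V \<and> y \<in> total P \<and> gsrc G x = u y} (total_atlas P) (\<lambda>(x, y). op x y) \<and>
     (\<forall>x\<in>total V. \<forall>y\<in>total P. gsrc G x = u y \<longrightarrow> u (op x y) = gtgt G x) \<and>
     (\<forall>x\<in>total V. \<forall>x'\<in>total V. \<forall>y\<in>total P. gsrc G x = gtgt G x' \<longrightarrow> gsrc G x' = u y \<longrightarrow>
        op (gmult G x x') y = op x (op x' y)) \<and>
     (\<forall>y\<in>total P. op (u y) y = y) \<and>
     vector_subbundle (prod_bundle P (prod_bundle V P))
       {(act (h, m), (h, m)) | h m. h \<in> carrier H \<and> m \<in> points (base P)}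
       {(op x y, (x, y)) | x y. x \<in> total V \<and> y \<in> total P \<and> gsrc G x = u y}"

definition vb_submodule :: "('h, 'z) monoid_scheme \<Rightarrow>
    ('h, 'b::euclidean_space, 'v, 'f::euclidean_space, 'y) vbundle_scheme \<Rightarrow> 'v groupoid \<Rightarrow> 'v set \<Rightarrow>
    ('m, 'c::euclidean_space, 'p, 'g::euclidean_space, 'x) vbundle_scheme \<Rightarrow> 'p set \<Rightarrow>
    ('h \<times> 'm \<Rightarrow> 'm) \<Rightarrow> ('p \<Rightarrow> 'v) \<Rightarrow> ('v \<Rightarrow> 'p \<Rightarrow> 'p) \<Rightarrow> bool" where
  "vb_submodule H V G E P L act u op \<longleftrightarrow>
     vb_subgroupoid H V G E \<and> vector_subbundle P (points (base P)) L \<and>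
     vb_module H (sub_bundle V (points (base V)) E) (sub_groupoid G E)
       (sub_bundle P (points (base P)) L) act u op"

end

theory Submission
  imports Defs
begin

text \<open>Source and target of \<open>x\<close> are the elements \<open>v\<close> of \<open>E\<^sub>e\<close> with \<open>(x, (x, v)) \<in> Mul\<close> and \<open>(x, (v, x)) \<in> Mul\<close>.
  They exist by the unit axioms, and are unique because \<open>Mul\<close> is a Dirac morphism. Associativity and the
  Lagrangian condition imply that \<open>x\<close> and \<open>y\<close> are related to some \<open>z\<close> iff the source of \<open>x\<close> is the target of
  \<open>y\<close>, and that \<open>z\<close> is then unique: over \<open>e\<close> one shows that the kernel of the source map is orthogonal to that
  of the target map, and elements of \<open>E\<close> carry the general case to the fiber over \<open>e\<close>. The multiplication of \<open>A\<close>
  is an action of \<open>A\<close> on itself, so only actions need to be treated.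

  Each structure map is obtained by solving a relation \<open>(z, (x, y)) \<in> Act\<close> in which a fiberwise linear
  function of \<open>(z, (x, y))\<close> that is injective on \<open>Act\<close> is prescribed. As \<open>Act\<close> is a smooth vector bundle, the
  solution depends smoothly on the data. Through a given \<open>x\<close> over \<open>g\<close> the source map has the section
  \<open>v \<mapsto> x + \<sigma> v - \<sigma> (s x)\<close>, where \<open>\<sigma>\<close> inverts the source map on \<open>E\<^sub>g\<close>; hence it is a submersion.\<close>

section \<open>Calculus of smooth maps\<close>

text \<open>At the outset neither \<open>Mul\<close> nor \<open>Act\<close> is a map: products may
  fail to exist or to be unique, and an intersection like
  \<open>Act \<inter> (L \<times> (E \<times> L))\<close> may jump in rank. Two parts of the
  hypotheses settle this. The Dirac condition gives honest maps in the backward direction: an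
  element of \<open>L\<close> over \<open>act (h, m)\<close> splits uniquely into an element of
  \<open>E\<close> over \<open>h\<close> and one of \<open>L\<close> over \<open>m\<close>. In
  particular every unit in \<open>E\<close> is a product of elements of \<open>E\<close> over
  \<open>h\<close> and its inverse, which is the device that moves questions to the fiber over the
  unit; moreover, the intersection above becomes the graph of a bundle map and has constant rank.
  The Lagrangian condition gives existence in the forward direction by duality:
  \<open>(x, y)\<close> has a product iff it is orthogonal to every \<open>(x', y')\<close> that is
  related to \<open>0\<close>.

  On the analytic side everything reduces to inverting a smooth family of matrices, since all
  equations are linear in the fibers. Subbundles are handled through trivializations of the ambient
  bundle, so that smoothness can always be tested in the ambient total space.\<close>

lemma Ck_on_subset: "Ck_on k N f \<Longrightarrow> M \<subseteq> N \<Longrightarrow> Ck_on k M f"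
  by (induction k arbitrary: f) (auto intro: continuous_on_subset)

lemma Ck_on_SucD:
  assumes "Ck_on (Suc k) N f"
  shows "x \<in> N \<Longrightarrow> (f has_derivative frechet_derivative f (at x)) (at x)"
    and "Ck_on k N (\<lambda>x. frechet_derivative f (at x) v)"
  using assms frechet_derivative_works by auto

text \<open>Openness of \<open>N\<close> makes the germs of \<open>f\<close> and \<open>g\<close>
  agree at each point, hence also their derivatives there.\<close>

lemma Ck_on_cong:
  assumes "open N" "Ck_on k N f" "\<And>x. x \<in> N \<Longrightarrow> f x = g x"
  shows "Ck_on k N g"
  using assms(2,3)
proof (induction k arbitrary: f g)
  case 0
  then show ?case using continuous_on_cong by fastforce
next
  case (Suc k)
  have d: "(g has_derivative frechet_derivative f (at x)) (at x)" if "x \<in> N" for x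
    by (rule has_derivative_transform_within_open[OF Ck_on_SucD(1)[OF Suc.prems(1) that] assms(1) that Suc.prems(2)])
  have "Ck_on k N (\<lambda>x. frechet_derivative g (at x) v)" for v
    by (rule Suc.IH[of "\<lambda>x. frechet_derivative f (at x) v"])
      (use Suc.prems(1) frechet_derivative_at[OF d] in auto)
  then show ?case using d by (auto simp: differentiable_def)
qed

text \<open>Replaces the canonical \<open>frechet_derivative\<close> by any explicit derivative
  \<open>f'\<close>, so that the rules for \<open>has_derivative\<close> can drive the inductions on
  the order below.\<close>

lemma Ck_on_Suc_derivI:
  assumes "open N" "\<And>x. x \<in> N \<Longrightarrow> (f has_derivative f' x) (at x)" "\<And>v. Ck_on k N (\<lambda>x. f' x v)"
  shows "Ck_on (Suc k) N f"
proof -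
  have "Ck_on k N (\<lambda>x. frechet_derivative f (at x) v)" for v
    by (rule Ck_on_cong[OF assms(1) assms(3)[of v]]) (use frechet_derivative_at[OF assms(2)] in auto)
  then show ?thesis using assms(2) by (auto simp: differentiable_def)
qed

lemma Ck_on_continuous: "Ck_on k N f \<Longrightarrow> continuous_on N f"
proof (cases k)
  case (Suc j)
  assume "Ck_on k N f"
  then show ?thesis
    using Suc by (auto intro!: continuous_at_imp_continuous_on differentiable_imp_continuous_within)
qed simp

lemma Ck_on_Suc_imp: "open N \<Longrightarrow> Ck_on (Suc k) N f \<Longrightarrow> Ck_on k N f"
proof (induction k arbitrary: f)
  case 0
  then show ?case using Ck_on_continuous[of "Suc 0"] by (metis Ck_on.simps(1))
next
  case (Suc k)
  show ?case
    by (rule Ck_on_Suc_derivI[OF Suc.prems(1) Ck_on_SucD(1)[OF Suc.prems(2)]])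
      (use Suc Ck_on_SucD(2)[OF Suc.prems(2)] in blast)+
qed

lemma Ck_on_linear:
  assumes "open N" "bounded_linear L" "Ck_on k N f"
  shows "Ck_on k N (\<lambda>x. L (f x))"
  using assms(3)
proof (induction k arbitrary: f)
  case 0
  then show ?case using bounded_linear.continuous_on[OF assms(2)] by simp
next
  case (Suc k)
  show ?case
    by (rule Ck_on_Suc_derivI[OF assms(1) bounded_linear.has_derivative[OF assms(2) Ck_on_SucD(1)[OF Suc.prems]]])
      (use Suc.IH Ck_on_SucD(2)[OF Suc.prems] in auto)
qed

lemma Ck_on_ident: "open N \<Longrightarrow> Ck_on k N (\<lambda>x. x)"
proof (cases k)
  case (Suc j)
  assume "open N"
  then show ?thesis
    unfolding Suc by (intro Ck_on_Suc_derivI[where f'="\<lambda>_ v. v"]) (auto simp: Ck_on_const)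
qed simp

lemma Ck_on_add:
  assumes "open N" "Ck_on k N f" "Ck_on k N g"
  shows "Ck_on k N (\<lambda>x. f x + g x)"
  using assms(2,3)
proof (induction k arbitrary: f g)
  case 0
  then show ?case by (simp add: continuous_on_add)
next
  case (Suc k)
  show ?case
    by (rule Ck_on_Suc_derivI[OF assms(1) has_derivative_add[OF Ck_on_SucD(1)[OF Suc.prems(1)]
            Ck_on_SucD(1)[OF Suc.prems(2)]]])
      (use Suc.IH Ck_on_SucD(2)[OF Suc.prems(1)] Ck_on_SucD(2)[OF Suc.prems(2)] in auto)
qed

lemma Ck_on_sum:
  assumes "open N" "\<And>i. i \<in> I \<Longrightarrow> Ck_on k N (f i)"
  shows "Ck_on k N (\<lambda>x. \<Sum>i\<in>I. f i x)"
  using assms(2)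
  by (induction I rule: infinite_finite_induct) (auto simp: Ck_on_const intro!: Ck_on_add assms(1))

lemma Ck_on_bilinear:
  assumes "open N" "bounded_bilinear B" "Ck_on k N f" "Ck_on k N g"
  shows "Ck_on k N (\<lambda>x. B (f x) (g x))"
  using assms(3,4)
proof (induction k arbitrary: f g)
  case 0
  then show ?case using bounded_bilinear.continuous_on[OF assms(2)] by simp
next
  case (Suc k)
  \<comment> \<open>The product rule contains undifferentiated factors, which have to be lowered by
    one order before the induction hypothesis applies.\<close>
  have fg: "Ck_on k N f" "Ck_on k N g" using Suc.prems Ck_on_Suc_imp assms(1) by blast+
  show ?case
    by (rule Ck_on_Suc_derivI[OF assms(1) bounded_bilinear.FDERIV[OF assms(2) Ck_on_SucD(1)[OF Suc.prems(1)]
            Ck_on_SucD(1)[OF Suc.prems(2)]]])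
      (use Suc.IH fg Ck_on_SucD(2)[OF Suc.prems(1)] Ck_on_SucD(2)[OF Suc.prems(2)] in \<open>auto intro!: Ck_on_add assms(1)\<close>)
qed

lemma Ck_on_Pair:
  fixes f :: "'a::euclidean_space \<Rightarrow> 'b::euclidean_space" and g :: "'a \<Rightarrow> 'c::euclidean_space"
  assumes "open N" "Ck_on k N f" "Ck_on k N g"
  shows "Ck_on k N (\<lambda>x. (f x, g x))"
proof -
  have "bounded_linear (\<lambda>y::'b. (y, 0::'c))" "bounded_linear (\<lambda>z::'c. (0::'b, z))"
    by (rule bounded_linear_Pair bounded_linear_ident bounded_linear_zero)+
  then have "Ck_on k N (\<lambda>x. (f x, 0::'c) + (0::'b, g x))"
    using Ck_on_add[OF assms(1) Ck_on_linear[OF assms(1) _ assms(2)] Ck_on_linear[OF assms(1) _ assms(3)]]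
    by blast
  then show ?thesis by simp
qed

lemma linear_basis_sum:
  fixes f :: "'a::euclidean_space \<Rightarrow> 'b::real_vector"
  assumes "linear f"
  shows "f v = (\<Sum>i\<in>Basis. (v \<bullet> i) *\<^sub>R f i)"
proof -
  have "f v = f (\<Sum>i\<in>Basis. (v \<bullet> i) *\<^sub>R i)" by (simp add: euclidean_representation)
  also have "\<dots> = (\<Sum>i\<in>Basis. (v \<bullet> i) *\<^sub>R f i)" using assms by (simp add: linear_sum linear_scale)
  finally show ?thesis .
qed

text \<open>Expanding \<open>f x\<close> in the basis turns the value into a sum of products of
  scalar functions and the columns \<open>L x i\<close>. This is the form in which the chain rule
  and the derivative of an inverse matrix appear.\<close>

lemma Ck_on_linear_family:
  fixes L :: "'a::euclidean_space \<Rightarrow> 'b::euclidean_space \<Rightarrow> 'c::euclidean_space"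
  assumes "open N" "\<And>x. x \<in> N \<Longrightarrow> linear (L x)" "\<And>i. i \<in> Basis \<Longrightarrow> Ck_on k N (\<lambda>x. L x i)" "Ck_on k N f"
  shows "Ck_on k N (\<lambda>x. L x (f x))"
proof (rule Ck_on_cong[OF assms(1)])
  show "Ck_on k N (\<lambda>x. \<Sum>i\<in>Basis. (f x \<bullet> i) *\<^sub>R L x i)"
    using assms(3) Ck_on_linear[OF assms(1) bounded_linear_inner_left assms(4)]
    by (intro Ck_on_sum Ck_on_bilinear[OF _ bounded_bilinear_scaleR] assms(1)) blast+
  fix x assume "x \<in> N"
  then show "(\<Sum>i\<in>Basis. (f x \<bullet> i) *\<^sub>R L x i) = L x (f x)"
    using linear_basis_sum assms(2) by metis
qed

text \<open>Induction on the order with \<open>g\<close> generalized: the derivative of the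
  composite is the linear family \<open>Dg (f x)\<close> applied to \<open>Df x v\<close>, and its
  columns are again composites with \<open>f\<close>, of one order less.\<close>

lemma Ck_on_compose:
  fixes f :: "'a::euclidean_space \<Rightarrow> 'b::euclidean_space" and g :: "'b \<Rightarrow> 'c::euclidean_space"
  assumes "open N" "open M" "f ` N \<subseteq> M" "Ck_on k N f" "Ck_on k M g"
  shows "Ck_on k N (\<lambda>x. g (f x))"
  using assms(4,5)
proof (induction k arbitrary: g)
  case 0
  then show ?case using assms(3) continuous_on_compose2[of M g N f] by simp
next
  case (Suc k)
  have d: "((\<lambda>x. g (f x)) has_derivative
      (\<lambda>v. frechet_derivative g (at (f x)) (frechet_derivative f (at x) v))) (at x)" if "x \<in> N" for x
    using has_derivative_compose[OF Ck_on_SucD(1)[OF Suc.prems(1) that] Ck_on_SucD(1)[OF Suc.prems(2)]]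
      that assms(3) by blast
  have fk: "Ck_on k N f" using Suc.prems assms(1) Ck_on_Suc_imp by blast
  show ?case
  proof (rule Ck_on_Suc_derivI[OF assms(1) d])
    fix v
    show "Ck_on k N (\<lambda>x. frechet_derivative g (at (f x)) (frechet_derivative f (at x) v))"
    proof (rule Ck_on_linear_family[OF assms(1) _ _ Ck_on_SucD(2)[OF Suc.prems(1)]])
      fix x assume "x \<in> N"
      then show "linear (frechet_derivative g (at (f x)))"
        using Suc.prems(2) assms(3) linear_frechet_derivative unfolding Ck_on.simps by blast
    qed (rule Suc.IH[OF fk Ck_on_SucD(2)[OF Suc.prems(2)]])
  qed
qed

section \<open>Smooth maps on open sets, all orders at once\<close>

definition smooth_open :: "'a::euclidean_space set \<Rightarrow> ('a \<Rightarrow> 'b::euclidean_space) \<Rightarrow> bool" where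
  "smooth_open N f \<longleftrightarrow> open N \<and> (\<forall>k. Ck_on k N f)"

lemma smooth_openD:
  "smooth_open N f \<Longrightarrow> open N" "smooth_open N f \<Longrightarrow> Ck_on k N f" "smooth_open N f \<Longrightarrow> continuous_on N f"
  using Ck_on_continuous[of k N f] by (simp_all add: smooth_open_def)

lemma smooth_open_const: "open N \<Longrightarrow> smooth_open N (\<lambda>_. c)"
  by (simp add: smooth_open_def Ck_on_const)

lemma smooth_open_subset: "smooth_open N f \<Longrightarrow> open M \<Longrightarrow> M \<subseteq> N \<Longrightarrow> smooth_open M f"
  using Ck_on_subset[of _ N f M] by (simp add: smooth_open_def)

lemma smooth_open_linear: "bounded_linear L \<Longrightarrow> smooth_open N f \<Longrightarrow> smooth_open N (\<lambda>x. L (f x))"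
  using Ck_on_linear[of N L _ f] by (simp add: smooth_open_def)

lemma smooth_open_ident: "open N \<Longrightarrow> smooth_open N (\<lambda>x. x)"
  by (simp add: smooth_open_def Ck_on_ident)

lemma smooth_open_bounded_linear: "bounded_linear L \<Longrightarrow> open N \<Longrightarrow> smooth_open N L"
  using smooth_open_linear[OF _ smooth_open_ident] .

lemma smooth_open_Pair: "smooth_open N f \<Longrightarrow> smooth_open N g \<Longrightarrow> smooth_open N (\<lambda>x. (f x, g x))"
  using Ck_on_Pair[of N _ f g] by (simp add: smooth_open_def)

lemma smooth_open_add: "smooth_open N f \<Longrightarrow> smooth_open N g \<Longrightarrow> smooth_open N (\<lambda>x. f x + g x)"
  using Ck_on_add[of N _ f g] by (simp add: smooth_open_def)

lemma smooth_open_diff: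
  assumes "smooth_open N f" "smooth_open N g" shows "smooth_open N (\<lambda>x. f x - g x)"
  using smooth_open_add[OF assms(1) smooth_open_linear[OF bounded_linear_minus[OF bounded_linear_ident] assms(2)]]
  by simp

lemma smooth_open_sum:
  "open N \<Longrightarrow> (\<And>i. i \<in> I \<Longrightarrow> smooth_open N (f i)) \<Longrightarrow> smooth_open N (\<lambda>x. \<Sum>i\<in>I. f i x)"
  using Ck_on_sum[of N I _ f] by (simp add: smooth_open_def)

lemma smooth_open_scaleR:
  "smooth_open N f \<Longrightarrow> smooth_open N g \<Longrightarrow> smooth_open N (\<lambda>x. f x *\<^sub>R g x)"
  using Ck_on_bilinear[OF _ bounded_bilinear_scaleR, of N _ f g] by (simp add: smooth_open_def)

lemma smooth_open_linear_family:
  fixes L :: "'a::euclidean_space \<Rightarrow> 'b::euclidean_space \<Rightarrow> 'c::euclidean_space"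
  assumes "\<And>x. x \<in> N \<Longrightarrow> linear (L x)" "\<And>i. i \<in> Basis \<Longrightarrow> smooth_open N (\<lambda>x. L x i)" "smooth_open N f"
  shows "smooth_open N (\<lambda>x. L x (f x))"
  using assms Ck_on_linear_family[of N L _ f] by (simp add: smooth_open_def)

lemma smooth_open_compose:
  "smooth_open N f \<Longrightarrow> smooth_open M g \<Longrightarrow> f ` N \<subseteq> M \<Longrightarrow> smooth_open N (\<lambda>x. g (f x))"
  using Ck_on_compose[of N M f _ g] by (simp add: smooth_open_def)

lemma smooth_open_vimage: "smooth_open N f \<Longrightarrow> open M \<Longrightarrow> open (N \<inter> f -` M)"
  using continuous_on_open_vimage[of N f] smooth_openD[of N f] by (metis Int_commute)

lemma smooth_onE:
  assumes "smooth_on S f" "x \<in> S"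
  obtains N g where "x \<in> N" "smooth_open N g" "\<And>y. y \<in> N \<Longrightarrow> y \<in> S \<Longrightarrow> f y = g y"
proof -
  obtain N g where "open N" "x \<in> N" "\<forall>k. Ck_on k N g" "\<forall>y\<in>N \<inter> S. f y = g y"
    using assms unfolding smooth_on_def by blast
  then show ?thesis using that[of N g] by (simp add: smooth_open_def)
qed

lemma smooth_onI:
  assumes "\<And>x. x \<in> S \<Longrightarrow> \<exists>N g. x \<in> N \<and> smooth_open N g \<and> (\<forall>y\<in>N \<inter> S. f y = g y)"
  shows "smooth_on S f"
  unfolding smooth_on_def
proof
  fix x assume "x \<in> S"
  then obtain N g where "x \<in> N" "smooth_open N g" "\<forall>y\<in>N \<inter> S. f y = g y" using assms by blast
  then show "\<exists>N g. open N \<and> x \<in> N \<and> (\<forall>k. Ck_on k N g) \<and> (\<forall>y\<in>N \<inter> S. f y = g y)"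
    unfolding smooth_open_def by (intro exI[of _ N] exI[of _ g]) simp
qed

section \<open>Smooth families of linear maps\<close>

text \<open>Injectivity of \<open>L a\<close> gives a lower bound \<open>c\<close>; nearby,
  \<open>L x\<close> differs from \<open>L a\<close> by at most \<open>c/2\<close> in operator norm,
  so half of the bound survives uniformly. The first assumption records that \<open>N\<close> is
  open.\<close>

lemma linear_family_bounded_below:
  fixes L :: "'a::euclidean_space \<Rightarrow> 'b::euclidean_space \<Rightarrow> 'b"
  assumes "smooth_open N (\<lambda>x. L x 0)" and lin: "\<And>x. x \<in> N \<Longrightarrow> linear (L x)"
    and sm: "\<And>i. i \<in> Basis \<Longrightarrow> smooth_open N (\<lambda>x. L x i)" and a: "a \<in> N" and inj: "inj (L a)"
  obtains M c where "open M" "a \<in> M" "M \<subseteq> N" "c > 0" "\<And>x v. x \<in> M \<Longrightarrow> c * norm v \<le> norm (L x v)"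
proof -
  have N: "open N" using assms(1) smooth_openD by blast
  obtain c where c: "c > 0" "\<And>v. norm (L a v) \<ge> c * norm v"
    using linear_inj_bounded_below_pos[OF lin[OF a] inj] by blast
  \<comment> \<open>The sum over basis vectors dominates the operator norm of
    \<open>L x - L a\<close>, because coordinates are bounded by the norm.\<close>
  define e where "e x = (\<Sum>i\<in>Basis. norm (L x i - L a i))" for x
  have "continuous_on N e"
    unfolding e_def using smooth_openD(3)[OF sm] by (intro continuous_intros) auto
  moreover have "e a = 0" by (simp add: e_def)
  ultimately have "open (N \<inter> e -` {..<c/2})" "a \<in> N \<inter> e -` {..<c/2}"
    using N a c by (auto simp: continuous_on_open_vimage Int_commute)
  moreover have "(c/2) * norm v \<le> norm (L x v)" if x: "x \<in> N \<inter> e -` {..<c/2}" for x v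
  proof -
    have "L x v - L a v = (\<Sum>i\<in>Basis. (v \<bullet> i) *\<^sub>R (L x i - L a i))"
      using x linear_basis_sum[OF lin[OF a], of v] linear_basis_sum[OF lin, of x v]
      by (simp add: scaleR_diff_right sum_subtractf)
    also have "norm \<dots> \<le> (\<Sum>i\<in>Basis. norm v * norm (L x i - L a i))"
      by (intro sum_norm_le) (auto intro!: mult_right_mono Basis_le_norm)
    also have "\<dots> \<le> norm v * (c/2)"
      using x mult_left_mono[of "e x" "c/2" "norm v"] by (simp add: e_def sum_distrib_left)
    finally have "norm (L x v - L a v) \<le> norm v * (c/2)" .
    then show ?thesis using c(2)[of v] norm_triangle_ineq2[of "L a v" "L a v - L x v"]
      by (simp add: norm_minus_commute field_simps)
  qed
  ultimately show ?thesis
    by (intro that[of "N \<inter> e -` {..<c/2}" "c/2"]) (use c in auto)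
qed

text \<open>This is the formula \<open>D(L^-1) = - L^-1 (DL) L^-1\<close>, evaluated on a fixed
  vector \<open>v\<close>; the uniform lower bound \<open>c\<close> controls the inverses near
  \<open>a\<close>.\<close>

lemma inverse_family_differentiable:
  fixes L :: "'a::euclidean_space \<Rightarrow> 'b::euclidean_space \<Rightarrow> 'b"
  assumes M: "open M" and lin: "\<And>x. x \<in> M \<Longrightarrow> linear (L x)"
    and sm: "\<And>v. smooth_open M (\<lambda>x. L x v)" and c: "c > 0"
    and below: "\<And>x v. x \<in> M \<Longrightarrow> c * norm v \<le> norm (L x v)" and a: "a \<in> M"
    and inv: "\<And>x. x \<in> M \<Longrightarrow> linear (K x)" "\<And>x v. x \<in> M \<Longrightarrow> L x (K x v) = v"
      "\<And>x v. x \<in> M \<Longrightarrow> K x (L x v) = v"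
  shows "((\<lambda>x. K x v) has_derivative
    (\<lambda>h. - K a (frechet_derivative (\<lambda>x. L x (K a v)) (at a) h))) (at a)"
proof -
  define F where "F x = L x (K a v)" for x
  define F' where "F' = frechet_derivative F (at a)"
  have F': "(F has_derivative F') (at a)"
    unfolding F'_def using sm[of "K a v"] a unfolding F_def smooth_open_def by (metis Ck_on_SucD(1))
  have Kb: "norm (K x w) \<le> norm w / c" if "x \<in> M" for x w
    using below[OF that, of "K x w"] inv(2)[OF that] c by (simp add: field_simps)
  have Ka: "bounded_linear (K a)" using inv(1)[OF a] by (simp add: linear_conv_bounded_linear)
  \<comment> \<open>Resolvent identity: \<open>F a = v\<close>, while
    \<open>K x (F x) = K a v\<close>.\<close>
  have eq: "K x v - K a v = K x (F a - F x)" if "x \<in> M" for x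
    using inv a that by (simp add: F_def linear_diff)
  \<comment> \<open>Continuity of the inverse at \<open>a\<close>, from the same identity and the
    bound \<open>1 / c\<close> on \<open>K x\<close>.\<close>
  have Kc: "((\<lambda>x. K x w) \<longlongrightarrow> K a w) (at a)" for w
  proof -
    have "((\<lambda>x. norm (L a (K a w) - L x (K a w)) / c) \<longlongrightarrow> norm (L a (K a w) - L a (K a w)) / c) (at a)"
      using smooth_openD(3)[OF sm[of "K a w"]] M a c
      by (intro tendsto_intros) (auto simp: continuous_on_def at_within_open[OF a M])
    then have "((\<lambda>x. norm (L a (K a w) - L x (K a w)) / c) \<longlongrightarrow> 0) (at a)" by simp
    moreover have "\<forall>\<^sub>F x in at a. norm (K x w - K a w) \<le> norm (L a (K a w) - L x (K a w)) / c"
      using eventually_at_in_open'[OF M a]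
    proof eventually_elim
      case (elim x)
      have "K x w - K a w = K x (L a (K a w) - L x (K a w))" using inv a elim by (simp add: linear_diff)
      then show ?case using Kb elim by metis
    qed
    ultimately have "((\<lambda>x. K x w - K a w) \<longlongrightarrow> 0) (at a)" by (rule Lim_null_comparison[rotated])
    then show ?thesis by (simp add: LIM_zero_iff)
  qed
  have "((\<lambda>x. (1 / norm (x - a)) *\<^sub>R (K x v - K a v - - K a (F' (x - a)))) \<longlongrightarrow> 0) (at a)"
  proof -
    \<comment> \<open>By the identity above, the difference quotient of the inverse equals
      \<open>- K x (q x + r x)\<close>, where \<open>r\<close> is the remainder of \<open>F\<close>
      and \<open>q\<close> its linear part. Adding \<open>K a (q x)\<close> leaves
      \<open>(K a - K x) (q x) - K x (r x)\<close>.\<close>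
    define r where "r x = (1 / norm (x - a)) *\<^sub>R (F x - F a - F' (x - a))" for x
    define q where "q x = (1 / norm (x - a)) *\<^sub>R F' (x - a)" for x
    have r: "(r \<longlongrightarrow> 0) (at a)"
      using F' unfolding has_derivative_def r_def by (simp add: Lim_ident_at divide_inverse)
    have lF': "bounded_linear F'" using F' has_derivative_bounded_linear by blast
    text \<open>\<open>(K a - K x) q x\<close> tends to \<open>0\<close>: expand the bounded \<open>q x\<close> in a basis.\<close>
    have qb: "\<bar>q x \<bullet> i\<bar> \<le> onorm F'" if "i \<in> Basis" for x i
    proof -
      have "\<bar>q x \<bullet> i\<bar> \<le> norm (q x)" using that Basis_le_norm by blast
      also have "\<dots> \<le> onorm F'"
        using onorm[OF lF', of "x - a"] onorm_pos_le[OF lF']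
        by (cases "x = a") (auto simp: q_def field_simps)
      finally show ?thesis .
    qed
    have t1: "((\<lambda>x. (q x \<bullet> i) *\<^sub>R (K a i - K x i)) \<longlongrightarrow> 0) (at a)" if "i \<in> Basis" for i
    proof (rule Lim_null_comparison)
      show "\<forall>\<^sub>F x in at a. norm ((q x \<bullet> i) *\<^sub>R (K a i - K x i)) \<le> onorm F' * norm (K a i - K x i)"
        using qb[OF that] by (intro always_eventually allI) (auto intro: mult_right_mono)
      have "((\<lambda>x. onorm F' * norm (K a i - K x i)) \<longlongrightarrow> onorm F' * norm (K a i - K a i)) (at a)"
        by (intro tendsto_intros Kc)
      then show "((\<lambda>x. onorm F' * norm (K a i - K x i)) \<longlongrightarrow> 0) (at a)" by simp
    qed
    have t2: "((\<lambda>x. \<Sum>i\<in>Basis. (q x \<bullet> i) *\<^sub>R (K a i - K x i)) \<longlongrightarrow> 0) (at a)"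
      using tendsto_sum[of Basis, OF t1] by simp
    have t3: "((\<lambda>x. - K x (r x)) \<longlongrightarrow> 0) (at a)"
    proof (rule Lim_null_comparison)
      show "\<forall>\<^sub>F x in at a. norm (- K x (r x)) \<le> norm (r x) / c"
        using eventually_at_in_open'[OF M a] by eventually_elim (use Kb in auto)
      show "((\<lambda>x. norm (r x) / c) \<longlongrightarrow> 0) (at a)"
        using tendsto_divide[OF tendsto_norm[OF r] tendsto_const[of c]] c by simp
    qed
    have "((\<lambda>x. (\<Sum>i\<in>Basis. (q x \<bullet> i) *\<^sub>R (K a i - K x i)) + - K x (r x)) \<longlongrightarrow> 0 + 0) (at a)"
      by (rule tendsto_add[OF t2 t3])
    moreover have "\<forall>\<^sub>F x in at a. (\<Sum>i\<in>Basis. (q x \<bullet> i) *\<^sub>R (K a i - K x i)) + - K x (r x) =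
        (1 / norm (x - a)) *\<^sub>R (K x v - K a v - - K a (F' (x - a)))"
      using eventually_at_in_open'[OF M a]
    proof eventually_elim
      case (elim x)
      have "(\<Sum>i\<in>Basis. (q x \<bullet> i) *\<^sub>R (K a i - K x i)) = K a (q x) - K x (q x)"
        using linear_basis_sum[OF inv(1)[OF a], of "q x"] linear_basis_sum[OF inv(1)[OF elim], of "q x"]
        by (simp add: scaleR_diff_right sum_subtractf)
      moreover have "q x + r x = (1 / norm (x - a)) *\<^sub>R (F x - F a)"
        by (simp add: q_def r_def algebra_simps)
      then have "K x (q x) + K x (r x) = (1 / norm (x - a)) *\<^sub>R K x (F x - F a)"
        using inv(1)[OF elim] by (metis linear_add linear_scale)
      moreover have "K x (F x - F a) = - (K x v - K a v)"
        using eq[OF elim] inv(1)[OF elim] by (simp add: linear_diff)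
      moreover have "K a (q x) = (1 / norm (x - a)) *\<^sub>R K a (F' (x - a))"
        unfolding q_def using inv(1)[OF a] by (simp add: linear_scale)
      moreover have "K a (q x) - K x (q x) + - K x (r x) = K a (q x) - (K x (q x) + K x (r x))"
        by simp
      ultimately show ?case by (simp add: scaleR_diff_right scaleR_add_right)
    qed
    ultimately show ?thesis by (simp add: tendsto_cong)
  qed
  moreover have "bounded_linear (\<lambda>h. - K a (F' h))"
    using bounded_linear_minus[OF bounded_linear_compose[OF Ka has_derivative_bounded_linear[OF F']]] .
  ultimately show ?thesis
    unfolding has_derivative_def F'_def F_def by (simp add: Lim_ident_at divide_inverse)
qed

text \<open>Bootstrapping: the derivative of the inverse is built from the inverse itself and the
  derivative of \<open>L\<close>, so being \<open>C^k\<close> gives \<open>C^(k+1)\<close>. Domain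
  and codomain coincide, so injectivity already gives an inverse.\<close>

lemma inverse_family_smooth:
  fixes L :: "'a::euclidean_space \<Rightarrow> 'b::euclidean_space \<Rightarrow> 'b"
  assumes lin: "\<And>x. x \<in> N \<Longrightarrow> linear (L x)"
    and sm: "\<And>v. smooth_open N (\<lambda>x. L x v)" and a: "a \<in> N" and inj: "inj (L a)"
  obtains M K where "a \<in> M" "M \<subseteq> N" "\<And>v. smooth_open M (\<lambda>x. K x v)" "\<And>x. x \<in> M \<Longrightarrow> linear (K x)"
    "\<And>x v. x \<in> M \<Longrightarrow> K x (L x v) = v"
proof -
  obtain M c where M: "open M" "a \<in> M" "M \<subseteq> N" "c > 0" "\<And>x v. x \<in> M \<Longrightarrow> c * norm v \<le> norm (L x v)"
    by (rule linear_family_bounded_below[OF sm lin sm a inj]) blast+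
  have "\<exists>K. linear K \<and> (\<forall>v. L x (K v) = v) \<and> (\<forall>v. K (L x v) = v)" if x: "x \<in> M" for x
  proof -
    have l: "linear (L x)" using lin M(3) x by blast
    moreover have "L x v = 0 \<Longrightarrow> v = 0" for v
      using M(5)[OF x, of v] M(4) by (simp add: mult_le_0_iff)
    ultimately have "inj (L x)" using linear_injective_0 by blast
    then show ?thesis
      using linear_injective_isomorphism[OF l] by blast
  qed
  then obtain K where K: "\<And>x. x \<in> M \<Longrightarrow> linear (K x)" "\<And>x v. x \<in> M \<Longrightarrow> L x (K x v) = v"
      "\<And>x v. x \<in> M \<Longrightarrow> K x (L x v) = v"
    by metis
  have lM: "linear (L x)" if "x \<in> M" for x using lin that M(3) by blast
  have sM: "smooth_open M (\<lambda>x. L x v)" for v using sm M smooth_open_subset by blast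
  have d: "((\<lambda>x. K x v) has_derivative (\<lambda>h. - K a (frechet_derivative (\<lambda>x. L x (K a v)) (at a) h))) (at a)"
    if "a \<in> M" for a v
    using that M(5) K by (intro inverse_family_differentiable[OF M(1) _ sM M(4)] lM) auto
  have "Ck_on k M (\<lambda>x. K x v)" for k v
  proof (induction k arbitrary: v)
    case 0
    have "(\<lambda>x. K x v) differentiable (at x)" if "x \<in> M" for x
      using d[OF that] differentiable_def by blast
    then show ?case
      by (auto intro!: continuous_at_imp_continuous_on differentiable_imp_continuous_within)
  next
    case (Suc k)
    show ?case
    proof (rule Ck_on_Suc_derivI[OF M(1) d])
      fix h
      have LD: "((\<lambda>x. L x w) has_derivative frechet_derivative (\<lambda>x. L x w) (at a)) (at a)" if "a \<in> M" for a w
        by (rule Ck_on_SucD(1)[OF smooth_openD(2)[OF sM] that])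
      \<comment> \<open>\<open>D x\<close> is the derivative of the matrix in the direction
        \<open>h\<close>. Its linearity in \<open>w\<close> holds because \<open>L\<close> is linear
        in \<open>w\<close> on a whole neighbourhood of \<open>x\<close>.\<close>
      define D where "D x w = frechet_derivative (\<lambda>x. L x w) (at x) h" for x w
      have Dl: "linear (D x)" if x: "x \<in> M" for x
      proof (rule linearI)
        fix w w' r
        have e: "\<forall>\<^sub>F y in at x. L y w + L y w' = L y (w + w')" "\<forall>\<^sub>F y in at x. r *\<^sub>R L y w = L y (r *\<^sub>R w)"
          using eventually_at_in_open'[OF M(1) x] lM
          by (auto elim!: eventually_mono simp: linear_add linear_scale)
        have "((\<lambda>x. L x (w + w')) has_derivative
            (\<lambda>h. frechet_derivative (\<lambda>x. L x w) (at x) h + frechet_derivative (\<lambda>x. L x w') (at x) h)) (at x)"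
          by (rule has_derivative_transform_eventually[OF has_derivative_add[OF LD[OF x] LD[OF x]] e(1)])
            (use lM[OF x] in \<open>auto simp: linear_add\<close>)
        from frechet_derivative_at[OF this, symmetric] show "D x (w + w') = D x w + D x w'"
          unfolding D_def by simp
        have "((\<lambda>x. L x (r *\<^sub>R w)) has_derivative
            (\<lambda>h. r *\<^sub>R frechet_derivative (\<lambda>x. L x w) (at x) h)) (at x)"
          by (rule has_derivative_transform_eventually[OF has_derivative_scaleR_right[OF LD[OF x]] e(2)])
            (use lM[OF x] in \<open>auto simp: linear_scale\<close>)
        from frechet_derivative_at[OF this, symmetric] show "D x (r *\<^sub>R w) = r *\<^sub>R D x w"
          unfolding D_def by simp
      qed
      have Ds: "Ck_on k M (\<lambda>x. D x w)" for w
        unfolding D_def by (rule Ck_on_SucD(2)[OF smooth_openD(2)[OF sM]])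
      have DK: "Ck_on k M (\<lambda>x. D x (K x v))"
        by (rule Ck_on_linear_family[OF M(1) Dl Ds Suc.IH])
      have "Ck_on k M (\<lambda>x. K x (D x (K x v)))"
        by (rule Ck_on_linear_family[OF M(1) K(1) Suc.IH DK])
      then have "Ck_on k M (\<lambda>x. - K x (D x (K x v)))"
        using M(1) Ck_on_linear[OF M(1) bounded_linear_minus[OF bounded_linear_ident]] by blast
      then show "Ck_on k M (\<lambda>x. - K x (frechet_derivative (\<lambda>y. L y (K x v)) (at x) h))"
        by (simp add: D_def)
    qed auto
  qed
  then have "smooth_open M (\<lambda>x. K x v)" for v using M(1) by (simp add: smooth_open_def)
  then show ?thesis using that[of M K] M K by blast
qed

text \<open>Here \<open>\<alpha> x\<close> goes between different spaces and is injective only on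
  \<open>W\<close> and only at \<open>a\<close>. A fixed left inverse of \<open>\<alpha> a\<close>
  reduces this to inverting a family of endomorphisms that starts at the identity.\<close>

lemma left_inverse_family_smooth:
  fixes \<alpha> :: "'a::euclidean_space \<Rightarrow> 'b::euclidean_space \<Rightarrow> 'c::euclidean_space"
  assumes lin: "\<And>x. x \<in> N \<Longrightarrow> linear (\<alpha> x)"
    and sm: "\<And>v. smooth_open N (\<lambda>x. \<alpha> x v)" and a: "a \<in> N" and W: "subspace W" and inj: "inj_on (\<alpha> a) W"
  obtains M K where "a \<in> M" "M \<subseteq> N" "\<And>v. smooth_open M (\<lambda>x. K x v)" "\<And>x. x \<in> M \<Longrightarrow> linear (K x)"
    "\<And>x w. x \<in> M \<Longrightarrow> w \<in> W \<Longrightarrow> K x (\<alpha> x w) = w"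
proof -
  obtain \<Lambda> where \<Lambda>: "linear \<Lambda>" "\<And>w. w \<in> W \<Longrightarrow> \<Lambda> (\<alpha> a w) = w"
    using linear_exists_left_inverse_on[OF lin[OF a] W inj] by blast
  obtain \<pi> :: "'b \<Rightarrow> 'b" where \<pi>: "linear \<pi>" "\<And>w. w \<in> W \<Longrightarrow> \<pi> w = w" "range \<pi> \<subseteq> W"
    using linear_exists_left_inverse_on[OF linear_id W inj_on_id] by auto
  \<comment> \<open>At \<open>x = a\<close> this is the identity; on \<open>W\<close> the fixed term
    \<open>\<Lambda> (\<alpha> a w)\<close> cancels \<open>w\<close>, leaving
    \<open>\<Lambda> (\<alpha> x w)\<close>. So an inverse of \<open>L x\<close> followed after
    \<open>\<Lambda>\<close> is a left inverse of \<open>\<alpha> x\<close> on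
    \<open>W\<close>.\<close>
  define L where "L x v = v + \<Lambda> (\<alpha> x (\<pi> v) - \<alpha> a (\<pi> v))" for x v
  have l: "linear (L x)" if "x \<in> N" for x
    unfolding L_def using lin[OF that] lin[OF a] \<Lambda>(1) \<pi>(1)
    by (intro linearI) (simp_all add: linear_add linear_diff linear_scale algebra_simps)
  have N: "open N" using sm smooth_openD by blast
  have s: "smooth_open N (\<lambda>x. L x v)" for v
    unfolding L_def using sm N \<Lambda>(1)
    by (intro smooth_open_add smooth_open_linear[of \<Lambda>] smooth_open_diff smooth_open_const)
      (auto simp: linear_conv_bounded_linear)
  have "inj (L a)" using \<Lambda>(1) by (simp add: L_def linear_0 inj_on_def)
  then obtain M K where MK: "a \<in> M" "M \<subseteq> N" "\<And>v. smooth_open M (\<lambda>x. K x v)" "\<And>x. x \<in> M \<Longrightarrow> linear (K x)"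
    "\<And>x v. x \<in> M \<Longrightarrow> K x (L x v) = v"
    using inverse_family_smooth[OF l s a] by metis
  define K' where "K' x v = K x (\<Lambda> v)" for x v
  show ?thesis
  proof (rule that[of M K'])
    show "linear (K' x)" if "x \<in> M" for x
      unfolding K'_def using linear_compose[OF \<Lambda>(1) MK(4)[OF that]] by (simp add: comp_def)
    show "K' x (\<alpha> x w) = w" if "x \<in> M" "w \<in> W" for x w
    proof -
      have "L x w = \<Lambda> (\<alpha> x w)" using \<Lambda> \<pi> that by (simp add: L_def linear_diff)
      then show ?thesis using MK(5)[OF that(1), of w] by (simp add: K'_def)
    qed
  qed (use MK in \<open>auto simp: K'_def\<close>)
qed

section \<open>Local coordinate representations\<close>

text \<open>A coordinate expression of \<open>f\<close> at \<open>p\<close> in two given charts.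
  Requiring \<open>f q\<close> to stay in the second chart for all nearby \<open>q\<close> in
  \<open>S\<close> builds local continuity into the notion, so that composition needs no separate
  shrinking of domains.\<close>

definition local_rep :: "'m set \<Rightarrow> 'm set \<times> ('m \<Rightarrow> 'b::euclidean_space) \<Rightarrow>
    'n set \<times> ('n \<Rightarrow> 'c::euclidean_space) \<Rightarrow> ('m \<Rightarrow> 'n) \<Rightarrow> 'm \<Rightarrow> bool" where
  "local_rep S c c' f p \<longleftrightarrow> p \<in> fst c \<inter> S \<and>
     (\<exists>N g. snd c p \<in> N \<and> smooth_open N g \<and>
        (\<forall>q\<in>fst c \<inter> S. snd c q \<in> N \<longrightarrow> f q \<in> fst c' \<and> snd c' (f q) = g (snd c q)))"

lemma local_repI:
  assumes "p \<in> U" "p \<in> S" "\<phi> p \<in> N" "smooth_open N g"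
    "\<And>q. q \<in> U \<Longrightarrow> q \<in> S \<Longrightarrow> \<phi> q \<in> N \<Longrightarrow> f q \<in> V \<and> \<psi> (f q) = g (\<phi> q)"
  shows "local_rep S (U, \<phi>) (V, \<psi>) f p"
  unfolding local_rep_def using assms by auto

lemma local_repE:
  assumes "local_rep S (U, \<phi>) (V, \<psi>) f p"
  obtains N g where "p \<in> U" "p \<in> S" "\<phi> p \<in> N" "smooth_open N g"
    "\<And>q. q \<in> U \<Longrightarrow> q \<in> S \<Longrightarrow> \<phi> q \<in> N \<Longrightarrow> f q \<in> V \<and> \<psi> (f q) = g (\<phi> q)"
  using assms unfolding local_rep_def by auto

lemma local_repD:
  assumes "local_rep S c c' f p"
  shows "p \<in> S" "p \<in> fst c" "f p \<in> fst c'"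
  using assms by (auto simp: local_rep_def)

lemma local_rep_mono: "local_rep S c c' f p \<Longrightarrow> T \<subseteq> S \<Longrightarrow> p \<in> T \<Longrightarrow> local_rep T c c' f p"
  unfolding local_rep_def by blast

lemma local_rep_cong:
  assumes "local_rep S c c' f p" "\<And>q. q \<in> S \<Longrightarrow> q \<in> fst c \<Longrightarrow> f q = g q"
  shows "local_rep S c c' g p"
  using assms unfolding local_rep_def by (metis IntE)

lemma local_rep_compose:
  assumes f: "local_rep S c c' f p" and g: "local_rep T c' c'' g (f p)"
    and ST: "\<And>q. q \<in> S \<Longrightarrow> q \<in> fst c \<Longrightarrow> f q \<in> fst c' \<Longrightarrow> f q \<in> T"
  shows "local_rep S c c'' (\<lambda>x. g (f x)) p"
proof -
  obtain U \<phi> V \<psi> X \<xi> where c: "c = (U, \<phi>)" "c' = (V, \<psi>)" "c'' = (X, \<xi>)" by (metis surj_pair)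
  obtain N F where F: "p \<in> U" "p \<in> S" "\<phi> p \<in> N" "smooth_open N F"
    "\<And>q. q \<in> U \<Longrightarrow> q \<in> S \<Longrightarrow> \<phi> q \<in> N \<Longrightarrow> f q \<in> V \<and> \<psi> (f q) = F (\<phi> q)"
    using f unfolding c by (rule local_repE) blast
  obtain M G where G: "f p \<in> V" "\<psi> (f p) \<in> M" "smooth_open M G"
    "\<And>q. q \<in> V \<Longrightarrow> q \<in> T \<Longrightarrow> \<psi> q \<in> M \<Longrightarrow> g q \<in> X \<and> \<xi> (g q) = G (\<psi> q)"
    using g unfolding c by (rule local_repE) blast
  let ?N = "N \<inter> F -` M"
  have "open ?N" using smooth_open_vimage[OF F(4) smooth_openD(1)[OF G(3)]] .
  then have "smooth_open ?N (\<lambda>x. G (F x))"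
    by (intro smooth_open_compose[OF smooth_open_subset[OF F(4)] G(3)]) auto
  then show ?thesis
    unfolding c by (rule local_repI[rotated 3]) (use F G ST[unfolded c fst_conv] in auto)
qed

lemma local_rep_Pair:
  assumes "local_rep S c (V, \<psi>) f p" "local_rep S c (X, \<xi>) g p"
  shows "local_rep S c (V \<times> X, map_prod \<psi> \<xi>) (\<lambda>x. (f x, g x)) p"
proof -
  obtain U \<phi> where c: "c = (U, \<phi>)" by (metis surj_pair)
  obtain N F where F: "p \<in> U" "p \<in> S" "\<phi> p \<in> N" "smooth_open N F"
    "\<And>q. q \<in> U \<Longrightarrow> q \<in> S \<Longrightarrow> \<phi> q \<in> N \<Longrightarrow> f q \<in> V \<and> \<psi> (f q) = F (\<phi> q)"
    using assms(1) unfolding c by (rule local_repE) blast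
  obtain M G where G: "\<phi> p \<in> M" "smooth_open M G"
    "\<And>q. q \<in> U \<Longrightarrow> q \<in> S \<Longrightarrow> \<phi> q \<in> M \<Longrightarrow> g q \<in> X \<and> \<xi> (g q) = G (\<phi> q)"
    using assms(2) unfolding c by (rule local_repE) blast
  have o: "open (N \<inter> M)" by (rule open_Int[OF smooth_openD(1)[OF F(4)] smooth_openD(1)[OF G(2)]])
  have "smooth_open (N \<inter> M) (\<lambda>x. (F x, G x))"
    by (rule smooth_open_Pair[OF smooth_open_subset[OF F(4) o] smooth_open_subset[OF G(2) o]]) auto
  then show ?thesis
    unfolding c by (rule local_repI[rotated 3]) (use F G in auto)
qed

lemma local_rep_fst: "p \<in> (U \<times> V) \<inter> S \<Longrightarrow> local_rep S (U \<times> V, map_prod \<phi> \<psi>) (U, \<phi>) fst p"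
  by (rule local_repI[where N=UNIV and g=fst])
    (auto intro!: smooth_open_bounded_linear bounded_linear_fst)

lemma local_rep_snd: "p \<in> (U \<times> V) \<inter> S \<Longrightarrow> local_rep S (U \<times> V, map_prod \<phi> \<psi>) (V, \<psi>) snd p"
  by (rule local_repI[where N=UNIV and g=snd])
    (auto intro!: smooth_open_bounded_linear bounded_linear_snd)

lemma local_rep_ident: "p \<in> U \<inter> S \<Longrightarrow> local_rep S (U, \<phi>) (U, \<phi>) (\<lambda>x. x) p"
  by (rule local_repI[where N=UNIV and g="\<lambda>x. x"]) (auto intro!: smooth_open_ident)

lemma local_rep_const: "p \<in> U \<inter> S \<Longrightarrow> a \<in> V \<Longrightarrow> local_rep S (U, \<phi>) (V, \<psi>) (\<lambda>_. a) p"
  by (rule local_repI[where N=UNIV and g="\<lambda>_. \<psi> a"]) (auto intro!: smooth_open_const)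

lemma local_rep_dom:
  assumes "local_rep S (U, \<phi>) c' f p" "p \<in> U'" "U' \<subseteq> U"
  shows "local_rep S (U', \<phi>) c' f p"
  using assms unfolding local_rep_def by fastforce

lemma local_rep_dom_Int:
  assumes "local_rep S (U \<inter> X, \<phi>) (V, \<psi>) f p" "S \<subseteq> X"
  shows "local_rep S (U, \<phi>) (V, \<psi>) f p"
proof -
  obtain N F where F: "p \<in> U \<inter> X" "p \<in> S" "\<phi> p \<in> N" "smooth_open N F"
    "\<And>q. q \<in> U \<inter> X \<Longrightarrow> q \<in> S \<Longrightarrow> \<phi> q \<in> N \<Longrightarrow> f q \<in> V \<and> \<psi> (f q) = F (\<phi> q)"
    using assms(1) by (rule local_repE) blast
  show ?thesis by (rule local_repI[of p U S \<phi> N F f V \<psi>]) (use F assms(2) in auto)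
qed

lemma local_rep_cod:
  assumes "local_rep S c (V, \<psi>) f p" "\<And>q. q \<in> S \<Longrightarrow> q \<in> fst c \<Longrightarrow> f q \<in> V \<Longrightarrow> f q \<in> V'"
  shows "local_rep S c (V', \<psi>) f p"
proof -
  obtain U \<phi> where c: "c = (U, \<phi>)" by (metis surj_pair)
  obtain N F where F: "p \<in> U" "p \<in> S" "\<phi> p \<in> N" "smooth_open N F"
    "\<And>q. q \<in> U \<Longrightarrow> q \<in> S \<Longrightarrow> \<phi> q \<in> N \<Longrightarrow> f q \<in> V \<and> \<psi> (f q) = F (\<phi> q)"
    using assms(1) unfolding c by (rule local_repE) blast
  show ?thesis unfolding c by (rule local_repI[of p U S \<phi> N F f V' \<psi>]) (use F assms(2) c in auto)
qed

text \<open>With this chart, maps into a Euclidean space are a special case.\<close>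

abbreviation euc :: "'b set \<times> ('b \<Rightarrow> 'b)" where
  "euc \<equiv> (UNIV, \<lambda>x. x)"

lemma local_rep_coord: "local_rep S c (V, \<psi>) f p \<Longrightarrow> local_rep S c euc (\<lambda>x. \<psi> (f x)) p"
  unfolding local_rep_def by auto

lemma local_rep_chart: "p \<in> U \<inter> S \<Longrightarrow> local_rep S (U, \<phi>) euc \<phi> p"
  using local_rep_coord[OF local_rep_ident] by fastforce

lemma local_rep_smooth_open:
  assumes "local_rep S c euc f p" "smooth_open N g" "f p \<in> N"
  shows "local_rep S c euc (\<lambda>x. g (f x)) p"
proof (rule local_rep_compose[where g=g and T=UNIV, OF assms(1)])
  show "local_rep UNIV euc euc g (f p)"
    by (rule local_repI[of _ _ _ _ N g]) (use assms in auto)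
qed auto

lemma local_rep_linear:
  "local_rep S c euc f p \<Longrightarrow> bounded_linear L \<Longrightarrow> local_rep S c euc (\<lambda>x. L (f x)) p"
  by (rule local_rep_smooth_open[OF _ smooth_open_bounded_linear[of L UNIV]]) auto

lemma local_rep_euc_Pair:
  "local_rep S c euc f p \<Longrightarrow> local_rep S c euc g p \<Longrightarrow> local_rep S c euc (\<lambda>x. (f x, g x)) p"
  using local_rep_coord[OF local_rep_Pair[of S c UNIV "\<lambda>x. x" f p UNIV "\<lambda>x. x" g]]
  by (simp add: map_prod_def)

lemma local_rep_euc_add:
  assumes "local_rep S c euc f p" "local_rep S c euc g p"
  shows "local_rep S c euc (\<lambda>x. f x + g x) p"
  using local_rep_linear[OF local_rep_euc_Pair[OF assms], of "\<lambda>(x, y). x + y"]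
    bounded_linear_add[OF bounded_linear_fst bounded_linear_snd]
  by (simp add: case_prod_unfold)

text \<open>Both halves of compatibility are pointwise: the condition that nearby points of one
  chart lie in the other is openness of the overlap, and the local expression is smoothness of the
  coordinate change.\<close>

lemma compatible_iff:
  fixes \<phi> \<psi> :: "'a \<Rightarrow> 'b::euclidean_space"
  assumes "inj_on \<phi> U" "inj_on \<psi> V"
  shows "compatible (U, \<phi>) (V, \<psi>) \<longleftrightarrow> (\<forall>p\<in>U \<inter> V.
    local_rep UNIV (U, \<phi>) (V, \<psi>) (\<lambda>x. x) p \<and> local_rep UNIV (V, \<psi>) (U, \<phi>) (\<lambda>x. x) p)"
proof -
  have "openin (top_of_set (\<phi> ` U)) (\<phi> ` (U \<inter> V)) \<and> smooth_on (\<phi> ` (U \<inter> V)) (\<psi> \<circ> inv_into U \<phi>)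
     \<longleftrightarrow> (\<forall>p\<in>U \<inter> V. local_rep UNIV (U, \<phi>) (V, \<psi>) (\<lambda>x. x) p)" (is "?l \<longleftrightarrow> ?r")
    if inj: "inj_on \<phi> U"
    for U V :: "'a set" and \<phi> :: "'a \<Rightarrow> 'b" and \<psi> :: "'a \<Rightarrow> 'b"
  proof
    assume l: ?l
    obtain T where T: "open T" "\<phi> ` (U \<inter> V) = \<phi> ` U \<inter> T" using l by (auto simp: openin_open)
    show ?r
    proof
      fix p assume p: "p \<in> U \<inter> V"
      obtain N g where N: "\<phi> p \<in> N" "smooth_open N g"
        "\<And>y. y \<in> N \<Longrightarrow> y \<in> \<phi> ` (U \<inter> V) \<Longrightarrow> (\<psi> \<circ> inv_into U \<phi>) y = g y"
        using smooth_onE[of "\<phi> ` (U \<inter> V)" "\<psi> \<circ> inv_into U \<phi>" "\<phi> p"] l p by blast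
      have TN: "smooth_open (N \<inter> T) g"
        by (rule smooth_open_subset[OF N(2) open_Int[OF smooth_openD(1)[OF N(2)] T(1)]]) auto
      show "local_rep UNIV (U, \<phi>) (V, \<psi>) (\<lambda>x. x) p"
      proof (rule local_repI[OF _ _ _ TN])
        fix q assume q: "q \<in> U" "\<phi> q \<in> N \<inter> T"
        then have "\<phi> q \<in> \<phi> ` (U \<inter> V)" using T(2) by blast
        then show "q \<in> V \<and> \<psi> q = g (\<phi> q)"
          using N(3)[of "\<phi> q"] q inj by (auto simp: inj_on_eq_iff)
      qed (use p N T in blast)+
    qed
  next
    assume r: ?r
    have "openin (top_of_set (\<phi> ` U)) (\<phi> ` (U \<inter> V))"
    proof (subst openin_subopen, intro ballI)
      fix y assume "y \<in> \<phi> ` (U \<inter> V)"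
      then obtain p where p: "p \<in> U \<inter> V" "y = \<phi> p" by blast
      obtain N where N: "\<phi> p \<in> N" "open N" "\<And>q. q \<in> U \<Longrightarrow> \<phi> q \<in> N \<Longrightarrow> q \<in> V"
        by (rule local_repE[OF r[rule_format, OF p(1)]]) (use smooth_openD(1) in blast)
      have "openin (top_of_set (\<phi> ` U)) (\<phi> ` U \<inter> N)"
        by (rule openin_open_Int[OF N(2)])
      moreover have "y \<in> \<phi> ` U \<inter> N" "\<phi> ` U \<inter> N \<subseteq> \<phi> ` (U \<inter> V)" using N p by auto
      ultimately show "\<exists>T. openin (top_of_set (\<phi> ` U)) T \<and> y \<in> T \<and> T \<subseteq> \<phi> ` (U \<inter> V)" by blast
    qed
    moreover have "smooth_on (\<phi> ` (U \<inter> V)) (\<psi> \<circ> inv_into U \<phi>)"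
    proof (rule smooth_onI)
      fix y assume "y \<in> \<phi> ` (U \<inter> V)"
      then obtain p where p: "p \<in> U \<inter> V" "y = \<phi> p" by blast
      obtain N g where N: "\<phi> p \<in> N" "smooth_open N g" "\<And>q. q \<in> U \<Longrightarrow> \<phi> q \<in> N \<Longrightarrow> \<psi> q = g (\<phi> q)"
        by (rule local_repE[OF r[rule_format, OF p(1)]]) blast
      then show "\<exists>N g. y \<in> N \<and> smooth_open N g \<and> (\<forall>y\<in>N \<inter> \<phi> ` (U \<inter> V). (\<psi> \<circ> inv_into U \<phi>) y = g y)"
        using p inj by (intro exI[of _ N] exI[of _ g]) (auto simp: inv_into_f_f[OF inj])
    qed
    ultimately show ?l by blast
  qed
  from this[OF assms(1), of V \<psi>] this[OF assms(2), of U \<phi>] show ?thesis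
    unfolding compatible_def prod.case Int_commute[of V U] by blast
qed

section \<open>Smooth atlases\<close>

lemma is_chart_inj: "is_chart d (U, \<phi>) \<Longrightarrow> inj_on \<phi> U"
  by (simp add: is_chart_def)

lemma is_chart_dim_unique:
  assumes "is_chart d c" "is_chart d' c" "p \<in> fst c" shows "d = d'"
proof -
  obtain U \<phi> where c: "c = (U, \<phi>)" by (metis surj_pair)
  then obtain W W' where "subspace W" "dim W = d" "openin (top_of_set W) (\<phi> ` U)"
    "subspace W'" "dim W' = d'" "openin (top_of_set W') (\<phi> ` U)"
    using assms by (auto simp: is_chart_def)
  moreover have "\<phi> ` U \<noteq> {}" using assms c by auto
  ultimately show ?thesis using dim_openin by metis
qed

lemma is_chart_empty: "is_chart 0 ({}, \<phi>)"
  unfolding is_chart_def by (auto intro!: exI[of _ "{0}"] simp: subspace_single_0)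

lemma smooth_atlasI:
  assumes "\<And>c. c \<in> \<A> \<Longrightarrow> is_chart d c"
    "\<And>c c' p. c \<in> \<A> \<Longrightarrow> c' \<in> \<A> \<Longrightarrow> p \<in> fst c \<Longrightarrow> p \<in> fst c' \<Longrightarrow> local_rep UNIV c c' (\<lambda>x. x) p"
  shows "smooth_atlas \<A>"
  unfolding smooth_atlas_def
proof (intro conjI exI ballI)
  fix c c' assume c: "c \<in> \<A>" "c' \<in> \<A>"
  obtain U \<phi> V \<psi> where e: "c = (U, \<phi>)" "c' = (V, \<psi>)" by (metis surj_pair)
  have "local_rep UNIV (U, \<phi>) (V, \<psi>) (\<lambda>x. x) p \<and> local_rep UNIV (V, \<psi>) (U, \<phi>) (\<lambda>x. x) p"
    if "p \<in> U \<inter> V" for p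
    using assms(2)[OF c, of p] assms(2)[OF c(2,1), of p] that e by simp
  then show "compatible c c'"
    unfolding e using c assms(1)[unfolded e] e by (subst compatible_iff) (auto intro: is_chart_inj)
qed (rule assms(1))

lemma smooth_atlas_local_rep:
  assumes A: "smooth_atlas \<A>" and c: "c \<in> \<A>" "c' \<in> \<A>" and p: "p \<in> fst c" "p \<in> fst c'"
  shows "local_rep UNIV c c' (\<lambda>x. x) p"
proof -
  obtain U \<phi> V \<psi> where e: "c = (U, \<phi>)" "c' = (V, \<psi>)" by (metis surj_pair)
  have "inj_on \<phi> U" "inj_on \<psi> V" "compatible (U, \<phi>) (V, \<psi>)"
    using A c unfolding smooth_atlas_def e is_chart_def by blast+
  then show ?thesis using p unfolding e by (simp add: compatible_iff)
qed

lemma points_iff: "p \<in> points \<A> \<longleftrightarrow> (\<exists>c\<in>\<A>. p \<in> fst c)"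
  by (force simp: points_def)

lemma smooth_atlas_subset: "smooth_atlas \<B> \<Longrightarrow> \<A> \<subseteq> \<B> \<Longrightarrow> smooth_atlas \<A>"
  unfolding smooth_atlas_def by (meson subsetD)

lemma max_atlas_superset: "smooth_atlas \<A> \<Longrightarrow> \<A> \<subseteq> max_atlas \<A>"
  unfolding max_atlas_def by (force simp: insert_absorb points_def)

lemma points_max_atlas:
  assumes "smooth_atlas \<A>" shows "points (max_atlas \<A>) = points \<A>"
proof
  show "points (max_atlas \<A>) \<subseteq> points \<A>"
    unfolding subset_iff points_iff[of _ "max_atlas \<A>"] by (auto simp: max_atlas_def)
  show "points \<A> \<subseteq> points (max_atlas \<A>)"
    using max_atlas_superset[OF assms] unfolding subset_iff points_iff by blast
qed

text \<open>Two charts of the maximal atlas are only known to be compatible with \<open>\<A>\<close>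
  separately, so the coordinate change is routed through a chart of \<open>\<A>\<close> at
  \<open>p\<close>.\<close>

lemma max_atlas_local_rep:
  assumes A: "smooth_atlas \<A>" and c: "c \<in> max_atlas \<A>" "c' \<in> max_atlas \<A>" and p: "p \<in> fst c" "p \<in> fst c'"
  shows "local_rep UNIV c c' (\<lambda>x. x) p"
proof -
  have "p \<in> points \<A>" using c(1) p(1) by (auto simp: max_atlas_def)
  then obtain b where b: "b \<in> \<A>" "p \<in> fst b" by (auto simp: points_iff)
  have "local_rep UNIV c b (\<lambda>x. x) p" "local_rep UNIV b c' (\<lambda>x. x) p"
    using c b p by (auto simp: max_atlas_def intro: smooth_atlas_local_rep)
  then show ?thesis using local_rep_compose[of UNIV c b "\<lambda>x. x" p UNIV c' "\<lambda>x. x"] by simp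
qed

text \<open>A chart with a point shares its dimension with some chart of \<open>\<A>\<close>,
  through which all charts are compared. Without points all charts are empty, and dimension
  \<open>0\<close> serves.\<close>

lemma max_atlas_dim:
  assumes A: "smooth_atlas \<A>"
  obtains d where "\<And>c. c \<in> max_atlas \<A> \<Longrightarrow> is_chart d c"
proof (cases "points \<A> = {}")
  case True
  have "is_chart 0 c" if "c \<in> max_atlas \<A>" for c
    using that True is_chart_empty[of "snd c"] unfolding max_atlas_def by (cases c) auto
  then show ?thesis using that by blast
next
  case False
  then obtain b p where b: "b \<in> \<A>" "p \<in> fst b" by (auto simp: points_iff)
  obtain d where d: "is_chart d b" using A b by (auto simp: smooth_atlas_def)
  have "is_chart d c" if c: "c \<in> max_atlas \<A>" for c
  proof -
    obtain d' where "is_chart d' c" "is_chart d' b"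
      using c b by (auto simp: max_atlas_def smooth_atlas_def)
    then show ?thesis using is_chart_dim_unique[OF d _ b(2)] by blast
  qed
  then show ?thesis using that by blast
qed

lemma smooth_atlas_max_atlas: "smooth_atlas \<A> \<Longrightarrow> smooth_atlas (max_atlas \<A>)"
  by (metis max_atlas_dim smooth_atlasI max_atlas_local_rep)

text \<open>Compatibility is needed near each point against a single chart of the maximal atlas; all
  other charts follow by composing coordinate changes.\<close>

lemma max_atlasI:
  assumes A: "smooth_atlas \<A>" and d: "is_chart d c" "\<And>c'. c' \<in> \<A> \<Longrightarrow> is_chart d c'" and pts: "fst c \<subseteq> points \<A>"
    and rep: "\<And>p. p \<in> fst c \<Longrightarrow> \<exists>b\<in>max_atlas \<A>. local_rep UNIV c b (\<lambda>x. x) p \<and> local_rep UNIV b c (\<lambda>x. x) p"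
  shows "c \<in> max_atlas \<A>"
proof -
  have comp: "local_rep UNIV c c' (\<lambda>x. x) p \<and> local_rep UNIV c' c (\<lambda>x. x) p"
    if c': "c' \<in> max_atlas \<A>" and p: "p \<in> fst c" "p \<in> fst c'" for c' p
  proof -
    obtain b where b: "b \<in> max_atlas \<A>" "local_rep UNIV c b (\<lambda>x. x) p" "local_rep UNIV b c (\<lambda>x. x) p"
      using rep p by blast
    have pb: "p \<in> fst b" using local_repD(3)[OF b(2)] by simp
    show ?thesis
      using local_rep_compose[OF b(2) max_atlas_local_rep[OF A b(1) c' pb p(2)]]
        local_rep_compose[OF max_atlas_local_rep[OF A c' b(1) p(2) pb] b(3)] by simp
  qed
  have cc: "local_rep UNIV c c (\<lambda>x. x) p" if "p \<in> fst c" for p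
    using local_rep_ident[of p "fst c" UNIV "snd c"] that by simp
  have "smooth_atlas (insert c \<A>)"
  proof (rule smooth_atlasI)
    show "is_chart d c'" if "c' \<in> insert c \<A>" for c' using that d by blast
    fix c1 c2 p assume c: "c1 \<in> insert c \<A>" "c2 \<in> insert c \<A>" "p \<in> fst c1" "p \<in> fst c2"
    have sub: "x \<in> max_atlas \<A>" if "x \<in> \<A>" for x using that max_atlas_superset[OF A] by blast
    show "local_rep UNIV c1 c2 (\<lambda>x. x) p"
      using c comp cc sub smooth_atlas_local_rep[OF A] by (metis insert_iff)
  qed
  then show ?thesis using pts by (simp add: max_atlas_def)
qed

text \<open>Any cover by compatible charts generates the same smooth structure. This identifies the
  various atlases of one manifold: products of maximal atlases, and total spaces with additional
  trivializations.\<close>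

lemma max_atlas_eqI:
  assumes A: "smooth_atlas \<A>" and B: "\<B> \<subseteq> max_atlas \<A>" and pts: "points \<A> \<subseteq> points \<B>"
  shows "smooth_atlas \<B>" "max_atlas \<B> = max_atlas \<A>"
proof -
  show SB: "smooth_atlas \<B>" by (rule smooth_atlas_subset[OF smooth_atlas_max_atlas[OF A] B])
  have pB: "points \<B> = points \<A>"
    using pts B points_max_atlas[OF A] unfolding set_eq_iff subset_iff points_iff by blast
  have ins: "smooth_atlas (insert c \<B>)" if "c \<in> max_atlas \<A>" for c
    using that B by (intro smooth_atlas_subset[OF smooth_atlas_max_atlas[OF A]]) auto
  show "max_atlas \<B> = max_atlas \<A>"
  proof
    show "max_atlas \<A> \<subseteq> max_atlas \<B>"
      using ins pB by (auto simp: max_atlas_def)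
    show "max_atlas \<B> \<subseteq> max_atlas \<A>"
    proof
      fix c assume c: "c \<in> max_atlas \<B>"
      then have cp: "fst c \<subseteq> points \<A>" using pB by (simp add: max_atlas_def)
      obtain d where d: "\<And>c'. c' \<in> max_atlas \<B> \<Longrightarrow> is_chart d c'" using max_atlas_dim[OF SB] by blast
      have AB: "c' \<in> max_atlas \<B>" if "c' \<in> \<A>" for c'
        using ins[of c'] that max_atlas_superset[OF A] pB by (auto simp: max_atlas_def points_iff)
      show "c \<in> max_atlas \<A>"
      proof (rule max_atlasI[OF A d[OF c] _ cp])
        show "is_chart d c'" if "c' \<in> \<A>" for c' using d AB that by blast
        fix p assume p: "p \<in> fst c"
        then obtain b where b: "b \<in> \<A>" "p \<in> fst b" using cp points_iff by (metis subsetD)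
        then show "\<exists>b\<in>max_atlas \<A>. local_rep UNIV c b (\<lambda>x. x) p \<and> local_rep UNIV b c (\<lambda>x. x) p"
          using max_atlas_local_rep[OF SB] c p AB max_atlas_superset[OF A] by blast
      qed
    qed
  qed
qed

lemma max_atlas_idem: "smooth_atlas \<A> \<Longrightarrow> max_atlas (max_atlas \<A>) = max_atlas \<A>"
  using max_atlas_eqI(2) points_max_atlas by blast

lemma chart_at: "smooth_atlas \<A> \<Longrightarrow> p \<in> points \<A> \<Longrightarrow> \<exists>U \<phi>. (U, \<phi>) \<in> max_atlas \<A> \<and> p \<in> U"
  using max_atlas_superset by (fastforce simp: points_def)

lemma max_atlas_dom: "(U, \<phi>) \<in> max_atlas \<A> \<Longrightarrow> U \<subseteq> points \<A>"
  by (auto simp: max_atlas_def)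

section \<open>The manifold topology\<close>

text \<open>The topology is generated by the charts of \<open>\<A>\<close> only. Induction over this
  generation, with smooth coordinate changes in the basic case, describes open sets in every chart
  of the maximal atlas.\<close>

lemma openin_manifold_chart:
  assumes A: "smooth_atlas \<A>" and N: "openin (manifold_topology \<A>) N"
    and c: "(U, \<phi>) \<in> max_atlas \<A>" and p: "p \<in> U" "p \<in> N"
  shows "\<exists>Q. open Q \<and> \<phi> p \<in> Q \<and> (\<forall>q\<in>U. \<phi> q \<in> Q \<longrightarrow> q \<in> N)"
proof -
  have "generate_topology_on {U \<inter> \<phi> -` N | U \<phi> N. (U, \<phi>) \<in> \<A> \<and> open N} N"
    using N unfolding manifold_topology_def by (simp add: openin_topology_generated_by)
  then show ?thesis using p(2)
  proof (induction N rule: generate_topology_on.induct)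
    case (Int a b)
    then obtain Q R where "open Q" "\<phi> p \<in> Q" "\<forall>q\<in>U. \<phi> q \<in> Q \<longrightarrow> q \<in> a"
      "open R" "\<phi> p \<in> R" "\<forall>q\<in>U. \<phi> q \<in> R \<longrightarrow> q \<in> b" by auto
    then show ?case by (intro exI[of _ "Q \<inter> R"]) auto
  next
    case (UN K)
    then show ?case by (meson Union_iff)
  next
    case (Basis s)
    then obtain V \<psi> M where s: "s = V \<inter> \<psi> -` M" "(V, \<psi>) \<in> \<A>" "open M" by blast
    have "local_rep UNIV (U, \<phi>) (V, \<psi>) (\<lambda>x. x) p"
      by (rule max_atlas_local_rep[OF A c]) (use s Basis p max_atlas_superset[OF A] in auto)
    then obtain Q g where Q: "\<phi> p \<in> Q" "smooth_open Q g"
      "\<And>q. q \<in> U \<Longrightarrow> \<phi> q \<in> Q \<Longrightarrow> q \<in> V \<and> \<psi> q = g (\<phi> q)"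
      by (rule local_repE) blast
    have "open (Q \<inter> g -` M)" by (rule smooth_open_vimage[OF Q(2) s(3)])
    moreover have "\<phi> p \<in> Q \<inter> g -` M" using Q(1) Q(3)[OF p(1)] Basis s by auto
    ultimately show ?case using Q(3) s by (intro exI[of _ "Q \<inter> g -` M"]) auto
  qed auto
qed

lemma openin_chart_vimage:
  assumes A: "smooth_atlas \<A>" and c: "(U, \<phi>) \<in> max_atlas \<A>" and Q: "open Q"
  shows "openin (manifold_topology \<A>) (U \<inter> \<phi> -` Q)"
proof (subst openin_subopen, intro ballI)
  fix p assume p: "p \<in> U \<inter> \<phi> -` Q"
  then obtain V \<psi> where V: "(V, \<psi>) \<in> \<A>" "p \<in> V"
    using max_atlas_dom[OF c] by (fastforce simp: points_def)
  have "local_rep UNIV (V, \<psi>) (U, \<phi>) (\<lambda>x. x) p"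
    by (rule max_atlas_local_rep[OF A _ c]) (use V p max_atlas_superset[OF A] in auto)
  then obtain R g where R: "\<psi> p \<in> R" "smooth_open R g"
    "\<And>q. q \<in> V \<Longrightarrow> \<psi> q \<in> R \<Longrightarrow> q \<in> U \<and> \<phi> q = g (\<psi> q)"
    by (rule local_repE) blast
  have "open (R \<inter> g -` Q)" by (rule smooth_open_vimage[OF R(2) Q])
  then have "openin (manifold_topology \<A>) (V \<inter> \<psi> -` (R \<inter> g -` Q))"
    unfolding manifold_topology_def using V(1) by (intro topology_generated_by_Basis) blast
  moreover have "p \<in> V \<inter> \<psi> -` (R \<inter> g -` Q)" using R V p by auto
  moreover have "V \<inter> \<psi> -` (R \<inter> g -` Q) \<subseteq> U \<inter> \<phi> -` Q" using R by auto
  ultimately show "\<exists>T. openin (manifold_topology \<A>) T \<and> p \<in> T \<and> T \<subseteq> U \<inter> \<phi> -` Q" by blast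
qed

lemma openin_max_chart:
  assumes "smooth_atlas \<A>" "(U, \<phi>) \<in> max_atlas \<A>"
  shows "openin (manifold_topology \<A>) U"
  using openin_chart_vimage[OF assms open_UNIV] by simp

lemma topspace_manifold_topology:
  assumes "smooth_atlas \<A>" shows "topspace (manifold_topology \<A>) = points \<A>"
proof
  show "topspace (manifold_topology \<A>) \<subseteq> points \<A>"
    unfolding manifold_topology_def by (auto simp: points_def)
  show "points \<A> \<subseteq> topspace (manifold_topology \<A>)"
    using chart_at[OF assms] openin_max_chart[OF assms] openin_subset by blast
qed

lemma openin_manifold_iff:
  assumes A: "smooth_atlas \<A>"
  shows "openin (manifold_topology \<A>) N \<longleftrightarrow>
    (\<forall>p\<in>N. \<exists>U \<phi> Q. (U, \<phi>) \<in> max_atlas \<A> \<and> p \<in> U \<and> open Q \<and> \<phi> p \<in> Q \<and> (\<forall>q\<in>U. \<phi> q \<in> Q \<longrightarrow> q \<in> N))"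
    (is "?l \<longleftrightarrow> ?r")
proof
  assume l: ?l
  show ?r
  proof
    fix p assume p: "p \<in> N"
    then have "p \<in> points \<A>" using openin_subset[OF l] topspace_manifold_topology[OF A] by blast
    then obtain U \<phi> where U: "(U, \<phi>) \<in> max_atlas \<A>" "p \<in> U" using chart_at[OF A] by blast
    show "\<exists>U \<phi> Q. (U, \<phi>) \<in> max_atlas \<A> \<and> p \<in> U \<and> open Q \<and> \<phi> p \<in> Q \<and> (\<forall>q\<in>U. \<phi> q \<in> Q \<longrightarrow> q \<in> N)"
      using openin_manifold_chart[OF A l U p] U by blast
  qed
next
  assume r: ?r
  show ?l
  proof (subst openin_subopen, intro ballI)
    fix p assume "p \<in> N"
    then obtain U \<phi> Q where U: "(U, \<phi>) \<in> max_atlas \<A>" "p \<in> U" "open Q" "\<phi> p \<in> Q" "\<forall>q\<in>U. \<phi> q \<in> Q \<longrightarrow> q \<in> N"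
      using r by blast
    then show "\<exists>T. openin (manifold_topology \<A>) T \<and> p \<in> T \<and> T \<subseteq> N"
      using openin_chart_vimage[OF A U(1,3)] by (intro exI[of _ "U \<inter> \<phi> -` Q"]) auto
  qed
qed

lemma manifold_topology_max_atlas:
  assumes "smooth_atlas \<A>" "smooth_atlas \<B>" "max_atlas \<A> = max_atlas \<B>"
  shows "manifold_topology \<A> = manifold_topology \<B>"
  using openin_manifold_iff[OF assms(1)] openin_manifold_iff[OF assms(2)] assms(3)
  by (simp add: topology_eq)

lemma openin_vimage_local_rep:
  assumes A: "smooth_atlas \<A>" and B: "smooth_atlas \<B>" and N: "openin (manifold_topology \<B>) N"
    and f: "\<And>p. p \<in> X \<Longrightarrow> \<exists>c\<in>max_atlas \<A>. \<exists>c'\<in>max_atlas \<B>. local_rep X c c' f p"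
    and X: "openin (manifold_topology \<A>) X"
  shows "openin (manifold_topology \<A>) {p \<in> X. f p \<in> N}"
  unfolding openin_manifold_iff[OF A]
proof
  fix p assume p: "p \<in> {p \<in> X. f p \<in> N}"
  then obtain U \<phi> V \<psi> where c: "(U, \<phi>) \<in> max_atlas \<A>" "(V, \<psi>) \<in> max_atlas \<B>" "local_rep X (U, \<phi>) (V, \<psi>) f p"
    using f by fastforce
  obtain Q g where Q: "p \<in> U" "\<phi> p \<in> Q" "smooth_open Q g"
    "\<And>q. q \<in> U \<Longrightarrow> q \<in> X \<Longrightarrow> \<phi> q \<in> Q \<Longrightarrow> f q \<in> V \<and> \<psi> (f q) = g (\<phi> q)"
    using c(3) by (rule local_repE) blast
  have "f p \<in> V" using local_repD(3)[OF c(3)] by simp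
  then obtain R where R: "open R" "\<psi> (f p) \<in> R" "\<forall>q\<in>V. \<psi> q \<in> R \<longrightarrow> q \<in> N"
    using openin_manifold_chart[OF B N c(2)] p by blast
  obtain Y where Y: "open Y" "\<phi> p \<in> Y" "\<forall>q\<in>U. \<phi> q \<in> Y \<longrightarrow> q \<in> X"
    using openin_manifold_chart[OF A X c(1) Q(1)] p by blast
  have "open (Q \<inter> g -` R \<inter> Y)" by (rule open_Int[OF smooth_open_vimage[OF Q(3) R(1)] Y(1)])
  moreover have "\<phi> p \<in> Q \<inter> g -` R \<inter> Y" using Q R Y p by auto
  moreover have "\<forall>q\<in>U. \<phi> q \<in> Q \<inter> g -` R \<inter> Y \<longrightarrow> q \<in> {p \<in> X. f p \<in> N}" using Q(4) R(3) Y(3) by auto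
  ultimately show "\<exists>U \<phi> Q. (U, \<phi>) \<in> max_atlas \<A> \<and> p \<in> U \<and> open Q \<and> \<phi> p \<in> Q \<and>
      (\<forall>q\<in>U. \<phi> q \<in> Q \<longrightarrow> q \<in> {p \<in> X. f p \<in> N})"
    using c(1) Q(1) by blast
qed

text \<open>A basis consists of the preimages, under countably many covering charts, of a countable
  basis of the model space.\<close>

lemma second_countable_manifold:
  assumes A: "smooth_atlas \<A>" and C: "countable C" "C \<subseteq> max_atlas \<A>" "points \<A> \<subseteq> points C"
  shows "second_countable (manifold_topology (\<A> :: ('m, 'b::euclidean_space) atlas))"
proof -
  obtain \<Q> :: "'b set set" where Q: "countable \<Q>" "topological_basis \<Q>"
    using ex_countable_basis by blast
  define \<B> where "\<B> = (\<lambda>((U, \<phi>), Q). U \<inter> \<phi> -` Q) ` (C \<times> \<Q>)"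
  show ?thesis
    unfolding second_countable_def
  proof (intro exI[of _ \<B>] conjI ballI allI impI)
    show "countable \<B>" unfolding \<B>_def using C Q by blast
    show "openin (manifold_topology \<A>) V" if "V \<in> \<B>" for V
      using that C Q openin_chart_vimage[OF A] topological_basis_open[OF Q(2)] by (auto simp: \<B>_def)
    fix N x assume N: "openin (manifold_topology \<A>) N \<and> x \<in> N"
    then have "x \<in> points C" using openin_subset topspace_manifold_topology[OF A] C(3) by blast
    then obtain U \<phi> where U: "(U, \<phi>) \<in> C" "x \<in> U" by (auto simp: points_def)
    obtain R where R: "open R" "\<phi> x \<in> R" "\<forall>q\<in>U. \<phi> q \<in> R \<longrightarrow> q \<in> N"
      using openin_manifold_chart[OF A, of N U \<phi> x] N U C(2) by blast
    obtain Q' where "Q' \<in> \<Q>" "\<phi> x \<in> Q'" "Q' \<subseteq> R"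
      using topological_basisE[OF Q(2) R(1,2)] by blast
    then show "\<exists>V\<in>\<B>. x \<in> V \<and> V \<subseteq> N"
      using U R by (intro bexI[of _ "U \<inter> \<phi> -` Q'"]) (auto simp: \<B>_def intro!: image_eqI[of _ _ "((U, \<phi>), Q')"])
  qed
qed

lemma countable_subcover:
  assumes "second_countable X" "\<And>i. i \<in> I \<Longrightarrow> openin X (F i)" "topspace X \<subseteq> (\<Union>i\<in>I. F i)"
  obtains J where "countable J" "J \<subseteq> I" "topspace X \<subseteq> (\<Union>i\<in>J. F i)"
proof -
  have "\<Union>(F ` I) = topspace X" using assms(2,3) openin_subset by fastforce
  then obtain \<V> where V: "countable \<V>" "\<V> \<subseteq> F ` I" "\<Union>\<V> = topspace X"
    using Lindelof_spaceD[OF second_countable_imp_Lindelof_space[OF assms(1)], of "F ` I"] assms(2)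
    by (metis (no_types, lifting) imageE)
  obtain J where "countable J" "J \<subseteq> I" "\<V> = F ` J"
    using countable_subset_image[of \<V> F I] V by blast
  then show ?thesis using that V(3) by auto
qed

section \<open>Smooth maps between manifolds\<close>

text \<open>One suitable pair of charts is required; \<open>smooth_at_local_rep\<close> shows that
  every pair at the point then works. The pointwise form with an arbitrary \<open>S\<close> fits
  maps defined only on composable pairs.\<close>

definition smooth_at :: "('m, 'b::euclidean_space) atlas \<Rightarrow> 'm set \<Rightarrow>
    ('n, 'c::euclidean_space) atlas \<Rightarrow> ('m \<Rightarrow> 'n) \<Rightarrow> 'm \<Rightarrow> bool" where
  "smooth_at \<A> S \<B> f p \<longleftrightarrow> (\<exists>c\<in>max_atlas \<A>. \<exists>c'\<in>max_atlas \<B>. local_rep S c c' f p)"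

lemma smooth_atI:
  "(U, \<phi>) \<in> max_atlas \<A> \<Longrightarrow> (V, \<psi>) \<in> max_atlas \<B> \<Longrightarrow> local_rep S (U, \<phi>) (V, \<psi>) f p \<Longrightarrow> smooth_at \<A> S \<B> f p"
  unfolding smooth_at_def by blast

lemma smooth_atE:
  assumes "smooth_at \<A> S \<B> f p"
  obtains U \<phi> V \<psi> where "(U, \<phi>) \<in> max_atlas \<A>" "(V, \<psi>) \<in> max_atlas \<B>" "local_rep S (U, \<phi>) (V, \<psi>) f p"
  using assms unfolding smooth_at_def by auto

lemma smooth_at_local_rep:
  assumes A: "smooth_atlas \<A>" and B: "smooth_atlas \<B>" and f: "smooth_at \<A> S \<B> f p"
    and c: "c \<in> max_atlas \<A>" "p \<in> fst c" and c': "c' \<in> max_atlas \<B>" "f p \<in> fst c'"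
  shows "local_rep S c c' f p"
proof -
  obtain b b' where b: "b \<in> max_atlas \<A>" "b' \<in> max_atlas \<B>" "local_rep S b b' f p"
    using f unfolding smooth_at_def by blast
  have "local_rep S c b (\<lambda>x. x) p"
    using max_atlas_local_rep[OF A c(1) b(1) c(2)] local_repD[OF b(3)] by (auto intro: local_rep_mono)
  then have "local_rep S c b' (\<lambda>x. f x) p" by (rule local_rep_compose) (use b in auto)
  then show ?thesis
    using local_rep_compose[of S c b' f p UNIV c' "\<lambda>x. x"] max_atlas_local_rep[OF B b(2) c'(1) _ c'(2)]
      local_repD[OF b(3)] by auto
qed

lemma smooth_at_compose:
  assumes B: "smooth_atlas \<B>" and f: "smooth_at \<A> S \<B> f p" and g: "smooth_at \<B> T \<C> g (f p)"
    and ST: "\<And>q. q \<in> S \<Longrightarrow> f q \<in> points \<B> \<Longrightarrow> f q \<in> T"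
  shows "smooth_at \<A> S \<C> (\<lambda>x. g (f x)) p"
proof -
  obtain a b where ab: "a \<in> max_atlas \<A>" "b \<in> max_atlas \<B>" "local_rep S a b f p"
    using f unfolding smooth_at_def by blast
  obtain b' c where bc: "b' \<in> max_atlas \<B>" "c \<in> max_atlas \<C>" "local_rep T b' c g (f p)"
    using g unfolding smooth_at_def by blast
  have "local_rep T b b' (\<lambda>x. x) (f p)"
    using max_atlas_local_rep[OF B ab(2) bc(1)] local_repD[OF ab(3)] local_repD[OF bc(3)]
    by (auto intro: local_rep_mono)
  then have "local_rep T b c (\<lambda>x. g x) (f p)" by (rule local_rep_compose) (use bc in auto)
  moreover have "fst b \<subseteq> points \<B>" using ab(2) by (auto simp: max_atlas_def)
  ultimately have "local_rep S a c (\<lambda>x. g (f x)) p"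
    using ST by (intro local_rep_compose[where g=g and T=T, OF ab(3)]) auto
  then show ?thesis using ab bc unfolding smooth_at_def by blast
qed

lemma smooth_at_mono: "smooth_at \<A> S \<B> f p \<Longrightarrow> T \<subseteq> S \<Longrightarrow> p \<in> T \<Longrightarrow> smooth_at \<A> T \<B> f p"
  unfolding smooth_at_def using local_rep_mono[of S _ _ f p T] by metis

lemma smooth_at_cong:
  "smooth_at \<A> S \<B> f p \<Longrightarrow> (\<And>q. q \<in> S \<Longrightarrow> q \<in> points \<A> \<Longrightarrow> f q = g q) \<Longrightarrow> smooth_at \<A> S \<B> g p"
proof (elim smooth_atE)
  fix U \<phi> V \<psi>
  assume eq: "\<And>q. q \<in> S \<Longrightarrow> q \<in> points \<A> \<Longrightarrow> f q = g q" and c: "(U, \<phi>) \<in> max_atlas \<A>"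
    "(V, \<psi>) \<in> max_atlas \<B>" "local_rep S (U, \<phi>) (V, \<psi>) f p"
  have "local_rep S (U, \<phi>) (V, \<psi>) g p"
    by (rule local_rep_cong[OF c(3)]) (use eq max_atlas_dom[OF c(1)] in auto)
  then show ?thesis by (rule smooth_atI[OF c(1,2)])
qed

lemma smooth_atD:
  assumes "smooth_at \<A> S \<B> f p" shows "p \<in> S" "p \<in> points \<A>" "f p \<in> points \<B>"
proof -
  obtain U \<phi> V \<psi> where c: "(U, \<phi>) \<in> max_atlas \<A>" "(V, \<psi>) \<in> max_atlas \<B>" "local_rep S (U, \<phi>) (V, \<psi>) f p"
    using assms by (rule smooth_atE)
  show "p \<in> S" "p \<in> points \<A>" "f p \<in> points \<B>"
    using local_repD[OF c(3)] max_atlas_dom[OF c(1)] max_atlas_dom[OF c(2)] by auto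
qed

lemma smooth_at_ident:
  assumes "smooth_atlas \<A>" "p \<in> S" "p \<in> points \<A>" shows "smooth_at \<A> S \<A> (\<lambda>x. x) p"
proof -
  obtain U \<phi> where "(U, \<phi>) \<in> max_atlas \<A>" "p \<in> U" using chart_at[OF assms(1,3)] by blast
  then show ?thesis using assms(2) smooth_atI[OF _ _ local_rep_ident] by fast
qed

lemma smooth_at_const:
  assumes "smooth_atlas \<A>" "smooth_atlas \<B>" "p \<in> S" "p \<in> points \<A>" "a \<in> points \<B>"
  shows "smooth_at \<A> S \<B> (\<lambda>_. a) p"
proof -
  obtain U \<phi> where "(U, \<phi>) \<in> max_atlas \<A>" "p \<in> U" using chart_at[OF assms(1,4)] by blast
  moreover obtain V \<psi> where "(V, \<psi>) \<in> max_atlas \<B>" "a \<in> V" using chart_at[OF assms(2,5)] by blast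
  moreover have "local_rep S (U, \<phi>) (V, \<psi>) (\<lambda>_. a) p"
    using calculation assms(3) by (intro local_rep_const) auto
  ultimately show ?thesis by (intro smooth_atI[where f="\<lambda>_. a"])
qed

lemma smooth_at_max_atlas:
  "max_atlas \<A> = max_atlas \<A>' \<Longrightarrow> max_atlas \<B> = max_atlas \<B>' \<Longrightarrow> smooth_at \<A> S \<B> f p = smooth_at \<A>' S \<B>' f p"
  by (simp add: smooth_at_def)

text \<open>Bridge between the definition by extensions of coordinate expressions and the pointwise
  notion with which all later arguments work.\<close>

lemma smooth_map_on_iff:
  assumes A: "smooth_atlas \<A>" and B: "smooth_atlas \<B>"
  shows "smooth_map_on \<A> S \<B> f \<longleftrightarrow> S \<subseteq> points \<A> \<and> f ` S \<subseteq> points \<B> \<and> (\<forall>p\<in>S. smooth_at \<A> S \<B> f p)"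
proof
  assume f: "smooth_map_on \<A> S \<B> f"
  note f' = this[unfolded smooth_map_on_def]
  have S: "S \<subseteq> points \<A>" "f ` S \<subseteq> points \<B>" using f' by blast+
  have "smooth_at \<A> S \<B> f p" if p: "p \<in> S" for p
  proof -
    obtain U \<phi> V \<psi> where c: "(U, \<phi>) \<in> \<A>" "p \<in> U" "(V, \<psi>) \<in> \<B>" "f p \<in> V"
      using S p by (fastforce simp: points_def image_subset_iff)
    obtain N where N: "openin (manifold_topology \<A>) N" "p \<in> N" "N \<subseteq> U" "f ` (N \<inter> S) \<subseteq> V"
      "smooth_on (\<phi> ` (N \<inter> S)) (\<psi> \<circ> f \<circ> inv_into U \<phi>)"
      using f'[THEN conjunct2, THEN conjunct2, THEN bspec[of _ _ p], OF p] c by fastforce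
    have cm: "(U, \<phi>) \<in> max_atlas \<A>" "(V, \<psi>) \<in> max_atlas \<B>"
      using c max_atlas_superset A B by blast+
    obtain Q where Q: "open Q" "\<phi> p \<in> Q" "\<forall>q\<in>U. \<phi> q \<in> Q \<longrightarrow> q \<in> N"
      using openin_manifold_chart[OF A N(1) cm(1) c(2) N(2)] by blast
    obtain M g where M: "\<phi> p \<in> M" "smooth_open M g"
      "\<And>y. y \<in> M \<Longrightarrow> y \<in> \<phi> ` (N \<inter> S) \<Longrightarrow> (\<psi> \<circ> f \<circ> inv_into U \<phi>) y = g y"
      using smooth_onE[OF N(5), of "\<phi> p"] N(2) p by blast
    have inj: "inj_on \<phi> U" using A c(1) by (auto simp: smooth_atlas_def intro: is_chart_inj)
    have "local_rep S (U, \<phi>) (V, \<psi>) f p"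
    proof (rule local_repI[of p U S \<phi> "M \<inter> Q" g])
      show "smooth_open (M \<inter> Q) g"
        by (rule smooth_open_subset[OF M(2) open_Int[OF smooth_openD(1)[OF M(2)] Q(1)]]) auto
      fix q assume q: "q \<in> U" "q \<in> S" "\<phi> q \<in> M \<inter> Q"
      then have "q \<in> N" using Q by blast
      then show "f q \<in> V \<and> \<psi> (f q) = g (\<phi> q)"
        using N(4) M(3)[of "\<phi> q"] q inv_into_f_f[OF inj q(1)] by auto
    qed (use c p M Q in auto)
    then show ?thesis by (rule smooth_atI[OF cm])
  qed
  then show "S \<subseteq> points \<A> \<and> f ` S \<subseteq> points \<B> \<and> (\<forall>p\<in>S. smooth_at \<A> S \<B> f p)" using S by blast
next
  assume f: "S \<subseteq> points \<A> \<and> f ` S \<subseteq> points \<B> \<and> (\<forall>p\<in>S. smooth_at \<A> S \<B> f p)"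
  have "\<exists>N. openin (manifold_topology \<A>) N \<and> p \<in> N \<and> N \<subseteq> U \<and> f ` (N \<inter> S) \<subseteq> V \<and>
          smooth_on (\<phi> ` (N \<inter> S)) (\<psi> \<circ> f \<circ> inv_into U \<phi>)"
    if p: "p \<in> S" and c: "(U, \<phi>) \<in> \<A>" "(V, \<psi>) \<in> \<B>" "p \<in> U" "f p \<in> V" for p U \<phi> V \<psi>
  proof -
    have cm: "(U, \<phi>) \<in> max_atlas \<A>" "(V, \<psi>) \<in> max_atlas \<B>"
      using c max_atlas_superset A B by blast+
    have inj: "inj_on \<phi> U" using A c(1) by (auto simp: smooth_atlas_def intro: is_chart_inj)
    have "local_rep S (U, \<phi>) (V, \<psi>) f p"
      using f p c cm by (intro smooth_at_local_rep[OF A B]) auto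
    then obtain M g where M: "\<phi> p \<in> M" "smooth_open M g"
      "\<And>q. q \<in> U \<Longrightarrow> q \<in> S \<Longrightarrow> \<phi> q \<in> M \<Longrightarrow> f q \<in> V \<and> \<psi> (f q) = g (\<phi> q)"
      by (rule local_repE) blast
    have "smooth_on (\<phi> ` (U \<inter> \<phi> -` M \<inter> S)) (\<psi> \<circ> f \<circ> inv_into U \<phi>)"
    proof (rule smooth_onI)
      fix y assume "y \<in> \<phi> ` (U \<inter> \<phi> -` M \<inter> S)"
      then show "\<exists>N g. y \<in> N \<and> smooth_open N g \<and>
          (\<forall>y\<in>N \<inter> \<phi> ` (U \<inter> \<phi> -` M \<inter> S). (\<psi> \<circ> f \<circ> inv_into U \<phi>) y = g y)"
        using M inv_into_f_f[OF inj] by (intro exI[of _ M] exI[of _ g]) auto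
    qed
    then show ?thesis
      using openin_chart_vimage[OF A cm(1) smooth_openD(1)[OF M(2)]] M c
      by (intro exI[of _ "U \<inter> \<phi> -` M"]) auto
  qed
  then show "smooth_map_on \<A> S \<B> f" using f unfolding smooth_map_on_def by auto
qed

lemma smooth_map_onI:
  assumes "smooth_atlas \<A>" "smooth_atlas \<B>" and f: "\<And>p. p \<in> S \<Longrightarrow> smooth_at \<A> S \<B> f p"
  shows "smooth_map_on \<A> S \<B> f"
  unfolding smooth_map_on_iff[OF assms(1,2)] using f smooth_atD(2,3)[OF f] by auto

lemma smooth_map_onD:
  assumes "smooth_map_on \<A> S \<B> f" "smooth_atlas \<A>" "smooth_atlas \<B>" "p \<in> S"
  shows "smooth_at \<A> S \<B> f p"
  using assms smooth_map_on_iff by blast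

lemma smooth_map_on_max_atlas:
  assumes "smooth_atlas \<A>" "smooth_atlas \<A>'" "smooth_atlas \<B>" "smooth_atlas \<B>'"
    "max_atlas \<A> = max_atlas \<A>'" "max_atlas \<B> = max_atlas \<B>'" "smooth_map_on \<A> S \<B> f"
  shows "smooth_map_on \<A>' S \<B>' f"
  using smooth_map_onD[OF assms(7,1,3)] smooth_at_max_atlas[OF assms(5,6)]
  by (intro smooth_map_onI assms) blast

definition euc_atlas :: "('b::euclidean_space, 'b) atlas" where
  "euc_atlas = {(UNIV, \<lambda>x. x)}"

lemma smooth_atlas_euc: "smooth_atlas (euc_atlas :: ('b::euclidean_space, 'b) atlas)"
proof (rule smooth_atlasI)
  show "is_chart DIM('b) c" if "c \<in> euc_atlas" for c :: "'b set \<times> ('b \<Rightarrow> 'b)"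
    using that unfolding euc_atlas_def is_chart_def
    by (auto intro!: exI[of _ UNIV] simp: dim_UNIV)
  show "local_rep UNIV c c' (\<lambda>x. x) p" if "c \<in> euc_atlas" "c' \<in> euc_atlas" for c c' :: "'b set \<times> ('b \<Rightarrow> 'b)" and p
    using that unfolding euc_atlas_def by (auto intro: local_rep_ident)
qed

lemma real_atlas_eq: "real_atlas = euc_atlas"
  by (simp add: real_atlas_def euc_atlas_def)

lemma points_euc [simp]: "points euc_atlas = UNIV"
  by (simp add: points_def euc_atlas_def)

lemma euc_in_max_atlas: "euc \<in> max_atlas euc_atlas"
  using max_atlas_superset[OF smooth_atlas_euc] by (auto simp: euc_atlas_def)

subsection \<open>Products\<close>

lemma points_prod_atlas: "points (prod_atlas \<A> \<B>) = points \<A> \<times> points \<B>"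
proof (rule equalityI; rule subsetI)
  show "p \<in> points \<A> \<times> points \<B>" if "p \<in> points (prod_atlas \<A> \<B>)" for p
    using that unfolding points_def prod_atlas_def by auto
  show "p \<in> points (prod_atlas \<A> \<B>)" if "p \<in> points \<A> \<times> points \<B>" for p
  proof -
    have "fst p \<in> points \<A>" "snd p \<in> points \<B>" using that by auto
    then obtain U \<phi> V \<psi> where "(U, \<phi>) \<in> \<A>" "fst p \<in> U" "(V, \<psi>) \<in> \<B>" "snd p \<in> V"
      unfolding points_iff by (metis prod.collapse)
    then have "(U \<times> V, map_prod \<phi> \<psi>) \<in> prod_atlas \<A> \<B>" "p \<in> fst (U \<times> V, map_prod \<phi> \<psi>)"
      unfolding prod_atlas_def by (blast, simp add: mem_Times_iff)
    then show ?thesis unfolding points_iff by blast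
  qed
qed

lemma is_chart_prod:
  assumes "is_chart d (U, \<phi>)" "is_chart e (V, \<psi>)" shows "is_chart (d + e) (U \<times> V, map_prod \<phi> \<psi>)"
proof -
  obtain W X where "subspace W" "dim W = d" "openin (top_of_set W) (\<phi> ` U)"
    "subspace X" "dim X = e" "openin (top_of_set X) (\<psi> ` V)" "inj_on \<phi> U" "inj_on \<psi> V"
    using assms by (auto simp: is_chart_def)
  then show ?thesis
    unfolding is_chart_def using map_prod_surj_on[of \<phi> U "\<phi> ` U" \<psi> V "\<psi> ` V"]
    by (auto intro!: exI[of _ "W \<times> X"] subspace_Times openin_Times map_prod_inj_on simp: dim_Times)
qed

lemma local_rep_prod_ident:
  assumes "local_rep UNIV (U, \<phi>) (U', \<phi>') (\<lambda>x. x) (fst p)" "local_rep UNIV (V, \<psi>) (V', \<psi>') (\<lambda>x. x) (snd p)"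
  shows "local_rep UNIV (U \<times> V, map_prod \<phi> \<psi>) (U' \<times> V', map_prod \<phi>' \<psi>') (\<lambda>x. x) p"
proof -
  have p: "p \<in> (U \<times> V) \<inter> UNIV" using local_repD(2)[OF assms(1)] local_repD(2)[OF assms(2)] by (cases p) auto
  show ?thesis
    using local_rep_Pair[OF local_rep_compose[OF local_rep_fst[OF p] assms(1)] local_rep_compose[OF local_rep_snd[OF p] assms(2)]]
    by simp
qed

lemma smooth_atlas_prod:
  assumes A: "smooth_atlas \<A>" and B: "smooth_atlas \<B>"
  shows "smooth_atlas (prod_atlas \<A> \<B>)"
proof -
  obtain d e where de: "\<And>c. c \<in> \<A> \<Longrightarrow> is_chart d c" "\<And>c. c \<in> \<B> \<Longrightarrow> is_chart e c"
    using A B unfolding smooth_atlas_def by blast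
  show ?thesis
  proof (rule smooth_atlasI[of _ "d + e"])
    show "is_chart (d + e) c" if "c \<in> prod_atlas \<A> \<B>" for c
      using that de by (auto simp: prod_atlas_def intro: is_chart_prod)
    show "local_rep UNIV c c' (\<lambda>x. x) p"
      if "c \<in> prod_atlas \<A> \<B>" "c' \<in> prod_atlas \<A> \<B>" "p \<in> fst c" "p \<in> fst c'" for c c' p
      using that smooth_atlas_local_rep[OF A] smooth_atlas_local_rep[OF B]
      by (fastforce simp: prod_atlas_def intro!: local_rep_prod_ident)
  qed
qed

lemma prod_max_atlas:
  assumes A: "smooth_atlas \<A>" and B: "smooth_atlas \<B>"
    and c: "(U, \<phi>) \<in> max_atlas \<A>" "(V, \<psi>) \<in> max_atlas \<B>"
  shows "(U \<times> V, map_prod \<phi> \<psi>) \<in> max_atlas (prod_atlas \<A> \<B>)"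
proof -
  obtain d e where de: "\<And>c. c \<in> max_atlas \<A> \<Longrightarrow> is_chart d c" "\<And>c. c \<in> max_atlas \<B> \<Longrightarrow> is_chart e c"
    using max_atlas_dim[OF A] max_atlas_dim[OF B] by metis
  note sub = max_atlas_superset[OF A] max_atlas_superset[OF B]
  show ?thesis
  proof (rule max_atlasI[OF smooth_atlas_prod[OF A B] is_chart_prod[OF de(1)[OF c(1)] de(2)[OF c(2)]]])
    show "is_chart (d + e) c'" if "c' \<in> prod_atlas \<A> \<B>" for c'
      using that de sub by (auto simp: prod_atlas_def intro!: is_chart_prod)
    show "fst (U \<times> V, map_prod \<phi> \<psi>) \<subseteq> points (prod_atlas \<A> \<B>)"
      using max_atlas_dom[OF c(1)] max_atlas_dom[OF c(2)] by (auto simp: points_prod_atlas)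
    fix p assume p: "p \<in> fst (U \<times> V, map_prod \<phi> \<psi>)"
    then have "fst p \<in> points \<A>" "snd p \<in> points \<B>" using max_atlas_dom[OF c(1)] max_atlas_dom[OF c(2)] by auto
    then obtain U' \<phi>' V' \<psi>' where c': "(U', \<phi>') \<in> \<A>" "fst p \<in> U'" "(V', \<psi>') \<in> \<B>" "snd p \<in> V'"
      by (fastforce simp: points_def)
    have m: "(U' \<times> V', map_prod \<phi>' \<psi>') \<in> max_atlas (prod_atlas \<A> \<B>)"
      using c' max_atlas_superset[OF smooth_atlas_prod[OF A B]] unfolding prod_atlas_def by blast
    have "(U', \<phi>') \<in> max_atlas \<A>" "(V', \<psi>') \<in> max_atlas \<B>" using c' sub by auto
    then have "local_rep UNIV (U \<times> V, map_prod \<phi> \<psi>) (U' \<times> V', map_prod \<phi>' \<psi>') (\<lambda>x. x) p"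
      "local_rep UNIV (U' \<times> V', map_prod \<phi>' \<psi>') (U \<times> V, map_prod \<phi> \<psi>) (\<lambda>x. x) p"
      using c c' p by (auto intro!: local_rep_prod_ident max_atlas_local_rep[OF A] max_atlas_local_rep[OF B])
    then show "\<exists>b\<in>max_atlas (prod_atlas \<A> \<B>). local_rep UNIV (U \<times> V, map_prod \<phi> \<psi>) b (\<lambda>x. x) p \<and>
        local_rep UNIV b (U \<times> V, map_prod \<phi> \<psi>) (\<lambda>x. x) p"
      using m by blast
  qed
qed

lemma prod_atlas_max_atlas_eq:
  assumes "smooth_atlas \<A>" "smooth_atlas \<B>"
    "smooth_atlas \<A>'" "smooth_atlas \<B>'" "max_atlas \<A>' = max_atlas \<A>" "max_atlas \<B>' = max_atlas \<B>"
  shows "max_atlas (prod_atlas \<A>' \<B>') = max_atlas (prod_atlas \<A> \<B>)"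
proof (rule max_atlas_eqI(2)[OF smooth_atlas_prod[OF assms(1,2)]])
  have "\<A>' \<subseteq> max_atlas \<A>" "\<B>' \<subseteq> max_atlas \<B>" using assms max_atlas_superset by metis+
  then show "prod_atlas \<A>' \<B>' \<subseteq> max_atlas (prod_atlas \<A> \<B>)"
    using prod_max_atlas[OF assms(1,2)] unfolding prod_atlas_def[of \<A>'] by blast
  have "points \<A>' = points \<A>" "points \<B>' = points \<B>" using assms points_max_atlas by metis+
  then show "points (prod_atlas \<A> \<B>) \<subseteq> points (prod_atlas \<A>' \<B>')" by (simp add: points_prod_atlas)
qed

lemma smooth_at_Pair:
  assumes A: "smooth_atlas \<A>" and B: "smooth_atlas \<B>" and C: "smooth_atlas \<C>"
    and fg: "smooth_at \<C> S \<A> f p" "smooth_at \<C> S \<B> g p"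
  shows "smooth_at \<C> S (prod_atlas \<A> \<B>) (\<lambda>x. (f x, g x)) p"
proof -
  obtain U \<phi> V \<psi> where c: "(U, \<phi>) \<in> max_atlas \<C>" "(V, \<psi>) \<in> max_atlas \<A>" "local_rep S (U, \<phi>) (V, \<psi>) f p"
    using fg(1) by (rule smooth_atE)
  obtain X \<xi> where x: "(X, \<xi>) \<in> max_atlas \<B>" "g p \<in> X" using chart_at[OF B smooth_atD(3)[OF fg(2)]] by blast
  have "local_rep S (U, \<phi>) (X, \<xi>) g p"
    using x local_repD[OF c(3)] by (intro smooth_at_local_rep[OF C B fg(2) c(1) _ x(1)]) auto
  then show ?thesis
    by (intro smooth_atI[OF c(1) prod_max_atlas[OF A B c(2) x(1)] local_rep_Pair[OF c(3)]])
qed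

lemma smooth_at_fst_snd:
  assumes A: "smooth_atlas \<A>" and B: "smooth_atlas \<B>" and p: "p \<in> S" "p \<in> points \<A> \<times> points \<B>"
  shows "smooth_at (prod_atlas \<A> \<B>) S \<A> fst p" "smooth_at (prod_atlas \<A> \<B>) S \<B> snd p"
proof -
  obtain U \<phi> V \<psi> where c: "(U, \<phi>) \<in> max_atlas \<A>" "fst p \<in> U" "(V, \<psi>) \<in> max_atlas \<B>" "snd p \<in> V"
    using chart_at[OF A] chart_at[OF B] p(2) by (metis mem_Times_iff)
  then have "p \<in> (U \<times> V) \<inter> S" using p(1) by (cases p) auto
  then show "smooth_at (prod_atlas \<A> \<B>) S \<A> fst p" "smooth_at (prod_atlas \<A> \<B>) S \<B> snd p"
    using smooth_atI[OF prod_max_atlas[OF A B c(1,3)] c(1) local_rep_fst]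
      smooth_atI[OF prod_max_atlas[OF A B c(1,3)] c(3) local_rep_snd] by blast+
qed

lemma smooth_manifold_prod:
  assumes "smooth_manifold \<A>" "smooth_manifold \<B>" shows "smooth_manifold (prod_atlas \<A> \<B>)"
proof -
  have A: "smooth_atlas \<A>" and B: "smooth_atlas \<B>" using assms by (auto simp: smooth_manifold_def)
  note AB = smooth_atlas_prod[OF A B]
  have op: "openin (manifold_topology (prod_atlas \<A> \<B>)) {p \<in> points (prod_atlas \<A> \<B>). fst p \<in> N}"
    if "openin (manifold_topology \<A>) N" for N
    using smooth_at_fst_snd(1)[OF A B] openin_topspace[of "manifold_topology (prod_atlas \<A> \<B>)"]
    by (intro openin_vimage_local_rep[OF AB A that])
      (auto simp: smooth_at_def topspace_manifold_topology[OF AB] points_prod_atlas)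
  have op2: "openin (manifold_topology (prod_atlas \<A> \<B>)) {p \<in> points (prod_atlas \<A> \<B>). snd p \<in> N}"
    if "openin (manifold_topology \<B>) N" for N
    using smooth_at_fst_snd(2)[OF A B] openin_topspace[of "manifold_topology (prod_atlas \<A> \<B>)"]
    by (intro openin_vimage_local_rep[OF AB B that])
      (auto simp: smooth_at_def topspace_manifold_topology[OF AB] points_prod_atlas)
  have "Hausdorff_space (manifold_topology (prod_atlas \<A> \<B>))"
    unfolding Hausdorff_space_def topspace_manifold_topology[OF AB]
  proof (intro allI impI)
    fix x y assume xy: "x \<in> points (prod_atlas \<A> \<B>) \<and> y \<in> points (prod_atlas \<A> \<B>) \<and> x \<noteq> y"
    then consider "fst x \<noteq> fst y" | "snd x \<noteq> snd y" by (metis prod.expand)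
    then show "\<exists>U V. openin (manifold_topology (prod_atlas \<A> \<B>)) U \<and>
        openin (manifold_topology (prod_atlas \<A> \<B>)) V \<and> x \<in> U \<and> y \<in> V \<and> disjnt U V"
    proof cases
      case 1
      then obtain U V where "openin (manifold_topology \<A>) U" "openin (manifold_topology \<A>) V"
        "fst x \<in> U" "fst y \<in> V" "disjnt U V"
        using assms(1) xy unfolding smooth_manifold_def Hausdorff_space_def topspace_manifold_topology[OF A]
        by (metis mem_Times_iff points_prod_atlas)
      then show ?thesis using op[of U] op[of V] xy by (fastforce simp: disjnt_def)
    next
      case 2
      then obtain U V where "openin (manifold_topology \<B>) U" "openin (manifold_topology \<B>) V"
        "snd x \<in> U" "snd y \<in> V" "disjnt U V"
        using assms(2) xy unfolding smooth_manifold_def Hausdorff_space_def topspace_manifold_topology[OF B]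
        by (metis mem_Times_iff points_prod_atlas)
      then show ?thesis using op2[of U] op2[of V] xy by (fastforce simp: disjnt_def)
    qed
  qed
  moreover have "second_countable (manifold_topology (prod_atlas \<A> \<B>))"
  proof -
    \<comment> \<open>Lindelof gives countable subatlases of both factors; the products of their
      charts are again countable in number.\<close>
    have "\<exists>J. countable J \<and> J \<subseteq> \<A> \<and> points \<A> \<subseteq> (\<Union>i\<in>J. fst i)" if "smooth_manifold \<A>"
      for \<A> :: "('x, 'y::euclidean_space) atlas"
    proof -
      have A: "smooth_atlas \<A>" and sc: "second_countable (manifold_topology \<A>)"
        using that by (auto simp: smooth_manifold_def)
      have "openin (manifold_topology \<A>) (fst c)" if "c \<in> \<A>" for c
        using that by (cases c) (auto intro: openin_chart_domain)
      moreover have "topspace (manifold_topology \<A>) \<subseteq> (\<Union>i\<in>\<A>. fst i)"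
        unfolding topspace_manifold_topology[OF A] by (auto simp: points_def)
      ultimately show ?thesis
        using countable_subcover[OF sc, of \<A> fst] unfolding topspace_manifold_topology[OF A] by metis
    qed
    from this[OF assms(1)] this[OF assms(2)]
    obtain J K where J: "countable J" "J \<subseteq> \<A>" "points \<A> \<subseteq> (\<Union>i\<in>J. fst i)"
      and K: "countable K" "K \<subseteq> \<B>" "points \<B> \<subseteq> (\<Union>i\<in>K. fst i)" by blast
    show ?thesis
    proof (rule second_countable_manifold[OF AB])
      have "prod_atlas J K = (\<lambda>(c, c'). (fst c \<times> fst c', map_prod (snd c) (snd c'))) ` (J \<times> K)"
        unfolding prod_atlas_def by force
      then show "countable (prod_atlas J K)" using J K by simp
      show "prod_atlas J K \<subseteq> max_atlas (prod_atlas \<A> \<B>)"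
        using J K max_atlas_superset[OF AB] unfolding prod_atlas_def by blast
      show "points (prod_atlas \<A> \<B>) \<subseteq> points (prod_atlas J K)"
        using J(3) K(3) unfolding points_prod_atlas by (intro Sigma_mono) (force simp: points_iff)+
    qed
  qed
  ultimately show ?thesis using AB by (simp add: smooth_manifold_def)
qed

subsection \<open>Euclidean-valued maps\<close>

abbreviation smooth_fun_at :: "('m, 'b::euclidean_space) atlas \<Rightarrow> 'm set \<Rightarrow> ('m \<Rightarrow> 'c::euclidean_space) \<Rightarrow> 'm \<Rightarrow> bool" where
  "smooth_fun_at \<A> S \<equiv> smooth_at \<A> S euc_atlas"

lemma smooth_fun_atI:
  "(U, \<phi>) \<in> max_atlas \<A> \<Longrightarrow> local_rep S (U, \<phi>) euc f p \<Longrightarrow> smooth_fun_at \<A> S f p"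
  by (rule smooth_atI[OF _ euc_in_max_atlas])

lemma smooth_fun_at_local_rep:
  assumes "smooth_atlas \<A>" "smooth_fun_at \<A> S f p" "c \<in> max_atlas \<A>" "p \<in> fst c"
  shows "local_rep S c euc f p"
  by (rule smooth_at_local_rep[OF assms(1) smooth_atlas_euc assms(2-4) euc_in_max_atlas]) simp

lemma smooth_fun_atE:
  assumes "smooth_atlas \<A>" "smooth_fun_at \<A> S f p"
  obtains U \<phi> where "(U, \<phi>) \<in> max_atlas \<A>" "p \<in> U" "local_rep S (U, \<phi>) euc f p"
proof -
  obtain U \<phi> where U: "(U, \<phi>) \<in> max_atlas \<A>" "p \<in> U"
    using chart_at[OF assms(1) smooth_atD(2)[OF assms(2)]] by blast
  then show ?thesis using that smooth_fun_at_local_rep[OF assms U(1)] by simp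
qed

lemma smooth_fun_at_linear:
  assumes "smooth_atlas \<A>" "smooth_fun_at \<A> S f p" "bounded_linear L"
  shows "smooth_fun_at \<A> S (\<lambda>x. L (f x)) p"
  by (rule smooth_fun_atE[OF assms(1,2)]) (rule smooth_fun_atI, assumption, rule local_rep_linear[OF _ assms(3)])

lemma smooth_fun_at_smooth_open:
  assumes "smooth_atlas \<A>" "smooth_fun_at \<A> S f p" "smooth_open UNIV g"
  shows "smooth_fun_at \<A> S (\<lambda>x. g (f x)) p"
  by (rule smooth_fun_atE[OF assms(1,2)]) (rule smooth_fun_atI, assumption, rule local_rep_smooth_open[OF _ assms(3)], simp_all)

lemma smooth_fun_at_Pair:
  assumes A: "smooth_atlas \<A>" and fg: "smooth_fun_at \<A> S f p" "smooth_fun_at \<A> S g p"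
  shows "smooth_fun_at \<A> S (\<lambda>x. (f x, g x)) p"
proof (rule smooth_fun_atE[OF A fg(1)])
  fix U \<phi> assume U: "(U, \<phi>) \<in> max_atlas \<A>" "p \<in> U" "local_rep S (U, \<phi>) euc f p"
  then have "local_rep S (U, \<phi>) euc g p" by (intro smooth_fun_at_local_rep[OF A fg(2)]) auto
  then show ?thesis by (rule smooth_fun_atI[OF U(1) local_rep_euc_Pair[OF U(3)]])
qed

lemma smooth_fun_at_add:
  assumes A: "smooth_atlas \<A>" and fg: "smooth_fun_at \<A> S f p" "smooth_fun_at \<A> S g p"
  shows "smooth_fun_at \<A> S (\<lambda>x. f x + g x) p"
  using smooth_fun_at_linear[OF A smooth_fun_at_Pair[OF assms], of "\<lambda>z. fst z + snd z"]
    bounded_linear_add[OF bounded_linear_fst bounded_linear_snd] by simp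

lemma smooth_fun_at_diff:
  assumes A: "smooth_atlas \<A>" and fg: "smooth_fun_at \<A> S f p" "smooth_fun_at \<A> S g p"
  shows "smooth_fun_at \<A> S (\<lambda>x. f x - g x) p"
  using smooth_fun_at_linear[OF A smooth_fun_at_Pair[OF assms], of "\<lambda>z. fst z - snd z"]
    bounded_linear_sub[OF bounded_linear_fst bounded_linear_snd] by simp

lemma smooth_functions_iff:
  assumes "smooth_atlas \<A>"
  shows "f \<in> smooth_functions \<A> \<longleftrightarrow> (\<forall>p\<in>points \<A>. smooth_fun_at \<A> (points \<A>) f p)"
  unfolding smooth_functions_def real_atlas_eq
  by (simp add: smooth_map_on_iff[OF assms smooth_atlas_euc])

section \<open>Submanifolds\<close>

text \<open>This covers the restricted atlases as well as the total space of a subbundle inside the total space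
  of the ambient bundle.\<close>

definition subatlas :: "('m, 'b::euclidean_space) atlas \<Rightarrow> 'm set \<Rightarrow> ('m, 'b) atlas \<Rightarrow> bool" where
  "subatlas \<A> S \<B> \<longleftrightarrow> smooth_atlas \<A> \<and> smooth_atlas \<B> \<and> points \<B> = S \<and>
     (\<forall>p\<in>S. \<exists>U \<phi>. (U, \<phi>) \<in> max_atlas \<A> \<and> p \<in> U \<and> (U \<inter> S, \<phi>) \<in> max_atlas \<B>)"

lemma subatlasE:
  assumes "subatlas \<A> S \<B>" "p \<in> S"
  obtains U \<phi> where "(U, \<phi>) \<in> max_atlas \<A>" "p \<in> U" "(U \<inter> S, \<phi>) \<in> max_atlas \<B>"
  using assms unfolding subatlas_def by blast

text \<open>The charts of the submanifold are restrictions of ambient charts, and a coordinate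
  expression over \<open>T\<close> only looks at points of \<open>T\<close>. Together with the
  statement for the codomain this moves all smoothness questions about subbundles to the ambient
  bundle.\<close>

lemma smooth_at_subatlas_dom:
  assumes sub: "subatlas \<A> S \<A>'" and T: "T \<subseteq> S" and p: "p \<in> T" and B: "smooth_atlas \<B>"
  shows "smooth_at \<A>' T \<B> f p \<longleftrightarrow> smooth_at \<A> T \<B> f p"
proof -
  have A: "smooth_atlas \<A>" "smooth_atlas \<A>'" using sub by (auto simp: subatlas_def)
  have pS: "p \<in> S" using p T by blast
  obtain U \<phi> where U: "(U, \<phi>) \<in> max_atlas \<A>" "p \<in> U" "(U \<inter> S, \<phi>) \<in> max_atlas \<A>'"
    by (rule subatlasE[OF sub pS])
  show ?thesis
  proof
    assume f: "smooth_at \<A>' T \<B> f p"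
    obtain V \<psi> where V: "(V, \<psi>) \<in> max_atlas \<B>" "f p \<in> V" using chart_at[OF B smooth_atD(3)[OF f]] by blast
    have "local_rep T (U \<inter> S, \<phi>) (V, \<psi>) f p"
      by (rule smooth_at_local_rep[OF A(2) B f U(3) _ V(1)]) (use U V pS in auto)
    then show "smooth_at \<A> T \<B> f p" by (rule smooth_atI[OF U(1) V(1) local_rep_dom_Int[OF _ T]])
  next
    assume f: "smooth_at \<A> T \<B> f p"
    obtain V \<psi> where V: "(V, \<psi>) \<in> max_atlas \<B>" "f p \<in> V" using chart_at[OF B smooth_atD(3)[OF f]] by blast
    have "local_rep T (U, \<phi>) (V, \<psi>) f p"
      by (rule smooth_at_local_rep[OF A(1) B f U(1) _ V(1)]) (use U V in auto)
    then have "local_rep T (U \<inter> S, \<phi>) (V, \<psi>) f p" by (rule local_rep_dom) (use U pS in auto)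
    then show "smooth_at \<A>' T \<B> f p" by (rule smooth_atI[OF U(3) V(1)])
  qed
qed

lemma smooth_at_subatlas_cod:
  assumes sub: "subatlas \<B> S \<B>'" and f: "\<And>q. q \<in> T \<Longrightarrow> f q \<in> S" and A: "smooth_atlas \<A>"
  shows "smooth_at \<A> T \<B>' f p \<longleftrightarrow> smooth_at \<A> T \<B> f p"
proof -
  have B: "smooth_atlas \<B>" "smooth_atlas \<B>'" using sub by (auto simp: subatlas_def)
  have *: "\<exists>U \<phi> V \<psi>. (U, \<phi>) \<in> max_atlas \<A> \<and> p \<in> U \<and> (V, \<psi>) \<in> max_atlas \<B> \<and> f p \<in> V \<and>
      f p \<in> S \<and> (V \<inter> S, \<psi>) \<in> max_atlas \<B>'"
    if pT: "p \<in> T" "p \<in> points \<A>"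
  proof -
    obtain V \<psi> where "(V, \<psi>) \<in> max_atlas \<B>" "f p \<in> V" "(V \<inter> S, \<psi>) \<in> max_atlas \<B>'"
      using subatlasE[OF sub f[OF pT(1)]] by blast
    then show ?thesis using chart_at[OF A pT(2)] f[OF pT(1)] by blast
  qed
  show ?thesis
  proof
    assume s: "smooth_at \<A> T \<B>' f p"
    obtain U \<phi> V \<psi> where c: "(U, \<phi>) \<in> max_atlas \<A>" "p \<in> U" "(V, \<psi>) \<in> max_atlas \<B>" "f p \<in> V" "f p \<in> S"
      "(V \<inter> S, \<psi>) \<in> max_atlas \<B>'" using *[OF smooth_atD(1,2)[OF s]] by blast
    have "local_rep T (U, \<phi>) (V \<inter> S, \<psi>) f p"
      by (rule smooth_at_local_rep[OF A B(2) s c(1) _ c(6)]) (use c in auto)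
    then have "local_rep T (U, \<phi>) (V, \<psi>) f p" by (rule local_rep_cod) auto
    then show "smooth_at \<A> T \<B> f p" by (rule smooth_atI[OF c(1,3)])
  next
    assume s: "smooth_at \<A> T \<B> f p"
    obtain U \<phi> V \<psi> where c: "(U, \<phi>) \<in> max_atlas \<A>" "p \<in> U" "(V, \<psi>) \<in> max_atlas \<B>" "f p \<in> V" "f p \<in> S"
      "(V \<inter> S, \<psi>) \<in> max_atlas \<B>'" using *[OF smooth_atD(1,2)[OF s]] by blast
    have "local_rep T (U, \<phi>) (V, \<psi>) f p"
      by (rule smooth_at_local_rep[OF A B(1) s c(1) _ c(3)]) (use c in auto)
    then have "local_rep T (U, \<phi>) (V \<inter> S, \<psi>) f p" by (rule local_rep_cod) (use f in auto)
    then show "smooth_at \<A> T \<B>' f p" by (rule smooth_atI[OF c(1,6)])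
  qed
qed

text \<open>With this, the Hausdorff property and second countability are inherited from the ambient
  manifold. The ambient open set inducing \<open>N\<close> is the union of all open sets whose trace
  lies in \<open>N\<close>.\<close>

lemma subatlas_topology:
  assumes sub: "subatlas \<A> S \<B>"
  shows "manifold_topology \<B> = subtopology (manifold_topology \<A>) S"
proof -
  have A: "smooth_atlas \<A>" "smooth_atlas \<B>" "points \<B> = S" using sub by (auto simp: subatlas_def)
  show ?thesis
    unfolding topology_eq
  proof (intro allI iffI)
    fix N assume N: "openin (manifold_topology \<B>) N"
    define M where "M = \<Union>{M. openin (manifold_topology \<A>) M \<and> M \<inter> S \<subseteq> N}"
    have "openin (manifold_topology \<A>) M" unfolding M_def by (rule openin_Union) blast
    moreover have "N = M \<inter> S"
    proof
      show "N \<subseteq> M \<inter> S"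
      proof
        fix p assume p: "p \<in> N"
        have pS: "p \<in> S" using p openin_subset[OF N] topspace_manifold_topology[OF A(2)] A(3) by blast
        obtain U \<phi> where U: "(U, \<phi>) \<in> max_atlas \<A>" "p \<in> U" "(U \<inter> S, \<phi>) \<in> max_atlas \<B>"
          by (rule subatlasE[OF sub pS])
        obtain Q where Q: "open Q" "\<phi> p \<in> Q" "\<forall>q\<in>U \<inter> S. \<phi> q \<in> Q \<longrightarrow> q \<in> N"
          using openin_manifold_chart[OF A(2) N U(3) _ p] U(2) pS by blast
        have "openin (manifold_topology \<A>) (U \<inter> \<phi> -` Q)" by (rule openin_chart_vimage[OF A(1) U(1) Q(1)])
        then have "U \<inter> \<phi> -` Q \<subseteq> M" unfolding M_def using Q(3) by blast
        then show "p \<in> M \<inter> S" using U(2) Q(2) pS by blast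
      qed
      show "M \<inter> S \<subseteq> N" unfolding M_def by blast
    qed
    ultimately show "openin (subtopology (manifold_topology \<A>) S) N"
      unfolding openin_subtopology by blast
  next
    fix N assume "openin (subtopology (manifold_topology \<A>) S) N"
    then obtain M where M: "openin (manifold_topology \<A>) M" "N = M \<inter> S" unfolding openin_subtopology by blast
    show "openin (manifold_topology \<B>) N"
      unfolding openin_manifold_iff[OF A(2)]
    proof
      fix p assume p: "p \<in> N"
      then have pS: "p \<in> S" "p \<in> M" using M by auto
      obtain U \<phi> where U: "(U, \<phi>) \<in> max_atlas \<A>" "p \<in> U" "(U \<inter> S, \<phi>) \<in> max_atlas \<B>"
        by (rule subatlasE[OF sub pS(1)])
      obtain Q where Q: "open Q" "\<phi> p \<in> Q" "\<forall>q\<in>U. \<phi> q \<in> Q \<longrightarrow> q \<in> M"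
        using openin_manifold_chart[OF A(1) M(1) U(1,2) pS(2)] by blast
      then have "p \<in> U \<inter> S" "\<forall>q\<in>U \<inter> S. \<phi> q \<in> Q \<longrightarrow> q \<in> N" using U pS M(2) by auto
      then show "\<exists>U \<phi> Q. (U, \<phi>) \<in> max_atlas \<B> \<and> p \<in> U \<and> open Q \<and> \<phi> p \<in> Q \<and> (\<forall>q\<in>U. \<phi> q \<in> Q \<longrightarrow> q \<in> N)"
        using U(3) Q(1,2) by blast
    qed
  qed
qed

lemma smooth_manifold_subatlas:
  assumes "subatlas \<A> S \<B>" "smooth_manifold \<A>" shows "smooth_manifold \<B>"
  using assms unfolding smooth_manifold_def subatlas_topology[OF assms(1)]
  by (auto simp: subatlas_def intro: Hausdorff_space_subtopology second_countable_subtopology)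

lemma subatlas_restrict:
  assumes A: "smooth_atlas \<A>" and S: "embedded_submanifold \<A> S"
  shows "subatlas \<A> S (restrict_atlas \<A> S)"
  unfolding subatlas_def
proof (intro conjI ballI A)
  show R: "smooth_atlas (restrict_atlas \<A> S)" "points (restrict_atlas \<A> S) = S"
    using S by (auto simp: embedded_submanifold_def)
  fix p assume "p \<in> S"
  then obtain X \<xi> where "(X, \<xi>) \<in> restrict_atlas \<A> S" "p \<in> X"
    using R(2) unfolding points_def by blast
  then obtain U where "(U, \<xi>) \<in> max_atlas \<A>" "p \<in> U" "(U \<inter> S, \<xi>) \<in> restrict_atlas \<A> S"
    unfolding restrict_atlas_def by blast
  then show "\<exists>U \<phi>. (U, \<phi>) \<in> max_atlas \<A> \<and> p \<in> U \<and> (U \<inter> S, \<phi>) \<in> max_atlas (restrict_atlas \<A> S)"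
    using max_atlas_superset[OF R(1)] by blast
qed

text \<open>The coordinate change maps one slice injectively and continuously into the other, so
  invariance of dimension compares the two subspaces.\<close>

lemma slice_dim_le:
  assumes A: "smooth_atlas \<A>" and c: "(U, \<phi>) \<in> max_atlas \<A>" "(V, \<psi>) \<in> max_atlas \<A>" and p: "p \<in> U" "p \<in> V" "p \<in> S"
    and W: "subspace W" "openin (top_of_set W) (\<phi> ` (U \<inter> S))" "subspace X" "\<psi> ` (V \<inter> S) \<subseteq> X"
  shows "dim W \<le> dim X"
proof -
  obtain N g where N: "\<phi> p \<in> N" "smooth_open N g" "\<And>q. q \<in> U \<Longrightarrow> \<phi> q \<in> N \<Longrightarrow> q \<in> V \<and> \<psi> q = g (\<phi> q)"
    by (rule local_repE[OF max_atlas_local_rep[OF A c, unfolded fst_conv, OF p(1,2)]]) blast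
  have inj: "inj_on \<psi> V" using max_atlas_dim[OF A] c(2) is_chart_inj by metis
  let ?D = "\<phi> ` (U \<inter> S) \<inter> N"
  show ?thesis
  proof (rule invariance_of_dimension_subspaces)
    show "openin (top_of_set W) ?D" by (rule openin_Int_open[OF W(2) smooth_openD(1)[OF N(2)]])
    show "continuous_on ?D g" by (rule continuous_on_subset[OF smooth_openD(3)[OF N(2)]]) auto
    have g: "\<And>q. q \<in> U \<Longrightarrow> \<phi> q \<in> N \<Longrightarrow> g (\<phi> q) = \<psi> q" "\<And>q. q \<in> U \<Longrightarrow> \<phi> q \<in> N \<Longrightarrow> q \<in> V" using N(3) by auto
    show "g \<in> ?D \<rightarrow> X" using g W(4) by auto
    show "inj_on g ?D"
    proof (rule inj_onI)
      fix x y assume xy: "x \<in> ?D" "y \<in> ?D" "g x = g y"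
      then obtain a b where ab: "a \<in> U" "b \<in> U" "x = \<phi> a" "y = \<phi> b" "\<phi> a \<in> N" "\<phi> b \<in> N" by blast
      then have "\<psi> a = \<psi> b" "a \<in> V" "b \<in> V" using xy g by auto
      then show "x = y" using inj ab by (simp add: inj_on_eq_iff)
    qed
    show "?D \<noteq> {}" using p N(1) by blast
  qed (use W in auto)
qed

lemma embedded_submanifoldI:
  assumes A: "smooth_atlas \<A>"
    and S: "\<And>p. p \<in> S \<Longrightarrow> \<exists>U \<phi> W. (U, \<phi>) \<in> max_atlas \<A> \<and> p \<in> U \<and> subspace W \<and> dim W = d \<and>
      \<phi> ` (U \<inter> S) = \<phi> ` U \<inter> W \<and> openin (top_of_set W) (\<phi> ` (U \<inter> S))"
  shows "embedded_submanifold \<A> S"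
proof -
  have pts: "points (restrict_atlas \<A> S) = S"
  proof
    show "points (restrict_atlas \<A> S) \<subseteq> S" unfolding restrict_atlas_def by (auto simp: points_def)
    show "S \<subseteq> points (restrict_atlas \<A> S)"
    proof
      fix p assume p: "p \<in> S"
      obtain U \<phi> W where U: "(U, \<phi>) \<in> max_atlas \<A>" "p \<in> U" "subspace W" "\<phi> ` (U \<inter> S) = \<phi> ` U \<inter> W"
        using S[OF p] by blast
      then have "(U \<inter> S, \<phi>) \<in> restrict_atlas \<A> S" unfolding restrict_atlas_def by blast
      then show "p \<in> points (restrict_atlas \<A> S)" using p U(2) unfolding points_def by blast
    qed
  qed
  have sub: "S \<subseteq> points \<A>" using S max_atlas_dom by blast
  \<comment> \<open>An empty \<open>S\<close> provides no subspace of dimension \<open>d\<close>,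
    and yet \<open>is_chart\<close> asks for a model subspace; hence the value \<open>0\<close> in
    that case.\<close>
  define e where "e = (if S = {} then 0 else d)"
  obtain k where k: "\<And>c. c \<in> max_atlas \<A> \<Longrightarrow> is_chart k c" using max_atlas_dim[OF A] by blast
  have "smooth_atlas (restrict_atlas \<A> S)"
  proof (rule smooth_atlasI[of _ e])
    fix c assume "c \<in> restrict_atlas \<A> S"
    then obtain U \<phi> W' where c: "c = (U \<inter> S, \<phi>)" "(U, \<phi>) \<in> max_atlas \<A>" "subspace W'" "\<phi> ` (U \<inter> S) = \<phi> ` U \<inter> W'"
      unfolding restrict_atlas_def by blast
    have inj: "inj_on \<phi> (U \<inter> S)" using is_chart_inj[OF k[OF c(2)]] inj_on_subset by blast
    obtain W0 where W0: "subspace W0" "openin (top_of_set W0) (\<phi> ` U)" using k[OF c(2)] by (auto simp: is_chart_def)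
    have o: "openin (top_of_set (W0 \<inter> W')) (\<phi> ` (U \<inter> S))"
      unfolding c(4) using W0(2) by (auto simp: openin_open)
    have ss: "subspace (W0 \<inter> W')" using W0 c by (simp add: subspace_inter)
    show "is_chart e c"
    proof (cases "U \<inter> S = {}")
      case True
      have "\<exists>W::'b set. subspace W \<and> dim W = e"
      proof (cases "S = {}")
        case True
        then show ?thesis by (intro exI[of _ "{0}"]) (simp add: e_def subspace_single_0)
      next
        case False
        then show ?thesis using S unfolding e_def by (metis ex_in_conv)
      qed
      then show ?thesis unfolding c is_chart_def True by simp
    next
      case False
      then obtain p where p: "p \<in> U" "p \<in> S" by blast
      obtain V \<psi> W where V: "(V, \<psi>) \<in> max_atlas \<A>" "p \<in> V" "subspace W" "dim W = d"
        "openin (top_of_set W) (\<psi> ` (V \<inter> S))" using S[OF p(2)] by blast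
      \<comment> \<open>\<open>restrict_atlas\<close> admits all slice charts, not only those given
        by the hypothesis. Comparing with a given one at a common point, in both directions, fixes
        the dimension.\<close>
      have "dim (W0 \<inter> W') \<le> dim W"
        by (rule slice_dim_le[OF A c(2) V(1) p(1) V(2) p(2) ss o V(3) openin_imp_subset[OF V(5)]])
      moreover have "dim W \<le> dim (W0 \<inter> W')"
        by (rule slice_dim_le[OF A V(1) c(2) V(2) p V(3,5) ss openin_imp_subset[OF o]])
      ultimately have "dim (W0 \<inter> W') = e" using V(4) p by (auto simp: e_def)
      then show ?thesis unfolding c is_chart_def using inj ss o by auto
    qed
  next
    fix c c' p assume cc: "c \<in> restrict_atlas \<A> S" "c' \<in> restrict_atlas \<A> S" "p \<in> fst c" "p \<in> fst c'"
    then obtain U \<phi> V \<psi> where c: "c = (U \<inter> S, \<phi>)" "(U, \<phi>) \<in> max_atlas \<A>" "c' = (V \<inter> S, \<psi>)" "(V, \<psi>) \<in> max_atlas \<A>"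
      unfolding restrict_atlas_def by blast
    have "local_rep UNIV (U, \<phi>) (V, \<psi>) (\<lambda>x. x) p"
      using cc c by (intro max_atlas_local_rep[OF A]) auto
    then obtain N g where N: "\<phi> p \<in> N" "smooth_open N g"
      "\<And>q. q \<in> U \<Longrightarrow> q \<in> UNIV \<Longrightarrow> \<phi> q \<in> N \<Longrightarrow> q \<in> V \<and> \<psi> q = g (\<phi> q)"
      by (rule local_repE) blast
    show "local_rep UNIV c c' (\<lambda>x. x) p"
      unfolding c by (rule local_repI[of p _ _ _ N g]) (use N cc c in auto)
  qed
  then show ?thesis using pts sub by (simp add: embedded_submanifold_def)
qed

text \<open>The slice may be cut out by the whole space, so every chart of the maximal atlas
  qualifies. As a consequence, subbundles over the full base carry the maximal atlas as their base
  atlas.\<close>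

lemma restrict_atlas_points: "restrict_atlas \<A> (points \<A>) = max_atlas \<A>"
proof (rule equalityI; rule subsetI)
  have eq: "U \<inter> points \<A> = U" if "(U, \<phi>) \<in> max_atlas \<A>" for U \<phi> using max_atlas_dom[OF that] by blast
  show "c \<in> max_atlas \<A>" if "c \<in> restrict_atlas \<A> (points \<A>)" for c
    using that eq unfolding restrict_atlas_def by auto
  show "c \<in> restrict_atlas \<A> (points \<A>)" if c: "c \<in> max_atlas \<A>" for c
  proof -
    obtain U \<phi> where U: "c = (U, \<phi>)" by (metis surj_pair)
    have "c = (U \<inter> points \<A>, \<phi>)" "\<phi> ` (U \<inter> points \<A>) = \<phi> ` U \<inter> UNIV" using eq c U by auto
    then show ?thesis unfolding restrict_atlas_def using c U subspace_UNIV by blast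
  qed
qed

lemma restrict_atlas_cong: "max_atlas \<A> = max_atlas \<B> \<Longrightarrow> restrict_atlas \<A> S = restrict_atlas \<B> S"
  by (simp add: restrict_atlas_def)

lemma embedded_submanifold_cong:
  assumes "max_atlas \<A> = max_atlas \<B>" "smooth_atlas \<A>" "smooth_atlas \<B>"
  shows "embedded_submanifold \<A> S \<longleftrightarrow> embedded_submanifold \<B> S"
  using restrict_atlas_cong[OF assms(1)] points_max_atlas assms by (metis embedded_submanifold_def)

subsection \<open>Submersions\<close>

lemma smooth_functions_compose:
  assumes A: "smooth_atlas \<A>" and B: "smooth_atlas \<B>" and f: "smooth_map \<A> \<B> f" and g: "g \<in> smooth_functions \<B>"
  shows "g \<circ> f \<in> smooth_functions \<A>"
  unfolding smooth_functions_iff[OF A] comp_def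
proof
  fix p assume p: "p \<in> points \<A>"
  then have fp: "f p \<in> points \<B>" "smooth_at \<A> (points \<A>) \<B> f p"
    using f unfolding smooth_map_on_iff[OF A B] by auto
  then have "smooth_fun_at \<B> (points \<B>) g (f p)" using g unfolding smooth_functions_iff[OF B] by blast
  then show "smooth_fun_at \<A> (points \<A>) (\<lambda>x. g (f x)) p" by (rule smooth_at_compose[OF B fp(2)])
qed

lemma tangent_map_in:
  assumes A: "smooth_atlas \<A>" and B: "smooth_atlas \<B>" and f: "smooth_map \<A> \<B> f" and p: "p \<in> points \<A>"
    and v: "v \<in> tangent_space \<A> p"
  shows "tangent_map \<B> f v \<in> tangent_space \<B> (f p)"
proof -
  have comp: "g \<circ> f \<in> smooth_functions \<A>" if "g \<in> smooth_functions \<B>" for g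
    by (rule smooth_functions_compose[OF A B f that])
  have sm: "(\<lambda>x. g x + h x) \<in> smooth_functions \<B>" "(\<lambda>x. g x * h x) \<in> smooth_functions \<B>" "(\<lambda>x. c * g x) \<in> smooth_functions \<B>"
    if "g \<in> smooth_functions \<B>" "h \<in> smooth_functions \<B>" for g h c
  proof -
    have "smooth_open UNIV (\<lambda>z :: real \<times> real. fst z *\<^sub>R snd z)"
      by (intro smooth_open_scaleR smooth_open_bounded_linear bounded_linear_fst bounded_linear_snd open_UNIV)
    then have m: "smooth_open UNIV (\<lambda>z :: real \<times> real. fst z * snd z)" by simp
    show "(\<lambda>x. g x + h x) \<in> smooth_functions \<B>" "(\<lambda>x. g x * h x) \<in> smooth_functions \<B>"
      "(\<lambda>x. c * g x) \<in> smooth_functions \<B>"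
      using that smooth_fun_at_add[OF B, of _ g _ h] smooth_fun_at_linear[OF B _ bounded_linear_mult_right, of _ g _ c]
        smooth_fun_at_smooth_open[OF B smooth_fun_at_Pair[OF B, of _ g _ h] m]
      unfolding smooth_functions_iff[OF B] by auto
  qed
  show ?thesis
    unfolding tangent_space_def tangent_map_def using v[unfolded tangent_space_def] comp sm by (simp add: comp_def)
qed

text \<open>A derivation ignores the values off \<open>points \<A>\<close>. This matters for
  composites such as \<open>g \<circ> f \<circ> \<sigma>\<close>, which agree with \<open>g\<close>
  only on the manifold.\<close>

lemma tangent_space_cong:
  assumes A: "smooth_atlas \<A>" and v: "v \<in> tangent_space \<A> p" and p: "p \<in> points \<A>" and f: "f \<in> smooth_functions \<A>"
    and g: "\<And>x. x \<in> points \<A> \<Longrightarrow> g x = f x"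
  shows "v g = v f"
proof -
  have s: "g \<in> smooth_functions \<A>" using smooth_functions_cong[OF f] g by auto
  have "v (\<lambda>x. g x - f x) = 0" by (rule tangent_const[OF v p, of _ 0]) (use g in auto)
  moreover have d: "(\<lambda>x. g x - f x) \<in> smooth_functions \<A>"
    by (rule smooth_functions_cong[OF smooth_functions_const[of 0]]) (use g in auto)
  have "\<And>f g. f \<in> smooth_functions \<A> \<Longrightarrow> g \<in> smooth_functions \<A> \<Longrightarrow> v (\<lambda>x. f x + g x) = v f + v g"
    using v unfolding tangent_space_def by blast
  from this[OF f d] have "v g = v f + v (\<lambda>x. g x - f x)" by simp
  ultimately show ?thesis by simp
qed

text \<open>A smooth section \<open>\<sigma>\<close> through \<open>p\<close> yields surjectivity on
  tangent vectors, since by functoriality \<open>tangent_map\<close> of \<open>f\<close> undoes that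
  of \<open>\<sigma>\<close>. The section is global because derivations act on globally defined
  functions.\<close>

lemma submersionI:
  assumes A: "smooth_atlas \<A>" and B: "smooth_atlas \<B>" and f: "smooth_map \<A> \<B> f"
    and sec: "\<And>p. p \<in> points \<A> \<Longrightarrow> \<exists>\<sigma>. smooth_map \<B> \<A> \<sigma> \<and> \<sigma> (f p) = p \<and> (\<forall>b\<in>points \<B>. f (\<sigma> b) = b)"
  shows "submersion \<A> \<B> f"
  unfolding submersion_def
proof (intro conjI ballI f equalityI subsetI)
  fix p v assume p: "p \<in> points \<A>"
  {
    assume "v \<in> tangent_map \<B> f ` tangent_space \<A> p"
    then show "v \<in> tangent_space \<B> (f p)" using tangent_map_in[OF A B f p] by blast
  next
    assume v: "v \<in> tangent_space \<B> (f p)"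
    obtain \<sigma> where \<sigma>: "smooth_map \<B> \<A> \<sigma>" "\<sigma> (f p) = p" "\<And>b. b \<in> points \<B> \<Longrightarrow> f (\<sigma> b) = b"
      using sec[OF p] by blast
    have fp: "f p \<in> points \<B>" using f p unfolding smooth_map_on_iff[OF A B] by blast
    have w: "tangent_map \<A> \<sigma> v \<in> tangent_space \<A> p" using tangent_map_in[OF B A \<sigma>(1) fp v] \<sigma>(2) by simp
    have "tangent_map \<B> f (tangent_map \<A> \<sigma> v) = v"
    proof
      fix g
      show "tangent_map \<B> f (tangent_map \<A> \<sigma> v) g = v g"
      proof (cases "g \<in> smooth_functions \<B>")
        case True
        then have "g \<circ> f \<in> smooth_functions \<A>"
          by (intro smooth_functions_compose[OF A B f])
        moreover have "v (g \<circ> f \<circ> \<sigma>) = v g"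
          by (rule tangent_space_cong[OF B v fp True]) (simp add: \<sigma>(3))
        ultimately show ?thesis using True by (simp add: tangent_map_def)
      next
        case False
        then show ?thesis using v by (simp add: tangent_map_def tangent_space_def)
      qed
    qed
    then show "v \<in> tangent_map \<B> f ` tangent_space \<A> p" using w by (metis image_eqI)
  }
qed

section \<open>Vector bundles\<close>

lemma chart_image_open:
  assumes A: "smooth_atlas \<A>" and c: "(U, \<phi>) \<in> max_atlas \<A>" and N: "openin (manifold_topology \<A>) N"
  shows "openin (top_of_set (\<phi> ` U)) (\<phi> ` (U \<inter> N))"
proof (subst openin_subopen, intro ballI)
  fix y assume "y \<in> \<phi> ` (U \<inter> N)"
  then obtain p where p: "p \<in> U" "p \<in> N" "y = \<phi> p" by blast
  obtain Q where Q: "open Q" "\<phi> p \<in> Q" "\<forall>q\<in>U. \<phi> q \<in> Q \<longrightarrow> q \<in> N"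
    using openin_manifold_chart[OF A N c p(1,2)] by blast
  then show "\<exists>T. openin (top_of_set (\<phi> ` U)) T \<and> y \<in> T \<and> T \<subseteq> \<phi> ` (U \<inter> N)"
    using p by (intro exI[of _ "\<phi> ` U \<inter> Q"]) (auto intro: openin_open_Int)
qed

lemma max_atlas_Int:
  assumes A: "smooth_atlas \<A>" and c: "(U, \<phi>) \<in> max_atlas \<A>" and N: "openin (manifold_topology \<A>) N"
  shows "(U \<inter> N, \<phi>) \<in> max_atlas \<A>"
proof -
  obtain d where d: "\<And>c. c \<in> max_atlas \<A> \<Longrightarrow> is_chart d c" using max_atlas_dim[OF A] by blast
  obtain W where W: "subspace W" "dim W = d" "openin (top_of_set W) (\<phi> ` U)" "inj_on \<phi> U"
    using d[OF c] by (auto simp: is_chart_def)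
  have "is_chart d (U \<inter> N, \<phi>)"
    unfolding is_chart_def using W openin_trans[OF chart_image_open[OF A c N] W(3)]
    by (auto intro: inj_on_subset)
  then show ?thesis
  proof (rule max_atlasI[OF A])
    show "is_chart d c'" if "c' \<in> \<A>" for c' using d that max_atlas_superset[OF A] by blast
    show "fst (U \<inter> N, \<phi>) \<subseteq> points \<A>" using max_atlas_dom[OF c] by auto
    fix p assume "p \<in> fst (U \<inter> N, \<phi>)"
    then have p: "p \<in> U" "p \<in> N" by auto
    obtain Q where Q: "open Q" "\<phi> p \<in> Q" "\<forall>q\<in>U. \<phi> q \<in> Q \<longrightarrow> q \<in> N"
      using openin_manifold_chart[OF A N c p] by blast
    have "local_rep UNIV (U, \<phi>) (U, \<phi>) (\<lambda>x. x) p" by (rule local_rep_ident) (use p in auto)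
    then have "local_rep UNIV (U \<inter> N, \<phi>) (U, \<phi>) (\<lambda>x. x) p" by (rule local_rep_dom) (use p in auto)
    moreover have "local_rep UNIV (U, \<phi>) (U \<inter> N, \<phi>) (\<lambda>x. x) p"
      by (rule local_repI[of p _ _ _ Q "\<lambda>x. x"]) (use p Q smooth_open_ident in auto)
    ultimately show "\<exists>b\<in>max_atlas \<A>. local_rep UNIV (U \<inter> N, \<phi>) b (\<lambda>x. x) p \<and> local_rep UNIV b (U \<inter> N, \<phi>) (\<lambda>x. x) p"
      using c by blast
  qed
qed

text \<open>Slices are cut out by linear subspaces, so a chart must be centred at \<open>e\<close>
  before a single point, or the fiber over it, becomes a slice. The translate stays in the model
  subspace because \<open>\<phi> e\<close> lies in it.\<close>

lemma max_atlas_translate: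
  fixes \<A> :: "('m, 'b::euclidean_space) atlas"
  assumes A: "smooth_atlas \<A>" and c: "(U, \<phi>) \<in> max_atlas \<A>" and e: "e \<in> U"
  shows "(U, \<lambda>x. \<phi> x - \<phi> e) \<in> max_atlas \<A>"
proof -
  obtain d where d: "\<And>c. c \<in> max_atlas \<A> \<Longrightarrow> is_chart d c" using max_atlas_dim[OF A] by blast
  obtain W where W: "subspace W" "dim W = d" "openin (top_of_set W) (\<phi> ` U)" "inj_on \<phi> U"
    using d[OF c] by (auto simp: is_chart_def)
  have eW: "\<phi> e \<in> W" using openin_imp_subset[OF W(3)] e by blast
  obtain T where T: "open T" "\<phi> ` U = W \<inter> T" using W(3) by (auto simp: openin_open)
  have "(\<lambda>x. \<phi> x - \<phi> e) ` U = W \<inter> (\<lambda>y. y + - \<phi> e) ` T"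
  proof (rule equalityI; rule subsetI)
    fix y assume "y \<in> (\<lambda>x. \<phi> x - \<phi> e) ` U"
    then obtain x where x: "x \<in> U" "y = \<phi> x - \<phi> e" by blast
    then have "\<phi> x \<in> W \<inter> T" using T by blast
    then show "y \<in> W \<inter> (\<lambda>y. y + - \<phi> e) ` T" using x eW W(1) by (auto simp: subspace_diff)
  next
    fix y assume y: "y \<in> W \<inter> (\<lambda>y. y + - \<phi> e) ` T"
    then obtain z where z: "z \<in> T" "y = z - \<phi> e" by auto
    then have "z \<in> W" using y eW W(1) subspace_add[of W y "\<phi> e"] by auto
    then have "z \<in> \<phi> ` U" using T z by blast
    then show "y \<in> (\<lambda>x. \<phi> x - \<phi> e) ` U" using z by auto
  qed
  moreover have "open ((\<lambda>y. y + - \<phi> e) ` T)" using open_translation[OF T(1), of "- \<phi> e"] by (simp add: add.commute)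
  ultimately have "openin (top_of_set W) ((\<lambda>x. \<phi> x - \<phi> e) ` U)" by (auto simp: openin_open)
  then have "is_chart d (U, \<lambda>x. \<phi> x - \<phi> e)"
    unfolding is_chart_def using W by (auto simp: inj_on_def)
  then show ?thesis
  proof (rule max_atlasI[OF A])
    show "is_chart d c'" if "c' \<in> \<A>" for c' using d that max_atlas_superset[OF A] by blast
    show "fst (U, \<lambda>x. \<phi> x - \<phi> e) \<subseteq> points \<A>" using max_atlas_dom[OF c] by auto
    fix p assume "p \<in> fst (U, \<lambda>x. \<phi> x - \<phi> e)"
    then have p: "p \<in> U" by auto
    have s: "smooth_open UNIV (\<lambda>x. x - \<phi> e)" "smooth_open UNIV (\<lambda>x. x + \<phi> e)"
      by (intro smooth_open_diff smooth_open_add smooth_open_ident smooth_open_const open_UNIV)+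
    have "local_rep UNIV (U, \<lambda>x. \<phi> x - \<phi> e) (U, \<phi>) (\<lambda>x. x) p"
      by (rule local_repI[OF _ _ _ s(2)]) (use p in auto)
    moreover have "local_rep UNIV (U, \<phi>) (U, \<lambda>x. \<phi> x - \<phi> e) (\<lambda>x. x) p"
      by (rule local_repI[OF _ _ _ s(1)]) (use p in auto)
    ultimately show "\<exists>b\<in>max_atlas \<A>. local_rep UNIV (U, \<lambda>x. \<phi> x - \<phi> e) b (\<lambda>x. x) p \<and>
        local_rep UNIV b (U, \<lambda>x. \<phi> x - \<phi> e) (\<lambda>x. x) p"
      using c by blast
  qed
qed

subsection \<open>Linear algebra in the fibers\<close>

definition fiber_linear :: "('m, 'b, 'a, 'f, 'z) vbundle_scheme \<Rightarrow> 'm \<Rightarrow> ('a \<Rightarrow> 'g::real_vector) \<Rightarrow> bool" where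
  "fiber_linear V m \<kappa> \<longleftrightarrow> (\<forall>x\<in>fiber V m. \<forall>y\<in>fiber V m. \<kappa> (vadd V x y) = \<kappa> x + \<kappa> y) \<and>
     (\<forall>x\<in>fiber V m. \<forall>c. \<kappa> (vscale V c x) = c *\<^sub>R \<kappa> x)"

lemma trivializationD:
  assumes "trivialization V r (U, \<tau>)"
  shows "openin (manifold_topology (base V)) U"
    and "m \<in> U \<Longrightarrow> fiber_linear V m \<tau>"
    and "m \<in> U \<Longrightarrow> inj_on \<tau> (fiber V m)"
    and "m \<in> U \<Longrightarrow> x \<in> fiber V m \<Longrightarrow> y \<in> fiber V m \<Longrightarrow> vadd V x y \<in> fiber V m"
    and "m \<in> U \<Longrightarrow> x \<in> fiber V m \<Longrightarrow> vscale V c x \<in> fiber V m"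
    and "\<exists>W. subspace W \<and> dim W = r \<and> (\<forall>m\<in>U. bij_betw \<tau> (fiber V m) W)"
  using assms unfolding trivialization_def fiber_linear_def by (auto simp: bij_betw_def)

lemma fiber_linear_compose: "fiber_linear V m \<tau> \<Longrightarrow> linear L \<Longrightarrow> fiber_linear V m (\<lambda>x. L (\<tau> x))"
  unfolding fiber_linear_def by (simp add: linear_add linear_scale)

lemma linear_projection:
  fixes W :: "'a::euclidean_space set"
  assumes "subspace W"
  obtains \<pi> where "linear \<pi>" "\<And>v. \<pi> v \<in> W" "\<And>w. w \<in> W \<Longrightarrow> \<pi> w = w"
  using linear_exists_left_inverse_on[OF linear_id assms inj_on_id] by auto

text \<open>The coordinate \<open>\<tau>\<close> fills only a subspace \<open>W\<close> of the model
  space. Projecting onto \<open>W\<close> before inverting \<open>\<tau>\<close> gives a linear map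
  on the whole space.\<close>

lemma fiber_linear_rep:
  fixes \<tau> :: "'a \<Rightarrow> 'f::euclidean_space" and \<kappa> :: "'a \<Rightarrow> 'g::real_vector"
  assumes t: "trivialization V r (U, \<tau>)" and m: "m \<in> U" and k: "fiber_linear V m \<kappa>"
  obtains L where "linear L" "\<And>x. x \<in> fiber V m \<Longrightarrow> \<kappa> x = L (\<tau> x)"
proof -
  obtain W where W: "subspace W" "bij_betw \<tau> (fiber V m) W" using trivializationD(6)[OF t] m by blast
  obtain \<pi> where \<pi>: "linear \<pi>" "\<And>v. \<pi> v \<in> W" "\<And>w. w \<in> W \<Longrightarrow> \<pi> w = w" using linear_projection[OF W(1)] by blast
  define i where "i = inv_into (fiber V m) \<tau>"
  have i: "i w \<in> fiber V m" "\<tau> (i w) = w" if "w \<in> W" for w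
    using W(2) that unfolding i_def bij_betw_def by (metis inv_into_into, metis f_inv_into_f)
  have it: "i (\<tau> x) = x" if "x \<in> fiber V m" for x
    using W(2) that unfolding i_def by (simp add: bij_betw_inv_into_left)
  have tl: "fiber_linear V m \<tau>" by (rule trivializationD(2)[OF t m])
  have ia: "i (w + w') = vadd V (i w) (i w')" if "w \<in> W" "w' \<in> W" for w w'
    using it[OF trivializationD(4)[OF t m i(1)[OF that(1)] i(1)[OF that(2)]]] tl i that
    by (simp add: fiber_linear_def)
  have isc: "i (c *\<^sub>R w) = vscale V c (i w)" if "w \<in> W" for w c
    using it[OF trivializationD(5)[OF t m i(1)[OF that]]] tl i that by (simp add: fiber_linear_def)
  show ?thesis
  proof (rule that[of "\<lambda>v. \<kappa> (i (\<pi> v))"])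
    show "linear (\<lambda>v. \<kappa> (i (\<pi> v)))"
      by (rule linearI) (use \<pi> ia isc i k in \<open>auto simp: linear_add linear_scale fiber_linear_def\<close>)
    show "\<kappa> x = \<kappa> (i (\<pi> (\<tau> x)))" if "x \<in> fiber V m" for x
      using that \<pi>(3) W(2) it by (simp add: bij_betwE)
  qed
qed

lemma trivialization_rank_unique:
  assumes t: "trivialization V r (U, \<tau>)" "trivialization V r' (U', \<tau>')" and m: "m \<in> U" "m \<in> U'"
  shows "r = r'"
proof -
  have le: "r' \<le> r" if t: "trivialization V r (U, \<tau>)" "trivialization V r' (U', \<tau>')" and m: "m \<in> U" "m \<in> U'"
    for r r' U U' \<tau> \<tau>'
  proof -
    obtain L where L: "linear L" "\<And>x. x \<in> fiber V m \<Longrightarrow> \<tau>' x = L (\<tau> x)"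
      by (rule fiber_linear_rep[OF t(1) m(1) trivializationD(2)[OF t(2) m(2)]]) blast
    obtain W where W: "subspace W" "dim W = r" "bij_betw \<tau> (fiber V m) W" using trivializationD(6)[OF t(1)] m by blast
    obtain W' where W': "subspace W'" "dim W' = r'" "bij_betw \<tau>' (fiber V m) W'" using trivializationD(6)[OF t(2)] m by blast
    have "W' = L ` W" using W W' L(2) by (force simp: bij_betw_def image_image)
    then show ?thesis using W W' dim_image_le[OF L(1), of W] by simp
  qed
  show ?thesis using le[OF t m] le[OF t(2,1) m(2,1)] by simp
qed

subsection \<open>Charts of the total space\<close>

definition tchart where
  "tchart V c t = ({x \<in> total V. proj V x \<in> fst c \<inter> fst t}, \<lambda>x. (snd c (proj V x), snd t x))"

lemma total_atlas_eq: "total_atlas V = {tchart V c t | c t. c \<in> base V \<and> t \<in> triv V}"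
  unfolding total_atlas_def tchart_def by force

lemma fst_tchart: "fst (tchart V c t) = {x \<in> total V. proj V x \<in> fst c \<inter> fst t}"
  by (simp add: tchart_def)

lemma is_chart_tchart:
  assumes A: "smooth_atlas (base V)" and c: "(U, \<phi>) \<in> max_atlas (base V)" "is_chart d (U, \<phi>)"
    and t: "trivialization V r (U', \<tau>)"
  shows "is_chart (d + r) (tchart V (U, \<phi>) (U', \<tau>))"
proof -
  obtain W where W: "subspace W" "dim W = d" "openin (top_of_set W) (\<phi> ` U)" "inj_on \<phi> U"
    using c by (auto simp: is_chart_def)
  obtain X where X: "subspace X" "dim X = r" "\<And>m. m \<in> U' \<Longrightarrow> bij_betw \<tau> (fiber V m) X"
    using trivializationD(6)[OF t] by blast
  let ?D = "{x \<in> total V. proj V x \<in> U \<inter> U'}"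
  have img: "(\<lambda>x. (\<phi> (proj V x), \<tau> x)) ` ?D = \<phi> ` (U \<inter> U') \<times> X"
  proof (rule equalityI; rule subsetI)
    fix z assume "z \<in> (\<lambda>x. (\<phi> (proj V x), \<tau> x)) ` ?D"
    then obtain x where x: "x \<in> ?D" "z = (\<phi> (proj V x), \<tau> x)" by blast
    then have "\<tau> x \<in> X" using bij_betwE[OF X(3), of "proj V x"] by (auto simp: fiber_def)
    then show "z \<in> \<phi> ` (U \<inter> U') \<times> X" using x by auto
  next
    fix z assume "z \<in> \<phi> ` (U \<inter> U') \<times> X"
    then obtain m w where m: "m \<in> U \<inter> U'" "w \<in> X" "z = (\<phi> m, w)" by blast
    then obtain x where "x \<in> fiber V m" "\<tau> x = w" using X(3)[of m] by (force simp: bij_betw_def)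
    then show "z \<in> (\<lambda>x. (\<phi> (proj V x), \<tau> x)) ` ?D" using m by (auto simp: fiber_def intro!: image_eqI[of _ _ x])
  qed
  have "inj_on (\<lambda>x. (\<phi> (proj V x), \<tau> x)) ?D"
  proof (rule inj_onI)
    fix x y assume xy: "x \<in> ?D" "y \<in> ?D" "(\<phi> (proj V x), \<tau> x) = (\<phi> (proj V y), \<tau> y)"
    then have "proj V x = proj V y" using W(4) by (auto simp: inj_on_eq_iff)
    then show "x = y"
      using trivializationD(3)[OF t, of "proj V x"] xy by (auto simp: fiber_def inj_on_def)
  qed
  moreover have "openin (top_of_set (W \<times> X)) (\<phi> ` (U \<inter> U') \<times> X)"
    by (intro openin_Times openin_trans[OF chart_image_open[OF A c(1) trivializationD(1)[OF t]] W(3)]) simp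
  ultimately show ?thesis
    unfolding tchart_def is_chart_def fst_conv snd_conv prod.case img
    using W(1,2) X(1,2) by (auto intro!: exI[of _ "W \<times> X"] subspace_Times simp: dim_Times)
qed

lemma local_rep_tchartI:
  assumes "local_rep S c (U \<inter> U', \<phi>) (\<lambda>q. proj V (f q)) p" "local_rep S c euc (\<lambda>q. \<tau> (f q)) p"
    "\<And>q. q \<in> S \<Longrightarrow> q \<in> fst c \<Longrightarrow> f q \<in> total V"
  shows "local_rep S c (tchart V (U, \<phi>) (U', \<tau>)) f p"
proof -
  obtain X \<xi> where c: "c = (X, \<xi>)" by (metis surj_pair)
  obtain N F where F: "p \<in> X" "p \<in> S" "\<xi> p \<in> N" "smooth_open N F"
    "\<And>q. q \<in> X \<Longrightarrow> q \<in> S \<Longrightarrow> \<xi> q \<in> N \<Longrightarrow> proj V (f q) \<in> U \<inter> U' \<and> \<phi> (proj V (f q)) = F (\<xi> q)"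
    using assms(1) unfolding c by (rule local_repE) blast
  obtain M G where G: "\<xi> p \<in> M" "smooth_open M G"
    "\<And>q. q \<in> X \<Longrightarrow> q \<in> S \<Longrightarrow> \<xi> q \<in> M \<Longrightarrow> \<tau> (f q) \<in> UNIV \<and> \<tau> (f q) = G (\<xi> q)"
    using assms(2) unfolding c by (rule local_repE) blast
  have o: "open (N \<inter> M)" by (rule open_Int[OF smooth_openD(1)[OF F(4)] smooth_openD(1)[OF G(2)]])
  have FG: "smooth_open (N \<inter> M) (\<lambda>x. (F x, G x))"
    by (rule smooth_open_Pair[OF smooth_open_subset[OF F(4) o] smooth_open_subset[OF G(2) o]]) auto
  show ?thesis
    unfolding c tchart_def by (rule local_repI[OF F(1,2) _ FG]) (use F G assms(3) c in auto)
qed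

lemma local_rep_tchart_triv:
  "x \<in> total V \<Longrightarrow> proj V x \<in> U \<inter> U' \<Longrightarrow> x \<in> S \<Longrightarrow> local_rep S (tchart V (U, \<phi>) (U', \<tau>)) euc \<tau> x"
  unfolding tchart_def
  by (rule local_repI[where N=UNIV and g=snd]) (auto intro!: smooth_open_bounded_linear bounded_linear_snd)

lemma local_rep_tchart_proj:
  "x \<in> total V \<Longrightarrow> proj V x \<in> U \<inter> U' \<Longrightarrow> x \<in> S \<Longrightarrow>
    local_rep S (tchart V (U, \<phi>) (U', \<tau>)) (U \<inter> U', \<phi>) (proj V) x"
  unfolding tchart_def
  by (rule local_repI[where N=UNIV and g=fst]) (auto intro!: smooth_open_bounded_linear bounded_linear_fst)

lemma vector_bundleD:
  assumes "vector_bundle V"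
  shows "smooth_manifold (base V)" "smooth_atlas (base V)" "smooth_atlas (total_atlas V)"
    "x \<in> total V \<Longrightarrow> proj V x \<in> points (base V)"
    "\<exists>r. \<forall>t\<in>triv V. trivialization V r t"
    "m \<in> points (base V) \<Longrightarrow> \<exists>U \<tau>. (U, \<tau>) \<in> triv V \<and> m \<in> U"
  using assms unfolding vector_bundle_def smooth_manifold_def by (auto 0 4)

lemma triv_subset_max_triv: "vector_bundle V \<Longrightarrow> triv V \<subseteq> max_triv V"
  unfolding max_triv_def by (auto simp: insert_absorb)

text \<open>In a change between charts of the total space, the base components take care of
  themselves; only the fiber coordinate of the second trivialization has to be smooth in the charts
  of the first.\<close>

lemma vector_bundleI:
  assumes M: "smooth_manifold (base V)" and p: "\<And>x. x \<in> total V \<Longrightarrow> proj V x \<in> points (base V)"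
    and t: "\<And>t. t \<in> triv V \<Longrightarrow> trivialization V r t"
    and cov: "\<And>m. m \<in> points (base V) \<Longrightarrow> \<exists>t\<in>triv V. m \<in> fst t"
    and comp: "\<And>t t' c x. t \<in> triv V \<Longrightarrow> t' \<in> triv V \<Longrightarrow> c \<in> base V \<Longrightarrow> x \<in> total V \<Longrightarrow> proj V x \<in> fst t \<Longrightarrow>
      proj V x \<in> fst t' \<Longrightarrow> proj V x \<in> fst c \<Longrightarrow> local_rep UNIV (tchart V c t) euc (snd t') x"
  shows "vector_bundle V"
proof -
  have A: "smooth_atlas (base V)" using M by (simp add: smooth_manifold_def)
  have op: "openin (manifold_topology (base V)) (fst t)" if "t \<in> triv V" for t
    using trivializationD(1)[of V r "fst t" "snd t"] t[OF that] by simp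
  have "smooth_atlas (total_atlas V)"
  proof -
    obtain d where d: "\<And>c. c \<in> max_atlas (base V) \<Longrightarrow> is_chart d c" using max_atlas_dim[OF A] by blast
    show ?thesis
    proof (rule smooth_atlasI[of _ "d + r"])
      fix c assume "c \<in> total_atlas V"
      then obtain b s where "c = tchart V b s" "b \<in> base V" "s \<in> triv V" unfolding total_atlas_eq by blast
      then show "is_chart (d + r) c"
        using is_chart_tchart[OF A, of "fst b" "snd b" d r "fst s" "snd s"] d t max_atlas_superset[OF A] by auto
    next
      fix c c' x assume c: "c \<in> total_atlas V" "c' \<in> total_atlas V" "x \<in> fst c" "x \<in> fst c'"
      obtain b s where b: "c = tchart V b s" "b \<in> base V" "s \<in> triv V" using c unfolding total_atlas_eq by blast
      obtain b' s' where b': "c' = tchart V b' s'" "b' \<in> base V" "s' \<in> triv V" using c unfolding total_atlas_eq by blast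
      have x: "x \<in> total V" "proj V x \<in> fst b" "proj V x \<in> fst s" "proj V x \<in> fst b'" "proj V x \<in> fst s'"
        using c b b' by (auto simp: fst_tchart)
      have m: "(fst b \<inter> fst s, snd b) \<in> max_atlas (base V)" "(fst b' \<inter> fst s', snd b') \<in> max_atlas (base V)"
        using max_atlas_Int[OF A, of "fst b" "snd b" "fst s"] max_atlas_Int[OF A, of "fst b'" "snd b'" "fst s'"]
          b b' op max_atlas_superset[OF A] by auto
      have "local_rep UNIV c (fst b \<inter> fst s, snd b) (proj V) x"
        unfolding b(1) using local_rep_tchart_proj[of x V "fst b" "fst s" UNIV "snd b" "snd s"] x by simp
      then have pr: "local_rep UNIV c (fst b' \<inter> fst s', snd b') (\<lambda>x. proj V x) x"
        by (rule local_rep_compose[OF _ max_atlas_local_rep[OF A m]]) (use x in auto)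
      have dom: "fst c \<subseteq> total V" using b by (auto simp: fst_tchart)
      have "local_rep UNIV c (tchart V (fst b', snd b') (fst s', snd s')) (\<lambda>x. x) x"
        by (rule local_rep_tchartI[OF pr]) (use comp[of s s' b x] b b' x dom in auto)
      then show "local_rep UNIV c c' (\<lambda>x. x) x" using b' by simp
    qed
  qed
  moreover have "(\<Union>(U, \<tau>)\<in>triv V. U) = points (base V)"
  proof (rule equalityI; rule subsetI)
    show "m \<in> points (base V)" if "m \<in> (\<Union>(U, \<tau>)\<in>triv V. U)" for m
      using that op openin_subset topspace_manifold_topology[OF A] by fastforce
    show "m \<in> (\<Union>(U, \<tau>)\<in>triv V. U)" if "m \<in> points (base V)" for m
      using cov[OF that] by auto
  qed
  moreover have "\<exists>r. \<forall>t\<in>triv V. trivialization V r t" using t by blast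
  moreover have "proj V ` total V \<subseteq> points (base V)" using p by blast
  ultimately show ?thesis
    unfolding vector_bundle_def using M by blast
qed

lemma points_total_atlas:
  assumes V: "vector_bundle V" shows "points (total_atlas V) = total V"
proof (rule equalityI; rule subsetI)
  show "x \<in> total V" if "x \<in> points (total_atlas V)" for x
    using that fst_tchart[of V] unfolding points_iff total_atlas_eq by blast
  show "x \<in> points (total_atlas V)" if x: "x \<in> total V" for x
  proof -
    have m: "proj V x \<in> points (base V)" by (rule vector_bundleD(4)[OF V x])
    obtain U \<tau> where t: "(U, \<tau>) \<in> triv V" "proj V x \<in> U" using vector_bundleD(6)[OF V m] by blast
    obtain c where c: "c \<in> base V" "proj V x \<in> fst c" using m unfolding points_iff by blast
    have "tchart V c (U, \<tau>) \<in> total_atlas V" unfolding total_atlas_eq using c t by blast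
    then show ?thesis unfolding points_iff using x c t by (intro bexI) (auto simp: fst_tchart)
  qed
qed

lemma vb_update_simps:
  "fiber (V\<lparr>triv := T\<rparr>) m = fiber V m" "tchart (V\<lparr>triv := T\<rparr>) c t = tchart V c t"
  "trivialization (V\<lparr>triv := T\<rparr>) r t = trivialization V r t"
  by (auto simp: fiber_def tchart_def trivialization_def)

lemma max_trivD:
  assumes V: "vector_bundle V" and t: "(U, \<tau>) \<in> max_triv V"
  shows "\<exists>r. trivialization V r (U, \<tau>)" "U \<subseteq> points (base V)"
    "(X, \<phi>) \<in> max_atlas (base V) \<Longrightarrow> tchart V (X, \<phi>) (U, \<tau>) \<in> max_atlas (total_atlas V)"
proof -
  let ?V = "V\<lparr>triv := insert (U, \<tau>) (triv V)\<rparr>"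
  have V': "vector_bundle ?V" using t by (simp add: max_triv_def)
  show r: "\<exists>r. trivialization V r (U, \<tau>)" using vector_bundleD(5)[OF V'] by (auto simp: vb_update_simps)
  note A = vector_bundleD(2)[OF V]
  show U: "U \<subseteq> points (base V)"
    using r trivializationD(1) openin_subset topspace_manifold_topology[OF A] by blast
  have sub: "total_atlas V \<subseteq> total_atlas ?V" unfolding total_atlas_eq vb_update_simps by auto
  \<comment> \<open>Adding the trivialization does not change the smooth structure of the total
    space. This settles charts over \<open>base V\<close>; charts over the maximal atlas are
    afterwards compared with these.\<close>
  have eq: "max_atlas (total_atlas ?V) = max_atlas (total_atlas V)"
    by (rule max_atlas_eqI(2)[symmetric, OF vector_bundleD(3)[OF V']])
      (use max_atlas_superset[OF vector_bundleD(3)[OF V']] sub in \<open>auto simp: points_total_atlas[OF V] points_total_atlas[OF V']\<close>)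
  have mem: "tchart V c (U, \<tau>) \<in> max_atlas (total_atlas V)" if "c \<in> base V" for c
  proof -
    have "tchart V c (U, \<tau>) \<in> total_atlas ?V"
      using that unfolding total_atlas_eq vb_update_simps mem_Collect_eq
      by (intro exI[of _ c] exI[of _ "(U, \<tau>)"]) simp
    then show ?thesis using eq max_atlas_superset[OF vector_bundleD(3)[OF V']] by blast
  qed
  assume X: "(X, \<phi>) \<in> max_atlas (base V)"
  obtain s where s: "\<forall>t\<in>triv ?V. trivialization ?V s t" using vector_bundleD(5)[OF V'] by blast
  then have sU: "trivialization V s (U, \<tau>)" by (simp add: vb_update_simps)
  obtain d where d: "\<And>c. c \<in> max_atlas (base V) \<Longrightarrow> is_chart d c" using max_atlas_dim[OF A] by blast
  note X' = max_atlas_superset[OF A]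
  have "is_chart (d + s) (tchart V (X, \<phi>) (U, \<tau>))" by (rule is_chart_tchart[OF A X d[OF X] sU])
  then show "tchart V (X, \<phi>) (U, \<tau>) \<in> max_atlas (total_atlas V)"
  proof (rule max_atlasI[OF vector_bundleD(3)[OF V]])
    fix c' assume "c' \<in> total_atlas V"
    then obtain b t where bt: "c' = tchart V b t" "b \<in> base V" "t \<in> triv V" unfolding total_atlas_eq by blast
    have "is_chart (d + s) (tchart V (fst b, snd b) (fst t, snd t))"
      using bt s d[of b] X' by (intro is_chart_tchart[OF A]) (auto simp: vb_update_simps)
    then show "is_chart (d + s) c'" using bt by simp
  next
    show "fst (tchart V (X, \<phi>) (U, \<tau>)) \<subseteq> points (total_atlas V)"
      unfolding points_total_atlas[OF V] by (auto simp: fst_tchart)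
    fix x assume "x \<in> fst (tchart V (X, \<phi>) (U, \<tau>))"
    then have x: "x \<in> total V" "proj V x \<in> X" "proj V x \<in> U" by (auto simp: fst_tchart)
    obtain b where b: "b \<in> base V" "proj V x \<in> fst b" using vector_bundleD(4)[OF V x(1)] unfolding points_iff by blast
    obtain Y \<psi> where Y: "b = (Y, \<psi>)" by (metis surj_pair)
    have bm: "(Y \<inter> U, \<psi>) \<in> max_atlas (base V)" "(X \<inter> U, \<phi>) \<in> max_atlas (base V)"
      using b Y X' X max_atlas_Int[OF A _ trivializationD(1)[OF sU]] by auto
    have XY: "local_rep UNIV (X \<inter> U, \<phi>) (Y \<inter> U, \<psi>) (\<lambda>x. x) (proj V x)"
      "local_rep UNIV (Y \<inter> U, \<psi>) (X \<inter> U, \<phi>) (\<lambda>x. x) (proj V x)"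
      using max_atlas_local_rep[OF A bm(2,1)] max_atlas_local_rep[OF A bm] x b Y by auto
    have "local_rep UNIV (tchart V (X, \<phi>) (U, \<tau>)) (tchart V (Y, \<psi>) (U, \<tau>)) (\<lambda>x. x) x"
      using x local_rep_compose[OF local_rep_tchart_proj XY(1), of UNIV]
      by (intro local_rep_tchartI local_rep_tchart_triv) (auto simp: fst_tchart)
    moreover have "local_rep UNIV (tchart V (Y, \<psi>) (U, \<tau>)) (tchart V (X, \<phi>) (U, \<tau>)) (\<lambda>x. x) x"
      using x b Y local_rep_compose[OF local_rep_tchart_proj XY(2), of UNIV]
      by (intro local_rep_tchartI local_rep_tchart_triv) (auto simp: fst_tchart)
    ultimately show "\<exists>b\<in>max_atlas (total_atlas V). local_rep UNIV (tchart V (X, \<phi>) (U, \<tau>)) b (\<lambda>x. x) x \<and>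
        local_rep UNIV b (tchart V (X, \<phi>) (U, \<tau>)) (\<lambda>x. x) x"
      using mem[OF b(1)] Y by blast
  qed
qed

lemma max_triv_at:
  assumes "vector_bundle V" "m \<in> points (base V)"
  obtains U \<tau> where "(U, \<tau>) \<in> triv V" "(U, \<tau>) \<in> max_triv V" "m \<in> U"
  using vector_bundleD(6)[OF assms] triv_subset_max_triv[OF assms(1)] by blast

lemma smooth_at_proj:
  assumes V: "vector_bundle V" and x: "x \<in> total V" "x \<in> S"
  shows "smooth_at (total_atlas V) S (base V) (proj V) x"
proof -
  note A = vector_bundleD(2)[OF V]
  obtain U \<tau> where t: "(U, \<tau>) \<in> max_triv V" "proj V x \<in> U"
    by (rule max_triv_at[OF V vector_bundleD(4)[OF V x(1)]])
  obtain X \<phi> where X: "(X, \<phi>) \<in> max_atlas (base V)" "proj V x \<in> X"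
    using chart_at[OF A vector_bundleD(4)[OF V x(1)]] by blast
  have "(X \<inter> U, \<phi>) \<in> max_atlas (base V)"
    using max_atlas_Int[OF A X(1)] max_trivD(1)[OF V t(1)] trivializationD(1) by blast
  then show ?thesis
    unfolding smooth_at_def
    using max_trivD(3)[OF V t(1) X(1)] local_rep_tchart_proj[of x V X U S \<phi> \<tau>] x X t by blast
qed

lemma smooth_at_triv:
  assumes V: "vector_bundle V" and t: "(U, \<tau>) \<in> max_triv V" and x: "x \<in> total V" "proj V x \<in> U" "x \<in> S"
  shows "smooth_fun_at (total_atlas V) S \<tau> x"
proof -
  note A = vector_bundleD(2)[OF V]
  obtain X \<phi> where X: "(X, \<phi>) \<in> max_atlas (base V)" "proj V x \<in> X"
    using chart_at[OF A vector_bundleD(4)[OF V x(1)]] by blast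
  show ?thesis
    unfolding smooth_at_def
    using max_trivD(3)[OF V t X(1)] local_rep_tchart_triv[of x V X U S \<phi> \<tau>] x X euc_in_max_atlas by blast
qed

lemma smooth_at_totalI:
  assumes V: "vector_bundle V" and C: "smooth_atlas \<C>" and pr: "smooth_at \<C> S (base V) (\<lambda>q. proj V (f q)) p"
    and t: "(U, \<tau>) \<in> max_triv V" "proj V (f p) \<in> U" "smooth_fun_at \<C> S (\<lambda>q. \<tau> (f q)) p"
    and f: "\<And>q. q \<in> S \<Longrightarrow> f q \<in> total V"
  shows "smooth_at \<C> S (total_atlas V) f p"
proof -
  note A = vector_bundleD(2)[OF V]
  obtain X \<phi> where X: "(X, \<phi>) \<in> max_atlas (base V)" "proj V (f p) \<in> X"
    using chart_at[OF A smooth_atD(3)[OF pr]] by blast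
  obtain Y \<psi> where Y: "(Y, \<psi>) \<in> max_atlas \<C>" "p \<in> Y" using chart_at[OF C smooth_atD(2)[OF pr]] by blast
  have XU: "(X \<inter> U, \<phi>) \<in> max_atlas (base V)"
    using max_atlas_Int[OF A X(1)] max_trivD(1)[OF V t(1)] trivializationD(1) by blast
  have "local_rep S (Y, \<psi>) (X \<inter> U, \<phi>) (\<lambda>q. proj V (f q)) p"
    by (rule smooth_at_local_rep[OF C A pr Y(1) _ XU]) (use X Y t in auto)
  moreover have "local_rep S (Y, \<psi>) euc (\<lambda>q. \<tau> (f q)) p"
    by (rule smooth_fun_at_local_rep[OF C t(3) Y(1)]) (use Y in auto)
  ultimately have "local_rep S (Y, \<psi>) (tchart V (X, \<phi>) (U, \<tau>)) f p"
    by (rule local_rep_tchartI) (rule f)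
  then show ?thesis unfolding smooth_at_def using Y(1) max_trivD(3)[OF V t(1) X(1)] by blast
qed

lemma smooth_manifold_total:
  assumes V: "vector_bundle V" shows "smooth_manifold (total_atlas V)"
proof -
  note A = vector_bundleD(2)[OF V] and T = vector_bundleD(3)[OF V]
  have op: "openin (manifold_topology (total_atlas V)) {x \<in> total V. proj V x \<in> N}"
    if "openin (manifold_topology (base V)) N" for N
    using smooth_at_proj[OF V] openin_topspace[of "manifold_topology (total_atlas V)"]
    unfolding topspace_manifold_topology[OF T] points_total_atlas[OF V]
    by (intro openin_vimage_local_rep[OF T A that]) (auto simp: smooth_at_def)
  have "Hausdorff_space (manifold_topology (total_atlas V))"
    unfolding Hausdorff_space_def topspace_manifold_topology[OF T] points_total_atlas[OF V]
  proof (intro allI impI)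
    fix x y assume xy: "x \<in> total V \<and> y \<in> total V \<and> x \<noteq> y"
    show "\<exists>U V'. openin (manifold_topology (total_atlas V)) U \<and>
        openin (manifold_topology (total_atlas V)) V' \<and> x \<in> U \<and> y \<in> V' \<and> disjnt U V'"
    \<comment> \<open>Points of different fibers are separated in the base; two points of one fiber
      lie in a common chart.\<close>
    proof (cases "proj V x = proj V y")
      case False
      then obtain M N where "openin (manifold_topology (base V)) M" "openin (manifold_topology (base V)) N"
        "proj V x \<in> M" "proj V y \<in> N" "disjnt M N"
        using vector_bundleD(1)[OF V] xy vector_bundleD(4)[OF V, of x] vector_bundleD(4)[OF V, of y]
        unfolding smooth_manifold_def Hausdorff_space_def topspace_manifold_topology[OF A] by blast
      then show ?thesis using op[of M] op[of N] xy by (fastforce simp: disjnt_def)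
    next
      case True
      obtain U \<tau> where t: "(U, \<tau>) \<in> max_triv V" "proj V x \<in> U"
        by (rule max_triv_at[OF V vector_bundleD(4)[OF V, of x]]) (use xy in auto)
      obtain X \<phi> where X: "(X, \<phi>) \<in> max_atlas (base V)" "proj V x \<in> X"
        using chart_at[OF A vector_bundleD(4)[OF V, of x]] xy by blast
      obtain D \<xi> where D: "tchart V (X, \<phi>) (U, \<tau>) = (D, \<xi>)" by (metis surj_pair)
      note c = max_trivD(3)[OF V t(1) X(1), unfolded D]
      have xyD: "x \<in> D" "y \<in> D"
        using D t X xy True fst_tchart[of V "(X, \<phi>)" "(U, \<tau>)"] by auto
      have "\<xi> x \<noteq> \<xi> y"
        using max_atlas_dim[OF T] c is_chart_inj xy xyD by (metis inj_on_eq_iff)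
      then obtain M N where "open M" "open N" "\<xi> x \<in> M" "\<xi> y \<in> N" "M \<inter> N = {}" using hausdorff by metis
      then show ?thesis
        using openin_chart_vimage[OF T c, of M] openin_chart_vimage[OF T c, of N] xyD
        by (intro exI[of _ "D \<inter> \<xi> -` M"] exI[of _ "D \<inter> \<xi> -` N"]) (auto simp: disjnt_def)
    qed
  qed
  moreover have "second_countable (manifold_topology (total_atlas V))"
  proof -
    have sc: "second_countable (manifold_topology (base V))" using vector_bundleD(1)[OF V] by (simp add: smooth_manifold_def)
    obtain r where r: "\<forall>t\<in>triv V. trivialization V r t" using vector_bundleD(5)[OF V] by blast
    let ?F = "\<lambda>(c, t). fst c \<inter> fst t"
    have o: "openin (manifold_topology (base V)) (?F i)" if "i \<in> base V \<times> triv V" for i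
    proof -
      obtain X \<phi> U \<tau> where i: "i = ((X, \<phi>), (U, \<tau>))" by (metis surj_pair)
      then show ?thesis
        using that r trivializationD(1)[of V r U \<tau>] by (auto intro!: openin_Int openin_chart_domain[of X \<phi>])
    qed
    have cov: "topspace (manifold_topology (base V)) \<subseteq> (\<Union>i\<in>base V \<times> triv V. ?F i)"
    proof
      fix m assume "m \<in> topspace (manifold_topology (base V))"
      then have m: "m \<in> points (base V)" using topspace_manifold_topology[OF A] by simp
      obtain U \<tau> where "(U, \<tau>) \<in> triv V" "m \<in> U" by (rule max_triv_at[OF V m])
      moreover obtain c where "c \<in> base V" "m \<in> fst c" using m unfolding points_iff by blast
      ultimately show "m \<in> (\<Union>i\<in>base V \<times> triv V. ?F i)" by (intro UN_I[of "(c, (U, \<tau>))"]) auto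
    qed
    obtain J where J: "countable J" "J \<subseteq> base V \<times> triv V" "topspace (manifold_topology (base V)) \<subseteq> (\<Union>i\<in>J. ?F i)"
      using countable_subcover[OF sc o cov] by blast
    let ?C = "(\<lambda>(c, t). tchart V c t) ` J"
    show ?thesis
    proof (rule second_countable_manifold[OF T])
      show "countable ?C" using J by blast
      show "?C \<subseteq> max_atlas (total_atlas V)"
      proof
        fix z assume "z \<in> ?C"
        then obtain c t where ct: "(c, t) \<in> J" "z = tchart V c t" by auto
        then have "c \<in> base V" "t \<in> triv V" using J(2) by auto
        then have "z \<in> total_atlas V" unfolding total_atlas_eq ct(2) by blast
        then show "z \<in> max_atlas (total_atlas V)" using max_atlas_superset[OF T] by blast
      qed
      show "points (total_atlas V) \<subseteq> points ?C"
      proof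
        fix x assume "x \<in> points (total_atlas V)"
        then have x: "x \<in> total V" using points_total_atlas[OF V] by simp
        obtain c t where "(c, t) \<in> J" "proj V x \<in> fst c \<inter> fst t"
          using J(3) vector_bundleD(4)[OF V x] topspace_manifold_topology[OF A] by fastforce
        then show "x \<in> points ?C"
          unfolding points_iff using x by (intro bexI[of _ "tchart V c t"]) (auto simp: fst_tchart)
      qed
    qed
  qed
  ultimately show ?thesis using T by (simp add: smooth_manifold_def)
qed

subsection \<open>Product bundles\<close>

lemma prod_bundle_simps [simp]:
  "base (prod_bundle V W) = prod_atlas (base V) (base W)"
  "total (prod_bundle V W) = total V \<times> total W"
  "proj (prod_bundle V W) = map_prod (proj V) (proj W)"
  "vadd (prod_bundle V W) (x, y) (x', y') = (vadd V x x', vadd W y y')"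
  "vscale (prod_bundle V W) c (x, y) = (vscale V c x, vscale W c y)"
  by (simp_all add: prod_bundle_def)

lemma fiber_prod: "fiber (prod_bundle V W) (m, n) = fiber V m \<times> fiber W n"
  by (auto simp: fiber_def)

lemma trivialization_prod:
  assumes A: "smooth_atlas (base V)" "smooth_atlas (base W)"
    and t: "trivialization V r (U, \<tau>)" "trivialization W s (X, \<sigma>)"
  shows "trivialization (prod_bundle V W) (r + s) (U \<times> X, map_prod \<tau> \<sigma>)"
proof -
  note AB = smooth_atlas_prod[OF A]
  have U: "U \<subseteq> points (base V)" "X \<subseteq> points (base W)"
    using trivializationD(1)[OF t(1)] trivializationD(1)[OF t(2)] openin_subset
      topspace_manifold_topology[OF A(1)] topspace_manifold_topology[OF A(2)] by blast+
  have top: "openin (manifold_topology (prod_atlas (base V) (base W))) (points (prod_atlas (base V) (base W)))"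
    using openin_topspace topspace_manifold_topology[OF AB] by metis
  have "openin (manifold_topology (prod_atlas (base V) (base W))) {p \<in> points (prod_atlas (base V) (base W)). fst p \<in> U}"
    "openin (manifold_topology (prod_atlas (base V) (base W))) {p \<in> points (prod_atlas (base V) (base W)). snd p \<in> X}"
    using smooth_at_fst_snd[OF A] openin_vimage_local_rep[OF AB A(1) trivializationD(1)[OF t(1)] _ top, of fst]
      openin_vimage_local_rep[OF AB A(2) trivializationD(1)[OF t(2)] _ top, of snd]
    by (simp_all add: smooth_at_def points_prod_atlas)
  then have "openin (manifold_topology (prod_atlas (base V) (base W)))
      ({p \<in> points (prod_atlas (base V) (base W)). fst p \<in> U} \<inter> {p \<in> points (prod_atlas (base V) (base W)). snd p \<in> X})"
    by (rule openin_Int)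
  also have "{p \<in> points (prod_atlas (base V) (base W)). fst p \<in> U} \<inter> {p \<in> points (prod_atlas (base V) (base W)). snd p \<in> X}
      = U \<times> X" using U by (auto simp: points_prod_atlas)
  finally have op: "openin (manifold_topology (prod_atlas (base V) (base W))) (U \<times> X)" .
  obtain Y Z where Y: "subspace Y" "dim Y = r" "\<forall>m\<in>U. bij_betw \<tau> (fiber V m) Y"
    and Z: "subspace Z" "dim Z = s" "\<forall>m\<in>X. bij_betw \<sigma> (fiber W m) Z"
    using trivializationD(6)[OF t(1)] trivializationD(6)[OF t(2)] by blast
  have bij: "\<forall>m\<in>U \<times> X. bij_betw (map_prod \<tau> \<sigma>) (fiber (prod_bundle V W) m) (Y \<times> Z)"
    using Y(3) Z(3) by (auto simp: fiber_prod intro!: bij_betw_map_prod)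
  show ?thesis
    unfolding trivialization_def prod.case
    using op bij Y(1,2) Z(1,2) t
    by (auto simp: fiber_prod trivialization_def intro!: exI[of _ "Y \<times> Z"] subspace_Times simp: dim_Times)
qed

text \<open>Charts of the product bundle list both base coordinates before both fiber coordinates,
  so they are not products of charts of the total spaces. The projections are linear after
  regrouping.\<close>

lemma local_rep_prod_fst_snd:
  fixes V :: "('m, 'c::euclidean_space, 'a, 'e::euclidean_space, 'z) vbundle_scheme"
    and W :: "('n, 'd::euclidean_space, 'b, 'f::euclidean_space, 'y) vbundle_scheme"
    and \<phi> :: "'m \<Rightarrow> 'c" and \<phi>' :: "'n \<Rightarrow> 'd" and \<tau> :: "'a \<Rightarrow> 'e" and \<tau>' :: "'b \<Rightarrow> 'f"
  assumes x: "x \<in> total V" "y \<in> total W" "proj V x \<in> U \<inter> X" "proj W y \<in> U' \<inter> X'" "(x, y) \<in> S"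
  shows "local_rep S (tchart (prod_bundle V W) (U \<times> U', map_prod \<phi> \<phi>') (X \<times> X', map_prod \<tau> \<tau>')) (tchart V (U, \<phi>) (X, \<tau>)) fst (x, y)"
    and "local_rep S (tchart (prod_bundle V W) (U \<times> U', map_prod \<phi> \<phi>') (X \<times> X', map_prod \<tau> \<tau>')) (tchart W (U', \<phi>') (X', \<tau>')) snd (x, y)"
proof -
  have b: "bounded_linear (\<lambda>z :: ('c \<times> 'd) \<times> ('e \<times> 'f). (fst (fst z), fst (snd z)))"
    "bounded_linear (\<lambda>z :: ('c \<times> 'd) \<times> ('e \<times> 'f). (snd (fst z), snd (snd z)))"
    by (intro bounded_linear_Pair bounded_linear_fst_comp bounded_linear_snd_comp bounded_linear_fst bounded_linear_snd)+
  show "local_rep S (tchart (prod_bundle V W) (U \<times> U', map_prod \<phi> \<phi>') (X \<times> X', map_prod \<tau> \<tau>')) (tchart V (U, \<phi>) (X, \<tau>)) fst (x, y)"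
    unfolding tchart_def
    by (rule local_repI[OF _ _ _ smooth_open_bounded_linear[OF b(1) open_UNIV]]) (use x in auto)
  show "local_rep S (tchart (prod_bundle V W) (U \<times> U', map_prod \<phi> \<phi>') (X \<times> X', map_prod \<tau> \<tau>')) (tchart W (U', \<phi>') (X', \<tau>')) snd (x, y)"
    unfolding tchart_def
    by (rule local_repI[OF _ _ _ smooth_open_bounded_linear[OF b(2) open_UNIV]]) (use x in auto)
qed

lemma vector_bundle_prod:
  assumes V: "vector_bundle V" and W: "vector_bundle W"
  shows "vector_bundle (prod_bundle V W)"
proof -
  note A = vector_bundleD(2)[OF V] vector_bundleD(2)[OF W]
  obtain r s where rs: "\<forall>t\<in>triv V. trivialization V r t" "\<forall>t\<in>triv W. trivialization W s t"
    using vector_bundleD(5)[OF V] vector_bundleD(5)[OF W] by blast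
  have tr: "\<exists>U \<tau> X \<sigma>. t = (U \<times> X, map_prod \<tau> \<sigma>) \<and> (U, \<tau>) \<in> triv V \<and> (X, \<sigma>) \<in> triv W"
    if "t \<in> triv (prod_bundle V W)" for t using that by (auto simp: prod_bundle_def)
  show ?thesis
  proof (rule vector_bundleI[of _ "r + s"])
    show "smooth_manifold (base (prod_bundle V W))"
      by (simp add: smooth_manifold_prod vector_bundleD(1)[OF V] vector_bundleD(1)[OF W])
    show "proj (prod_bundle V W) x \<in> points (base (prod_bundle V W))" if "x \<in> total (prod_bundle V W)" for x
      using that vector_bundleD(4)[OF V] vector_bundleD(4)[OF W] by (auto simp: points_prod_atlas)
    show "trivialization (prod_bundle V W) (r + s) t" if "t \<in> triv (prod_bundle V W)" for t
      using tr[OF that] rs by (auto intro!: trivialization_prod[OF A])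
    show "\<exists>t\<in>triv (prod_bundle V W). m \<in> fst t" if m: "m \<in> points (base (prod_bundle V W))" for m
    proof -
      have m12: "fst m \<in> points (base V)" "snd m \<in> points (base W)" using m by (auto simp: points_prod_atlas)
      obtain U \<tau> X \<sigma> where "(U, \<tau>) \<in> triv V" "fst m \<in> U" "(X, \<sigma>) \<in> triv W" "snd m \<in> X"
        using vector_bundleD(6)[OF V m12(1)] vector_bundleD(6)[OF W m12(2)] by blast
      then have "(U \<times> X, map_prod \<tau> \<sigma>) \<in> triv (prod_bundle V W)" "m \<in> fst (U \<times> X, map_prod \<tau> \<sigma>)"
        unfolding prod_bundle_def by (auto simp: mem_Times_iff)
      then show ?thesis by blast
    qed
    fix t t' c x
    assume h: "t \<in> triv (prod_bundle V W)" "t' \<in> triv (prod_bundle V W)" "c \<in> base (prod_bundle V W)"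
      "x \<in> total (prod_bundle V W)" "proj (prod_bundle V W) x \<in> fst t" "proj (prod_bundle V W) x \<in> fst t'"
      "proj (prod_bundle V W) x \<in> fst c"
    obtain U \<tau> X \<sigma> where t: "t = (U \<times> X, map_prod \<tau> \<sigma>)" "(U, \<tau>) \<in> triv V" "(X, \<sigma>) \<in> triv W" using tr[OF h(1)] by blast
    obtain U' \<tau>' X' \<sigma>' where t': "t' = (U' \<times> X', map_prod \<tau>' \<sigma>')" "(U', \<tau>') \<in> triv V" "(X', \<sigma>') \<in> triv W" using tr[OF h(2)] by blast
    obtain Y \<phi> Z \<psi> where c: "c = (Y \<times> Z, map_prod \<phi> \<psi>)" "(Y, \<phi>) \<in> base V" "(Z, \<psi>) \<in> base W"
      using h(3) by (auto simp: prod_atlas_def)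
    obtain v w where x: "x = (v, w)" by (metis surj_pair)
    have mem: "v \<in> total V" "w \<in> total W" "proj V v \<in> Y \<inter> U" "proj W w \<in> Z \<inter> X" "proj V v \<in> U'" "proj W w \<in> X'"
      using h x t t' c by auto
    have "local_rep UNIV (tchart V (Y, \<phi>) (U, \<tau>)) euc \<tau>' v"
      using triv_subset_max_triv[OF V] max_atlas_superset[OF A(1)] c t t' mem
      by (intro smooth_fun_at_local_rep[OF vector_bundleD(3)[OF V] smooth_at_triv[OF V, of U']] max_trivD(3)[OF V])
        (auto simp: fst_tchart)
    then have 1: "local_rep UNIV (tchart (prod_bundle V W) c t) euc (\<lambda>z. \<tau>' (fst z)) x"
      using local_rep_compose[where g=\<tau>' and f=fst, OF local_rep_prod_fst_snd(1)[OF mem(1-4), of UNIV \<phi> \<psi> \<tau> \<sigma>]]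
      unfolding x c t by auto
    have "local_rep UNIV (tchart W (Z, \<psi>) (X, \<sigma>)) euc \<sigma>' w"
      using triv_subset_max_triv[OF W] max_atlas_superset[OF A(2)] c t t' mem
      by (intro smooth_fun_at_local_rep[OF vector_bundleD(3)[OF W] smooth_at_triv[OF W, of X']] max_trivD(3)[OF W])
        (auto simp: fst_tchart)
    then have 2: "local_rep UNIV (tchart (prod_bundle V W) c t) euc (\<lambda>z. \<sigma>' (snd z)) x"
      using local_rep_compose[where g=\<sigma>' and f=snd, OF local_rep_prod_fst_snd(2)[OF mem(1-4), of UNIV \<phi> \<psi> \<tau> \<sigma>]]
      unfolding x c t by auto
    show "local_rep UNIV (tchart (prod_bundle V W) c t) euc (snd t') x"
      using local_rep_euc_Pair[OF 1 2] by (simp add: t' map_prod_def case_prod_unfold)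
  qed
qed

lemma smooth_at_prod_bundle_fst_snd:
  assumes V: "vector_bundle V" and W: "vector_bundle W" and z: "z \<in> total V \<times> total W" "z \<in> S"
  shows "smooth_at (total_atlas (prod_bundle V W)) S (total_atlas V) fst z"
    "smooth_at (total_atlas (prod_bundle V W)) S (total_atlas W) snd z"
proof -
  note P = vector_bundle_prod[OF V W]
  obtain x y where z': "z = (x, y)" "x \<in> total V" "y \<in> total W" using z by auto
  obtain U \<tau> X \<sigma> where t: "(U, \<tau>) \<in> triv V" "proj V x \<in> U" "(X, \<sigma>) \<in> triv W" "proj W y \<in> X"
    using vector_bundleD(6)[OF V vector_bundleD(4)[OF V z'(2)]] vector_bundleD(6)[OF W vector_bundleD(4)[OF W z'(3)]] by blast
  obtain Y \<phi> Z \<psi> where c: "(Y, \<phi>) \<in> max_atlas (base V)" "proj V x \<in> Y" "(Z, \<psi>) \<in> max_atlas (base W)" "proj W y \<in> Z"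
    using chart_at[OF vector_bundleD(2)[OF V] vector_bundleD(4)[OF V z'(2)]]
      chart_at[OF vector_bundleD(2)[OF W] vector_bundleD(4)[OF W z'(3)]] by blast
  have "(U \<times> X, map_prod \<tau> \<sigma>) \<in> triv (prod_bundle V W)" using t by (auto simp: prod_bundle_def)
  then have m: "(U \<times> X, map_prod \<tau> \<sigma>) \<in> max_triv (prod_bundle V W)" using triv_subset_max_triv[OF P] by blast
  have mc: "tchart (prod_bundle V W) (Y \<times> Z, map_prod \<phi> \<psi>) (U \<times> X, map_prod \<tau> \<sigma>) \<in> max_atlas (total_atlas (prod_bundle V W))"
    by (rule max_trivD(3)[OF P m])
      (simp add: prod_max_atlas[OF vector_bundleD(2)[OF V] vector_bundleD(2)[OF W] c(1,3)])
  have cV: "tchart V (Y, \<phi>) (U, \<tau>) \<in> max_atlas (total_atlas V)" "tchart W (Z, \<psi>) (X, \<sigma>) \<in> max_atlas (total_atlas W)"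
    using max_trivD(3)[OF V _ c(1)] max_trivD(3)[OF W _ c(3)] t triv_subset_max_triv[OF V] triv_subset_max_triv[OF W] by blast+
  have h: "proj V x \<in> Y \<inter> U" "proj W y \<in> Z \<inter> X" "(x, y) \<in> S" using t c z z' by auto
  show "smooth_at (total_atlas (prod_bundle V W)) S (total_atlas V) fst z"
    "smooth_at (total_atlas (prod_bundle V W)) S (total_atlas W) snd z"
    unfolding smooth_at_def z'(1)
    using local_rep_prod_fst_snd[OF z'(2,3) h, of \<phi> \<psi> \<tau> \<sigma>] mc cV by blast+
qed

subsection \<open>Smooth families of linear maps along a manifold\<close>

text \<open>Passes from maps \<open>\<beta> m\<close> that are linear only on \<open>W\<close> to a
  smooth family of linear maps on the whole model space: the coefficients along an orthonormal basis
  of \<open>W\<close> are smooth, and there are finitely many of them.\<close>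

lemma smooth_linear_family:
  fixes \<beta> :: "'m \<Rightarrow> 'f::euclidean_space \<Rightarrow> 'g::euclidean_space" and \<A> :: "('m, 'b::euclidean_space) atlas"
  assumes A: "smooth_atlas \<A>" and N: "openin (manifold_topology \<A>) N" "p \<in> N" and W: "subspace W"
    and lin: "\<And>m v w. m \<in> N \<Longrightarrow> v \<in> W \<Longrightarrow> w \<in> W \<Longrightarrow> \<beta> m (v + w) = \<beta> m v + \<beta> m w"
      "\<And>m v c. m \<in> N \<Longrightarrow> v \<in> W \<Longrightarrow> \<beta> m (c *\<^sub>R v) = c *\<^sub>R \<beta> m v"
    and sm: "\<And>w. w \<in> W \<Longrightarrow> smooth_fun_at \<A> N (\<lambda>m. \<beta> m w) p" and c: "(U, \<phi>) \<in> max_atlas \<A>" "p \<in> U"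
  obtains Q B where "\<phi> p \<in> Q" "open Q" "\<And>y. linear (B y)" "\<And>v. smooth_open Q (\<lambda>y. B y v)"
    "\<And>m. m \<in> U \<Longrightarrow> \<phi> m \<in> Q \<Longrightarrow> m \<in> N \<and> (\<forall>w\<in>W. B (\<phi> m) w = \<beta> m w)"
proof -
  obtain D where D: "D \<subseteq> W" "pairwise orthogonal D" "\<And>x. x \<in> D \<Longrightarrow> norm x = 1" "independent D" "span D = W"
    using orthonormal_basis_subspace[OF W] by metis
  have fin: "finite D" by (rule independent_imp_finite[OF D(4)])
  have ex: "(\<Sum>d\<in>D. (w \<bullet> d) *\<^sub>R d) = w" if "w \<in> W" for w
    by (rule orthonormal_basis_expand[OF D(2,3) _ fin]) (use that D(5) in auto)
  have "\<exists>M g. \<phi> p \<in> M \<and> smooth_open M g \<and> (\<forall>m\<in>U \<inter> N. \<phi> m \<in> M \<longrightarrow> \<beta> m d = g (\<phi> m))" if d: "d \<in> D" for d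
  proof -
    have "local_rep N (U, \<phi>) euc (\<lambda>m. \<beta> m d) p"
      by (rule smooth_fun_at_local_rep[OF A sm c(1)]) (use d D c in auto)
    then show ?thesis by (rule local_repE) blast
  qed
  then obtain M g where Mg: "\<And>d. d \<in> D \<Longrightarrow> \<phi> p \<in> M d" "\<And>d. d \<in> D \<Longrightarrow> smooth_open (M d) (g d)"
    "\<And>d m. d \<in> D \<Longrightarrow> m \<in> U \<inter> N \<Longrightarrow> \<phi> m \<in> M d \<Longrightarrow> \<beta> m d = g d (\<phi> m)" by metis
  obtain R where R: "open R" "\<phi> p \<in> R" "\<forall>q\<in>U. \<phi> q \<in> R \<longrightarrow> q \<in> N"
    using openin_manifold_chart[OF A N(1) c N(2)] by blast
  define Q where "Q = R \<inter> (\<Inter>d\<in>D. M d)"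
  have Q: "open Q" "\<phi> p \<in> Q" unfolding Q_def using R Mg(1) smooth_openD(1)[OF Mg(2)] fin by (auto intro!: open_INT)
  define B where "B y v = (\<Sum>d\<in>D. (v \<bullet> d) *\<^sub>R g d y)" for y v
  have Bl: "linear (B y)" for y
    unfolding B_def by (rule linearI) (simp_all add: inner_add_left scaleR_add_left sum.distrib scaleR_sum_right)
  have "smooth_open Q (\<lambda>y. B y v)" for v
    unfolding B_def
  proof (rule smooth_open_sum[OF Q(1)])
    fix d assume d: "d \<in> D"
    have "smooth_open Q (g d)" by (rule smooth_open_subset[OF Mg(2)[OF d] Q(1)]) (use d in \<open>auto simp: Q_def\<close>)
    then show "smooth_open Q (\<lambda>y. (v \<bullet> d) *\<^sub>R g d y)"
      by (rule smooth_open_scaleR[OF smooth_open_const[OF Q(1)]])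
  qed
  moreover have "m \<in> N \<and> (\<forall>w\<in>W. B (\<phi> m) w = \<beta> m w)" if m: "m \<in> U" "\<phi> m \<in> Q" for m
  proof (intro conjI ballI)
    show mN: "m \<in> N" using m R by (auto simp: Q_def)
    fix w assume w: "w \<in> W"
    have b0: "\<beta> m 0 = 0" using lin(2)[OF mN subspace_0[OF W], of 0] by simp
    have sumW: "(\<Sum>d\<in>E. a d *\<^sub>R d) \<in> W \<and> \<beta> m (\<Sum>d\<in>E. a d *\<^sub>R d) = (\<Sum>d\<in>E. a d *\<^sub>R \<beta> m d)" if "finite E" "E \<subseteq> D" for E a
      using that
    proof (induction E rule: finite_induct)
      case empty
      then show ?case using subspace_0[OF W] b0 by simp
    next
      case (insert x F)
      then have "x \<in> W" using D(1) by auto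
      then show ?case
        using insert lin[OF mN] subspace_scale[OF W \<open>x \<in> W\<close>] by (auto intro!: subspace_add[OF W])
    qed
    have "B (\<phi> m) w = (\<Sum>d\<in>D. (w \<bullet> d) *\<^sub>R \<beta> m d)"
      unfolding B_def using Mg(3) m mN by (intro sum.cong) (auto simp: Q_def)
    also have "\<dots> = \<beta> m (\<Sum>d\<in>D. (w \<bullet> d) *\<^sub>R d)" using sumW[OF fin order_refl] by simp
    also have "\<dots> = \<beta> m w" using ex[OF w] by simp
    finally show "B (\<phi> m) w = \<beta> m w" .
  qed
  ultimately show ?thesis using that[of Q B] Q Bl by blast
qed

subsection \<open>Subbundles\<close>

lemma fiber_rep:
  assumes t: "trivialization V r (U, \<tau>)" and m: "m \<in> U" and W: "W \<subseteq> \<tau> ` fiber V m" and w: "w \<in> W"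
  shows "inv_into (fiber V m) \<tau> w \<in> fiber V m" "\<tau> (inv_into (fiber V m) \<tau> w) = w"
  using W w by (auto intro: inv_into_into f_inv_into_f)

lemma inv_triv_linear:
  assumes t: "trivialization V r (U, \<tau>)" and m: "m \<in> U"
  defines "i \<equiv> inv_into (fiber V m) \<tau>"
  assumes "v \<in> \<tau> ` fiber V m" "w \<in> \<tau> ` fiber V m"
  shows "i (v + w) = vadd V (i v) (i w)" "i (c *\<^sub>R v) = vscale V c (i v)" "v + w \<in> \<tau> ` fiber V m" "c *\<^sub>R v \<in> \<tau> ` fiber V m"
proof -
  obtain x y where x: "x \<in> fiber V m" "v = \<tau> x" "y \<in> fiber V m" "w = \<tau> y" using assms by blast
  have inj: "inj_on \<tau> (fiber V m)" by (rule trivializationD(3)[OF t m])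
  have xy: "vadd V x y \<in> fiber V m" "vscale V c x \<in> fiber V m"
    using x trivializationD(4,5)[OF t m] by auto
  have e: "v + w = \<tau> (vadd V x y)" "c *\<^sub>R v = \<tau> (vscale V c x)"
    using trivializationD(2)[OF t m] x by (auto simp: fiber_linear_def)
  show "i (v + w) = vadd V (i v) (i w)" "i (c *\<^sub>R v) = vscale V c (i v)"
    unfolding e unfolding i_def x by (simp_all add: inv_into_f_f[OF inj] x xy)
  show "v + w \<in> \<tau> ` fiber V m" "c *\<^sub>R v \<in> \<tau> ` fiber V m" using e xy by auto
qed

text \<open>Near \<open>f p\<close> the fiberwise injective map \<open>\<kappa>\<close> has a smooth left inverse on \<open>R\<close>.\<close>

lemma smooth_at_subbundle:
  fixes V :: "('m, 'b::euclidean_space, 'a, 'f::euclidean_space, 'z) vbundle_scheme" and \<kappa> :: "'a \<Rightarrow> 'g::euclidean_space"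
  assumes V: "vector_bundle V" and t: "(U, \<tau>) \<in> max_triv V" and W: "subspace W" "\<And>m. m \<in> U \<inter> S \<Longrightarrow> \<tau> ` (R \<inter> fiber V m) = W"
    and R: "R \<subseteq> total V" "proj V ` R \<subseteq> S" and C: "smooth_atlas \<C>" and f: "\<And>q. q \<in> T \<Longrightarrow> f q \<in> R"
    and p: "proj V (f p) \<in> U" and pr: "smooth_at \<C> T (base V) (\<lambda>q. proj V (f q)) p"
    and N: "openin (manifold_topology (base V)) N" "proj V (f p) \<in> N" "\<And>m. m \<in> N \<Longrightarrow> fiber_linear V m \<kappa>"
    and k: "\<And>x. x \<in> fiber V (proj V (f p)) \<Longrightarrow> smooth_fun_at (total_atlas V) UNIV \<kappa> x"
    and inj: "inj_on \<kappa> (R \<inter> fiber V (proj V (f p)))"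
    and kf: "smooth_fun_at \<C> T (\<lambda>q. \<kappa> (f q)) p"
  shows "smooth_at \<C> T (total_atlas V) f p"
proof -
  note A = vector_bundleD(2)[OF V]
  obtain r where r: "trivialization V r (U, \<tau>)" using max_trivD(1)[OF V t] by blast
  define m0 where "m0 = proj V (f p)"
  have pT: "p \<in> T" by (rule smooth_atD(1)[OF pr])
  have m0: "m0 \<in> S" "m0 \<in> U" "m0 \<in> N" "m0 \<in> points (base V)"
    using f[OF pT] R p N smooth_atD(3)[OF pr] unfolding m0_def by auto
  obtain W0 where W0: "\<forall>m\<in>U. bij_betw \<tau> (fiber V m) W0" using trivializationD(6)[OF r] by blast
  have WW: "W \<subseteq> \<tau> ` fiber V m" if "m \<in> U" for m
  proof -
    have "W \<subseteq> W0" using W(2)[of m0] m0 W0 by (force simp: bij_betw_def)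
    then show ?thesis using W0 that by (simp add: bij_betw_def)
  qed
  \<comment> \<open>\<open>\<iota> m w\<close> is the local section with constant fiber coordinate
    \<open>w\<close>. Evaluating \<open>\<kappa>\<close> on such sections gives its matrix as a
    function of the base point.\<close>
  define \<iota> where "\<iota> m = inv_into (fiber V m) \<tau>" for m
  have io: "\<iota> m w \<in> fiber V m" "\<tau> (\<iota> m w) = w" if "m \<in> U" "w \<in> W" for m w
    using fiber_rep[OF r that(1) WW[OF that(1)] that(2)] unfolding \<iota>_def by auto
  define N' where "N' = N \<inter> U"
  have N': "openin (manifold_topology (base V)) N'" "m0 \<in> N'"
    unfolding N'_def using N(1) trivializationD(1)[OF r] m0 by auto
  obtain X \<phi> where X: "(X, \<phi>) \<in> max_atlas (base V)" "m0 \<in> X" using chart_at[OF A m0(4)] by blast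
  have sm: "smooth_fun_at (base V) N' (\<lambda>m. \<kappa> (\<iota> m w)) m0" if w: "w \<in> W" for w
  proof -
    have id: "smooth_at (base V) N' (base V) (\<lambda>m. m) m0" by (rule smooth_at_ident[OF A N'(2) m0(4)])
    have "smooth_at (base V) N' (total_atlas V) (\<lambda>m. \<iota> m w) m0"
    proof (rule smooth_at_totalI[OF V A _ t])
      show "smooth_at (base V) N' (base V) (\<lambda>q. proj V (\<iota> q w)) m0"
        by (rule smooth_at_cong[OF id]) (use io(1)[OF _ w] in \<open>auto simp: N'_def fiber_def\<close>)
      show "smooth_fun_at (base V) N' (\<lambda>q. \<tau> (\<iota> q w)) m0"
        by (rule smooth_at_cong[OF smooth_at_const[OF A smooth_atlas_euc N'(2) m0(4), of w]])
          (use io(2)[OF _ w] in \<open>auto simp: N'_def\<close>)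
      show "proj V (\<iota> m0 w) \<in> U" using io(1)[OF m0(2) w] m0 by (simp add: fiber_def)
      show "\<iota> q w \<in> total V" if "q \<in> N'" for q using io(1)[OF _ w, of q] that by (simp add: fiber_def N'_def)
    qed
    then show ?thesis
      by (rule smooth_at_compose[OF vector_bundleD(3)[OF V] _ k]) (use io(1)[OF m0(2) w] in \<open>auto simp: m0_def\<close>)
  qed
  have lin: "\<kappa> (\<iota> m (v + w)) = \<kappa> (\<iota> m v) + \<kappa> (\<iota> m w) \<and> \<kappa> (\<iota> m (c *\<^sub>R v)) = c *\<^sub>R \<kappa> (\<iota> m v)"
    if "m \<in> N'" "v \<in> W" "w \<in> W" for m v w c
  proof -
    have mU: "m \<in> U" "m \<in> N" using that by (auto simp: N'_def)
    have "v \<in> \<tau> ` fiber V m" "w \<in> \<tau> ` fiber V m" using WW[OF mU(1)] that by auto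
    note l = inv_triv_linear(1,2)[OF r mU(1) this, folded \<iota>_def]
    show ?thesis
      unfolding l using N(3)[OF mU(2)] io(1)[OF mU(1)] that unfolding fiber_linear_def by auto
  qed
  have lin1: "\<kappa> (\<iota> m (v + w)) = \<kappa> (\<iota> m v) + \<kappa> (\<iota> m w)" if "m \<in> N'" "v \<in> W" "w \<in> W" for m v w
    using lin[OF that] by blast
  have lin2: "\<kappa> (\<iota> m (c *\<^sub>R v)) = c *\<^sub>R \<kappa> (\<iota> m v)" if "m \<in> N'" "v \<in> W" for m v c
    using lin[OF that that(2)] by blast
  obtain Q B where Q: "\<phi> m0 \<in> Q" "open Q" "\<And>y. linear (B y)" "\<And>v. smooth_open Q (\<lambda>y. B y v)"
    "\<And>m. m \<in> X \<Longrightarrow> \<phi> m \<in> Q \<Longrightarrow> m \<in> N' \<and> (\<forall>w\<in>W. B (\<phi> m) w = \<kappa> (\<iota> m w))"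
    by (rule smooth_linear_family[of "base V" N' m0 W "\<lambda>m w. \<kappa> (\<iota> m w)" X \<phi>])
      (assumption | rule A N' W(1) lin1 lin2 sm X that)+
  have \<iota>R: "\<iota> m0 w \<in> R \<inter> fiber V m0" if w: "w \<in> W" for w
  proof -
    obtain x where x: "x \<in> R \<inter> fiber V m0" "w = \<tau> x" using W(2)[of m0] m0 w by blast
    then show ?thesis using inv_into_f_f[OF trivializationD(3)[OF r m0(2)], of x] by (simp add: \<iota>_def)
  qed
  have injB: "inj_on (B (\<phi> m0)) W"
  proof (rule inj_onI)
    fix v w assume vw: "v \<in> W" "w \<in> W" "B (\<phi> m0) v = B (\<phi> m0) w"
    then have "\<kappa> (\<iota> m0 v) = \<kappa> (\<iota> m0 w)" using Q(5)[OF X(2) Q(1)] by simp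
    then have "\<iota> m0 v = \<iota> m0 w" using inj \<iota>R vw unfolding m0_def inj_on_def by blast
    then show "v = w" using io(2)[OF m0(2)] vw by metis
  qed
  obtain M K where M: "\<phi> m0 \<in> M" "M \<subseteq> Q" "\<And>v. smooth_open M (\<lambda>x. K x v)" "\<And>x. x \<in> M \<Longrightarrow> linear (K x)"
    "\<And>x w. x \<in> M \<Longrightarrow> w \<in> W \<Longrightarrow> K x (B x w) = w"
    by (rule left_inverse_family_smooth[OF Q(3,4,1) W(1) injB]) blast
  \<comment> \<open>On \<open>R\<close> the fiber coordinate is recovered from the base point and
    the value of \<open>\<kappa>\<close>; substituting \<open>f\<close> expresses its coordinate by
    two maps known to be smooth.\<close>
  have key: "\<tau> x = K (\<phi> (proj V x)) (\<kappa> x)" if x: "x \<in> R" "proj V x \<in> X" "\<phi> (proj V x) \<in> M" for x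
  proof -
    let ?m = "proj V x"
    have m: "?m \<in> N'" "\<And>w. w \<in> W \<Longrightarrow> B (\<phi> ?m) w = \<kappa> (\<iota> ?m w)" using Q(5)[OF x(2)] x(3) M(2) by auto
    have mU: "?m \<in> U" "?m \<in> S" using m R x by (auto simp: N'_def)
    have xf: "x \<in> R \<inter> fiber V ?m" using x R by (auto simp: fiber_def)
    have tw: "\<tau> x \<in> W" using W(2)[of ?m] mU xf by blast
    have "\<iota> ?m (\<tau> x) = x" unfolding \<iota>_def using inv_into_f_f[OF trivializationD(3)[OF r mU(1)]] xf by blast
    then have "B (\<phi> ?m) (\<tau> x) = \<kappa> x" using m(2)[OF tw] by simp
    then show ?thesis using M(5)[OF x(3) tw] by simp
  qed
  obtain Y \<psi> where Y: "(Y, \<psi>) \<in> max_atlas \<C>" "p \<in> Y" using chart_at[OF C smooth_atD(2)[OF pr]] by blast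
  have r1: "local_rep T (Y, \<psi>) (X, \<phi>) (\<lambda>q. proj V (f q)) p"
    by (rule smooth_at_local_rep[OF C A pr Y(1) _ X(1)]) (use Y X m0_def in auto)
  obtain N1 g1 where g1: "\<psi> p \<in> N1" "smooth_open N1 g1"
    "\<And>q. q \<in> Y \<Longrightarrow> q \<in> T \<Longrightarrow> \<psi> q \<in> N1 \<Longrightarrow> proj V (f q) \<in> X \<and> \<phi> (proj V (f q)) = g1 (\<psi> q)"
    using r1 by (rule local_repE) blast
  have r2: "local_rep T (Y, \<psi>) euc (\<lambda>q. \<kappa> (f q)) p"
    by (rule smooth_fun_at_local_rep[OF C kf Y(1)]) (use Y in auto)
  obtain N2 g2 where g2: "\<psi> p \<in> N2" "smooth_open N2 g2"
    "\<And>q. q \<in> Y \<Longrightarrow> q \<in> T \<Longrightarrow> \<psi> q \<in> N2 \<Longrightarrow> \<kappa> (f q) \<in> UNIV \<and> \<kappa> (f q) = g2 (\<psi> q)"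
    using r2 by (rule local_repE) blast
  have oM: "open M" using smooth_openD(1)[OF M(3)] .
  let ?D = "(N1 \<inter> g1 -` M) \<inter> N2"
  have oD: "open ?D" by (rule open_Int[OF smooth_open_vimage[OF g1(2) oM] smooth_openD(1)[OF g2(2)]])
  have s1: "smooth_open ?D g1" by (rule smooth_open_subset[OF g1(2) oD]) auto
  have s2: "smooth_open ?D g2" by (rule smooth_open_subset[OF g2(2) oD]) auto
  have s3: "smooth_open ?D (\<lambda>x. K (g1 x) v)" for v
    by (rule smooth_open_compose[OF s1 M(3)]) auto
  have s4: "smooth_open ?D (\<lambda>x. K (g1 x) (g2 x))"
    by (rule smooth_open_linear_family[of ?D "\<lambda>x. K (g1 x)" g2, OF _ s3 s2]) (use M(4) in auto)
  have g1p: "g1 (\<psi> p) \<in> M" using g1(3)[OF Y(2) pT g1(1)] M(1) m0_def by simp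
  have "local_rep T (Y, \<psi>) euc (\<lambda>q. \<tau> (f q)) p"
    by (rule local_repI[OF Y(2) pT _ s4]) (use g1 g2 g1p key f in auto)
  then have "smooth_fun_at \<C> T (\<lambda>q. \<tau> (f q)) p" by (rule smooth_fun_atI[OF Y(1)])
  then show ?thesis
    by (rule smooth_at_totalI[OF V C pr t p]) (use f R in auto)
qed

lemma vector_subbundleD:
  assumes R: "vector_subbundle V S R"
  shows "embedded_submanifold (base V) S" "R \<subseteq> total V" "vector_bundle (sub_bundle V S R)"
    "x \<in> R \<Longrightarrow> proj V x \<in> S"
    "m \<in> S \<Longrightarrow> \<exists>U \<tau> W. (U, \<tau>) \<in> max_triv V \<and> m \<in> U \<and> subspace W \<and> (\<forall>m\<in>U \<inter> S. \<tau> ` (R \<inter> fiber V m) = W)"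
    "x \<in> R \<Longrightarrow> y \<in> R \<Longrightarrow> proj V x = proj V y \<Longrightarrow> vadd V x y \<in> R"
    "x \<in> R \<Longrightarrow> vscale V c x \<in> R"
    "m \<in> S \<Longrightarrow> \<exists>x\<in>R. proj V x = m"
proof -
  show "embedded_submanifold (base V) S" "R \<subseteq> total V" and sb: "vector_bundle (sub_bundle V S R)"
    using R by (auto simp: vector_subbundle_def)
  have pts: "points (base (sub_bundle V S R)) = S"
    using R by (simp add: vector_subbundle_def embedded_submanifold_def sub_bundle_def)
  show pr: "proj V x \<in> S" if "x \<in> R" for x
    using vector_bundleD(4)[OF sb, of x] that pts by (simp add: sub_bundle_def)
  show "\<exists>U \<tau> W. (U, \<tau>) \<in> max_triv V \<and> m \<in> U \<and> subspace W \<and> (\<forall>m\<in>U \<inter> S. \<tau> ` (R \<inter> fiber V m) = W)" if "m \<in> S" for m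
  proof -
    have "m \<in> points (base (sub_bundle V S R))" using that pts by simp
    from vector_bundleD(6)[OF sb this] obtain X \<tau> where X: "(X, \<tau>) \<in> triv (sub_bundle V S R)" "m \<in> X"
      by blast
    then obtain U where "X = U \<inter> S" "(U, \<tau>) \<in> max_triv V" "\<exists>W. subspace W \<and> (\<forall>m\<in>U \<inter> S. \<tau> ` (R \<inter> fiber V m) = W)"
      by (auto simp: sub_bundle_def)
    then show ?thesis using X(2) by blast
  qed
  have fib: "fiber (sub_bundle V S R) m = {x \<in> R. proj V x = m}" for m by (auto simp: fiber_def sub_bundle_def)
  have tr: "\<exists>X \<tau> r. m \<in> X \<and> trivialization (sub_bundle V S R) r (X, \<tau>)" if "m \<in> S" for m
  proof -
    have "m \<in> points (base (sub_bundle V S R))" using that pts by simp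
    from vector_bundleD(6)[OF sb this] vector_bundleD(5)[OF sb] obtain X \<tau> r
      where "(X, \<tau>) \<in> triv (sub_bundle V S R)" "m \<in> X" "\<forall>t\<in>triv (sub_bundle V S R). trivialization (sub_bundle V S R) r t" by blast
    then show ?thesis by blast
  qed
  show "vadd V x y \<in> R" if xy: "x \<in> R" "y \<in> R" "proj V x = proj V y" for x y
  proof -
    obtain X \<tau> r where "proj V x \<in> X" "trivialization (sub_bundle V S R) r (X, \<tau>)" using tr[OF pr[OF xy(1)]] by blast
    then have "vadd (sub_bundle V S R) x y \<in> fiber (sub_bundle V S R) (proj V x)"
      using xy fib by (intro trivializationD(4)) auto
    then show ?thesis unfolding fib by (simp add: sub_bundle_def)
  qed
  show "vscale V c x \<in> R" if x: "x \<in> R" for x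
  proof -
    obtain X \<tau> r where "proj V x \<in> X" "trivialization (sub_bundle V S R) r (X, \<tau>)" using tr[OF pr[OF x]] by blast
    then have "vscale (sub_bundle V S R) c x \<in> fiber (sub_bundle V S R) (proj V x)"
      using x fib by (intro trivializationD(5)) auto
    then show ?thesis unfolding fib by (simp add: sub_bundle_def)
  qed
  show "\<exists>x\<in>R. proj V x = m" if m: "m \<in> S"
  proof -
    obtain X \<tau> r where X: "m \<in> X" "trivialization (sub_bundle V S R) r (X, \<tau>)" using tr[OF m] by blast
    obtain W where "subspace W" "bij_betw \<tau> (fiber (sub_bundle V S R) m) W" using trivializationD(6)[OF X(2)] X(1) by blast
    then have "fiber (sub_bundle V S R) m \<noteq> {}" using subspace_0 by (auto simp: bij_betw_def)
    then show ?thesis unfolding fib by blast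
  qed
qed

text \<open>Metric, anchor and bracket are extension fields that the bundle notions do not see. This
  lets statements pass between Courant algebroids and their underlying bundles, for example past
  \<open>opposite\<close>.\<close>

lemma vector_bundle_scheme_cong:
  fixes V :: "('m, 'b::euclidean_space, 'a, 'f::euclidean_space, 'z) vbundle_scheme"
    and V' :: "('m, 'b, 'a, 'f, 'y) vbundle_scheme"
  assumes "base V = base V'" "total V = total V'" "proj V = proj V'" "vadd V = vadd V'" "vscale V = vscale V'"
    "triv V = triv V'"
  shows "total_atlas V = total_atlas V'" "vector_bundle V \<longleftrightarrow> vector_bundle V'" "max_triv V = max_triv V'"
    "vector_subbundle V S R \<longleftrightarrow> vector_subbundle V' S R" "sub_bundle V S R = sub_bundle V' S R"
proof -
  have vb: "vector_bundle V \<longleftrightarrow> vector_bundle V'"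
    if "base V = base V'" "total V = total V'" "proj V = proj V'" "vadd V = vadd V'" "vscale V = vscale V'"
      "triv V = triv V'"
    for V :: "('m, 'b::euclidean_space, 'a, 'f::euclidean_space, 'z) vbundle_scheme"
      and V' :: "('m, 'b, 'a, 'f, 'y) vbundle_scheme"
    using that unfolding vector_bundle_def total_atlas_def trivialization_def fiber_def by simp
  show "total_atlas V = total_atlas V'" using assms by (simp add: total_atlas_def)
  show "vector_bundle V \<longleftrightarrow> vector_bundle V'" using assms by (rule vb)
  show mt: "max_triv V = max_triv V'"
    unfolding max_triv_def using assms by (intro Collect_cong vb) simp_all
  show sb: "sub_bundle V S R = sub_bundle V' S R"
    using assms mt by (simp add: sub_bundle_def fiber_def)
  show "vector_subbundle V S R \<longleftrightarrow> vector_subbundle V' S R"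
    unfolding vector_subbundle_def sb using assms by simp
qed

text \<open>Since \<open>sub_bundle\<close> uses trivializations of \<open>V\<close> itself and
  slice charts of its base, its charts are literally restrictions of charts of the ambient total
  space.\<close>

lemma subatlas_sub_bundle:
  assumes V: "vector_bundle V" and R: "vector_subbundle V S R"
  shows "subatlas (total_atlas V) R (total_atlas (sub_bundle V S R))"
  unfolding subatlas_def
proof (intro conjI ballI)
  show "smooth_atlas (total_atlas V)" by (rule vector_bundleD(3)[OF V])
  note sb = vector_subbundleD(3)[OF R]
  show S: "smooth_atlas (total_atlas (sub_bundle V S R))" by (rule vector_bundleD(3)[OF sb])
  show "points (total_atlas (sub_bundle V S R)) = R" using points_total_atlas[OF sb] by (simp add: sub_bundle_def)
  fix x assume x: "x \<in> R"
  have m: "proj V x \<in> S" by (rule vector_subbundleD(4)[OF R x])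
  obtain U \<tau> W where U: "(U, \<tau>) \<in> max_triv V" "proj V x \<in> U" "subspace W" "\<forall>m\<in>U \<inter> S. \<tau> ` (R \<inter> fiber V m) = W"
    using vector_subbundleD(5)[OF R m] by blast
  have "proj V x \<in> points (restrict_atlas (base V) S)"
    using m vector_subbundleD(1)[OF R] by (simp add: embedded_submanifold_def)
  then obtain c where c: "c \<in> restrict_atlas (base V) S" "proj V x \<in> fst c" unfolding points_iff by blast
  then obtain X \<phi> where X: "(X, \<phi>) \<in> max_atlas (base V)" "c = (X \<inter> S, \<phi>)" "proj V x \<in> X"
    unfolding restrict_atlas_def by auto
  have cb: "c \<in> base (sub_bundle V S R)" using c(1) by (simp add: sub_bundle_def)
  have "(U \<inter> S, \<tau>) \<in> triv (sub_bundle V S R)" using U by (auto simp: sub_bundle_def)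
  then have "tchart (sub_bundle V S R) c (U \<inter> S, \<tau>) \<in> total_atlas (sub_bundle V S R)"
    unfolding total_atlas_eq using cb by blast
  moreover have "tchart (sub_bundle V S R) c (U \<inter> S, \<tau>) =
      ({y \<in> total V. proj V y \<in> X \<inter> U} \<inter> R, \<lambda>y. (\<phi> (proj V y), \<tau> y))"
    unfolding tchart_def X(2) using vector_subbundleD(4)[OF R] vector_subbundleD(2)[OF R] by (auto simp: sub_bundle_def)
  moreover have "({y \<in> total V. proj V y \<in> X \<inter> U}, \<lambda>y. (\<phi> (proj V y), \<tau> y)) \<in> max_atlas (total_atlas V)"
    using max_trivD(3)[OF V U(1) X(1)] by (simp add: tchart_def)
  ultimately show "\<exists>D \<xi>. (D, \<xi>) \<in> max_atlas (total_atlas V) \<and> x \<in> D \<and> (D \<inter> R, \<xi>) \<in> max_atlas (total_atlas (sub_bundle V S R))"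
    using max_atlas_superset[OF S] x X(3) U(2) vector_subbundleD(2)[OF R] by (metis (no_types, lifting) IntI mem_Collect_eq subsetD)
qed

lemma vector_subbundleI:
  fixes V :: "('m, 'b::euclidean_space, 'a, 'f::euclidean_space, 'z) vbundle_scheme"
  assumes V: "vector_bundle V" and S: "embedded_submanifold (base V) S" and R: "R \<subseteq> total V" "\<And>x. x \<in> R \<Longrightarrow> proj V x \<in> S"
    and fl: "\<And>p. p \<in> S \<Longrightarrow> \<exists>U \<tau> W. (U, \<tau>) \<in> max_triv V \<and> p \<in> U \<and> subspace W \<and> dim W = d \<and>
      (\<forall>m\<in>U \<inter> S. \<tau> ` (R \<inter> fiber V m) = W)"
  shows "vector_subbundle V S R"
proof -
  note A = vector_bundleD(2)[OF V] and T = vector_bundleD(3)[OF V]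
  note sub = subatlas_restrict[OF A S]
  let ?V = "sub_bundle V S R"
  have simps: "base ?V = restrict_atlas (base V) S" "total ?V = R" "proj ?V = proj V" "vadd ?V = vadd V" "vscale ?V = vscale V"
    by (simp_all add: sub_bundle_def)
  have fib: "fiber ?V m = R \<inter> fiber V m" for m using R by (auto simp: fiber_def simps)
  \<comment> \<open>As for submanifolds: over an empty \<open>S\<close> there is no witness of
    dimension \<open>d\<close>, and rank \<open>0\<close> is used.\<close>
  define e where "e = (if S = {} then 0 else d)"
  have tr: "\<exists>U \<tau> W. t = (U \<inter> S, \<tau>) \<and> (U, \<tau>) \<in> max_triv V \<and> subspace W \<and> (\<forall>m\<in>U \<inter> S. \<tau> ` (R \<inter> fiber V m) = W)"
    if "t \<in> triv ?V" for t using that by (auto simp: sub_bundle_def)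
  have "vector_bundle ?V"
  proof (rule vector_bundleI[of _ e])
    show "smooth_manifold (base ?V)"
      unfolding simps by (rule smooth_manifold_subatlas[OF sub vector_bundleD(1)[OF V]])
    show "proj ?V x \<in> points (base ?V)" if "x \<in> total ?V" for x
      using that R(2) S by (auto simp: simps embedded_submanifold_def)
    show "\<exists>t\<in>triv ?V. m \<in> fst t" if "m \<in> points (base ?V)" for m
    proof -
      have "m \<in> S" using that S by (simp add: simps embedded_submanifold_def)
      from fl[OF this] obtain U \<tau> W where "(U, \<tau>) \<in> max_triv V" "m \<in> U" "subspace W" "\<forall>m\<in>U \<inter> S. \<tau> ` (R \<inter> fiber V m) = W"
        by blast
      then have "(U \<inter> S, \<tau>) \<in> triv ?V" "m \<in> fst (U \<inter> S, \<tau>)" using \<open>m \<in> S\<close> by (auto simp: sub_bundle_def)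
      then show ?thesis by blast
    qed
  next
    fix t assume t: "t \<in> triv ?V"
    obtain U \<tau> W where U: "t = (U \<inter> S, \<tau>)" "(U, \<tau>) \<in> max_triv V" "subspace W" "\<And>m. m \<in> U \<inter> S \<Longrightarrow> \<tau> ` (R \<inter> fiber V m) = W"
      using tr[OF t] by blast
    obtain r where r: "trivialization V r (U, \<tau>)" using max_trivD(1)[OF V U(2)] by blast
    have dimW: "\<exists>W'. subspace W' \<and> dim W' = e \<and> (\<forall>m\<in>U \<inter> S. bij_betw \<tau> (R \<inter> fiber V m) W')"
    proof (cases "U \<inter> S = {}")
      case True
      have "\<exists>W::'f set. subspace W \<and> dim W = e"
      proof (cases "S = {}")
        case True
        then show ?thesis by (intro exI[of _ "{0}"]) (simp add: e_def subspace_single_0)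
      next
        case False
        then show ?thesis using fl unfolding e_def by (metis ex_in_conv)
      qed
      then show ?thesis unfolding True by simp
    next
      case False
      then obtain p where p: "p \<in> U" "p \<in> S" by blast
      obtain X \<sigma> Y where X: "(X, \<sigma>) \<in> max_triv V" "p \<in> X" "subspace Y" "dim Y = d" "\<And>m. m \<in> X \<inter> S \<Longrightarrow> \<sigma> ` (R \<inter> fiber V m) = Y"
        using fl[OF p(2)] by blast
      obtain s where s: "trivialization V s (X, \<sigma>)" using max_trivD(1)[OF V X(1)] by blast
      \<comment> \<open>An arbitrary flattening trivialization is compared with a given one in the
        single fiber over \<open>p\<close>; linear maps in both directions show that the flattened
        images have equal dimension.\<close>
      obtain L where L: "linear L" "\<And>x. x \<in> fiber V p \<Longrightarrow> \<sigma> x = L (\<tau> x)"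
        by (rule fiber_linear_rep[OF r p(1) trivializationD(2)[OF s X(2)]]) blast
      obtain L' where L': "linear L'" "\<And>x. x \<in> fiber V p \<Longrightarrow> \<tau> x = L' (\<sigma> x)"
        by (rule fiber_linear_rep[OF s X(2) trivializationD(2)[OF r p(1)]]) blast
      have "Y = L ` W" using U(4)[of p] X(5)[of p] L(2) p X(2) by (auto simp: image_image cong: image_cong_simp)
      moreover have "W = L' ` Y" using U(4)[of p] X(5)[of p] L'(2) p X(2) by (auto simp: image_image cong: image_cong_simp)
      ultimately have "dim W = d" using dim_image_le[OF L(1), of W] dim_image_le[OF L'(1), of Y] X(4) by simp
      then have "dim W = e" using p by (auto simp: e_def)
      moreover have "bij_betw \<tau> (R \<inter> fiber V m) W" if "m \<in> U \<inter> S" for m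
        using U(4)[OF that] trivializationD(3)[OF r, of m] that by (auto simp: bij_betw_def intro: inj_on_subset)
      ultimately show ?thesis using U(3) by blast
    qed
    have clo: "vadd V x y \<in> R \<inter> fiber V m" "vscale V c x \<in> R \<inter> fiber V m"
      if m: "m \<in> U \<inter> S" and xy: "x \<in> R \<inter> fiber V m" "y \<in> R \<inter> fiber V m" for m x y c
    proof -
      have mU: "m \<in> U" using m by blast
      have f: "vadd V x y \<in> fiber V m" "vscale V c x \<in> fiber V m" using trivializationD(4,5)[OF r mU] xy by auto
      have "\<tau> (vadd V x y) \<in> W" "\<tau> (vscale V c x) \<in> W"
        using trivializationD(2)[OF r mU] xy U(4)[OF m] subspace_add[OF U(3)] subspace_scale[OF U(3)]
        by (auto simp: fiber_linear_def)
      then obtain a b where "a \<in> R \<inter> fiber V m" "\<tau> (vadd V x y) = \<tau> a" "b \<in> R \<inter> fiber V m" "\<tau> (vscale V c x) = \<tau> b"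
        unfolding U(4)[OF m, symmetric] by blast
      then show "vadd V x y \<in> R \<inter> fiber V m" "vscale V c x \<in> R \<inter> fiber V m"
        using trivializationD(3)[OF r mU] f by (auto simp: inj_on_eq_iff)
    qed
    have op: "openin (manifold_topology (restrict_atlas (base V) S)) (U \<inter> S)"
      unfolding subatlas_topology[OF sub] openin_subtopology using trivializationD(1)[OF r] by blast
    show "trivialization ?V e t"
      unfolding trivialization_def U(1) prod.case fib simps
      using op dimW clo trivializationD(2)[OF r] by (auto simp: fiber_linear_def)
  next
    fix t t' c x
    assume h: "t \<in> triv ?V" "t' \<in> triv ?V" "c \<in> base ?V" "x \<in> total ?V" "proj ?V x \<in> fst t" "proj ?V x \<in> fst t'"
      "proj ?V x \<in> fst c"
    obtain U \<tau> where U: "t = (U \<inter> S, \<tau>)" "(U, \<tau>) \<in> max_triv V" using tr[OF h(1)] by blast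
    obtain U' \<tau>' where U': "t' = (U' \<inter> S, \<tau>')" "(U', \<tau>') \<in> max_triv V" using tr[OF h(2)] by blast
    obtain X \<phi> where X: "c = (X \<inter> S, \<phi>)" "(X, \<phi>) \<in> max_atlas (base V)"
      using h(3) unfolding simps restrict_atlas_def by blast
    have xx: "x \<in> total V" "proj V x \<in> X \<inter> U" "proj V x \<in> U'" "x \<in> R" using h U U' X R by (auto simp: simps)
    have "local_rep UNIV (tchart V (X, \<phi>) (U, \<tau>)) euc \<tau>' x"
      by (rule smooth_fun_at_local_rep[OF T smooth_at_triv[OF V U'(2)] max_trivD(3)[OF V U(2) X(2)]])
        (use xx in \<open>auto simp: fst_tchart\<close>)
    then have "local_rep UNIV (fst (tchart ?V c t), snd (tchart V (X, \<phi>) (U, \<tau>))) euc \<tau>' x"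
      by (rule local_rep_dom[of UNIV "fst (tchart V (X, \<phi>) (U, \<tau>))" "snd (tchart V (X, \<phi>) (U, \<tau>))", unfolded prod.collapse])
        (use xx R h U X in \<open>auto simp: fst_tchart simps\<close>)
    then show "local_rep UNIV (tchart ?V c t) euc (snd t') x"
      by (simp add: U X U' tchart_def simps)
  qed
  then show ?thesis unfolding vector_subbundle_def using S R by blast
qed

lemma local_rep_linear_family:
  assumes y: "local_rep S c euc y p" "y p \<in> Q" and f: "local_rep S c euc f p"
    and B: "\<And>y. linear (B y)" "\<And>v. smooth_open Q (\<lambda>y. B y v)"
  shows "local_rep S c euc (\<lambda>x. B (y x) (f x)) p"
proof -
  have o: "open Q" by (rule smooth_openD(1)[OF B(2)])
  have o2: "open (Q \<times> UNIV)" using o by (simp add: open_Times)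
  have s1: "smooth_open (Q \<times> UNIV) fst" "smooth_open (Q \<times> UNIV) snd"
    by (intro smooth_open_bounded_linear bounded_linear_fst bounded_linear_snd o2)+
  have "smooth_open (Q \<times> UNIV) (\<lambda>z. B (fst z) v)" for v
    by (rule smooth_open_compose[OF s1(1) B(2)]) auto
  then have "smooth_open (Q \<times> UNIV) (\<lambda>z. B (fst z) (snd z))"
    by (intro smooth_open_linear_family[of _ "\<lambda>z. B (fst z)" snd, OF B(1) _ s1(2)])
  from local_rep_smooth_open[OF local_rep_euc_Pair[OF y(1) f] this] y(2) show ?thesis by simp
qed

text \<open>Comparison with one old trivialization \<open>\<tau>0\<close> over a larger set suffices
  for leaving the new chart: from \<open>\<tau>0\<close> one continues to any other old
  trivialization.\<close>

lemma max_trivI: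
  assumes V: "vector_bundle V" and t0: "(U0, \<tau>0) \<in> triv V" "trivialization V r (U0, \<tau>0)"
    and t: "trivialization V r (U, \<tau>)" "U \<subseteq> U0" "U \<noteq> {}"
    and to: "\<And>x. x \<in> total V \<Longrightarrow> proj V x \<in> U \<Longrightarrow> smooth_fun_at (total_atlas V) UNIV \<tau> x"
    and fro: "\<And>c x. c \<in> base V \<Longrightarrow> x \<in> total V \<Longrightarrow> proj V x \<in> U \<Longrightarrow> proj V x \<in> fst c \<Longrightarrow>
      local_rep UNIV (tchart V c (U, \<tau>)) euc \<tau>0 x"
  shows "(U, \<tau>) \<in> max_triv V"
  unfolding max_triv_def mem_Collect_eq
proof (rule vector_bundleI[of _ r]; (unfold vb_update_simps)?)
  let ?V = "V\<lparr>triv := insert (U, \<tau>) (triv V)\<rparr>"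
  note A = vector_bundleD(2)[OF V] and T = vector_bundleD(3)[OF V]
  obtain s where s: "\<forall>t\<in>triv V. trivialization V s t" using vector_bundleD(5)[OF V] by blast
  obtain m where m: "m \<in> U" using t(3) by blast
  have "s = r" using trivialization_rank_unique[OF _ t0(2), of s] s t0(1) m t(2) by blast
  then have rr: "\<forall>t\<in>triv V. trivialization V r t" using s by blast
  show "smooth_manifold (base ?V)" using vector_bundleD(1)[OF V] by simp
  show "proj ?V x \<in> points (base ?V)" if "x \<in> total ?V" for x using that vector_bundleD(4)[OF V] by simp
  show "trivialization V r t'" if "t' \<in> triv ?V" for t' using that rr t(1) by auto
  show "\<exists>t\<in>triv ?V. m \<in> fst t" if "m \<in> points (base ?V)" for m
    using vector_bundleD(6)[OF V, of m] that by force
  fix a b c x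
  assume h: "a \<in> triv ?V" "b \<in> triv ?V" "c \<in> base ?V" "x \<in> total ?V" "proj ?V x \<in> fst a" "proj ?V x \<in> fst b"
    "proj ?V x \<in> fst c"
  have x: "x \<in> total V" "proj V x \<in> fst a" "proj V x \<in> fst b" "proj V x \<in> fst c" "c \<in> base V" using h by auto
  have cm: "(fst c, snd c) \<in> max_atlas (base V)" using x(5) max_atlas_superset[OF A] by auto
  have fl: "smooth_fun_at (total_atlas V) UNIV (snd b) x"
  proof (cases "b \<in> triv V")
    case True
    then show ?thesis using smooth_at_triv[OF V, of "fst b" "snd b" x UNIV] triv_subset_max_triv[OF V] x by auto
  next
    case False
    then show ?thesis using h(2) to x by auto
  qed
  have old: "local_rep UNIV (tchart V c t') euc (snd b) x" if t': "t' \<in> triv V" "proj V x \<in> fst t'" for t'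
    using smooth_fun_at_local_rep[OF T fl max_trivD(3)[OF V, of "fst t'" "snd t'" "fst c" "snd c"]]
      t' x cm triv_subset_max_triv[OF V] by (auto simp: fst_tchart)
  show "local_rep UNIV (tchart V c a) euc (snd b) x"
  proof (cases "a \<in> triv V")
    case True
    then show ?thesis using old x by blast
  next
    case False
    then have a: "a = (U, \<tau>)" using h(1) by auto
    obtain X \<phi> where c: "c = (X, \<phi>)" by (metis surj_pair)
    have pU: "proj V x \<in> X \<inter> U" using x a c by auto
    have "local_rep UNIV (tchart V c a) (X \<inter> U, \<phi>) (proj V) x"
      unfolding a c by (rule local_rep_tchart_proj[OF x(1) pU]) simp
    then have "local_rep UNIV (tchart V c a) (X \<inter> U0, \<phi>) (\<lambda>x. proj V x) x"
      by (rule local_rep_cod) (use t(2) in auto)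
    then have "local_rep UNIV (tchart V c a) (tchart V (X, \<phi>) (U0, \<tau>0)) (\<lambda>x. x) x"
      by (rule local_rep_tchartI) (use fro[OF x(5,1)] pU c a in \<open>auto simp: fst_tchart\<close>)
    from local_rep_compose[OF this, of UNIV _ "snd b"] old[OF t0(1)] pU t(2) c show ?thesis by auto
  qed
qed

lemma openin_prod_manifold:
  assumes A: "smooth_atlas \<A>" "smooth_atlas \<B>"
    and U: "openin (manifold_topology \<A>) U" "openin (manifold_topology \<B>) X"
  shows "openin (manifold_topology (prod_atlas \<A> \<B>)) (U \<times> X)"
proof -
  note AB = smooth_atlas_prod[OF A]
  have UX: "U \<subseteq> points \<A>" "X \<subseteq> points \<B>"
    using U openin_subset topspace_manifold_topology[OF A(1)] topspace_manifold_topology[OF A(2)] by blast+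
  have top: "openin (manifold_topology (prod_atlas \<A> \<B>)) (points (prod_atlas \<A> \<B>))"
    using openin_topspace topspace_manifold_topology[OF AB] by metis
  have "openin (manifold_topology (prod_atlas \<A> \<B>)) {p \<in> points (prod_atlas \<A> \<B>). fst p \<in> U}"
    "openin (manifold_topology (prod_atlas \<A> \<B>)) {p \<in> points (prod_atlas \<A> \<B>). snd p \<in> X}"
    using smooth_at_fst_snd[OF A] openin_vimage_local_rep[OF AB A(1) U(1) _ top, of fst]
      openin_vimage_local_rep[OF AB A(2) U(2) _ top, of snd]
    by (simp_all add: smooth_at_def points_prod_atlas)
  then have "openin (manifold_topology (prod_atlas \<A> \<B>))
      ({p \<in> points (prod_atlas \<A> \<B>). fst p \<in> U} \<inter> {p \<in> points (prod_atlas \<A> \<B>). snd p \<in> X})"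
    by (rule openin_Int)
  moreover have "{p \<in> points (prod_atlas \<A> \<B>). fst p \<in> U} \<inter> {p \<in> points (prod_atlas \<A> \<B>). snd p \<in> X}
      = U \<times> X" using UX by (auto simp: points_prod_atlas)
  ultimately show ?thesis by simp
qed

text \<open>The graph of a bundle map \<open>\<rho> : \<Phi>\<^sup>* V2 \<rightarrow> V1\<close> is flattened by the shear
  \<open>(x, y) \<mapsto> (\<tau> x, \<sigma> y - B (\<tau> x))\<close>, where \<open>B\<close> is the matrix of \<open>\<rho>\<close> in the trivializations \<open>\<tau>\<close> and \<open>\<sigma>\<close>.\<close>

lemma graph_subbundle:
  fixes V2 :: "('n, 'c::euclidean_space, 'd, 'g::euclidean_space, 'y) vbundle_scheme"
    and V1 :: "('m, 'b::euclidean_space, 'a, 'f::euclidean_space, 'z) vbundle_scheme"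
  assumes V2: "vector_bundle V2" and V1: "vector_bundle V1" and Phi: "smooth_map (base V1) (base V2) \<Phi>"
    and Gr: "Gr = {(\<Phi> m, m) | m. m \<in> points (base V1)}"
    and emb: "embedded_submanifold (prod_atlas (base V2) (base V1)) Gr"
    and rho: "\<And>m x. m \<in> points (base V1) \<Longrightarrow> x \<in> fiber V2 (\<Phi> m) \<Longrightarrow> \<rho> m x \<in> fiber V1 m"
    and add: "\<And>m x y. m \<in> points (base V1) \<Longrightarrow> x \<in> fiber V2 (\<Phi> m) \<Longrightarrow> y \<in> fiber V2 (\<Phi> m) \<Longrightarrow>
      \<rho> m (vadd V2 x y) = vadd V1 (\<rho> m x) (\<rho> m y)"
    and sc: "\<And>m x c. m \<in> points (base V1) \<Longrightarrow> x \<in> fiber V2 (\<Phi> m) \<Longrightarrow> \<rho> m (vscale V2 c x) = vscale V1 c (\<rho> m x)"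
    and sm: "\<And>m0. m0 \<in> points (base V1) \<Longrightarrow> \<exists>U \<tau> X \<sigma>. (U, \<tau>) \<in> triv V2 \<and> \<Phi> m0 \<in> U \<and> (X, \<sigma>) \<in> triv V1 \<and> m0 \<in> X \<and>
      (\<forall>w\<in>\<tau> ` fiber V2 (\<Phi> m0). smooth_fun_at (base V1) {m \<in> X. \<Phi> m \<in> U}
        (\<lambda>m. \<sigma> (\<rho> m (inv_into (fiber V2 (\<Phi> m)) \<tau> w))) m0)"
  shows "vector_subbundle (prod_bundle V2 V1) Gr {(x, \<rho> m x) | m x. m \<in> points (base V1) \<and> x \<in> fiber V2 (\<Phi> m)}"
    (is "vector_subbundle ?P Gr ?R")
proof -
  note A2 = vector_bundleD(2)[OF V2] and A1 = vector_bundleD(2)[OF V1]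
  note P = vector_bundle_prod[OF V2 V1]
  note AP = vector_bundleD(2)[OF P] and TP = vector_bundleD(3)[OF P]
  obtain r2 r1 where r: "\<forall>t\<in>triv V2. trivialization V2 r2 t" "\<forall>t\<in>triv V1. trivialization V1 r1 t"
    using vector_bundleD(5)[OF V2] vector_bundleD(5)[OF V1] by blast
  show ?thesis
  proof (rule vector_subbundleI[OF P, where d=r2])
    show "embedded_submanifold (base ?P) Gr" using emb by simp
    show "?R \<subseteq> total ?P" using rho by (auto simp: fiber_def)
    show "proj ?P x \<in> Gr" if "x \<in> ?R" for x using that rho unfolding Gr by (auto simp: fiber_def)
  next
    fix p assume "p \<in> Gr"
    then obtain m0 where m0: "m0 \<in> points (base V1)" "p = (\<Phi> m0, m0)" unfolding Gr by blast
    obtain U \<tau> X \<sigma> where US: "(U, \<tau>) \<in> triv V2" "\<Phi> m0 \<in> U" "(X, \<sigma>) \<in> triv V1" "m0 \<in> X"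
      and smw: "\<And>w. w \<in> \<tau> ` fiber V2 (\<Phi> m0) \<Longrightarrow> smooth_fun_at (base V1) {m \<in> X. \<Phi> m \<in> U}
        (\<lambda>m. \<sigma> (\<rho> m (inv_into (fiber V2 (\<Phi> m)) \<tau> w))) m0"
      using sm[OF m0(1)] by blast
    have rt: "trivialization V2 r2 (U, \<tau>)" "trivialization V1 r1 (X, \<sigma>)" using r US by auto
    obtain W2 where W2: "subspace W2" "dim W2 = r2" "\<And>m. m \<in> U \<Longrightarrow> bij_betw \<tau> (fiber V2 m) W2" using trivializationD(6)[OF rt(1)] by blast
    obtain W1 where W1: "subspace W1" "dim W1 = r1" "\<And>m. m \<in> X \<Longrightarrow> bij_betw \<sigma> (fiber V1 m) W1" using trivializationD(6)[OF rt(2)] by blast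
    define N where "N = {m \<in> X. \<Phi> m \<in> U}"
    have Xp: "X \<subseteq> points (base V1)"
      using trivializationD(1)[OF rt(2)] openin_subset topspace_manifold_topology[OF A1] by blast
    have N: "openin (manifold_topology (base V1)) N" "m0 \<in> N"
    proof -
      have "smooth_at (base V1) X (base V2) \<Phi> q" if "q \<in> X" for q
        using smooth_at_mono[OF _ Xp that] smooth_map_onD[OF Phi A1 A2] Xp that by blast
      then have "\<exists>c\<in>max_atlas (base V1). \<exists>c'\<in>max_atlas (base V2). local_rep X c c' \<Phi> q" if "q \<in> X" for q
        using that unfolding smooth_at_def by blast
      from openin_vimage_local_rep[OF A1 A2 trivializationD(1)[OF rt(1)] this trivializationD(1)[OF rt(2)]]
      show "openin (manifold_topology (base V1)) N" unfolding N_def .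
      show "m0 \<in> N" unfolding N_def using US by simp
    qed
    define \<iota> where "\<iota> m = inv_into (fiber V2 (\<Phi> m)) \<tau>" for m
    \<comment> \<open>The matrix of \<open>\<rho>\<close> in the two trivializations, applied to the
      constant coordinate \<open>w\<close>.\<close>
    define \<beta> where "\<beta> m w = \<sigma> (\<rho> m (\<iota> m w))" for m w
    have NU: "\<Phi> m \<in> U" "m \<in> X" "m \<in> points (base V1)" if "m \<in> N" for m using that Xp by (auto simp: N_def)
    have img: "\<tau> ` fiber V2 (\<Phi> m) = W2" if "m \<in> N" for m using W2(3)[OF NU(1)[OF that]] by (simp add: bij_betw_def)
    have io: "\<iota> m w \<in> fiber V2 (\<Phi> m)" "\<tau> (\<iota> m w) = w" if "m \<in> N" "w \<in> W2" for m w
      using fiber_rep[OF rt(1) NU(1)[OF that(1)], of W2 w] img[OF that(1)] that(2) unfolding \<iota>_def by auto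
    have lin1: "\<beta> m (v + w) = \<beta> m v + \<beta> m w" if "m \<in> N" "v \<in> W2" "w \<in> W2" for m v w
    proof -
      have "\<iota> m (v + w) = vadd V2 (\<iota> m v) (\<iota> m w)"
        unfolding \<iota>_def using inv_triv_linear(1)[OF rt(1) NU(1)[OF that(1)]] that img[OF that(1)] by blast
      then show ?thesis
        using trivializationD(2)[OF rt(2) NU(2)[OF that(1)]] add[OF NU(3)[OF that(1)]] rho[OF NU(3)[OF that(1)]] io[OF that(1)] that
        unfolding \<beta>_def fiber_linear_def by simp
    qed
    have lin2: "\<beta> m (c *\<^sub>R v) = c *\<^sub>R \<beta> m v" if "m \<in> N" "v \<in> W2" for m v c
    proof -
      have "\<iota> m (c *\<^sub>R v) = vscale V2 c (\<iota> m v)"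
        unfolding \<iota>_def using inv_triv_linear(2)[OF rt(1) NU(1)[OF that(1)], of v v] that img[OF that(1)] by blast
      then show ?thesis
        using trivializationD(2)[OF rt(2) NU(2)[OF that(1)]] sc[OF NU(3)[OF that(1)]] rho[OF NU(3)[OF that(1)]] io[OF that(1)] that
        unfolding \<beta>_def fiber_linear_def by simp
    qed
    have smb: "smooth_fun_at (base V1) N (\<lambda>m. \<beta> m w) m0" if "w \<in> W2" for w
      unfolding \<beta>_def \<iota>_def N_def by (rule smw) (use that img[OF N(2)] in simp)
    obtain Y \<psi> where Y: "(Y, \<psi>) \<in> max_atlas (base V1)" "m0 \<in> Y" using chart_at[OF A1 m0(1)] by blast
    obtain Q B where Q: "\<psi> m0 \<in> Q" "open Q" "\<And>y. linear (B y)" "\<And>v. smooth_open Q (\<lambda>y. B y v)"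
      "\<And>m. m \<in> Y \<Longrightarrow> \<psi> m \<in> Q \<Longrightarrow> m \<in> N \<and> (\<forall>w\<in>W2. B (\<psi> m) w = \<beta> m w)"
      by (rule smooth_linear_family[of "base V1" N m0 W2 \<beta> Y \<psi>])
        (assumption | rule A1 N W2(1) lin1 lin2 smb Y that)+
    \<comment> \<open>The smooth family \<open>B\<close> represents \<open>\<rho>\<close> only here.
      Over \<open>Z\<close> it maps \<open>W2\<close> into \<open>W1\<close>, which keeps the shear
      inside the model space \<open>W2 \<times> W1\<close>.\<close>
    define Z where "Z = Y \<inter> \<psi> -` Q"
    have Z: "openin (manifold_topology (base V1)) Z" "m0 \<in> Z" "Z \<subseteq> N" "Z \<subseteq> X"
      unfolding Z_def using openin_chart_vimage[OF A1 Y(1) Q(2)] Y(2) Q(1,5) NU(2) by auto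
    have BZ: "B (\<psi> m) w = \<beta> m w" if "m \<in> Z" "w \<in> W2" for m w using Q(5)[of m] that by (auto simp: Z_def)
    have BW: "B (\<psi> m) w \<in> W1" if "m \<in> Z" "w \<in> W2" for m w
    proof -
      have mN: "m \<in> N" using that Z by auto
      show ?thesis unfolding BZ[OF that] \<beta>_def
        using W1(3)[OF NU(2)[OF mN]] rho[OF NU(3)[OF mN] io(1)[OF mN that(2)]] by (simp add: bij_betwE)
    qed
    define \<theta> where "\<theta> z = (\<tau> (fst z), \<sigma> (snd z) - B (\<psi> (proj V1 (snd z))) (\<tau> (fst z)))" for z
    have t0: "(U \<times> X, map_prod \<tau> \<sigma>) \<in> triv ?P" using US by (auto simp: prod_bundle_def)
    note rt0 = trivialization_prod[OF A2 A1 rt]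
    have UZ: "openin (manifold_topology (prod_atlas (base V2) (base V1))) (U \<times> Z)"
      by (rule openin_prod_manifold[OF A2 A1 trivializationD(1)[OF rt(1)] Z(1)])
    have tm: "trivialization ?P (r2 + r1) (U \<times> Z, \<theta>)"
      unfolding trivialization_def prod.case
    proof (intro conjI ballI allI exI[of _ "W2 \<times> W1"])
      show "openin (manifold_topology (base ?P)) (U \<times> Z)" using UZ by simp
      show "subspace (W2 \<times> W1)" "dim (W2 \<times> W1) = r2 + r1" using W2 W1 by (auto simp: subspace_Times dim_Times)
      fix m assume m: "m \<in> U \<times> Z"
      obtain a b where ab: "m = (a, b)" "a \<in> U" "b \<in> Z" "b \<in> X" using m Z(4) by auto
      have mUX: "m \<in> U \<times> X" using ab by auto
      have th: "\<theta> z = (\<tau> (fst z), \<sigma> (snd z) - B (\<psi> b) (\<tau> (fst z)))" if "z \<in> fiber ?P m" for z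
        using that unfolding \<theta>_def ab fiber_prod by (auto simp: fiber_def)
      have f: "bij_betw \<tau> (fiber V2 a) W2" "bij_betw \<sigma> (fiber V1 b) W1" using W2(3)[OF ab(2)] W1(3)[OF ab(4)] by auto
      show "bij_betw \<theta> (fiber ?P m) (W2 \<times> W1)"
        unfolding bij_betw_def
      proof
        show "inj_on \<theta> (fiber ?P m)"
        proof (rule inj_onI)
          fix x y assume xy: "x \<in> fiber ?P m" "y \<in> fiber ?P m" "\<theta> x = \<theta> y"
          have e: "\<tau> (fst x) = \<tau> (fst y)" "\<sigma> (snd x) = \<sigma> (snd y)" using xy(3) unfolding th[OF xy(1)] th[OF xy(2)] by auto
          have "fst x \<in> fiber V2 a" "fst y \<in> fiber V2 a" "snd x \<in> fiber V1 b" "snd y \<in> fiber V1 b"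
            using xy unfolding ab fiber_prod by auto
          then show "x = y" using e f unfolding bij_betw_def inj_on_def by (metis prod.expand)
        qed
        show "\<theta> ` fiber ?P m = W2 \<times> W1"
        proof (rule equalityI; rule subsetI)
          fix z assume "z \<in> \<theta> ` fiber ?P m"
          then obtain x where x: "x \<in> fiber ?P m" "z = \<theta> x" by blast
          have "\<tau> (fst x) \<in> W2" "\<sigma> (snd x) \<in> W1" using x(1) f unfolding ab fiber_prod by (auto simp: bij_betwE)
          then show "z \<in> W2 \<times> W1" unfolding x(2) th[OF x(1)] using BW[OF ab(3)] subspace_diff[OF W1(1)] by auto
        next
          fix z assume "z \<in> W2 \<times> W1"
          then obtain u v where uv: "z = (u, v)" "u \<in> W2" "v \<in> W1" by auto
          then have "v + B (\<psi> b) u \<in> W1" using BW[OF ab(3)] subspace_add[OF W1(1)] by auto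
          then obtain x y where xy: "x \<in> fiber V2 a" "\<tau> x = u" "y \<in> fiber V1 b" "\<sigma> y = v + B (\<psi> b) u"
            using uv f unfolding bij_betw_def by (metis imageE)
          then have "(x, y) \<in> fiber ?P m" unfolding ab fiber_prod by auto
          moreover from th[OF this] have "\<theta> (x, y) = z" using xy uv by simp
          ultimately show "z \<in> \<theta> ` fiber ?P m" by blast
        qed
      qed
      have fl: "fiber_linear ?P m (map_prod \<tau> \<sigma>)" by (rule trivializationD(2)[OF rt0 mUX])
      fix x assume x: "x \<in> fiber ?P m"
      have q: "\<theta> z = (fst (map_prod \<tau> \<sigma> z), snd (map_prod \<tau> \<sigma> z) - B (\<psi> b) (fst (map_prod \<tau> \<sigma> z)))" if "z \<in> fiber ?P m" for z
        using th[OF that] by (cases z) auto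
      {
        fix y assume y: "y \<in> fiber ?P m"
        show v: "vadd ?P x y \<in> fiber ?P m" by (rule trivializationD(4)[OF rt0 mUX x y])
        show "\<theta> (vadd ?P x y) = \<theta> x + \<theta> y"
          unfolding q[OF v] q[OF x] q[OF y] using fl x y Q(3) by (simp add: fiber_linear_def linear_add)
      next
        fix c
        show v: "vscale ?P c x \<in> fiber ?P m" by (rule trivializationD(5)[OF rt0 mUX x])
        show "\<theta> (vscale ?P c x) = c *\<^sub>R \<theta> x"
          unfolding q[OF v] q[OF x] using fl x Q(3) by (simp add: fiber_linear_def linear_scale scaleR_diff_right)
      }
    qed
    have base2: "smooth_fun_at (prod_atlas (base V2) (base V1)) UNIV (\<lambda>m. \<psi> (snd m)) m" if m: "m \<in> U \<times> Z" for m
    proof -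
      have mp: "m \<in> points (base V2) \<times> points (base V1)"
        using m openin_subset[OF UZ] unfolding topspace_manifold_topology[OF smooth_atlas_prod[OF A2 A1]] points_prod_atlas
        by blast
      have "smooth_fun_at (base V1) UNIV \<psi> (snd m)"
        by (rule smooth_fun_atI[OF Y(1) local_rep_chart]) (use m in \<open>auto simp: Z_def\<close>)
      then show ?thesis by (rule smooth_at_compose[OF A1 smooth_at_fst_snd(2)[OF A2 A1 UNIV_I mp]]) simp
    qed
    have "(U \<times> Z, \<theta>) \<in> max_triv ?P"
    proof (rule max_trivI[OF P t0 rt0 tm])
      show "U \<times> Z \<subseteq> U \<times> X" "U \<times> Z \<noteq> {}" using Z US by auto
    next
      fix x assume x: "x \<in> total ?P" "proj ?P x \<in> U \<times> Z"
      obtain a b where ab: "x = (a, b)" "a \<in> total V2" "b \<in> total V1" "proj V2 a \<in> U" "proj V1 b \<in> Z" "proj V1 b \<in> X"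
        using x Z(4) by auto
      have "smooth_fun_at (total_atlas ?P) UNIV (map_prod \<tau> \<sigma>) x"
        using triv_subset_max_triv[OF P] t0 ab by (intro smooth_at_triv[OF P, of "U \<times> X"]) auto
      then have s12: "smooth_fun_at (total_atlas ?P) UNIV (\<lambda>z. fst (map_prod \<tau> \<sigma> z)) x"
        "smooth_fun_at (total_atlas ?P) UNIV (\<lambda>z. snd (map_prod \<tau> \<sigma> z)) x"
        using smooth_fun_at_linear[OF TP _ bounded_linear_fst] smooth_fun_at_linear[OF TP _ bounded_linear_snd] by blast+
      have s3: "smooth_fun_at (total_atlas ?P) UNIV (\<lambda>z. \<psi> (snd (proj ?P z))) x"
        by (rule smooth_at_compose[where g="\<lambda>m. \<psi> (snd m)" and T=UNIV, OF AP smooth_at_proj[OF P x(1) UNIV_I]])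
          (use base2[OF x(2)] in simp_all)
      have xp: "x \<in> points (total_atlas ?P)" using x points_total_atlas[OF P] by simp
      obtain D \<xi> where D: "(D, \<xi>) \<in> max_atlas (total_atlas ?P)" "x \<in> D" using chart_at[OF TP xp] by blast
      note lr = smooth_fun_at_local_rep[OF TP _ D(1)]
      have "local_rep UNIV (D, \<xi>) euc (\<lambda>z. B (\<psi> (snd (proj ?P z))) (fst (map_prod \<tau> \<sigma> z))) x"
        by (rule local_rep_linear_family[OF lr[OF s3] _ lr[OF s12(1)] Q(3,4)]) (use D ab in \<open>auto simp: Z_def\<close>)
      then have "smooth_fun_at (total_atlas ?P) UNIV (\<lambda>z. B (\<psi> (snd (proj ?P z))) (fst (map_prod \<tau> \<sigma> z))) x"
        by (rule smooth_fun_atI[OF D(1)])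
      from smooth_fun_at_Pair[OF TP s12(1) smooth_fun_at_diff[OF TP s12(2) this]]
      show "smooth_fun_at (total_atlas ?P) UNIV \<theta> x" by (simp add: \<theta>_def[abs_def] case_prod_unfold map_prod_def)
    next
      fix c x assume c: "c \<in> base ?P" and x: "x \<in> total ?P" "proj ?P x \<in> U \<times> Z" "proj ?P x \<in> fst c"
      obtain D \<phi> where D: "c = (D, \<phi>)" by (metis surj_pair)
      let ?c = "tchart ?P c (U \<times> Z, \<theta>)"
      have l1: "local_rep UNIV ?c euc \<theta> x"
        unfolding D by (rule local_rep_tchart_triv) (use x D in auto)
      have cD: "(D \<inter> U \<times> Z, \<phi>) \<in> max_atlas (base ?P)"
        using max_atlas_Int[OF AP _ trivializationD(1)[OF tm]] c D max_atlas_superset[OF AP] by blast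
      have pr: "local_rep UNIV ?c (D \<inter> U \<times> Z, \<phi>) (proj ?P) x"
        unfolding D by (rule local_rep_tchart_proj) (use x D in auto)
      have "local_rep UNIV (D \<inter> U \<times> Z, \<phi>) euc (\<lambda>m. \<psi> (snd m)) (proj ?P x)"
        by (rule smooth_fun_at_local_rep[OF AP _ cD]) (use base2[OF x(2)] x D in auto)
      then have l2: "local_rep UNIV ?c euc (\<lambda>z. \<psi> (snd (proj ?P z))) x"
        by (rule local_rep_compose[where f="proj ?P" and g="\<lambda>m. \<psi> (snd m)", OF pr]) simp
      \<comment> \<open>Inverse shear: the old second coordinate is the new one plus
        \<open>B\<close> applied to the first coordinate, which the shear leaves fixed.\<close>
      have l3: "local_rep UNIV ?c euc (\<lambda>z. fst (\<theta> z)) x" "local_rep UNIV ?c euc (\<lambda>z. snd (\<theta> z)) x"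
        by (intro local_rep_linear[OF l1] bounded_linear_fst bounded_linear_snd)+
      have "local_rep UNIV ?c euc (\<lambda>z. B (\<psi> (snd (proj ?P z))) (fst (\<theta> z))) x"
        by (rule local_rep_linear_family[OF l2 _ l3(1) Q(3,4)]) (use x in \<open>auto simp: Z_def\<close>)
      from local_rep_euc_Pair[OF l3(1) local_rep_euc_add[OF l3(2) this]]
      show "local_rep UNIV ?c euc (map_prod \<tau> \<sigma>) x" by (simp add: \<theta>_def case_prod_unfold map_prod_def)
    qed
    moreover have "\<theta> ` (?R \<inter> fiber ?P m) = W2 \<times> {0}" if m: "m \<in> U \<times> Z \<inter> Gr" for m
    proof -
      obtain b where b: "m = (\<Phi> b, b)" "b \<in> points (base V1)" "b \<in> Z" "\<Phi> b \<in> U" using m Gr by auto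
      have bN: "b \<in> N" using b Z by auto
      have Rm: "?R \<inter> fiber ?P m = (\<lambda>x. (x, \<rho> b x)) ` fiber V2 (\<Phi> b)"
        using rho b(2) unfolding b fiber_prod by (force simp: fiber_def)
      have th: "\<theta> (x, \<rho> b x) = (\<tau> x, 0)" if x: "x \<in> fiber V2 (\<Phi> b)" for x
      proof -
        have tx: "\<tau> x \<in> W2" using img[OF bN] x by blast
        have "\<iota> b (\<tau> x) = x" unfolding \<iota>_def by (rule inv_into_f_f[OF trivializationD(3)[OF rt(1) b(4)] x])
        then have "B (\<psi> b) (\<tau> x) = \<sigma> (\<rho> b x)" using BZ[OF b(3) tx] by (simp add: \<beta>_def)
        moreover have "proj V1 (\<rho> b x) = b" using rho[OF b(2) x] by (simp add: fiber_def)
        ultimately show ?thesis by (simp add: \<theta>_def)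
      qed
      have "\<theta> ` (?R \<inter> fiber ?P m) = (\<lambda>x. (\<tau> x, 0)) ` fiber V2 (\<Phi> b)"
        unfolding Rm image_image using th by (rule image_cong[OF refl])
      also have "\<dots> = (\<lambda>w. (w, 0)) ` W2" using img[OF bN] by (auto simp: image_image[symmetric])
      finally show ?thesis by auto
    qed
    moreover have "subspace (W2 \<times> {0::'f})" "dim (W2 \<times> {0::'f}) = r2"
      using W2 by (auto simp: subspace_Times dim_Times subspace_single_0)
    moreover have "p \<in> U \<times> Z" using m0 US Z by auto
    ultimately show "\<exists>U \<tau> W. (U, \<tau>) \<in> max_triv ?P \<and> p \<in> U \<and> subspace W \<and> dim W = r2 \<and>
        (\<forall>m\<in>U \<inter> Gr. \<tau> ` (?R \<inter> fiber ?P m) = W)" by blast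
  qed
qed

subsection \<open>Subspaces of a fiber\<close>

text \<open>With the base chart centred at \<open>e\<close>, the subspace \<open>F\<close> becomes
  the slice \<open>{0} \<times> W\<close> of a chart of the total space. This will provide the
  manifold of units.\<close>

lemma embedded_fiber_subspace:
  assumes V: "vector_bundle V" and t: "(U, \<tau>) \<in> max_triv V" "e \<in> U" and F: "F \<subseteq> fiber V e" "\<tau> ` F = W" "subspace W"
  shows "embedded_submanifold (total_atlas V) F"
proof (rule embedded_submanifoldI[OF vector_bundleD(3)[OF V], where d="dim W"])
  note A = vector_bundleD(2)[OF V]
  fix u assume u: "u \<in> F"
  obtain r where r: "trivialization V r (U, \<tau>)" using max_trivD(1)[OF V t(1)] by blast
  have eb: "e \<in> points (base V)" using max_trivD(2)[OF V t(1)] t(2) by blast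
  obtain X \<phi> where X: "(X, \<phi>) \<in> max_atlas (base V)" "e \<in> X" using chart_at[OF A eb] by blast
  have inj: "inj_on \<phi> X" using max_atlas_dim[OF A] X(1) is_chart_inj by metis
  define \<psi> where "\<psi> x = \<phi> x - \<phi> e" for x
  have p0: "\<psi> x = 0 \<longleftrightarrow> x = e" if "x \<in> X" for x using inj X(2) that by (auto simp: \<psi>_def inj_on_eq_iff)
  have m: "(X, \<psi>) \<in> max_atlas (base V)" unfolding \<psi>_def by (rule max_atlas_translate[OF A X])
  let ?D = "{x \<in> total V. proj V x \<in> X \<inter> U}" and ?\<xi> = "\<lambda>x. (\<psi> (proj V x), \<tau> x)"
  have c: "(?D, ?\<xi>) \<in> max_atlas (total_atlas V)" using max_trivD(3)[OF V t(1) m] by (simp add: tchart_def)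
  have FD: "F \<subseteq> ?D" "\<And>x. x \<in> F \<Longrightarrow> ?\<xi> x = (0, \<tau> x)" using F(1) X(2) t(2) p0 by (auto simp: fiber_def)
  have img: "?\<xi> ` (?D \<inter> F) = {0} \<times> W"
  proof -
    have "?\<xi> ` (?D \<inter> F) = (\<lambda>x. (0, \<tau> x)) ` F" using FD by (intro image_cong) auto
    then show ?thesis using F(2) by auto
  qed
  have sl: "?\<xi> ` (?D \<inter> F) = ?\<xi> ` ?D \<inter> ({0} \<times> W)"
  proof (rule equalityI; rule subsetI)
    show "z \<in> ?\<xi> ` ?D \<inter> ({0} \<times> W)" if "z \<in> ?\<xi> ` (?D \<inter> F)" for z using that img by blast
    fix z assume "z \<in> ?\<xi> ` ?D \<inter> ({0} \<times> W)"
    then show "z \<in> ?\<xi> ` (?D \<inter> F)" unfolding img by blast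
  qed
  have ss: "subspace ({0 :: 'b} \<times> W)" using F(3) by (auto simp: subspace_Times subspace_single_0)
  moreover have "dim ({0 :: 'b} \<times> W) = dim W" using F(3) by (simp add: dim_Times subspace_single_0)
  ultimately show "\<exists>U \<phi> W'. (U, \<phi>) \<in> max_atlas (total_atlas V) \<and> u \<in> U \<and> subspace W' \<and> dim W' = dim W \<and>
      \<phi> ` (U \<inter> F) = \<phi> ` U \<inter> W' \<and> openin (top_of_set W') (\<phi> ` (U \<inter> F))"
    using c sl img FD(1) u
    by (intro exI[of _ ?D] exI[of _ ?\<xi>] exI[of _ "{0} \<times> W"]) auto
qed

text \<open>Within one fiber the base coordinate is constant, so an affine expression in fiber
  coordinates is enough. The sections of source and target constructed later are of this
  kind.\<close>

lemma smooth_at_fiber_affine: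
  assumes V: "vector_bundle V" and t: "(U, \<tau>) \<in> max_triv V" "e \<in> U" and F: "F \<subseteq> fiber V e"
    and s: "(X, \<sigma>) \<in> max_triv V" "g \<in> X" and f: "\<And>u. u \<in> F \<Longrightarrow> f u \<in> fiber V g"
    and L: "linear L" "\<And>u. u \<in> F \<Longrightarrow> \<sigma> (f u) = a + L (\<tau> u)" and u: "u \<in> F"
  shows "smooth_at (total_atlas V) F (total_atlas V) f u"
proof -
  note A = vector_bundleD(2)[OF V] and T = vector_bundleD(3)[OF V]
  have gb: "g \<in> points (base V)" using max_trivD(2)[OF V s(1)] s(2) by blast
  have uF: "u \<in> total V" "proj V u \<in> U" "u \<in> points (total_atlas V)"
    using u F t(2) points_total_atlas[OF V] by (auto simp: fiber_def)
  show ?thesis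
  proof (rule smooth_at_totalI[OF V T _ s(1)])
    show "smooth_at (total_atlas V) F (base V) (\<lambda>q. proj V (f q)) u"
      by (rule smooth_at_cong[OF smooth_at_const[OF T A u uF(3) gb]]) (use f in \<open>auto simp: fiber_def\<close>)
    show "proj V (f u) \<in> X" using f[OF u] s(2) by (simp add: fiber_def)
    have "smooth_fun_at (total_atlas V) F (\<lambda>q. L (\<tau> q)) u"
      by (rule smooth_fun_at_linear[OF T smooth_at_triv[OF V t(1) uF(1,2) u]])
        (use L(1) in \<open>simp add: linear_conv_bounded_linear\<close>)
    then have "smooth_fun_at (total_atlas V) F (\<lambda>q. a + L (\<tau> q)) u"
      by (intro smooth_fun_at_add[OF T] smooth_at_const[OF T smooth_atlas_euc u uF(3)]) simp_all
    then show "smooth_fun_at (total_atlas V) F (\<lambda>q. \<sigma> (f q)) u"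
      by (rule smooth_at_cong) (use L(2) in simp)
    show "f q \<in> total V" if "q \<in> F" for q using f[OF that] by (simp add: fiber_def)
  qed
qed

section \<open>Linear algebra of Lagrangian relations\<close>

text \<open>The bundle record has no field for the zero vector; it is obtained by scaling an
  arbitrary element of the fiber by \<open>0\<close>.\<close>

definition vzero :: "('m, 'b, 'a, 'f, 'z) vbundle_scheme \<Rightarrow> 'm \<Rightarrow> 'a" where
  "vzero V m = vscale V 0 (SOME x. x \<in> fiber V m)"

definition vdiff :: "('m, 'b, 'a, 'f, 'z) vbundle_scheme \<Rightarrow> 'a \<Rightarrow> 'a \<Rightarrow> 'a" where
  "vdiff V x y = vadd V x (vscale V (- 1) y)"

lemma fiber_coord:
  assumes V: "vector_bundle V" and m: "m \<in> points (base V)"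
  obtains U \<tau> r W where "(U, \<tau>) \<in> max_triv V" "m \<in> U" "trivialization V r (U, \<tau>)" "subspace W" "bij_betw \<tau> (fiber V m) W"
    "inj_on \<tau> (fiber V m)" "fiber_linear V m \<tau>"
proof -
  obtain U \<tau> where t: "(U, \<tau>) \<in> max_triv V" "m \<in> U" by (rule max_triv_at[OF V m])
  obtain r where r: "trivialization V r (U, \<tau>)" using max_trivD(1)[OF V t(1)] by blast
  then show ?thesis using that t trivializationD(2,3)[OF r t(2)] trivializationD(6)[OF r] by blast
qed

text \<open>The record does not postulate vector space axioms; they are transported from the model
  space along an injective, fiberwise linear trivialization.\<close>

lemma fiber_ops:
  assumes V: "vector_bundle V" and m: "m \<in> points (base V)" and x: "x \<in> fiber V m" and y: "y \<in> fiber V m"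
  shows "vadd V x y \<in> fiber V m" "vscale V c x \<in> fiber V m" "vdiff V x y \<in> fiber V m" "vzero V m \<in> fiber V m"
    "vscale V 0 x = vzero V m" "vadd V x (vzero V m) = x" "vadd V (vzero V m) x = x" "vdiff V x x = vzero V m"
    "vdiff V x y = vzero V m \<Longrightarrow> x = y" "vadd V y (vdiff V x y) = x" "vadd V (vdiff V x y) y = x"
    "vadd V x (vdiff V y x) = y"
proof -
  obtain U \<tau> r W where t: "(U, \<tau>) \<in> max_triv V" "m \<in> U" "trivialization V r (U, \<tau>)" "subspace W"
    "bij_betw \<tau> (fiber V m) W" "inj_on \<tau> (fiber V m)" "fiber_linear V m \<tau>" by (rule fiber_coord[OF V m])
  note cl = trivializationD(4,5)[OF t(3,2)]
  have l: "\<tau> (vadd V a b) = \<tau> a + \<tau> b" "\<tau> (vscale V c a) = c *\<^sub>R \<tau> a" if "a \<in> fiber V m" "b \<in> fiber V m" for a b c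
    using t(7) that by (auto simp: fiber_linear_def)
  have inj: "a = b" if "a \<in> fiber V m" "b \<in> fiber V m" "\<tau> a = \<tau> b" for a b using t(6) that by (auto simp: inj_on_def)
  have s: "(SOME x. x \<in> fiber V m) \<in> fiber V m" using x by (rule someI)
  show a: "vadd V x y \<in> fiber V m" "vscale V c x \<in> fiber V m" for c using cl x y by auto
  have df: "vdiff V a b \<in> fiber V m" "\<tau> (vdiff V a b) = \<tau> a - \<tau> b" if "a \<in> fiber V m" "b \<in> fiber V m" for a b
    using that cl l unfolding vdiff_def by auto
  show d: "vdiff V x y \<in> fiber V m" by (rule df(1)[OF x y])
  show z: "vzero V m \<in> fiber V m" unfolding vzero_def using cl s by auto
  have tz: "\<tau> (vzero V m) = 0" unfolding vzero_def using l(2)[OF s s] by simp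
  show "vscale V 0 x = vzero V m" by (rule inj) (use x cl z tz l(2)[OF x x] in auto)
  show "vadd V x (vzero V m) = x" by (rule inj) (use x cl z tz l(1)[OF x z] in auto)
  show "vadd V (vzero V m) x = x" by (rule inj) (use x cl z tz l(1)[OF z x] in auto)
  show "vdiff V x x = vzero V m" by (rule inj) (use df[OF x x] z tz in auto)
  show "x = y" if "vdiff V x y = vzero V m" by (rule inj) (use df[OF x y] that tz x y in auto)
  show "vadd V y (vdiff V x y) = x" by (rule inj) (use df[OF x y] cl l(1)[OF y d] x y in auto)
  show "vadd V (vdiff V x y) y = x" by (rule inj) (use df[OF x y] cl l(1)[OF d y] x y in auto)
  show "vadd V x (vdiff V y x) = y" by (rule inj) (use df[OF y x] cl l(1)[OF x df(1)[OF y x]] x y in auto)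
qed

lemma vzero_in: "vector_bundle V \<Longrightarrow> m \<in> points (base V) \<Longrightarrow> vzero V m \<in> fiber V m"
proof -
  assume V: "vector_bundle V" and m: "m \<in> points (base V)"
  obtain W and \<tau> :: "'c \<Rightarrow> 'd" where t: "subspace W" "bij_betw \<tau> (fiber V m) W" by (rule fiber_coord[OF V m]) blast
  then obtain x where "x \<in> fiber V m" using subspace_0 by (force simp: bij_betw_def)
  then show "vzero V m \<in> fiber V m" using fiber_ops(4)[OF V m] by blast
qed

text \<open>The inclusion of the double annihilator in \<open>D\<close>, for a nondegenerate but
  possibly indefinite form: the component of \<open>x\<close> orthogonal to \<open>D\<close> in
  coordinates is converted into a vector of the fiber by the inverse of the Gram operator.\<close>

lemma annihilator_separates:
  fixes V :: "('m, 'b::euclidean_space, 'a, 'f::euclidean_space, 'z) vbundle_scheme"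
  assumes V: "vector_bundle V" and m: "m \<in> points (base V)"
    and b: "\<And>x. x \<in> fiber V m \<Longrightarrow> fiber_linear V m (b x)" "\<And>x. x \<in> fiber V m \<Longrightarrow> fiber_linear V m (\<lambda>y. b y x)"
    and nd: "\<And>x. x \<in> fiber V m \<Longrightarrow> (\<And>y. y \<in> fiber V m \<Longrightarrow> b x y = (0::real)) \<Longrightarrow> x = vzero V m"
    and D: "D \<subseteq> fiber V m" "vzero V m \<in> D" "\<And>x y. x \<in> D \<Longrightarrow> y \<in> D \<Longrightarrow> vadd V x y \<in> D" "\<And>x c. x \<in> D \<Longrightarrow> vscale V c x \<in> D"
    and x: "x \<in> fiber V m" "x \<notin> D"
  shows "\<exists>w\<in>fiber V m. (\<forall>d\<in>D. b w d = 0) \<and> b w x \<noteq> 0"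
proof -
  obtain U \<tau> r W where t: "(U, \<tau>) \<in> max_triv V" "m \<in> U" "trivialization V r (U, \<tau>)" "subspace W"
    "bij_betw \<tau> (fiber V m) W" "inj_on \<tau> (fiber V m)" "fiber_linear V m \<tau>" by (rule fiber_coord[OF V m])
  have img: "\<tau> ` fiber V m = W" using t(5) by (simp add: bij_betw_def)
  define \<iota> where "\<iota> = inv_into (fiber V m) \<tau>"
  have io: "\<iota> w \<in> fiber V m" "\<tau> (\<iota> w) = w" if "w \<in> W" for w
    using fiber_rep[OF t(3,2) _ that] img unfolding \<iota>_def by auto
  have it: "\<iota> (\<tau> y) = y" if "y \<in> fiber V m" for y unfolding \<iota>_def by (rule inv_into_f_f[OF t(6) that])
  have il: "\<iota> (v + w) = vadd V (\<iota> v) (\<iota> w)" "\<iota> (c *\<^sub>R v) = vscale V c (\<iota> v)" if "v \<in> W" "w \<in> W" for v w c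
    using inv_triv_linear(1,2)[OF t(3,2)] that img unfolding \<iota>_def by blast+
  obtain \<pi> where \<pi>: "linear \<pi>" "\<And>v. \<pi> v \<in> W" "\<And>w. w \<in> W \<Longrightarrow> \<pi> w = w" using linear_projection[OF t(4)] by blast
  obtain B where B: "B \<subseteq> W" "pairwise orthogonal B" "\<And>x. x \<in> B \<Longrightarrow> norm x = 1" "independent B" "span B = W"
    using orthonormal_basis_subspace[OF t(4)] by metis
  have finB: "finite B" by (rule independent_imp_finite[OF B(4)])
  have ex: "(\<Sum>d\<in>B. (w \<bullet> d) *\<^sub>R d) = w" if "w \<in> W" for w
    by (rule orthonormal_basis_expand[OF B(2,3) _ finB]) (use that B(5) in auto)
  \<comment> \<open>The Gram operator: it expresses the form \<open>b\<close> through the Euclidean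
    inner product on the coordinate space \<open>W\<close>.\<close>
  define T where "T u = (\<Sum>i\<in>B. b (\<iota> (\<pi> u)) (\<iota> i) *\<^sub>R i)" for u
  have bil: "b (\<iota> (\<pi> (u + v))) (\<iota> i) = b (\<iota> (\<pi> u)) (\<iota> i) + b (\<iota> (\<pi> v)) (\<iota> i)"
    "b (\<iota> (\<pi> (c *\<^sub>R u))) (\<iota> i) = c * b (\<iota> (\<pi> u)) (\<iota> i)" if "i \<in> B" for u v i c
  proof -
    have i: "\<iota> i \<in> fiber V m" using io(1) B(1) that by blast
    show "b (\<iota> (\<pi> (u + v))) (\<iota> i) = b (\<iota> (\<pi> u)) (\<iota> i) + b (\<iota> (\<pi> v)) (\<iota> i)"
      "b (\<iota> (\<pi> (c *\<^sub>R u))) (\<iota> i) = c * b (\<iota> (\<pi> u)) (\<iota> i)"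
      unfolding linear_add[OF \<pi>(1)] linear_scale[OF \<pi>(1)] il[OF \<pi>(2) \<pi>(2)]
      using b(2)[OF i] io(1)[OF \<pi>(2)] by (auto simp: fiber_linear_def)
  qed
  have lT: "linear T"
    unfolding T_def by (rule linearI) (simp_all add: bil scaleR_add_left sum.distrib scaleR_sum_right cong: sum.cong)
  have Tb: "T u \<bullet> w = b (\<iota> u) (\<iota> w)" if u: "u \<in> W" and w: "w \<in> W" for u w
  proof -
    have "linear (\<lambda>w. b (\<iota> u) (\<iota> (\<pi> w)))"
      by (rule linearI; unfold linear_add[OF \<pi>(1)] linear_scale[OF \<pi>(1)] il[OF \<pi>(2) \<pi>(2)])
        (use b(1)[OF io(1)[OF u]] io(1)[OF \<pi>(2)] in \<open>auto simp: fiber_linear_def\<close>)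
    then have "b (\<iota> u) (\<iota> (\<pi> (\<Sum>d\<in>B. (w \<bullet> d) *\<^sub>R d))) = (\<Sum>d\<in>B. (w \<bullet> d) *\<^sub>R b (\<iota> u) (\<iota> (\<pi> d)))"
      by (simp only: linear_sum[of "\<lambda>w. b (\<iota> u) (\<iota> (\<pi> w))"] linear_scale[of "\<lambda>w. b (\<iota> u) (\<iota> (\<pi> w))"])
    also have "\<dots> = (\<Sum>d\<in>B. (w \<bullet> d) * b (\<iota> u) (\<iota> d))"
      by (rule sum.cong[OF refl]) (use \<pi>(3) B(1) in auto)
    finally have "b (\<iota> u) (\<iota> w) = (\<Sum>d\<in>B. (w \<bullet> d) * b (\<iota> u) (\<iota> d))"
      unfolding ex[OF w] \<pi>(3)[OF w] .
    then show ?thesis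
      unfolding T_def \<pi>(3)[OF u] inner_sum_left inner_scaleR_left by (simp add: inner_commute[of w] mult.commute)
  qed
  have TW: "T ` W \<subseteq> W" unfolding T_def using B(1) by (auto intro!: subspace_sum[OF t(4)] subspace_scale[OF t(4)])
  have injT: "inj_on T W"
  proof (rule inj_onI)
    fix u v assume uv: "u \<in> W" "v \<in> W" "T u = T v"
    have d: "u - v \<in> W" "T (u - v) = 0" using uv subspace_diff[OF t(4)] linear_diff[OF lT] by auto
    have z: "vzero V m \<in> fiber V m" by (rule vzero_in[OF V m])
    have "\<tau> (vzero V m) = 0"
      using t(7) z fiber_ops(5)[OF V m z z] unfolding fiber_linear_def by (metis scale_zero_left)
    moreover have "\<iota> (u - v) = vzero V m"
    proof (rule nd[OF io(1)[OF d(1)]])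
      fix y assume y: "y \<in> fiber V m"
      then have "\<tau> y \<in> W" using img by blast
      from Tb[OF d(1) this] show "b (\<iota> (u - v)) y = 0" using d(2) it[OF y] by simp
    qed
    ultimately have "u - v = 0" using io(2)[OF d(1)] by simp
    then show "u = v" by simp
  qed
  \<comment> \<open>Nondegeneracy makes \<open>T\<close> injective on \<open>W\<close>, and the
    dimension count makes it surjective onto \<open>W\<close>.\<close>
  have "dim (T ` W) = dim W" using dim_image_eq[OF lT, of W] injT t(4) by (simp add: span_eq_iff[THEN iffD2])
  then have TWeq: "T ` W = W"
    using subspace_dim_equal[OF linear_subspace_image[OF lT t(4)] t(4) TW] by simp
  have sD: "subspace (\<tau> ` D)"
  proof (rule subspaceI)
    have "\<tau> (vzero V m) = 0"
      using t(7) D(1,2) fiber_ops(5)[OF V m, of "vzero V m" "vzero V m"] unfolding fiber_linear_def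
      by (metis scale_zero_left subsetD)
    then show "0 \<in> \<tau> ` D" using D(2) by (metis imageI)
    show "u + v \<in> \<tau> ` D" if uv: "u \<in> \<tau> ` D" "v \<in> \<tau> ` D" for u v
    proof -
      obtain p q where pq: "p \<in> D" "u = \<tau> p" "q \<in> D" "v = \<tau> q" using uv by blast
      then have "p \<in> fiber V m" "q \<in> fiber V m" using D(1) by auto
      then have "u + v = \<tau> (vadd V p q)" using t(7) pq by (simp add: fiber_linear_def)
      then show ?thesis using D(3)[OF pq(1,3)] by blast
    qed
    show "c *\<^sub>R u \<in> \<tau> ` D" if u: "u \<in> \<tau> ` D" for c u
    proof -
      obtain p where p: "p \<in> D" "u = \<tau> p" using u by blast
      then have "p \<in> fiber V m" using D(1) by auto
      then have "c *\<^sub>R u = \<tau> (vscale V c p)" using t(7) p by (simp add: fiber_linear_def)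
      then show ?thesis using D(4)[OF p(1)] by blast
    qed
  qed
  \<comment> \<open>Euclidean decomposition of the coordinate of \<open>x\<close> along
    \<open>D\<close>. The orthogonal part \<open>z\<close> is nonzero because \<open>x\<close> is
    not in \<open>D\<close>, and \<open>z \<bullet> \<tau> x\<close> is its squared norm.\<close>
  obtain y z where yz: "y \<in> span (\<tau> ` D)" "\<And>w. w \<in> span (\<tau> ` D) \<Longrightarrow> orthogonal z w" "\<tau> x = y + z"
    using orthogonal_subspace_decomp_exists[of "\<tau> ` D" "\<tau> x"] by blast
  have sp: "span (\<tau> ` D) = \<tau> ` D" using sD by (simp add: span_eq_iff)
  have yW: "y \<in> W" using yz(1) sp D(1) img by blast
  have xW: "\<tau> x \<in> W" using x(1) img by blast
  have zW: "z \<in> W" using subspace_diff[OF t(4) xW yW] yz(3) by simp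
  have z0: "z \<noteq> 0"
  proof
    assume "z = 0"
    then obtain d where "d \<in> D" "\<tau> x = \<tau> d" using yz sp by auto
    then show False using x t(6) D(1) by (metis inj_on_eq_iff subsetD)
  qed
  have "z \<in> T ` W" using zW TWeq by simp
  then obtain u where u: "u \<in> W" "T u = z" by auto
  have "b (\<iota> u) d = z \<bullet> \<tau> d" if "d \<in> fiber V m" for d
    using Tb[OF u(1), of "\<tau> d"] u(2) it[OF that] that img by auto
  moreover have "z \<bullet> \<tau> d = 0" if "d \<in> D" for d
    using yz(2)[of "\<tau> d"] that sp by (auto simp: orthogonal_def)
  moreover have "z \<bullet> \<tau> x \<noteq> 0"
    using yz(2)[OF yz(1)] z0 unfolding yz(3) by (simp add: orthogonal_def inner_add_right)
  ultimately have "\<forall>d\<in>D. b (\<iota> u) d = 0" "b (\<iota> u) x \<noteq> 0" using D(1) x(1) by (simp_all add: subset_iff)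
  then show ?thesis using io(1)[OF u(1)] by blast
qed

section \<open>Dirac structures and Dirac morphisms, fiber by fiber\<close>

lemma prod_courant_simps [simp]:
  "base (prod_courant A B) = prod_atlas (base A) (base B)"
  "total (prod_courant A B) = total A \<times> total B"
  "proj (prod_courant A B) = map_prod (proj A) (proj B)"
  "vadd (prod_courant A B) = vadd (prod_bundle A B)"
  "vscale (prod_courant A B) = vscale (prod_bundle A B)"
  "triv (prod_courant A B) = triv (prod_bundle A B)"
  "metric (prod_courant A B) (x, y) (x', y') = metric A x x' + metric B y y'"
  by (simp_all add: prod_courant_def vbundle.extend_def courant.fields_def prod_bundle_def)

lemma opposite_simps [simp]:
  "base (opposite A) = base A" "total (opposite A) = total A" "proj (opposite A) = proj A" "vadd (opposite A) = vadd A"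
  "vscale (opposite A) = vscale A" "triv (opposite A) = triv A" "metric (opposite A) x y = - metric A x y"
  by (simp_all add: opposite_def)

lemma prod_bundle_courant: "prod_bundle B (opposite (prod_courant A P)) = prod_bundle B (prod_bundle A P)"
  by (simp add: prod_bundle_def)

lemma vector_subbundle_prod_courant:
  "vector_subbundle (prod_courant B (opposite (prod_courant A P))) S R \<longleftrightarrow>
    vector_subbundle (prod_bundle B (prod_bundle A P)) S R"
  unfolding prod_bundle_courant[symmetric] by (rule vector_bundle_scheme_cong(4)) simp_all

lemma dirac_structureD:
  assumes "dirac_structure A E"
  shows "vector_bundle A" "vector_subbundle A (points (base A)) E"
    "m \<in> points (base A) \<Longrightarrow> E \<inter> fiber A m = {x \<in> fiber A m. \<forall>y\<in>E \<inter> fiber A m. metric A x y = 0}"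
    "m \<in> points (base A) \<Longrightarrow> x \<in> fiber A m \<Longrightarrow> fiber_linear A m (metric A x)"
    "m \<in> points (base A) \<Longrightarrow> x \<in> fiber A m \<Longrightarrow> fiber_linear A m (\<lambda>y. metric A y x)"
    "m \<in> points (base A) \<Longrightarrow> x \<in> fiber A m \<Longrightarrow> y \<in> fiber A m \<Longrightarrow> metric A x y = metric A y x"
    "m \<in> points (base A) \<Longrightarrow> x \<in> fiber A m \<Longrightarrow> (\<And>y. y \<in> fiber A m \<Longrightarrow> metric A x y = 0) \<Longrightarrow> x = vzero A m"
proof -
  have V: "vector_bundle A" and bm: "bundle_metric A"
    using assms by (auto simp: dirac_structure_def courant_algebroid_def)
  show "vector_bundle A" by (rule V)
  show "vector_subbundle A (points (base A)) E"
    "m \<in> points (base A) \<Longrightarrow> E \<inter> fiber A m = {x \<in> fiber A m. \<forall>y\<in>E \<inter> fiber A m. metric A x y = 0}"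
    using assms by (auto simp: dirac_structure_def lagrangian_subbundle_def)
  have met: "metric A x y = metric A y x" "metric A (vadd A x y) z = metric A x z + metric A y z"
    "metric A (vscale A c x) y = c * metric A x y"
    if "m \<in> points (base A)" "x \<in> fiber A m" "y \<in> fiber A m" "z \<in> fiber A m" for m x y z c
    using bm that unfolding bundle_metric_def by blast+
  show "metric A x y = metric A y x" if "m \<in> points (base A)" "x \<in> fiber A m" "y \<in> fiber A m" for m x y
    using met(1)[OF that that(2)] .
  show l2: "fiber_linear A m (\<lambda>y. metric A y x)" if "m \<in> points (base A)" "x \<in> fiber A m" for m x
    using met(2,3)[OF that(1) _ _ that(2)] met(3)[OF that(1) _ that(2,2)] by (simp add: fiber_linear_def)
  show "fiber_linear A m (metric A x)" if m: "m \<in> points (base A)" "x \<in> fiber A m" for m x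
    unfolding fiber_linear_def
  proof (intro conjI ballI allI)
    fix y assume y: "y \<in> fiber A m"
    show "metric A x (vadd A y z) = metric A x y + metric A x z" if z: "z \<in> fiber A m" for z
      using met(1)[OF m fiber_ops(1)[OF V m(1) y z] m(2)] met(2)[OF m(1) y z m(2)] met(1)[OF m y y] met(1)[OF m z z] by simp
    show "metric A x (vscale A c y) = c *\<^sub>R metric A x y" for c
      using met(1)[OF m fiber_ops(2)[OF V m(1) y y] m(2)] met(3)[OF m(1) y m(2,2)] met(1)[OF m y y] by simp
  qed
  show "x = vzero A m" if m: "m \<in> points (base A)" "x \<in> fiber A m" and y: "\<And>y. y \<in> fiber A m \<Longrightarrow> metric A x y = 0" for m x
  proof -
    have "x = vscale A 0 x" using bm m y unfolding bundle_metric_def by blast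
    then show ?thesis using fiber_ops(5)[OF V m(1,2,2)] by simp
  qed
qed

text \<open>Only the Dirac morphism condition, without unit or associativity laws. It is
  instantiated for \<open>Mul\<close>, with \<open>A\<close> in the role of \<open>P\<close>, and
  for \<open>Act\<close>.\<close>

locale dirac_rel =
  fixes A :: "('h, 'b::euclidean_space, 'a, 'f::euclidean_space) courant" and E :: "'a set"
    and P :: "('m, 'c::euclidean_space, 'p, 'g::euclidean_space) courant" and L :: "'p set"
    and act :: "'h \<times> 'm \<Rightarrow> 'm" and Act :: "('p \<times> ('a \<times> 'p)) set"
  assumes dA: "dirac_structure A E" and dP: "dirac_structure P L"
    and mor: "dirac_morphism (prod_courant A P) (E \<times> L) P L act Act"
begin

abbreviation "GrA \<equiv> {(act (h, m), (h, m)) | h m. h \<in> points (base A) \<and> m \<in> points (base P)}"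

lemmas vA = dirac_structureD(1)[OF dA] and vP = dirac_structureD(1)[OF dP]

lemma vAP: "vector_bundle (prod_bundle A P)" "vector_bundle (prod_bundle P (prod_bundle A P))"
  by (intro vector_bundle_prod vA vP)+

lemma Gr_eq: "{(act p, p) | p. p \<in> points (base (prod_courant A P))} = GrA"
  by (auto simp: points_prod_atlas)

lemma mor': "lagrangian_subbundle (prod_courant P (opposite (prod_courant A P))) GrA Act"
  "smooth_map (prod_atlas (base A) (base P)) (base P) act"
  using mor unfolding dirac_morphism_def courant_morphism_def Let_def Gr_eq by auto

lemma sub: "vector_subbundle (prod_bundle P (prod_bundle A P)) GrA Act"
  using mor'(1) unfolding lagrangian_subbundle_def vector_subbundle_prod_courant by blast

lemma act_points: "h \<in> points (base A) \<Longrightarrow> m \<in> points (base P) \<Longrightarrow> act (h, m) \<in> points (base P)"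
  using mor'(2) unfolding smooth_map_on_def points_prod_atlas by blast

lemma rel_base:
  assumes "(z, (x, y)) \<in> Act"
  shows "x \<in> total A" "y \<in> total P" "z \<in> total P" "proj P z = act (proj A x, proj P y)"
    "proj A x \<in> points (base A)" "proj P y \<in> points (base P)"
  using vector_subbundleD(2)[OF sub] vector_subbundleD(4)[OF sub assms] assms by auto

lemma rel_fiber:
  assumes "(z, (x, y)) \<in> Act" "x \<in> fiber A h" "y \<in> fiber P m" shows "z \<in> fiber P (act (h, m))"
  using rel_base[OF assms(1)] assms by (auto simp: fiber_def)

lemma rel_add:
  assumes "(z, (x, y)) \<in> Act" "(z', (x', y')) \<in> Act" "proj A x = proj A x'" "proj P y = proj P y'"
  shows "(vadd P z z', (vadd A x x', vadd P y y')) \<in> Act"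
  using vector_subbundleD(6)[OF sub assms(1,2)] assms rel_base(4)[OF assms(1)] rel_base(4)[OF assms(2)] by simp

lemma rel_scale: "(z, (x, y)) \<in> Act \<Longrightarrow> (vscale P c z, (vscale A c x, vscale P c y)) \<in> Act"
  using vector_subbundleD(7)[OF sub] by fastforce

lemma rel_diff:
  assumes "(z, (x, y)) \<in> Act" "(z', (x', y')) \<in> Act" "proj A x = proj A x'" "proj P y = proj P y'"
  shows "(vdiff P z z', (vdiff A x x', vdiff P y y')) \<in> Act"
proof -
  have "proj A (vscale A (- 1) x') = proj A x'"
    using fiber_ops(2)[OF vA rel_base(5)[OF assms(2)], of x' x' "-1"] rel_base(1)[OF assms(2)] by (simp add: fiber_def)
  moreover have "proj P (vscale P (- 1) y') = proj P y'"
    using fiber_ops(2)[OF vP rel_base(6)[OF assms(2)], of y' y' "-1"] rel_base(2)[OF assms(2)] by (simp add: fiber_def)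
  ultimately show ?thesis
    unfolding vdiff_def using assms by (intro rel_add[OF assms(1) rel_scale[OF assms(2)]]) auto
qed

lemma rel_zero:
  assumes h: "h \<in> points (base A)" and m: "m \<in> points (base P)"
  shows "(vzero P (act (h, m)), (vzero A h, vzero P m)) \<in> Act"
proof -
  have "(act (h, m), (h, m)) \<in> GrA" using h m by blast
  then obtain w where "w \<in> Act" "proj (prod_bundle P (prod_bundle A P)) w = (act (h, m), (h, m))"
    using vector_subbundleD(8)[OF sub] by blast
  moreover obtain z x y where "w = (z, (x, y))" by (metis surj_pair)
  ultimately have w: "(z, (x, y)) \<in> Act" "proj A x = h" "proj P y = m" "proj P z = act (h, m)" by auto
  have f: "x \<in> fiber A h" "y \<in> fiber P m" "z \<in> fiber P (act (h, m))" using rel_base[OF w(1)] w by (auto simp: fiber_def)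
  show ?thesis
    using rel_scale[OF w(1), of 0] fiber_ops(5)[OF vA h f(1,1)] fiber_ops(5)[OF vP m f(2,2)]
      fiber_ops(5)[OF vP act_points[OF h m] f(3,3)] by simp
qed

text \<open>The relation equals its own orthogonal; because of the opposite metric on the source,
  orthogonality becomes an equality between inner products upstairs and downstairs.\<close>

lemma rel_iff_orthogonal:
  assumes h: "h \<in> points (base A)" "m \<in> points (base P)" and f: "x \<in> fiber A h" "y \<in> fiber P m" "z \<in> fiber P (act (h, m))"
  shows "(z, (x, y)) \<in> Act \<longleftrightarrow> (\<forall>z' x' y'. (z', (x', y')) \<in> Act \<longrightarrow> x' \<in> fiber A h \<longrightarrow> y' \<in> fiber P m \<longrightarrow>
    metric P z z' = metric A x x' + metric P y y')"
proof -
  let ?C = "prod_courant P (opposite (prod_courant A P))"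
  have "(act (h, m), (h, m)) \<in> GrA" using h by blast
  then have lag: "Act \<inter> fiber ?C (act (h, m), (h, m)) =
      {x \<in> fiber ?C (act (h, m), (h, m)). \<forall>y\<in>Act \<inter> fiber ?C (act (h, m), (h, m)). metric ?C x y = 0}"
    using mor'(1) unfolding lagrangian_subbundle_def by blast
  have fib: "fiber ?C (act (h, m), (h, m)) = fiber P (act (h, m)) \<times> (fiber A h \<times> fiber P m)"
    by (auto simp: fiber_def)
  have "(z, (x, y)) \<in> Act \<longleftrightarrow> (z, (x, y)) \<in> Act \<inter> fiber ?C (act (h, m), (h, m))" using f unfolding fib by blast
  also have "\<dots> \<longleftrightarrow> (\<forall>w\<in>Act \<inter> fiber ?C (act (h, m), (h, m)). metric ?C (z, (x, y)) w = 0)"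
    using f by (subst lag) (auto simp: fib)
  also have "\<dots> \<longleftrightarrow> (\<forall>z' x' y'. (z', (x', y')) \<in> Act \<longrightarrow> x' \<in> fiber A h \<longrightarrow> y' \<in> fiber P m \<longrightarrow>
    metric P z z' = metric A x x' + metric P y y')"
  proof
    assume l: "\<forall>w\<in>Act \<inter> fiber ?C (act (h, m), (h, m)). metric ?C (z, (x, y)) w = 0"
    show "\<forall>z' x' y'. (z', (x', y')) \<in> Act \<longrightarrow> x' \<in> fiber A h \<longrightarrow> y' \<in> fiber P m \<longrightarrow>
      metric P z z' = metric A x x' + metric P y y'"
    proof (intro allI impI)
      fix z' x' y' assume r: "(z', (x', y')) \<in> Act" "x' \<in> fiber A h" "y' \<in> fiber P m"
      have "(z', (x', y')) \<in> Act \<inter> fiber ?C (act (h, m), (h, m))" unfolding fib using r rel_fiber[OF r] by simp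
      from l[rule_format, OF this] show "metric P z z' = metric A x x' + metric P y y'" by simp
    qed
  next
    assume r: "\<forall>z' x' y'. (z', (x', y')) \<in> Act \<longrightarrow> x' \<in> fiber A h \<longrightarrow> y' \<in> fiber P m \<longrightarrow>
      metric P z z' = metric A x x' + metric P y y'"
    show "\<forall>w\<in>Act \<inter> fiber ?C (act (h, m), (h, m)). metric ?C (z, (x, y)) w = 0"
    proof
      fix w assume w: "w \<in> Act \<inter> fiber ?C (act (h, m), (h, m))"
      obtain z' x' y' where e: "w = (z', (x', y'))" by (metis surj_pair)
      show "metric ?C (z, (x, y)) w = 0" using w r[rule_format, of z' x' y'] unfolding e fib by simp
    qed
  qed
  finally show ?thesis .
qed

lemma rel_isotropic:
  assumes "(z, (x, y)) \<in> Act" "(z', (x', y')) \<in> Act" "x \<in> fiber A h" "x' \<in> fiber A h" "y \<in> fiber P m" "y' \<in> fiber P m"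
  shows "metric P z z' = metric A x x' + metric P y y'"
proof -
  have "h \<in> points (base A)" "m \<in> points (base P)" using rel_base(5,6)[OF assms(1)] assms by (auto simp: fiber_def)
  from rel_iff_orthogonal[OF this assms(3,5) rel_fiber[OF assms(1,3,5)]] assms show ?thesis by blast
qed

lemma metric_zero:
  "m \<in> points (base P) \<Longrightarrow> y \<in> fiber P m \<Longrightarrow> metric P (vzero P m) y = 0"
  "m \<in> points (base P) \<Longrightarrow> y \<in> fiber P m \<Longrightarrow> metric P y (vzero P m) = 0"
  "h \<in> points (base A) \<Longrightarrow> x \<in> fiber A h \<Longrightarrow> metric A (vzero A h) x = 0"
  "h \<in> points (base A) \<Longrightarrow> x \<in> fiber A h \<Longrightarrow> metric A x (vzero A h) = 0"
proof -
  have *: "metric C (vzero C m) y = 0 \<and> metric C y (vzero C m) = 0"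
    if C: "dirac_structure C F" and m: "m \<in> points (base C)" "y \<in> fiber C m"
    for C :: "('u, 'v::euclidean_space, 'w, 'x::euclidean_space) courant" and F m y
  proof -
    note v = dirac_structureD(1)[OF C]
    have "vzero C m = vscale C 0 y" using fiber_ops(5)[OF v m(1,2,2)] by simp
    then have "metric C (vzero C m) y = 0"
      using dirac_structureD(5)[OF C m] m(2) unfolding fiber_linear_def by simp
    then show ?thesis using dirac_structureD(6)[OF C m(1) vzero_in[OF v m(1)] m(2)] by simp
  qed
  show "m \<in> points (base P) \<Longrightarrow> y \<in> fiber P m \<Longrightarrow> metric P (vzero P m) y = 0"
    "m \<in> points (base P) \<Longrightarrow> y \<in> fiber P m \<Longrightarrow> metric P y (vzero P m) = 0"
    "h \<in> points (base A) \<Longrightarrow> x \<in> fiber A h \<Longrightarrow> metric A (vzero A h) x = 0"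
    "h \<in> points (base A) \<Longrightarrow> x \<in> fiber A h \<Longrightarrow> metric A x (vzero A h) = 0"
    using *[OF dP] *[OF dA] by blast+
qed

lemma zero_in_sub: "h \<in> points (base A) \<Longrightarrow> vzero A h \<in> E" "m \<in> points (base P) \<Longrightarrow> vzero P m \<in> L"
proof -
  assume h: "h \<in> points (base A)"
  have "vzero A h \<in> E \<inter> fiber A h"
    by (subst dirac_structureD(3)[OF dA h]) (use vzero_in[OF vA h] metric_zero(3)[OF h] in auto)
  then show "vzero A h \<in> E" by blast
next
  assume m: "m \<in> points (base P)"
  have "vzero P m \<in> L \<inter> fiber P m"
    by (subst dirac_structureD(3)[OF dP m]) (use vzero_in[OF vP m] metric_zero(1)[OF m] in auto)
  then show "vzero P m \<in> L" by blast
qed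

lemma rel_split_unique:
  assumes "h \<in> points (base A)" "m \<in> points (base P)" "z \<in> L" "z \<in> fiber P (act (h, m))"
  shows "\<exists>!w. w \<in> (E \<inter> fiber A h) \<times> (L \<inter> fiber P m) \<and> (z, w) \<in> Act"
proof -
  have "(h, m) \<in> points (base (prod_courant A P))" using assms by (simp add: points_prod_atlas)
  then have "\<exists>!w. w \<in> (E \<times> L) \<inter> fiber (prod_courant A P) (h, m) \<and> (z, w) \<in> Act"
    using mor assms(3,4) unfolding dirac_morphism_def by blast
  moreover have "(E \<times> L) \<inter> fiber (prod_courant A P) (h, m) = (E \<inter> fiber A h) \<times> (L \<inter> fiber P m)"
    by (auto simp: fiber_def)
  ultimately show ?thesis by simp
qed

lemma rel_split:
  assumes "h \<in> points (base A)" "m \<in> points (base P)" "z \<in> L" "z \<in> fiber P (act (h, m))"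
  obtains x y where "x \<in> E \<inter> fiber A h" "y \<in> L \<inter> fiber P m" "(z, (x, y)) \<in> Act"
  using rel_split_unique[OF assms] by auto

text \<open>The zero vector splits into zero vectors, and the splitting is unique. This is the
  source of injectivity for everything involving \<open>E\<close> and \<open>L\<close>.\<close>

lemma rel_zero_unique:
  assumes h: "h \<in> points (base A)" "m \<in> points (base P)" and x: "x \<in> E \<inter> fiber A h" and y: "y \<in> L \<inter> fiber P m"
    and r: "(vzero P (act (h, m)), (x, y)) \<in> Act"
  shows "x = vzero A h" "y = vzero P m"
proof -
  note am = act_points[OF h]
  have "vzero P (act (h, m)) \<in> L" "vzero P (act (h, m)) \<in> fiber P (act (h, m))"
    using zero_in_sub(2)[OF am] vzero_in[OF vP am] by auto
  from rel_split_unique[OF h this] have "(x, y) = (vzero A h, vzero P m)"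
    using x y r rel_zero[OF h] zero_in_sub(1)[OF h(1)] zero_in_sub(2)[OF h(2)] vzero_in[OF vA h(1)] vzero_in[OF vP h(2)]
    by blast
  then show "x = vzero A h" "y = vzero P m" by auto
qed

text \<open>The image of \<open>E \<times> L\<close> is isotropic to \<open>L\<close>, hence contained in \<open>L\<close>.\<close>

lemma rel_forward:
  assumes r: "(z, (x, y)) \<in> Act" and x: "x \<in> E" and y: "y \<in> L" shows "z \<in> L"
proof -
  let ?h = "proj A x" and ?m = "proj P y"
  have f: "x \<in> fiber A ?h" "y \<in> fiber P ?m" "?h \<in> points (base A)" "?m \<in> points (base P)"
    using rel_base[OF r] by (auto simp: fiber_def)
  note am = act_points[OF f(3,4)]
  have zf: "z \<in> fiber P (act (?h, ?m))" by (rule rel_fiber[OF r f(1,2)])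
  have "metric P z w = 0" if w: "w \<in> L \<inter> fiber P (act (?h, ?m))" for w
  proof -
    obtain x' y' where xy: "x' \<in> E \<inter> fiber A ?h" "y' \<in> L \<inter> fiber P ?m" "(w, (x', y')) \<in> Act"
      using rel_split[OF f(3,4)] w by blast
    have "metric A x x' = 0" "metric P y y' = 0"
      using dirac_structureD(3)[OF dA f(3)] dirac_structureD(3)[OF dP f(4)] x y f xy by blast+
    then show ?thesis using rel_isotropic[OF r xy(3) f(1) _ f(2)] xy by auto
  qed
  then have "z \<in> L \<inter> fiber P (act (?h, ?m))" by (subst dirac_structureD(3)[OF dP am]) (use zf in blast)
  then show ?thesis by blast
qed

text \<open>For a Lagrangian relation, the set of pairs that have a product and the set of pairs
  related to \<open>0\<close> are each other's annihilators.\<close>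

lemma rel_dual:
  assumes h: "h \<in> points (base A)" "m \<in> points (base P)" and f: "x \<in> fiber A h" "y \<in> fiber P m"
    and an: "\<And>x' y'. (vzero P (act (h, m)), (x', y')) \<in> Act \<Longrightarrow> x' \<in> fiber A h \<Longrightarrow> y' \<in> fiber P m \<Longrightarrow>
      metric A x x' + metric P y y' = 0"
  shows "\<exists>z. (z, (x, y)) \<in> Act"
proof (rule ccontr)
  assume no: "\<nexists>z. (z, (x, y)) \<in> Act"
  let ?V = "prod_bundle A P" and ?p = "(h, m)"
  define b where "b v w = metric A (fst v) (fst w) + metric P (snd v) (snd w)" for v w
  \<comment> \<open>The pairs over \<open>(h, m)\<close> that have a product. If
    \<open>(x, y)\<close> were not among them, some pair \<open>(a, k)\<close> would be orthogonal
    to \<open>D\<close> but not to \<open>(x, y)\<close>.\<close>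
  define D where "D = {w \<in> fiber ?V ?p. \<exists>z. (z, w) \<in> Act}"
  have p: "?p \<in> points (base ?V)" using h by (simp add: points_prod_atlas)
  have z: "vzero ?V ?p = (vzero A h, vzero P m)"
    using fiber_ops(5)[OF vAP(1) p, of "(x, y)" "(x, y)"] fiber_ops(5)[OF vA h(1) f(1,1)] fiber_ops(5)[OF vP h(2) f(2,2)] f
    by (simp add: fiber_prod)
  have n1: "fiber_linear ?V ?p (b w)" "fiber_linear ?V ?p (\<lambda>v. b v w)" if "w \<in> fiber ?V ?p" for w
    using that dirac_structureD(4,5)[OF dA h(1)] dirac_structureD(4,5)[OF dP h(2)]
    by (auto simp: b_def fiber_prod fiber_linear_def algebra_simps)
  have n2: "w = vzero ?V ?p" if w: "w \<in> fiber ?V ?p" and 0: "\<And>v. v \<in> fiber ?V ?p \<Longrightarrow> b w v = 0" for w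
  proof -
    obtain a a' where ab: "w = (a, a')" "a \<in> fiber A h" "a' \<in> fiber P m" using w by (auto simp: fiber_prod)
    have "metric A a c = 0" if "c \<in> fiber A h" for c
      using 0[of "(c, vzero P m)"] that vzero_in[OF vP h(2)] metric_zero(2)[OF h(2) ab(3)] ab(1) by (simp add: fiber_prod b_def)
    moreover have "metric P a' c = 0" if "c \<in> fiber P m" for c
      using 0[of "(vzero A h, c)"] that vzero_in[OF vA h(1)] metric_zero(4)[OF h(1) ab(2)] ab(1) by (simp add: fiber_prod b_def)
    ultimately show ?thesis
      unfolding z ab(1) using dirac_structureD(7)[OF dA h(1) ab(2)] dirac_structureD(7)[OF dP h(2) ab(3)] by blast
  qed
  have n3: "D \<subseteq> fiber ?V ?p" unfolding D_def by blast
  have n4: "vzero ?V ?p \<in> D"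
    unfolding D_def using vzero_in[OF vAP(1) p] rel_zero[OF h] unfolding z by blast
  have n5: "vadd ?V v w \<in> D" if vw: "v \<in> D" "w \<in> D" for v w
  proof -
    obtain a k c d where e: "v = (a, k)" "w = (c, d)" by (metis surj_pair)
    obtain z z' where "(z, (a, k)) \<in> Act" "(z', (c, d)) \<in> Act" "(a, k) \<in> fiber ?V ?p" "(c, d) \<in> fiber ?V ?p"
      using vw unfolding D_def e by blast
    note v = e this
    have "(vadd P z z', vadd ?V v w) \<in> Act"
      using rel_add[OF v(3,4)] v by (simp add: fiber_prod) (simp add: fiber_def)
    then show ?thesis unfolding D_def using fiber_ops(1)[OF vAP(1) p v(5,6)] v(1,2) by blast
  qed
  have n6: "vscale ?V c v \<in> D" if v: "v \<in> D" for v c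
  proof -
    obtain a k where e: "v = (a, k)" by (metis surj_pair)
    obtain z where "(z, (a, k)) \<in> Act" "(a, k) \<in> fiber ?V ?p" using v unfolding D_def e by blast
    note v = e this
    have "(vscale P c z, vscale ?V c v) \<in> Act" using rel_scale[OF v(2)] v(1) by simp
    then show ?thesis unfolding D_def using fiber_ops(2)[OF vAP(1) p v(3,3)] v(1) by blast
  qed
  have n7: "(x, y) \<in> fiber ?V ?p" using f by (simp add: fiber_prod)
  have n8: "(x, y) \<notin> D" unfolding D_def using no by blast
  have "\<exists>w\<in>fiber ?V ?p. (\<forall>d\<in>D. b w d = 0) \<and> b w (x, y) \<noteq> 0"
    by (rule annihilator_separates[of ?V ?p b D "(x, y)"]) (assumption | rule vAP(1) p n1 n2 n3 n4 n5 n6 n7 n8)+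
  then obtain w where w: "w \<in> fiber ?V ?p" "\<forall>d\<in>D. b w d = 0" "b w (x, y) \<noteq> 0" by blast
  obtain a k where "w = (a, k)" by (metis surj_pair)
  then have ab: "a \<in> fiber A h" "k \<in> fiber P m" "\<And>d. d \<in> D \<Longrightarrow> b (a, k) d = 0"
    "metric A a x + metric P k y \<noteq> 0" using w by (auto simp: fiber_prod b_def)
  note am = act_points[OF h]
  \<comment> \<open>As \<open>(a, k)\<close> is orthogonal to \<open>D\<close>, its pair with
    \<open>0\<close> is orthogonal to the whole relation over this point, hence belongs to it; but
    then hypothesis \<open>an\<close> forces it to be orthogonal to \<open>(x, y)\<close>.\<close>
  have "(vzero P (act (h, m)), (a, k)) \<in> Act"
    unfolding rel_iff_orthogonal[OF h ab(1,2) vzero_in[OF vP am]]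
  proof (intro allI impI)
    fix z' x' y' assume r: "(z', (x', y')) \<in> Act" "x' \<in> fiber A h" "y' \<in> fiber P m"
    have "(x', y') \<in> D" unfolding D_def using r by (auto simp: fiber_prod)
    then show "metric P (vzero P (act (h, m))) z' = metric A a x' + metric P k y'"
      using ab(3)[of "(x', y')"] metric_zero(1)[OF am rel_fiber[OF r]] by (simp add: b_def)
  qed
  from an[OF this ab(1,2)] ab(4) dirac_structureD(6)[OF dA h(1) f(1) ab(1)] dirac_structureD(6)[OF dP h(2) f(2) ab(2)]
  show False by simp
qed

end

section \<open>Dirac Lie groups and their actions\<close>

text \<open>The moment map of an action, and for \<open>Act = Mul\<close> the target map. Keeping it
  outside the locales lets both share one constant.\<close>

definition unit_left where
  "unit_left H A E Act y = (THE v. v \<in> E \<inter> fiber A \<one>\<^bsub>H\<^esub> \<and> (y, (v, y)) \<in> Act)"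

definition unit_right where
  "unit_right H A E Mul x = (THE v. v \<in> E \<inter> fiber A \<one>\<^bsub>H\<^esub> \<and> (x, (x, v)) \<in> Mul)"

definition rel_app where
  "rel_app R x y = (THE z. (z, (x, y)) \<in> R)"

locale dirac_group =
  fixes H :: "('h, 'z) monoid_scheme" and A :: "('h, 'b::euclidean_space, 'a, 'f::euclidean_space) courant" and E :: "'a set"
    and Mul :: "('a \<times> ('a \<times> 'a)) set" and \<epsilon> :: "('a \<times> unit) set"
  assumes dlg: "dirac_lie_group H A E Mul \<epsilon>"
begin

sublocale mul: dirac_rel A E A E "\<lambda>(g, h). g \<otimes>\<^bsub>H\<^esub> h" Mul
  using dlg unfolding dirac_lie_group_def by unfold_locales blast+

lemma lie: "lie_group H (base A)" and group: "group H" and carrier: "carrier H = points (base A)"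
  using dlg unfolding dirac_lie_group_def lie_group_def by blast+

abbreviation e where "e \<equiv> \<one>\<^bsub>H\<^esub>"

lemma e_in: "e \<in> points (base A)"
  using group.is_monoid[OF group] monoid.one_closed carrier by metis

lemma inv_in: "g \<in> points (base A) \<Longrightarrow> inv\<^bsub>H\<^esub> g \<in> points (base A)"
  using group.inv_closed[OF group] carrier by metis

text \<open>The Dirac condition over the point puts all of \<open>E\<close> over \<open>e\<close>
  into \<open>\<epsilon>\<close>. Conversely \<open>\<epsilon>\<close> is isotropic, hence
  orthogonal to \<open>E\<close> there, and \<open>E\<close> is its own orthogonal.\<close>

lemma eps_eq: "\<epsilon> = {(x, ()) | x. x \<in> E \<inter> fiber A e}"
proof -
  have m: "dirac_morphism pt_courant {()} A E (\<lambda>_. e) \<epsilon>" using dlg unfolding dirac_lie_group_def by blast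
  let ?C = "prod_courant A (opposite pt_courant)"
  have pt: "points (base pt_courant) = {()}" by (auto simp: pt_courant_def pt_atlas_def points_def)
  have lag: "lagrangian_subbundle ?C {(e, ())} \<epsilon>"
    using m unfolding dirac_morphism_def courant_morphism_def Let_def pt by simp
  have vs: "vector_subbundle ?C {(e, ())} \<epsilon>" using lag unfolding lagrangian_subbundle_def by blast
  have ptp: "proj pt_courant x = ()" "total pt_courant = {()}" "metric pt_courant x y = 0" for x y by (auto simp: pt_courant_def)
  have sup: "(x, ()) \<in> \<epsilon>" if "x \<in> E \<inter> fiber A e" for x
  proof -
    have "\<exists>!x1. x1 \<in> {()} \<inter> fiber pt_courant () \<and> (x, x1) \<in> \<epsilon>"
      using m that unfolding dirac_morphism_def pt by simp
    then show ?thesis by auto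
  qed
  have sub: "x \<in> E \<inter> fiber A e" if x: "(x, u) \<in> \<epsilon>" for x u
  proof -
    have lag': "Act0 \<inter> fiber ?C (e, ()) = {x \<in> fiber ?C (e, ()). \<forall>y\<in>Act0 \<inter> fiber ?C (e, ()). metric ?C x y = 0}"
      if "Act0 = \<epsilon>" for Act0 using lag that unfolding lagrangian_subbundle_def by blast
    have xf: "x \<in> fiber A e"
      using vector_subbundleD(2)[OF vs] vector_subbundleD(4)[OF vs x] x by (auto simp: fiber_def)
    have fib: "fiber ?C (e, ()) = fiber A e \<times> UNIV" by (auto simp: fiber_def ptp)
    have "metric A x y = 0" if y: "y \<in> E \<inter> fiber A e" for y
    proof -
      have "metric ?C (x, u) (y, ()) = 0"
        using lag'[OF refl] x sup[OF y] xf y unfolding fib by blast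
      then show ?thesis by (simp add: ptp)
    qed
    then have "x \<in> {x \<in> fiber A e. \<forall>y\<in>E \<inter> fiber A e. metric A x y = 0}" using xf by blast
    then show ?thesis using dirac_structureD(3)[OF mul.dA e_in] by simp
  qed
  show ?thesis
  proof (rule Set.set_eqI)
    fix p show "p \<in> \<epsilon> \<longleftrightarrow> p \<in> {(x, ()) | x. x \<in> E \<inter> fiber A e}"
      using sup[of "fst p"] sub[of "fst p" "snd p"] by (cases p) (auto simp del: Int_iff)
  qed
qed

section \<open>Unit laws and the source map\<close>

lemma unitL: "(\<exists>v\<in>E \<inter> fiber A e. (z, (v, x)) \<in> Mul) \<longleftrightarrow> z = x \<and> x \<in> total A"
proof -
  have eq: "Mul O rel_times \<epsilon> (Id_on (total A)) = Id_on (total A) O lunit_rel"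
    using dlg unfolding dirac_lie_group_def by blast
  have "(z, ((), x)) \<in> Mul O rel_times \<epsilon> (Id_on (total A)) \<longleftrightarrow> (\<exists>v\<in>E \<inter> fiber A e. (z, (v, x)) \<in> Mul)"
    using mul.rel_base(2) unfolding eps_eq rel_times_def by blast
  moreover have "(z, ((), x)) \<in> Id_on (total A) O lunit_rel \<longleftrightarrow> z = x \<and> x \<in> total A"
    unfolding lunit_rel_def by blast
  ultimately show ?thesis using eq by simp
qed

lemma unitR: "(\<exists>v\<in>E \<inter> fiber A e. (z, (x, v)) \<in> Mul) \<longleftrightarrow> z = x \<and> x \<in> total A"
proof -
  have eq: "Mul O rel_times (Id_on (total A)) \<epsilon> = Id_on (total A) O runit_rel"
    using dlg unfolding dirac_lie_group_def by blast
  have "(z, (x, ())) \<in> Mul O rel_times (Id_on (total A)) \<epsilon> \<longleftrightarrow> (\<exists>v\<in>E \<inter> fiber A e. (z, (x, v)) \<in> Mul)"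
    using mul.rel_base(1) unfolding eps_eq rel_times_def by blast
  moreover have "(z, (x, ())) \<in> Id_on (total A) O runit_rel \<longleftrightarrow> z = x \<and> x \<in> total A"
    unfolding runit_rel_def by blast
  ultimately show ?thesis using eq by simp
qed

lemma zero_e: "vzero A e \<in> E \<inter> fiber A e"
  using mul.zero_in_sub(1)[OF e_in] vzero_in[OF mul.vA e_in] by blast

lemma E_diff: "x \<in> E \<inter> fiber A g \<Longrightarrow> y \<in> E \<inter> fiber A g \<Longrightarrow> vdiff A x y \<in> E \<inter> fiber A g"
proof -
  assume xy: "x \<in> E \<inter> fiber A g" "y \<in> E \<inter> fiber A g"
  note sb = dirac_structureD(2)[OF mul.dA]
  have g: "g \<in> points (base A)" using vector_subbundleD(4)[OF sb, of x] xy by (auto simp: fiber_def)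
  have "proj A (vscale A (-1) y) = proj A x" using fiber_ops(2)[OF mul.vA g, of y y "-1"] xy by (auto simp: fiber_def)
  then have "vdiff A x y \<in> E"
    unfolding vdiff_def using xy by (intro vector_subbundleD(6)[OF sb] vector_subbundleD(7)[OF sb]) auto
  then show ?thesis using fiber_ops(3)[OF mul.vA g] xy by blast
qed

abbreviation s where "s \<equiv> unit_right H A E Mul"

text \<open>Subtracting the two relations leaves zero as a product of zero and
  \<open>v - v'\<close>, both in \<open>E\<close>, so \<open>rel_zero_unique\<close>
  applies.\<close>

lemma s_unique:
  assumes "v \<in> E \<inter> fiber A e" "v' \<in> E \<inter> fiber A e" "(x, (x, v)) \<in> Mul" "(x, (x, v')) \<in> Mul" shows "v = v'"
proof -
  let ?g = "proj A x"
  have x: "x \<in> fiber A ?g" "?g \<in> points (base A)" using mul.rel_base[OF assms(3)] by (auto simp: fiber_def)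
  have ge: "?g \<otimes>\<^bsub>H\<^esub> e = ?g" using x(2) carrier group by (simp add: group.is_monoid monoid.r_one)
  have "(vdiff A x x, (vdiff A x x, vdiff A v v')) \<in> Mul"
    by (rule mul.rel_diff[OF assms(3,4)]) (use assms(1,2) in \<open>auto simp: fiber_def\<close>)
  then have "(vzero A ?g, (vzero A ?g, vdiff A v v')) \<in> Mul" using fiber_ops(8)[OF mul.vA x(2,1,1)] by simp
  then have "vdiff A v v' = vzero A e"
    using mul.rel_zero_unique(2)[OF x(2) e_in, of "vzero A ?g" "vdiff A v v'"] E_diff[OF assms(1,2)] ge
      mul.zero_in_sub(1)[OF x(2)] vzero_in[OF mul.vA x(2)] by simp
  then show ?thesis using fiber_ops(9)[OF mul.vA e_in] assms(1,2) by blast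
qed

lemma s_eqI: "v \<in> E \<inter> fiber A e \<Longrightarrow> (x, (x, v)) \<in> Mul \<Longrightarrow> s x = v"
  unfolding unit_right_def by (rule the_equality) (use s_unique in blast)+

lemma s_in: assumes "x \<in> total A" shows "s x \<in> E \<inter> fiber A e" "(x, (x, s x)) \<in> Mul"
proof -
  obtain v where "v \<in> E \<inter> fiber A e" "(x, (x, v)) \<in> Mul" using unitR[of x x] assms by blast
  then show "s x \<in> E \<inter> fiber A e" "(x, (x, s x)) \<in> Mul" using s_eqI by auto
qed

lemma unit_mulL: "(z, (v, x)) \<in> Mul \<Longrightarrow> v \<in> E \<inter> fiber A e \<Longrightarrow> z = x"
  using unitL by blast

lemma unit_mulR: "(z, (x, v)) \<in> Mul \<Longrightarrow> v \<in> E \<inter> fiber A e \<Longrightarrow> z = x"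
  using unitR by blast

lemma s_unit: "v \<in> E \<inter> fiber A e \<Longrightarrow> s v = v"
  using s_in[of v] unit_mulL[of v v "s v"] by (auto simp: fiber_def)

lemma assocM: "(\<exists>v. (z, (v, w)) \<in> Mul \<and> (v, (x, y)) \<in> Mul) \<longleftrightarrow> (\<exists>v. (z, (x, v)) \<in> Mul \<and> (v, (y, w)) \<in> Mul)"
proof -
  have eq: "Mul O rel_times Mul (Id_on (total A)) = Mul O rel_times (Id_on (total A)) Mul O assoc_rel"
    using dlg unfolding dirac_lie_group_def by blast
  have "(z, ((x, y), w)) \<in> Mul O rel_times Mul (Id_on (total A)) \<longleftrightarrow> (\<exists>v. (z, (v, w)) \<in> Mul \<and> (v, (x, y)) \<in> Mul)"
    using mul.rel_base(2) unfolding rel_times_def by blast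
  moreover have "(z, ((x, y), w)) \<in> Mul O rel_times (Id_on (total A)) Mul O assoc_rel \<longleftrightarrow>
      (\<exists>v. (z, (x, v)) \<in> Mul \<and> (v, (y, w)) \<in> Mul)"
    using mul.rel_base(1) unfolding rel_times_def assoc_rel_def by blast
  ultimately show ?thesis using eq by simp
qed

text \<open>Write \<open>y\<close> as \<open>y (s y)\<close> and reassociate: some \<open>v\<close>
  over \<open>(x, y)\<close> multiplies with the unit \<open>s y\<close> to \<open>z\<close>. The
  unit law identifies \<open>v\<close> with \<open>z\<close>, at a stage where products are not yet
  known to be unique.\<close>

lemma s_mul: "(z, (x, y)) \<in> Mul \<Longrightarrow> s z = s y"
proof -
  assume z: "(z, (x, y)) \<in> Mul"
  have y: "y \<in> total A" by (rule mul.rel_base(2)[OF z])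
  obtain v where v: "(z, (v, s y)) \<in> Mul" "(v, (x, y)) \<in> Mul" using assocM z s_in(2)[OF y] by blast
  have "v = z" using unit_mulR[OF v(1)] s_in(1)[OF y] by simp
  then show ?thesis using s_eqI[OF s_in(1)[OF y]] v(1) by simp
qed

text \<open>The splitting of the Dirac condition, applied to a unit over \<open>g g^-1 = e\<close>.
  Multiplication by the factors moves elements between the fiber over \<open>g\<close> and the one
  over \<open>e\<close>.\<close>

lemma split_unit:
  assumes v: "v \<in> E \<inter> fiber A e" and g: "g \<in> points (base A)"
  obtains a b where "a \<in> E \<inter> fiber A g" "b \<in> E \<inter> fiber A (inv\<^bsub>H\<^esub> g)" "(v, (a, b)) \<in> Mul" "s b = v"
proof -
  have "g \<otimes>\<^bsub>H\<^esub> inv\<^bsub>H\<^esub> g = e" using g carrier group.r_inv[OF group] by simp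
  then obtain a b where ab: "a \<in> E \<inter> fiber A g" "b \<in> E \<inter> fiber A (inv\<^bsub>H\<^esub> g)" "(v, (a, b)) \<in> Mul"
    using mul.rel_split[OF g inv_in[OF g], of v] v by auto
  then show ?thesis using that s_mul[OF ab(3)] s_unit[OF v] by metis
qed

end

section \<open>Moment map, composability and uniqueness of products\<close>

locale dirac_act = dirac_group H A E Mul \<epsilon>
  for H :: "('h, 'z) monoid_scheme" and A :: "('h, 'b::euclidean_space, 'a, 'f::euclidean_space) courant" and E Mul \<epsilon> +
  fixes P :: "('m, 'c::euclidean_space, 'p, 'g::euclidean_space) courant" and L :: "'p set"
    and act :: "'h \<times> 'm \<Rightarrow> 'm" and Act :: "('p \<times> ('a \<times> 'p)) set"
  assumes dact: "dirac_action H A E Mul \<epsilon> P L act Act"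
begin

sublocale ac: dirac_rel A E P L act Act
  using dact mul.dA unfolding dirac_action_def by unfold_locales blast+

lemma smooth_act: "smooth_action H (base A) (base P) act"
  using dact unfolding dirac_action_def by blast

lemma act_e: "m \<in> points (base P) \<Longrightarrow> act (e, m) = m"
  and act_mult: "g \<in> points (base A) \<Longrightarrow> h \<in> points (base A) \<Longrightarrow> m \<in> points (base P) \<Longrightarrow>
    act (g \<otimes>\<^bsub>H\<^esub> h, m) = act (g, act (h, m))"
proof -
  have ga: "group_action H (points (base P)) (\<lambda>h. \<lambda>m\<in>points (base P). act (h, m))"
    using smooth_act unfolding smooth_action_def by blast
  show "m \<in> points (base P) \<Longrightarrow> act (e, m) = m"
    using group_action.id_eq_one[OF ga] by (metis restrict_apply')
  show "act (g \<otimes>\<^bsub>H\<^esub> h, m) = act (g, act (h, m))" if "g \<in> points (base A)" "h \<in> points (base A)" "m \<in> points (base P)"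
    using group_action.composition_rule[OF ga that(3), of g h] that carrier ac.act_points by simp
qed

lemma act_inv: "g \<in> points (base A) \<Longrightarrow> m \<in> points (base P) \<Longrightarrow> act (inv\<^bsub>H\<^esub> g, act (g, m)) = m"
  using act_mult[OF inv_in] act_e group.l_inv[OF group] carrier by metis

lemma unitP: "(\<exists>v\<in>E \<inter> fiber A e. (z, (v, x)) \<in> Act) \<longleftrightarrow> z = x \<and> x \<in> total P"
proof -
  have eq: "Act O rel_times \<epsilon> (Id_on (total P)) = Id_on (total P) O lunit_rel"
    using dact unfolding dirac_action_def by blast
  have "(z, ((), x)) \<in> Act O rel_times \<epsilon> (Id_on (total P)) \<longleftrightarrow> (\<exists>v\<in>E \<inter> fiber A e. (z, (v, x)) \<in> Act)"
    using ac.rel_base(2) unfolding eps_eq rel_times_def by blast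
  moreover have "(z, ((), x)) \<in> Id_on (total P) O lunit_rel \<longleftrightarrow> z = x \<and> x \<in> total P"
    unfolding lunit_rel_def by blast
  ultimately show ?thesis using eq by simp
qed

lemma unit_act: "(z, (v, y)) \<in> Act \<Longrightarrow> v \<in> E \<inter> fiber A e \<Longrightarrow> z = y"
  using unitP by blast

lemma assocP: "(\<exists>v. (z, (v, w)) \<in> Act \<and> (v, (x, y)) \<in> Mul) \<longleftrightarrow> (\<exists>v. (z, (x, v)) \<in> Act \<and> (v, (y, w)) \<in> Act)"
proof -
  have eq: "Act O rel_times Mul (Id_on (total P)) = Act O rel_times (Id_on (total A)) Act O assoc_rel"
    using dact unfolding dirac_action_def by blast
  have "(z, ((x, y), w)) \<in> Act O rel_times Mul (Id_on (total P)) \<longleftrightarrow> (\<exists>v. (z, (v, w)) \<in> Act \<and> (v, (x, y)) \<in> Mul)"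
    using ac.rel_base(2) unfolding rel_times_def by blast
  moreover have "(z, ((x, y), w)) \<in> Act O rel_times (Id_on (total A)) Act O assoc_rel \<longleftrightarrow>
      (\<exists>v. (z, (x, v)) \<in> Act \<and> (v, (y, w)) \<in> Act)"
    using ac.rel_base(1) unfolding rel_times_def assoc_rel_def by blast
  ultimately show ?thesis using eq by simp
qed

abbreviation u where "u \<equiv> unit_left H A E Act"

lemma u_unique:
  assumes "v \<in> E \<inter> fiber A e" "v' \<in> E \<inter> fiber A e" "(x, (v, x)) \<in> Act" "(x, (v', x)) \<in> Act" shows "v = v'"
proof -
  let ?m = "proj P x"
  have x: "x \<in> fiber P ?m" "?m \<in> points (base P)" using ac.rel_base[OF assms(3)] by (auto simp: fiber_def)
  have "(vdiff P x x, (vdiff A v v', vdiff P x x)) \<in> Act"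
    by (rule ac.rel_diff[OF assms(3,4)]) (use assms(1,2) in \<open>auto simp: fiber_def\<close>)
  then have "(vzero P ?m, (vdiff A v v', vzero P ?m)) \<in> Act" using fiber_ops(8)[OF ac.vP x(2,1,1)] by simp
  then have "vdiff A v v' = vzero A e"
    using ac.rel_zero_unique(1)[OF e_in x(2), of "vdiff A v v'" "vzero P ?m"] E_diff[OF assms(1,2)] act_e[OF x(2)]
      ac.zero_in_sub(2)[OF x(2)] vzero_in[OF ac.vP x(2)] by simp
  then show ?thesis using fiber_ops(9)[OF mul.vA e_in] assms(1,2) by blast
qed

lemma u_eqI: "v \<in> E \<inter> fiber A e \<Longrightarrow> (x, (v, x)) \<in> Act \<Longrightarrow> u x = v"
  unfolding unit_left_def by (rule the_equality) (use u_unique in blast)+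

lemma u_in: assumes "x \<in> total P" shows "u x \<in> E \<inter> fiber A e" "(x, (u x, x)) \<in> Act"
proof -
  obtain v where "v \<in> E \<inter> fiber A e" "(x, (v, x)) \<in> Act" using unitP[of x x] assms by blast
  then show "u x \<in> E \<inter> fiber A e" "(x, (u x, x)) \<in> Act" using u_eqI by auto
qed

text \<open>Since \<open>x = x (s x)\<close>, reassociating produces some \<open>v\<close> related
  to \<open>(s x, y)\<close>. A unit acts trivially, so \<open>v = y\<close>, and therefore
  \<open>s x\<close> is the unit that fixes \<open>y\<close>.\<close>

lemma act_composable: assumes z: "(z, (x, y)) \<in> Act" shows "s x = u y"
proof -
  have x: "x \<in> total A" by (rule ac.rel_base(1)[OF z])
  obtain v where v: "(z, (x, v)) \<in> Act" "(v, (s x, y)) \<in> Act" using assocP z s_in(2)[OF x] by blast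
  have "v = y" using unit_act[OF v(2)] s_in(1)[OF x] by simp
  then show ?thesis using u_eqI[OF s_in(1)[OF x]] v(2) by simp
qed

text \<open>Phrased with an arbitrary left unit \<open>v\<close> of \<open>x\<close>: the target map
  becomes available only once this locale has been applied to the group acting on itself.\<close>

lemma act_target: assumes z: "(z, (x, y)) \<in> Act" and v: "v \<in> E \<inter> fiber A e" "(x, (v, x)) \<in> Mul" shows "u z = v"
proof -
  obtain w where w: "(z, (v, w)) \<in> Act" "(w, (x, y)) \<in> Act" using assocP z v(2) by blast
  have "w = z" using unit_act[OF w(1)] v by simp
  then show ?thesis using u_eqI[OF v(1)] w(1) by simp
qed

text \<open>Factor the unit of \<open>y\<close> as \<open>a b\<close>; reassociating
  \<open>(a b) y = y\<close> gives \<open>y = a r\<close> with \<open>r = b y\<close>. Thus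
  \<open>y\<close> is the image under an element of \<open>E\<close> over any prescribed
  \<open>h\<close>.\<close>

lemma act_factor:
  assumes y: "y \<in> total P" and h: "h \<in> points (base A)"
  obtains a b r where "a \<in> E \<inter> fiber A h" "b \<in> E \<inter> fiber A (inv\<^bsub>H\<^esub> h)" "(u y, (a, b)) \<in> Mul" "s b = u y"
    "(r, (b, y)) \<in> Act" "(y, (a, r)) \<in> Act"
proof -
  obtain a b where ab: "a \<in> E \<inter> fiber A h" "b \<in> E \<inter> fiber A (inv\<^bsub>H\<^esub> h)" "(u y, (a, b)) \<in> Mul" "s b = u y"
    by (rule split_unit[OF u_in(1)[OF y] h])
  then show ?thesis using that assocP u_in(2)[OF y] by blast
qed

text \<open>The difference \<open>d\<close> of two products is related to \<open>(0, 0)\<close>.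
  Every \<open>w\<close> in its fiber is some product \<open>a r\<close> over the same base points,
  so isotropy gives \<open><d, w> = <0, a> + <0, r> = 0\<close>, and the metric is
  nondegenerate.\<close>

lemma act_unique: assumes z: "(z, (x, y)) \<in> Act" "(z', (x, y)) \<in> Act" shows "z = z'"
proof -
  let ?h = "proj A x" and ?m = "proj P y"
  have f: "x \<in> fiber A ?h" "y \<in> fiber P ?m" "?h \<in> points (base A)" "?m \<in> points (base P)"
    using ac.rel_base[OF z(1)] by (auto simp: fiber_def)
  note am = ac.act_points[OF f(3,4)]
  have zf: "z \<in> fiber P (act (?h, ?m))" "z' \<in> fiber P (act (?h, ?m))" using ac.rel_fiber[OF _ f(1,2)] z by auto
  have k: "(vdiff P z z', (vzero A ?h, vzero P ?m)) \<in> Act"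
    using ac.rel_diff[OF z] fiber_ops(8)[OF mul.vA f(3,1,1)] fiber_ops(8)[OF ac.vP f(4,2,2)] by simp
  have "metric P (vdiff P z z') w = 0" if w: "w \<in> fiber P (act (?h, ?m))" for w
  proof -
    obtain a b r where ab: "a \<in> E \<inter> fiber A ?h" "b \<in> E \<inter> fiber A (inv\<^bsub>H\<^esub> ?h)" "(r, (b, w)) \<in> Act" "(w, (a, r)) \<in> Act"
      by (rule act_factor[OF _ f(3), of w]) (use w in \<open>auto simp: fiber_def\<close>)
    have r: "r \<in> fiber P ?m"
      using ac.rel_fiber[OF ab(3) _ w, of "inv\<^bsub>H\<^esub> ?h"] ab(2) act_inv[OF f(3,4)] by auto
    show ?thesis
      using ac.rel_isotropic[OF k ab(4) vzero_in[OF mul.vA f(3)] _ vzero_in[OF ac.vP f(4)] r] ab(1)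
        ac.metric_zero(1)[OF f(4) r] ac.metric_zero(3)[OF f(3), of a] by simp
  qed
  then have "vdiff P z z' = vzero P (act (?h, ?m))"
    by (intro dirac_structureD(7)[OF ac.dP am fiber_ops(3)[OF ac.vP am zf]])
  then show ?thesis using fiber_ops(9)[OF ac.vP am zf] by simp
qed

end

section \<open>The group acting on itself, and the target map\<close>

context dirac_group begin

lemma self_action: "dirac_action H A E Mul \<epsilon> A E (\<lambda>(g, h). g \<otimes>\<^bsub>H\<^esub> h) Mul"
proof -
  interpret G: group H by (rule group)
  have bij: "bij_betw (\<lambda>m\<in>points (base A). x \<otimes>\<^bsub>H\<^esub> m) (points (base A)) (points (base A))" if x: "x \<in> carrier H" for x
  proof (rule bij_betw_byWitness[where f'="\<lambda>m. inv\<^bsub>H\<^esub> x \<otimes>\<^bsub>H\<^esub> m"])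
    show "\<forall>a\<in>points (base A). inv\<^bsub>H\<^esub> x \<otimes>\<^bsub>H\<^esub> (\<lambda>m\<in>points (base A). x \<otimes>\<^bsub>H\<^esub> m) a = a"
      using x unfolding carrier[symmetric] by (simp add: G.inv_solve_left' G.m_assoc[symmetric])
    show "\<forall>a'\<in>points (base A). (\<lambda>m\<in>points (base A). x \<otimes>\<^bsub>H\<^esub> m) (inv\<^bsub>H\<^esub> x \<otimes>\<^bsub>H\<^esub> a') = a'"
      using x unfolding carrier[symmetric] by (simp add: G.m_assoc[symmetric])
  qed (use x in \<open>auto simp: carrier[symmetric]\<close>)
  have "group_action H (points (base A)) (\<lambda>h. \<lambda>m\<in>points (base A). (case (h, m) of (g, h) \<Rightarrow> g \<otimes>\<^bsub>H\<^esub> h))"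
  proof (intro group_action.intro group_hom.intro group_hom_axioms.intro group group_BijGroup)
    show "(\<lambda>h. \<lambda>m\<in>points (base A). (case (h, m) of (g, h) \<Rightarrow> g \<otimes>\<^bsub>H\<^esub> h)) \<in> hom H (BijGroup (points (base A)))"
    proof (rule homI)
      fix x assume x: "x \<in> carrier H"
      from bij[OF x]
      show "(\<lambda>m\<in>points (base A). (case (x, m) of (g, h) \<Rightarrow> g \<otimes>\<^bsub>H\<^esub> h)) \<in> carrier (BijGroup (points (base A)))"
        by (simp add: BijGroup_def Bij_def)
    next
      fix x y assume xy: "x \<in> carrier H" "y \<in> carrier H"
      have b: "(\<lambda>m\<in>points (base A). z \<otimes>\<^bsub>H\<^esub> m) \<in> Bij (points (base A))" if "z \<in> carrier H" for z
        using bij[OF that] by (simp add: Bij_def)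
      show "(\<lambda>m\<in>points (base A). (case (x \<otimes>\<^bsub>H\<^esub> y, m) of (g, h) \<Rightarrow> g \<otimes>\<^bsub>H\<^esub> h)) =
        (\<lambda>m\<in>points (base A). (case (x, m) of (g, h) \<Rightarrow> g \<otimes>\<^bsub>H\<^esub> h)) \<otimes>\<^bsub>BijGroup (points (base A))\<^esub>
        (\<lambda>m\<in>points (base A). (case (y, m) of (g, h) \<Rightarrow> g \<otimes>\<^bsub>H\<^esub> h))"
        using b[OF xy(1)] b[OF xy(2)] xy unfolding carrier[symmetric]
        by (auto simp: BijGroup_def compose_def G.m_assoc)
    qed
  qed
  then show ?thesis
    using dlg unfolding dirac_action_def dirac_lie_group_def smooth_action_def lie_group_def by auto
qed

interpretation self: dirac_act H A E Mul \<epsilon> A E "\<lambda>(g, h). g \<otimes>\<^bsub>H\<^esub> h" Mul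
  by unfold_locales (rule self_action)

abbreviation t where "t \<equiv> unit_left H A E Mul"

lemmas t_in = self.u_in and mul_composable = self.act_composable and mul_unique = self.act_unique

lemma t_mul: "(z, (x, y)) \<in> Mul \<Longrightarrow> t z = t x"
  by (rule self.act_target[OF _ t_in[OF mul.rel_base(1)]])

lemma t_unit: "v \<in> E \<inter> fiber A e \<Longrightarrow> t v = v"
  using t_in[of v] unit_mulR[of v "t v" v] by (auto simp: fiber_def)

end

section \<open>Existence of products\<close>

context dirac_act begin

lemma u_act: "(z, (x, y)) \<in> Act \<Longrightarrow> u z = t x"
  using act_target t_in ac.rel_base(1) by blast

text \<open>Over the unit \<open>w\<close> differs from \<open>s w\<close> by an element
  \<open>q\<close> of the kernel of the source map. The unit \<open>s w\<close> acts on
  \<open>r\<close>, and linearity leaves the product of \<open>q\<close> with zero, whose existence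
  is a matter of \<open>rel_dual\<close>.\<close>

lemma act_e_exists:
  assumes w: "w \<in> fiber A e" and r: "r \<in> total P" and c: "s w = u r"
  shows "\<exists>z. (z, (w, r)) \<in> Act"
proof -
  let ?n = "proj P r" and ?v = "s w"
  have wt: "w \<in> total A" using w by (simp add: fiber_def)
  have v: "?v \<in> E \<inter> fiber A e" by (rule s_in(1)[OF wt])
  have vf: "?v \<in> fiber A e" using v by blast
  have n: "?n \<in> points (base P)" "r \<in> fiber P ?n" using r vector_bundleD(4)[OF ac.vP] by (auto simp: fiber_def)
  define q where "q = vdiff A w ?v"
  have q: "q \<in> fiber A e" unfolding q_def by (rule fiber_ops(3)[OF mul.vA e_in w vf])
  have "(?v, (?v, ?v)) \<in> Mul" using s_in(2)[of ?v] s_unit[OF v] v by (auto simp: fiber_def)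
  then have qq: "(q, (q, vzero A e)) \<in> Mul"
    using mul.rel_diff[OF s_in(2)[OF wt], of ?v ?v ?v] fiber_ops(8)[OF mul.vA e_in vf vf] w vf unfolding q_def
    by (simp add: fiber_def)
  have "\<exists>z. (z, (q, vzero P ?n)) \<in> Act"
  proof (rule ac.rel_dual[OF e_in n(1) q vzero_in[OF ac.vP n(1)]])
    fix x' y' assume xy: "(vzero P (act (e, ?n)), (x', y')) \<in> Act" "x' \<in> fiber A e" "y' \<in> fiber P ?n"
    \<comment> \<open>Multiplying the relation for \<open>x'\<close> by zero on the left and
      reassociating shows \<open>x' = 0 x'\<close>, where \<open>0\<close> is the zero unit; so
      \<open>x'\<close> lies in the kernel of the target map.\<close>
    have "(vzero P ?n, (vzero A e, vzero P ?n)) \<in> Act" using ac.rel_zero[OF e_in n(1)] act_e[OF n(1)] by simp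
    moreover have "(vzero P ?n, (x', y')) \<in> Act" using xy act_e[OF n(1)] by simp
    ultimately obtain v where "(vzero P ?n, (v, y')) \<in> Act" "(v, (vzero A e, x')) \<in> Mul" using assocP by blast
    moreover from this have "v = x'" using unit_mulL[OF _ zero_e] by blast
    ultimately have "(x', (vzero A e, x')) \<in> Mul" by simp
    \<comment> \<open>The kernel of the source is orthogonal to that of the target: isotropy of
      \<open>q = q 0\<close> against \<open>x' = 0 x'\<close> reads
      \<open><q, x'> = <q, 0> + <0, x'>\<close>.\<close>
    then have "metric A q x' = 0"
      using mul.rel_isotropic[OF qq, of x' "vzero A e" x' e e] q xy(2) vzero_in[OF mul.vA e_in]
        mul.metric_zero(1)[OF e_in xy(2)] mul.metric_zero(4)[OF e_in q] by simp
    then show "metric A q x' + metric P (vzero P ?n) y' = 0" using ac.metric_zero(1)[OF n(1) xy(3)] by simp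
  qed
  then obtain z where z: "(z, (q, vzero P ?n)) \<in> Act" by blast
  have "(r, (?v, r)) \<in> Act" using u_in(2)[OF r] c by simp
  then have "(vadd P z r, (vadd A q ?v, vadd P (vzero P ?n) r)) \<in> Act"
    by (rule ac.rel_add[OF z]) (use q vf vzero_in[OF ac.vP n(1)] in \<open>auto simp: fiber_def\<close>)
  moreover have "vadd A q ?v = w" unfolding q_def by (rule fiber_ops(11)[OF mul.vA e_in w vf])
  moreover have "vadd P (vzero P ?n) r = r" by (rule fiber_ops(7)[OF ac.vP n n(2)])
  ultimately show ?thesis by auto
qed

text \<open>Factor the common unit as \<open>b a\<close> with \<open>a\<close> over the base point
  of \<open>x\<close>. Then \<open>x = x (b a) = w a\<close> with \<open>w = x b\<close> over the
  unit, and \<open>w (a y)\<close> exists by the previous lemma; reassociating turns it into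
  \<open>(w a) y\<close>, where \<open>w a = x\<close> by uniqueness.\<close>

lemma act_exists:
  assumes x: "x \<in> total A" and y: "y \<in> total P" and c: "s x = u y"
  shows "\<exists>z. (z, (x, y)) \<in> Act"
proof -
  let ?h = "proj A x"
  have h: "?h \<in> points (base A)" "x \<in> fiber A ?h" using x vector_bundleD(4)[OF mul.vA] by (auto simp: fiber_def)
  interpret G: group H by (rule group)
  have ii: "inv\<^bsub>H\<^esub> (inv\<^bsub>H\<^esub> ?h) = ?h" "?h \<otimes>\<^bsub>H\<^esub> inv\<^bsub>H\<^esub> ?h = e" using h carrier by auto
  obtain b a r where ab: "b \<in> E \<inter> fiber A (inv\<^bsub>H\<^esub> ?h)" "a \<in> E \<inter> fiber A ?h" "(u y, (b, a)) \<in> Mul"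
    "(r, (a, y)) \<in> Act"
    using act_factor[OF y inv_in[OF h(1)]] unfolding ii by metis
  have "(x, (x, u y)) \<in> Mul" using s_in(2)[OF x] c by simp
  then obtain w where w: "(x, (w, a)) \<in> Mul" "(w, (x, b)) \<in> Mul" using assocM ab(3) by blast
  have wf: "w \<in> fiber A e" using mul.rel_fiber[OF w(2) h(2), of "inv\<^bsub>H\<^esub> ?h"] ab(1) ii by auto
  have "s w = t a" by (rule mul_composable[OF w(1)])
  also have "t a = u r" using u_act[OF ab(4)] by simp
  finally obtain z where z: "(z, (w, r)) \<in> Act" using act_e_exists[OF wf ac.rel_base(3)[OF ab(4)]] by blast
  then obtain q where "(z, (q, y)) \<in> Act" "(q, (w, a)) \<in> Mul" using assocP ab(4) by blast
  then show ?thesis using mul_unique[OF w(1)] by blast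
qed

lemma rel_app_eq: "(z, (x, y)) \<in> Act \<Longrightarrow> rel_app Act x y = z"
  unfolding rel_app_def by (rule the_equality) (use act_unique in blast)+

lemma act_iff: "(z, (x, y)) \<in> Act \<longleftrightarrow> x \<in> total A \<and> y \<in> total P \<and> s x = u y \<and> z = rel_app Act x y"
  using act_exists act_composable rel_app_eq ac.rel_base(1,2) by metis

end

section \<open>Inverses\<close>

context dirac_group begin

interpretation self: dirac_act H A E Mul \<epsilon> A E "\<lambda>(g, h). g \<otimes>\<^bsub>H\<^esub> h" Mul
  by unfold_locales (rule self_action)

lemmas mul_exists = self.act_exists and mul_iff = self.act_iff

lemma unit_eq: "x \<in> E \<inter> fiber A e \<Longrightarrow> (x, (x, x)) \<in> Mul"
  using s_in(2)[of x] s_unit[of x] by (auto simp: fiber_def)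

text \<open>In the fiber over the unit the inverse of \<open>p\<close> is \<open>s p + t p - p\<close>; a general \<open>x\<close> is brought into
  that fiber by composing with an element of \<open>E\<close>.\<close>

lemma right_inverse:
  assumes x: "x \<in> total A"
  shows "\<exists>y. (t x, (x, y)) \<in> Mul"
proof -
  let ?g = "proj A x"
  have g: "?g \<in> points (base A)" "x \<in> fiber A ?g" using x vector_bundleD(4)[OF mul.vA] by (auto simp: fiber_def)
  have ge: "?g \<otimes>\<^bsub>H\<^esub> inv\<^bsub>H\<^esub> ?g = e" using g(1) carrier group.r_inv[OF group] by simp
  obtain c d where c: "c \<in> E \<inter> fiber A (inv\<^bsub>H\<^esub> ?g)" "(s x, (c, d)) \<in> Mul"
    by (rule split_unit[OF s_in(1)[OF x] inv_in[OF g(1)]])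
  \<comment> \<open>The factor \<open>c\<close> of the unit \<open>s x\<close> is composable with
    \<open>x\<close>, and the product \<open>p\<close> lies over \<open>e\<close>; a right inverse
    of \<open>p\<close> then gives one of \<open>x\<close> after reassociation.\<close>
  have "t c = s x" using t_mul[OF c(2)] t_unit[OF s_in(1)[OF x]] by simp
  then obtain p where p: "(p, (x, c)) \<in> Mul" using mul_exists[OF x, of c] mul.rel_base(1)[OF c(2)] by auto
  have pe: "p \<in> fiber A e" using mul.rel_fiber[OF p g(2), of "inv\<^bsub>H\<^esub> ?g"] c(1) ge by auto
  have pt: "p \<in> total A" using pe by (simp add: fiber_def)
  have tp: "t p \<in> E \<inter> fiber A e" "(p, (t p, p)) \<in> Mul" using t_in[OF pt] by auto
  have sp: "s p \<in> E \<inter> fiber A e" "(p, (p, s p)) \<in> Mul" using s_in[OF pt] by auto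
  have tpf: "t p \<in> fiber A e" "s p \<in> fiber A e" using tp sp by auto
  let ?d = "vdiff A (t p) p"
  have d: "?d \<in> fiber A e" by (rule fiber_ops(3)[OF mul.vA e_in tpf(1) pe])
  \<comment> \<open>This is \<open>t p = (t p)(t p)\<close> minus \<open>p = (t p) p\<close>. Adding
    \<open>p = p (s p)\<close> gives \<open>t p\<close> as the product of \<open>p\<close> and
    \<open>s p + (t p - p)\<close>.\<close>
  have "(?d, (vzero A e, ?d)) \<in> Mul"
    using mul.rel_diff[OF unit_eq[OF tp(1)] tp(2)] fiber_ops(8)[OF mul.vA e_in tpf(1) tpf(1)] tpf pe by (simp add: fiber_def)
  from mul.rel_add[OF sp(2) this]
  have "(vadd A p ?d, (vadd A p (vzero A e), vadd A (s p) ?d)) \<in> Mul"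
    using pe tpf d vzero_in[OF mul.vA e_in] by (simp add: fiber_def)
  then have "(t p, (p, vadd A (s p) ?d)) \<in> Mul"
    using fiber_ops(12)[OF mul.vA e_in pe tpf(1)] fiber_ops(6)[OF mul.vA e_in pe pe] by simp
  then obtain y where "(t p, (x, y)) \<in> Mul" using assocM p by blast
  then show ?thesis using t_mul[OF p] by auto
qed

text \<open>As for groups, a right inverse \<open>y\<close> has itself a right inverse
  \<open>z\<close>, and \<open>x = x (y z) = (x y) z = z\<close>; hence \<open>y\<close> is
  two-sided.\<close>

lemma inverse_exists:
  assumes x: "x \<in> total A"
  obtains y where "y \<in> total A" "(t x, (x, y)) \<in> Mul" "(s x, (y, x)) \<in> Mul" "s y = t x" "t y = s x"
proof -
  obtain y where y: "(t x, (x, y)) \<in> Mul" using right_inverse[OF x] by blast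
  have yt: "y \<in> total A" by (rule mul.rel_base(2)[OF y])
  obtain z where z: "(t y, (y, z)) \<in> Mul" using right_inverse[OF yt] by blast
  have zt: "z \<in> total A" by (rule mul.rel_base(2)[OF z])
  have sx: "s x = t y" by (rule mul_composable[OF y])
  have "(x, (x, t y)) \<in> Mul" using s_in(2)[OF x] sx by simp
  then obtain v where v: "(x, (v, z)) \<in> Mul" "(v, (x, y)) \<in> Mul" using assocM z by blast
  have "v = t x" by (rule mul_unique[OF v(2) y])
  then have "(v, z) = (t x, x)" using unit_mulL[OF v(1)] t_in(1)[OF x] by simp
  then have "(s x, (y, x)) \<in> Mul" using z unfolding sx by simp
  moreover have "s y = t x" using s_mul[OF y] s_unit[OF t_in(1)[OF x]] by simp
  ultimately show ?thesis by (rule that[OF yt y]) (rule sx[symmetric])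
qed

definition vinv where "vinv x = (SOME y. y \<in> total A \<and> (t x, (x, y)) \<in> Mul \<and> (s x, (y, x)) \<in> Mul \<and> s y = t x \<and> t y = s x)"

lemma vinv: "x \<in> total A \<Longrightarrow> vinv x \<in> total A \<and> (t x, (x, vinv x)) \<in> Mul \<and> (s x, (vinv x, x)) \<in> Mul \<and>
    s (vinv x) = t x \<and> t (vinv x) = s x"
  unfolding vinv_def by (rule someI_ex) (use inverse_exists in blast)

text \<open>Reassociating with the inverse recovers the second factor as the product of
  \<open>vinv x\<close> and \<open>z\<close>.\<close>

lemma mul_left_cancel:
  assumes "(z, (x, y)) \<in> Mul" "(z, (x, y')) \<in> Mul" shows "y = y'"
proof -
  have x: "x \<in> total A" by (rule mul.rel_base(1)[OF assms(1)])
  note i = vinv[OF x]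
  have "y0 = rel_app Mul (vinv x) z" if z: "(z, (x, y0)) \<in> Mul" for y0
  proof -
    have y0: "y0 \<in> total A" by (rule mul.rel_base(2)[OF z])
    have "(y0, (s x, y0)) \<in> Mul" using t_in(2)[OF y0] mul_composable[OF z] by simp
    then obtain v where v: "(y0, (vinv x, v)) \<in> Mul" "(v, (x, y0)) \<in> Mul" using assocM i by blast
    have "v = z" by (rule mul_unique[OF v(2) z])
    then show ?thesis using v(1) mul_iff by blast
  qed
  then show ?thesis using assms by metis
qed

end

section \<open>Smoothness of maps into a Dirac morphism\<close>

lemma smooth_fun_triv:
  assumes V: "vector_bundle V" and t: "(U, \<tau>) \<in> max_triv V" and L: "linear L"
    and f: "smooth_at \<C> T (total_atlas V) f p" and p: "proj V (f p) \<in> U"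
  shows "smooth_fun_at \<C> T (\<lambda>q. L (\<tau> (f q))) p"
proof -
  have "f p \<in> total V" using smooth_atD(3)[OF f] points_total_atlas[OF V] by simp
  then have "smooth_fun_at (total_atlas V) UNIV \<tau> (f p)" using p by (intro smooth_at_triv[OF V t]) auto
  then have "smooth_fun_at (total_atlas V) UNIV (\<lambda>x. L (\<tau> x)) (f p)"
    by (rule smooth_fun_at_linear[OF vector_bundleD(3)[OF V]]) (rule linear_conv_bounded_linear[THEN iffD1, OF L])
  from smooth_at_compose[OF vector_bundleD(3)[OF V] f this] show ?thesis by simp
qed

lemma smooth_at_proj_compose:
  assumes V: "vector_bundle V" and f: "smooth_at \<C> T (total_atlas V) f p"
  shows "smooth_at \<C> T (base V) (\<lambda>q. proj V (f q)) p"
proof -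
  have "f p \<in> total V" using smooth_atD(3)[OF f] points_total_atlas[OF V] by simp
  then have "smooth_at (total_atlas V) UNIV (base V) (proj V) (f p)" by (intro smooth_at_proj[OF V]) auto
  from smooth_at_compose[OF vector_bundleD(3)[OF V] f this] show ?thesis by simp
qed

lemma linear_zero: "linear (\<lambda>_. 0)" by (rule linearI) auto

lemma linear_complement: "linear \<pi> \<Longrightarrow> linear (\<lambda>v. v - \<pi> v)"
  by (rule linear_compose_sub[OF linear_ident])

lemma triv_zero_iff:
  assumes V: "vector_bundle V" and t: "(U, \<tau>) \<in> max_triv V" and m: "m \<in> U" and x: "x \<in> fiber V m"
  shows "\<tau> x = 0 \<longleftrightarrow> x = vzero V m"
proof -
  have mp: "m \<in> points (base V)" using max_trivD(2)[OF V t] m by blast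
  obtain r where r: "trivialization V r (U, \<tau>)" using max_trivD(1)[OF V t] by blast
  have l: "\<tau> (vscale V 0 x) = 0" using trivializationD(2)[OF r m] x by (simp add: fiber_linear_def)
  then have z: "\<tau> (vzero V m) = 0" using fiber_ops(5)[OF V mp x x] by simp
  then show ?thesis using trivializationD(3)[OF r m] vzero_in[OF V mp] x by (metis inj_onD)
qed

text \<open>In a flattening trivialization, membership in the subbundle is the vanishing of a fixed
  linear function. So the requirement to lie in \<open>E\<close> or \<open>L\<close> can be one
  component of the prescribed data.\<close>

lemma flat_complement_iff:
  assumes V: "vector_bundle V" and t: "(U, \<tau>) \<in> max_triv V" and m: "m \<in> U" and x: "x \<in> fiber V m"
    and W: "\<tau> ` (R \<inter> fiber V m) = W" and \<pi>: "\<And>v. \<pi> v \<in> W" "\<And>w. w \<in> W \<Longrightarrow> \<pi> w = w"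
  shows "\<tau> x - \<pi> (\<tau> x) = 0 \<longleftrightarrow> x \<in> R"
proof -
  obtain r where r: "trivialization V r (U, \<tau>)" using max_trivD(1)[OF V t] by blast
  have "x \<in> R" if "\<tau> x \<in> W"
  proof -
    obtain y where "y \<in> R" "y \<in> fiber V m" "\<tau> x = \<tau> y" using \<open>\<tau> x \<in> W\<close> W by blast
    then show ?thesis using trivializationD(3)[OF r m] x by (metis inj_onD)
  qed
  moreover have "\<tau> x \<in> W" if "x \<in> R" using that x W by blast
  ultimately show ?thesis using \<pi> by (metis right_minus_eq)
qed

lemma triv_sub_bundleI:
  assumes "(U, \<tau>) \<in> max_triv V" "subspace W" "\<And>m. m \<in> U \<inter> S \<Longrightarrow> \<tau> ` (R \<inter> fiber V m) = W"
  shows "(U \<inter> S, \<tau>) \<in> triv (sub_bundle V S R)"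
proof -
  have "\<exists>W. subspace W \<and> (\<forall>m\<in>U \<inter> S. \<tau> ` (R \<inter> fiber V m) = W)" using assms(2,3) by (intro exI[of _ W]) simp
  then show ?thesis using assms(1) unfolding sub_bundle_def by simp blast
qed

section \<open>Smooth solutions of the relation, and its part inside \<open>E\<close> and
  \<open>L\<close>\<close>

context dirac_rel begin

text \<open>The prescribed data combine into a fiberwise linear map, and \<open>ker\<close> says
  that it is injective on the fiber of \<open>Act\<close> at the point in question. Choosing some
  \<open>Li\<close> to be zero leaves that component free, the identity prescribes it, and the
  complement of a projection constrains it to the subbundle.\<close>

lemma rel_smooth:
  fixes \<C> :: "('q, 'e::euclidean_space) atlas"
    and L1 :: "'g \<Rightarrow> 'g" and L2 :: "'f::euclidean_space \<Rightarrow> 'f" and L3 :: "'g::euclidean_space \<Rightarrow> 'g"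
  assumes C: "smooth_atlas \<C>" and p: "p \<in> T" and f: "\<And>q. q \<in> T \<Longrightarrow> (z q, (x q, y q)) \<in> Act"
    and pr: "smooth_at \<C> T (base A) (\<lambda>q. proj A (x q)) p" "smooth_at \<C> T (base P) (\<lambda>q. proj P (y q)) p"
    and t: "(U1, \<tau>1) \<in> max_triv P" "(U2, \<tau>2) \<in> max_triv A" "(U3, \<tau>3) \<in> max_triv P"
    and pU: "proj P (z p) \<in> U1" "proj A (x p) \<in> U2" "proj P (y p) \<in> U3"
    and L: "linear L1" "linear L2" "linear L3"
    and ker: "\<And>z' x' y'. (z', (x', y')) \<in> Act \<Longrightarrow> x' \<in> fiber A (proj A (x p)) \<Longrightarrow> y' \<in> fiber P (proj P (y p)) \<Longrightarrow>
      L1 (\<tau>1 z') = 0 \<Longrightarrow> L2 (\<tau>2 x') = 0 \<Longrightarrow> L3 (\<tau>3 y') = 0 \<Longrightarrow>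
      z' = vzero P (act (proj A (x p), proj P (y p))) \<and> x' = vzero A (proj A (x p)) \<and> y' = vzero P (proj P (y p))"
    and kf: "smooth_fun_at \<C> T (\<lambda>q. L1 (\<tau>1 (z q))) p" "smooth_fun_at \<C> T (\<lambda>q. L2 (\<tau>2 (x q))) p"
      "smooth_fun_at \<C> T (\<lambda>q. L3 (\<tau>3 (y q))) p"
  shows "smooth_at \<C> T (total_atlas P) z p" "smooth_at \<C> T (total_atlas A) x p" "smooth_at \<C> T (total_atlas P) y p"
proof -
  let ?V = "prod_bundle P (prod_bundle A P)"
  let ?h = "proj A (x p)" and ?m = "proj P (y p)"
  define F where "F q = (z q, (x q, y q))" for q
  define \<kappa> where "\<kappa> w = (L1 (\<tau>1 (fst w)), (L2 (\<tau>2 (fst (snd w))), L3 (\<tau>3 (snd (snd w)))))" for w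
  have sA: "smooth_atlas (base A)" "smooth_atlas (base P)" "smooth_atlas (prod_atlas (base A) (base P))"
    using vector_bundleD(2)[OF vA] vector_bundleD(2)[OF vP] smooth_atlas_prod by auto
  note rb = rel_base[OF f[OF p]]
  have hm: "?h \<in> points (base A)" "?m \<in> points (base P)" "act (?h, ?m) \<in> points (base P)" using rb act_points by auto
  have pF: "proj ?V (F p) = (act (?h, ?m), (?h, ?m))" using rb(4) by (simp add: F_def)
  have Fp: "F p \<in> Act" using f[OF p] by (simp add: F_def)
  obtain r1 r2 r3 where r: "trivialization P r1 (U1, \<tau>1)" "trivialization A r2 (U2, \<tau>2)" "trivialization P r3 (U3, \<tau>3)"
    using max_trivD(1)[OF vP t(1)] max_trivD(1)[OF vA t(2)] max_trivD(1)[OF vP t(3)] by blast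
  have prP: "smooth_at \<C> T (prod_atlas (base A) (base P)) (\<lambda>q. (proj A (x q), proj P (y q))) p"
    by (rule smooth_at_Pair[OF sA(1,2) C pr])
  have sact: "smooth_at (prod_atlas (base A) (base P)) (points (base A) \<times> points (base P)) (base P) act (?h, ?m)"
    using smooth_map_onD[OF mor'(2) sA(3,2)] hm by (simp add: points_prod_atlas)
  \<comment> \<open>The base point of \<open>z\<close> is determined by those of \<open>x\<close>
    and \<open>y\<close> through the action on the base.\<close>
  have "smooth_at \<C> T (base P) (\<lambda>q. act (proj A (x q), proj P (y q))) p"
    by (rule smooth_at_compose[OF sA(3) prP sact]) (simp add: points_prod_atlas)
  then have prz: "smooth_at \<C> T (base P) (\<lambda>q. proj P (z q)) p"
    by (rule smooth_at_cong) (use rel_base(4)[OF f] in simp)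
  have prF: "smooth_at \<C> T (base ?V) (\<lambda>q. proj ?V (F q)) p"
    using smooth_at_Pair[OF sA(2,3) C prz prP] by (simp add: F_def)
  have sm: "smooth_at \<C> T (total_atlas ?V) F p"
  proof -
    have "(act (?h, ?m), (?h, ?m)) \<in> GrA" using hm by blast
    from vector_subbundleD(5)[OF sub this] obtain U \<tau> W where fl: "(U, \<tau>) \<in> max_triv ?V" "(act (?h, ?m), (?h, ?m)) \<in> U"
      "subspace W" "\<And>m. m \<in> U \<inter> GrA \<Longrightarrow> \<tau> ` (Act \<inter> fiber ?V m) = W" by blast
    have N: "openin (manifold_topology (base ?V)) (U1 \<times> (U2 \<times> U3))"
      unfolding prod_bundle_simps using trivializationD(1)[OF r(1)] trivializationD(1)[OF r(2)] trivializationD(1)[OF r(3)]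
      by (intro openin_prod_manifold sA)
    have Np: "proj ?V (F p) \<in> U1 \<times> (U2 \<times> U3)" using pU by (simp add: F_def)
    have lin: "fiber_linear ?V w \<kappa>" if "w \<in> U1 \<times> (U2 \<times> U3)" for w
    proof -
      obtain a b c where w: "w = (a, (b, c))" "a \<in> U1" "b \<in> U2" "c \<in> U3" using \<open>w \<in> U1 \<times> (U2 \<times> U3)\<close> by blast
      have "fiber_linear P a (\<lambda>x. L1 (\<tau>1 x))" "fiber_linear A b (\<lambda>x. L2 (\<tau>2 x))" "fiber_linear P c (\<lambda>x. L3 (\<tau>3 x))"
        using fiber_linear_compose[OF trivializationD(2)[OF r(1) w(2)] L(1)]
          fiber_linear_compose[OF trivializationD(2)[OF r(2) w(3)] L(2)]
          fiber_linear_compose[OF trivializationD(2)[OF r(3) w(4)] L(3)] by simp_all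
      then show ?thesis unfolding w(1) by (auto simp: fiber_linear_def fiber_prod \<kappa>_def)
    qed
    have k: "smooth_fun_at (total_atlas ?V) UNIV \<kappa> w" if w: "w \<in> fiber ?V (proj ?V (F p))" for w
    proof -
      have wt: "w \<in> total P \<times> total (prod_bundle A P)" and wp: "proj P (fst w) = proj P (z p)"
        "proj A (fst (snd w)) = ?h" "proj P (snd (snd w)) = ?m"
        using w by (auto simp: fiber_def F_def)
      have t2: "snd w \<in> total A \<times> total P" using wt by auto
      note vV = vector_bundleD(3)[OF vAP(2)]
      have s: "smooth_at (total_atlas ?V) UNIV (total_atlas P) fst w"
        "smooth_at (total_atlas ?V) UNIV (total_atlas (prod_bundle A P)) snd w"
        by (rule smooth_at_prod_bundle_fst_snd[OF vP vAP(1) wt UNIV_I])+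
      have s2: "smooth_at (total_atlas ?V) UNIV (total_atlas A) (\<lambda>w. fst (snd w)) w"
        "smooth_at (total_atlas ?V) UNIV (total_atlas P) (\<lambda>w. snd (snd w)) w"
        by (rule smooth_at_compose[OF vector_bundleD(3)[OF vAP(1)] s(2) smooth_at_prod_bundle_fst_snd(1)[OF vA vP t2 UNIV_I]],
            simp, rule smooth_at_compose[OF vector_bundleD(3)[OF vAP(1)] s(2) smooth_at_prod_bundle_fst_snd(2)[OF vA vP t2 UNIV_I]],
            simp)
      have "smooth_fun_at (total_atlas ?V) UNIV (\<lambda>w. L1 (\<tau>1 (fst w))) w"
        by (rule smooth_fun_triv[OF vP t(1) L(1) s(1)]) (simp add: wp pU)
      moreover have "smooth_fun_at (total_atlas ?V) UNIV (\<lambda>w. L2 (\<tau>2 (fst (snd w)))) w"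
        by (rule smooth_fun_triv[OF vA t(2) L(2) s2(1)]) (simp add: wp pU)
      moreover have "smooth_fun_at (total_atlas ?V) UNIV (\<lambda>w. L3 (\<tau>3 (snd (snd w)))) w"
        by (rule smooth_fun_triv[OF vP t(3) L(3) s2(2)]) (simp add: wp pU)
      ultimately show ?thesis unfolding \<kappa>_def by (intro smooth_fun_at_Pair[OF vV])
    qed
    \<comment> \<open>By linearity it is enough that the difference of two elements with equal data
      vanishes, and that is the hypothesis \<open>ker\<close>.\<close>
    have inj: "inj_on \<kappa> (Act \<inter> fiber ?V (proj ?V (F p)))"
    proof (rule inj_onI)
      fix v w assume vw: "v \<in> Act \<inter> fiber ?V (proj ?V (F p))" "w \<in> Act \<inter> fiber ?V (proj ?V (F p))" "\<kappa> v = \<kappa> w"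
      obtain a b c a' b' c' where e: "v = (a, (b, c))" "w = (a', (b', c'))" by (metis surj_pair)
      have R: "(a, (b, c)) \<in> Act" "(a', (b', c')) \<in> Act" using vw(1,2) unfolding e by blast+
      have fb: "a \<in> fiber P (act (?h, ?m))" "b \<in> fiber A ?h" "c \<in> fiber P ?m"
        "a' \<in> fiber P (act (?h, ?m))" "b' \<in> fiber A ?h" "c' \<in> fiber P ?m"
        using vw(1,2) unfolding e pF fiber_prod by auto
      have d: "(vdiff P a a', (vdiff A b b', vdiff P c c')) \<in> Act"
        by (rule rel_diff[OF R]) (use fb in \<open>auto simp: fiber_def\<close>)
      have df: "vdiff P a a' \<in> fiber P (act (?h, ?m))" "vdiff A b b' \<in> fiber A ?h" "vdiff P c c' \<in> fiber P ?m"
        using fiber_ops(3)[OF vP hm(3) fb(1,4)] fiber_ops(3)[OF vA hm(1) fb(2,5)] fiber_ops(3)[OF vP hm(2) fb(3,6)] by auto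
      have l0: "L1 (\<tau>1 (vdiff P a a')) = L1 (\<tau>1 a) - L1 (\<tau>1 a')" "L2 (\<tau>2 (vdiff A b b')) = L2 (\<tau>2 b) - L2 (\<tau>2 b')"
        "L3 (\<tau>3 (vdiff P c c')) = L3 (\<tau>3 c) - L3 (\<tau>3 c')"
      proof -
        have *: "K (vdiff B u v) = K u - K v" if "vector_bundle B" "n \<in> points (base B)" "fiber_linear B n K" "u \<in> fiber B n" "v \<in> fiber B n"
          for B :: "('u, 'i::euclidean_space, 'j, 'k::euclidean_space, 'l) vbundle_scheme" and n u v and K :: "'j \<Rightarrow> 'k"
          using that fiber_ops(2)[OF that(1,2,5,5), of "- 1"] unfolding vdiff_def fiber_linear_def by simp
        show "L1 (\<tau>1 (vdiff P a a')) = L1 (\<tau>1 a) - L1 (\<tau>1 a')"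
          by (rule *[OF vP hm(3) fiber_linear_compose[OF trivializationD(2)[OF r(1)] L(1)] fb(1,4)]) (use pU rb(4) in simp)
        show "L2 (\<tau>2 (vdiff A b b')) = L2 (\<tau>2 b) - L2 (\<tau>2 b')"
          by (rule *[OF vA hm(1) fiber_linear_compose[OF trivializationD(2)[OF r(2)] L(2)] fb(2,5)]) (use pU in simp)
        show "L3 (\<tau>3 (vdiff P c c')) = L3 (\<tau>3 c) - L3 (\<tau>3 c')"
          by (rule *[OF vP hm(2) fiber_linear_compose[OF trivializationD(2)[OF r(3)] L(3)] fb(3,6)]) (use pU in simp)
      qed
      have "vdiff P a a' = vzero P (act (?h, ?m)) \<and> vdiff A b b' = vzero A ?h \<and> vdiff P c c' = vzero P ?m"
        by (rule ker[OF d df(2,3)]) (use vw(3) in \<open>simp_all add: l0 e \<kappa>_def\<close>)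
      then show "v = w"
        using fiber_ops(9)[OF vP hm(3) fb(1,4)] fiber_ops(9)[OF vA hm(1) fb(2,5)] fiber_ops(9)[OF vP hm(2) fb(3,6)]
        unfolding e by simp
    qed
    have kF: "smooth_fun_at \<C> T (\<lambda>q. \<kappa> (F q)) p"
      unfolding \<kappa>_def F_def fst_conv snd_conv by (intro smooth_fun_at_Pair[OF C] kf)
    show ?thesis
    proof (rule smooth_at_subbundle[of ?V U \<tau> W GrA Act \<C> T F p "U1 \<times> (U2 \<times> U3)" \<kappa>])
      show "proj ?V ` Act \<subseteq> GrA" using vector_subbundleD(4)[OF sub] by blast
      show "F q \<in> Act" if "q \<in> T" for q using f[OF that] by (simp add: F_def)
    qed (assumption | rule vAP(2) fl C N Np lin k inj kF prF vector_subbundleD(2)[OF sub] | (simp only: pF, rule fl))+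
  qed
  have wt: "F p \<in> total P \<times> total (prod_bundle A P)" using rb by (simp add: F_def)
  have t2: "snd (F p) \<in> total A \<times> total P" using rb by (simp add: F_def)
  have "smooth_at \<C> T (total_atlas P) (\<lambda>q. fst (F q)) p"
    by (rule smooth_at_compose[OF vector_bundleD(3)[OF vAP(2)] sm smooth_at_prod_bundle_fst_snd(1)[OF vP vAP(1) wt UNIV_I]]) simp
  then show "smooth_at \<C> T (total_atlas P) z p" by (simp add: F_def)
  have s: "smooth_at \<C> T (total_atlas (prod_bundle A P)) (\<lambda>q. snd (F q)) p"
    by (rule smooth_at_compose[OF vector_bundleD(3)[OF vAP(2)] sm smooth_at_prod_bundle_fst_snd(2)[OF vP vAP(1) wt UNIV_I]]) simp
  have "smooth_at \<C> T (total_atlas A) (\<lambda>q. fst (snd (F q))) p"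
    by (rule smooth_at_compose[OF vector_bundleD(3)[OF vAP(1)] s smooth_at_prod_bundle_fst_snd(1)[OF vA vP t2 UNIV_I]]) simp
  then show "smooth_at \<C> T (total_atlas A) x p" by (simp add: F_def)
  have "smooth_at \<C> T (total_atlas P) (\<lambda>q. snd (snd (F q))) p"
    by (rule smooth_at_compose[OF vector_bundleD(3)[OF vAP(1)] s smooth_at_prod_bundle_fst_snd(2)[OF vA vP t2 UNIV_I]]) simp
  then show "smooth_at \<C> T (total_atlas P) y p" by (simp add: F_def)
qed

text \<open>The graph of the splitting \<open>z \<mapsto> (x, y)\<close> of elements of \<open>L\<close> is \<open>Act \<inter> (L \<times> E \<times> L)\<close>.\<close>

lemma sub_graph:
  "vector_subbundle (prod_bundle (sub_bundle P (points (base P)) L)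
      (prod_bundle (sub_bundle A (points (base A)) E) (sub_bundle P (points (base P)) L))) GrA (Act \<inter> (L \<times> (E \<times> L)))"
proof -
  let ?L = "sub_bundle P (points (base P)) L" and ?E = "sub_bundle A (points (base A)) E"
  note sE = dirac_structureD(2)[OF dA] and sL = dirac_structureD(2)[OF dP]
  note bA = vector_bundleD(2)[OF vA] and bP = vector_bundleD(2)[OF vP]
  have bs: "base ?L = max_atlas (base P)" "base ?E = max_atlas (base A)" by (simp_all add: sub_bundle_def restrict_atlas_points)
  have fs: "fiber ?L m = L \<inter> fiber P m" "fiber ?E h = E \<inter> fiber A h" for m h
    using vector_subbundleD(2)[OF sL] vector_subbundleD(2)[OF sE] by (auto simp: sub_bundle_def fiber_def)
  have ops: "vadd ?L = vadd P" "vscale ?L = vscale P" "vadd ?E = vadd A" "vscale ?E = vscale A" by (simp_all add: sub_bundle_def)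
  have vE: "vector_bundle ?E" and vL: "vector_bundle ?L" using vector_subbundleD(3)[OF sE] vector_subbundleD(3)[OF sL] by auto
  note vEL = vector_bundle_prod[OF vE vL]
  \<comment> \<open>The subbundles live over the maximal atlases of the bases; these equalities move
    the smoothness of \<open>act\<close> and the embedding of its graph from the original
    atlases.\<close>
  have mA: "smooth_atlas (max_atlas (base A))" "max_atlas (max_atlas (base A)) = max_atlas (base A)"
    and mP: "smooth_atlas (max_atlas (base P))" "max_atlas (max_atlas (base P)) = max_atlas (base P)"
    using max_atlas_idem[OF bA] max_atlas_idem[OF bP] smooth_atlas_max_atlas[OF bA] smooth_atlas_max_atlas[OF bP] by auto
  have pts: "points (max_atlas (base A)) = points (base A)" "points (max_atlas (base P)) = points (base P)"
    by (rule points_max_atlas[OF bA], rule points_max_atlas[OF bP])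
  have ptsEL: "points (base (prod_bundle ?E ?L)) = points (base A) \<times> points (base P)" by (simp add: bs points_prod_atlas pts)
  note sAP = smooth_atlas_prod[OF bA bP] and mAP = smooth_atlas_prod[OF mA(1) mP(1)]
  have eqAP: "max_atlas (prod_atlas (max_atlas (base A)) (max_atlas (base P))) = max_atlas (prod_atlas (base A) (base P))"
    by (rule prod_atlas_max_atlas_eq[OF bA bP mA(1) mP(1) mA(2) mP(2)])
  \<comment> \<open>The unique splitting of the Dirac condition. It goes from the fiber of
    \<open>L\<close> over \<open>act p\<close> to the fibers over \<open>p\<close>, so it is a
    bundle map out of the pullback of \<open>L\<close> along \<open>act\<close>.\<close>
  define \<rho> where "\<rho> p z = (THE w. w \<in> (E \<inter> fiber A (fst p)) \<times> (L \<inter> fiber P (snd p)) \<and> (z, w) \<in> Act)" for p z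
  have rho: "\<rho> p z \<in> (E \<inter> fiber A (fst p)) \<times> (L \<inter> fiber P (snd p))" "(z, \<rho> p z) \<in> Act"
    if "p \<in> points (base A) \<times> points (base P)" "z \<in> L \<inter> fiber P (act p)" for p z
  proof -
    have "fst p \<in> points (base A)" "snd p \<in> points (base P)" "z \<in> L" "z \<in> fiber P (act (fst p, snd p))" using that by auto
    from theI'[OF rel_split_unique[OF this]]
    show "\<rho> p z \<in> (E \<inter> fiber A (fst p)) \<times> (L \<inter> fiber P (snd p))" "(z, \<rho> p z) \<in> Act" unfolding \<rho>_def by auto
  qed
  have rhoI: "\<rho> p z = w" if "p \<in> points (base A) \<times> points (base P)" "w \<in> (E \<inter> fiber A (fst p)) \<times> (L \<inter> fiber P (snd p))" "(z, w) \<in> Act" for p z w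
  proof -
    obtain x y where w: "w = (x, y)" by (cases w)
    have zL: "z \<in> L" using rel_forward[of z x y] that w by auto
    have zf: "z \<in> fiber P (act (fst p, snd p))" using rel_fiber[of z x y] that w by auto
    have "fst p \<in> points (base A)" "snd p \<in> points (base P)" using that by auto
    from rel_split_unique[OF this zL zf] show ?thesis unfolding \<rho>_def by (rule the1_equality) (use that in blast)
  qed
  have "vector_subbundle (prod_bundle ?L (prod_bundle ?E ?L)) GrA
    {(z, \<rho> p z) | p z. p \<in> points (base (prod_bundle ?E ?L)) \<and> z \<in> fiber ?L (act p)}"
  proof (rule graph_subbundle[where \<Phi>=act])
    show "vector_bundle ?L" "vector_bundle (prod_bundle ?E ?L)" by (rule vL vEL)+
    show "smooth_map (base (prod_bundle ?E ?L)) (base ?L) act"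
      using smooth_map_on_max_atlas[OF sAP mAP bP mP(1) eqAP[symmetric] mP(2)[symmetric] mor'(2)]
      by (simp add: bs points_prod_atlas pts)
    show "GrA = {(act m, m) | m. m \<in> points (base (prod_bundle ?E ?L))}" unfolding ptsEL by blast
    have "max_atlas (prod_atlas (base ?L) (base (prod_bundle ?E ?L))) = max_atlas (prod_atlas (base P) (prod_atlas (base A) (base P)))"
      unfolding prod_bundle_simps bs by (rule prod_atlas_max_atlas_eq[OF bP sAP mP(1) mAP mP(2) eqAP])
    moreover have "smooth_atlas (prod_atlas (base ?L) (base (prod_bundle ?E ?L)))"
      unfolding prod_bundle_simps bs by (rule smooth_atlas_prod[OF mP(1) mAP])
    ultimately show "embedded_submanifold (prod_atlas (base ?L) (base (prod_bundle ?E ?L))) GrA"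
      using embedded_submanifold_cong smooth_atlas_prod[OF bP sAP] vector_subbundleD(1)[OF sub] unfolding prod_bundle_simps by blast
  next
    fix m x assume m: "m \<in> points (base (prod_bundle ?E ?L))" and x: "x \<in> fiber ?L (act m)"
    have mp: "m \<in> points (base A) \<times> points (base P)" using m unfolding ptsEL .
    have xp: "x \<in> L \<inter> fiber P (act m)" using x unfolding fs .
    obtain h n where hn: "m = (h, n)" by (cases m)
    note r = rho[OF mp xp]
    show "\<rho> m x \<in> fiber (prod_bundle ?E ?L) m" using r(1) unfolding hn fiber_prod fs by simp
    obtain a b where ab: "\<rho> m x = (a, b)" by (cases "\<rho> m x")
    have abf: "a \<in> E" "a \<in> fiber A h" "b \<in> L" "b \<in> fiber P n" using r(1) ab hn by simp_all
    have hp: "h \<in> points (base A)" "n \<in> points (base P)" using mp hn by auto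
    have am: "act m \<in> points (base P)" using act_points[of h n] mp hn by simp
    show "\<rho> m (vscale ?L c x) = vscale (prod_bundle ?E ?L) c (\<rho> m x)" for c
      unfolding ab prod_bundle_simps ops
    proof (rule rhoI[OF mp])
      show "(vscale P c x, vscale A c a, vscale P c b) \<in> Act" using rel_scale r(2) unfolding ab by blast
      show "(vscale A c a, vscale P c b) \<in> (E \<inter> fiber A (fst m)) \<times> (L \<inter> fiber P (snd m))"
        using abf fiber_ops(2)[OF vA hp(1), of a a c] fiber_ops(2)[OF vP hp(2), of b b c]
          vector_subbundleD(7)[OF sE, of a c] vector_subbundleD(7)[OF sL, of b c] unfolding hn by simp
    qed
    fix x' assume x': "x' \<in> fiber ?L (act m)"
    have xp': "x' \<in> L \<inter> fiber P (act m)" using x' unfolding fs .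
    note r' = rho[OF mp xp']
    obtain a' b' where ab': "\<rho> m x' = (a', b')" by (cases "\<rho> m x'")
    have abf': "a' \<in> E" "a' \<in> fiber A h" "b' \<in> L" "b' \<in> fiber P n" using r'(1) ab' hn by simp_all
    show "\<rho> m (vadd ?L x x') = vadd (prod_bundle ?E ?L) (\<rho> m x) (\<rho> m x')"
      unfolding ab ab' prod_bundle_simps ops
    proof (rule rhoI[OF mp])
      have pr: "proj A a = proj A a'" "proj P b = proj P b'" using r(1) r'(1) unfolding ab ab' by (auto simp: fiber_def)
      show "(vadd P x x', vadd A a a', vadd P b b') \<in> Act" using rel_add[OF _ _ pr] r(2) r'(2) unfolding ab ab' by blast
      show "(vadd A a a', vadd P b b') \<in> (E \<inter> fiber A (fst m)) \<times> (L \<inter> fiber P (snd m))"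
        using abf abf' fiber_ops(1)[OF vA hp(1), of a a'] fiber_ops(1)[OF vP hp(2), of b b']
          vector_subbundleD(6)[OF sE _ _ pr(1)] vector_subbundleD(6)[OF sL _ _ pr(2)] unfolding hn by simp
    qed
  next
    fix m0 assume "m0 \<in> points (base (prod_bundle ?E ?L))"
    then have m0: "m0 \<in> points (base A) \<times> points (base P)" unfolding ptsEL .
    obtain h n where hn: "m0 = (h, n)" "h \<in> points (base A)" "n \<in> points (base P)" using m0 by blast
    have am: "act m0 \<in> points (base P)" using act_points[OF hn(2,3)] hn(1) by simp
    obtain U1 \<tau>1 W1 where f1: "(U1, \<tau>1) \<in> max_triv P" "act m0 \<in> U1" "subspace W1"
      "\<And>m. m \<in> U1 \<inter> points (base P) \<Longrightarrow> \<tau>1 ` (L \<inter> fiber P m) = W1" using vector_subbundleD(5)[OF sL am] by blast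
    obtain U2 \<tau>2 W2 where f2: "(U2, \<tau>2) \<in> max_triv A" "h \<in> U2" "subspace W2"
      "\<And>m. m \<in> U2 \<inter> points (base A) \<Longrightarrow> \<tau>2 ` (E \<inter> fiber A m) = W2" using vector_subbundleD(5)[OF sE hn(2)] by blast
    obtain U3 \<tau>3 W3 where f3: "(U3, \<tau>3) \<in> max_triv P" "n \<in> U3" "subspace W3"
      "\<And>m. m \<in> U3 \<inter> points (base P) \<Longrightarrow> \<tau>3 ` (L \<inter> fiber P m) = W3" using vector_subbundleD(5)[OF sL hn(3)] by blast
    obtain \<pi>2 where p2: "linear \<pi>2" "\<And>v. \<pi>2 v \<in> W2" "\<And>w. w \<in> W2 \<Longrightarrow> \<pi>2 w = w" by (rule linear_projection[OF f2(3)]) blast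
    obtain \<pi>3 where p3: "linear \<pi>3" "\<And>v. \<pi>3 v \<in> W3" "\<And>w. w \<in> W3 \<Longrightarrow> \<pi>3 w = w" by (rule linear_projection[OF f3(3)]) blast
    have t1: "(U1 \<inter> points (base P), \<tau>1) \<in> triv ?L" by (rule triv_sub_bundleI[OF f1(1,3,4)])
    have t2: "((U2 \<inter> points (base A)) \<times> (U3 \<inter> points (base P)), map_prod \<tau>2 \<tau>3) \<in> triv (prod_bundle ?E ?L)"
    proof -
      have "(U2 \<inter> points (base A), \<tau>2) \<in> triv ?E" by (rule triv_sub_bundleI[OF f2(1,3,4)])
      moreover have "(U3 \<inter> points (base P), \<tau>3) \<in> triv ?L" by (rule triv_sub_bundleI[OF f3(1,3,4)])
      ultimately show ?thesis unfolding prod_bundle_def by auto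
    qed
    obtain r1 where r1: "trivialization P r1 (U1, \<tau>1)" using max_trivD(1)[OF vP f1(1)] by blast
    show "\<exists>U \<tau> X \<sigma>. (U, \<tau>) \<in> triv ?L \<and> act m0 \<in> U \<and> (X, \<sigma>) \<in> triv (prod_bundle ?E ?L) \<and> m0 \<in> X \<and>
      (\<forall>w\<in>\<tau> ` fiber ?L (act m0). smooth_fun_at (base (prod_bundle ?E ?L)) {m \<in> X. act m \<in> U}
        (\<lambda>m. \<sigma> (\<rho> m (inv_into (fiber ?L (act m)) \<tau> w))) m0)"
    proof (intro exI conjI ballI)
      show "(U1 \<inter> points (base P), \<tau>1) \<in> triv ?L" by (rule t1)
      show "((U2 \<inter> points (base A)) \<times> (U3 \<inter> points (base P)), map_prod \<tau>2 \<tau>3) \<in> triv (prod_bundle ?E ?L)" by (rule t2)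
      show "act m0 \<in> U1 \<inter> points (base P)" using f1(2) am by blast
      show "m0 \<in> (U2 \<inter> points (base A)) \<times> (U3 \<inter> points (base P))" using hn f2(2) f3(2) by blast
      fix w assume "w \<in> \<tau>1 ` fiber ?L (act m0)"
      then have w: "w \<in> W1" using f1(4)[of "act m0"] f1(2) am unfolding fs by blast
      let ?T = "{m \<in> (U2 \<inter> points (base A)) \<times> (U3 \<inter> points (base P)). act m \<in> U1 \<inter> points (base P)}"
      \<comment> \<open>The section of \<open>L\<close> along \<open>act\<close> with constant
        coordinate \<open>w\<close>; smoothness of its splitting is what
        \<open>graph_subbundle\<close> requires.\<close>
      define z where "z m = inv_into (L \<inter> fiber P (act m)) \<tau>1 w" for m
      have z: "z m \<in> L \<inter> fiber P (act m)" "\<tau>1 (z m) = w" if "m \<in> ?T" for m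
      proof -
        have "w \<in> \<tau>1 ` (L \<inter> fiber P (act m))" using f1(4)[of "act m"] that w by simp
        then show "z m \<in> L \<inter> fiber P (act m)" "\<tau>1 (z m) = w" unfolding z_def by (rule inv_into_into, rule f_inv_into_f)
      qed
      define x where "x m = fst (\<rho> m (z m))" for m
      define y where "y m = snd (\<rho> m (z m))" for m
      have rT: "(z m, (x m, y m)) \<in> Act" "x m \<in> E \<inter> fiber A (fst m)" "y m \<in> L \<inter> fiber P (snd m)" if "m \<in> ?T" for m
      proof -
        have "m \<in> points (base A) \<times> points (base P)" using that by auto
        note r = rho[OF this z(1)[OF that]]
        show "(z m, (x m, y m)) \<in> Act" unfolding x_def y_def using r(2) by simp
        show "x m \<in> E \<inter> fiber A (fst m)" "y m \<in> L \<inter> fiber P (snd m)" unfolding x_def y_def using r(1) by (auto simp: mem_Times_iff)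
      qed
      have m0T: "m0 \<in> ?T" using hn f2(2) f3(2) f1(2) am by blast
      have pj: "proj A (x m) = fst m" "proj P (y m) = snd m" "proj P (z m) = act m" if "m \<in> ?T" for m
        using rT(2,3)[OF that] z(1)[OF that] by (auto simp: fiber_def)
      note pj0 = pj[OF m0T]
      have c: "smooth_fun_at (prod_atlas (base A) (base P)) ?T (\<lambda>_. k) m0" for k :: "'k::euclidean_space"
        by (rule smooth_at_const[OF sAP smooth_atlas_euc m0T]) (use m0 in \<open>auto simp: points_prod_atlas\<close>)
      have b: "smooth_at (prod_atlas (base A) (base P)) ?T (base A) (\<lambda>m. proj A (x m)) m0"
        "smooth_at (prod_atlas (base A) (base P)) ?T (base P) (\<lambda>m. proj P (y m)) m0"
        by (rule smooth_at_cong[OF smooth_at_fst_snd(1)[OF bA bP m0T m0]], simp add: pj,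
            rule smooth_at_cong[OF smooth_at_fst_snd(2)[OF bA bP m0T m0]], simp add: pj)
      have k1: "smooth_fun_at (prod_atlas (base A) (base P)) ?T (\<lambda>m. \<tau>1 (z m)) m0"
        by (rule smooth_at_cong[OF c[of w]]) (simp add: z)
      have k2: "smooth_fun_at (prod_atlas (base A) (base P)) ?T (\<lambda>m. \<tau>2 (x m) - \<pi>2 (\<tau>2 (x m))) m0"
      proof (rule smooth_at_cong[OF c[of 0]])
        fix m assume m: "m \<in> ?T"
        then have mm: "fst m \<in> U2" "fst m \<in> U2 \<inter> points (base A)" by auto
        show "0 = \<tau>2 (x m) - \<pi>2 (\<tau>2 (x m))"
          using flat_complement_iff[OF vA f2(1) mm(1) _ f2(4)[OF mm(2)] p2(2,3), of "x m"] rT(2)[OF m] by simp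
      qed
      have k3: "smooth_fun_at (prod_atlas (base A) (base P)) ?T (\<lambda>m. \<tau>3 (y m) - \<pi>3 (\<tau>3 (y m))) m0"
      proof (rule smooth_at_cong[OF c[of 0]])
        fix m assume m: "m \<in> ?T"
        then have mm: "snd m \<in> U3" "snd m \<in> U3 \<inter> points (base P)" by auto
        show "0 = \<tau>3 (y m) - \<pi>3 (\<tau>3 (y m))"
          using flat_complement_iff[OF vP f3(1) mm(1) _ f3(4)[OF mm(2)] p3(2,3), of "y m"] rT(3)[OF m] by simp
      qed
      \<comment> \<open>The data are the coordinate of \<open>z\<close> together with the conditions
        that \<open>x\<close> lies in \<open>E\<close> and \<open>y\<close> in \<open>L\<close>. An
        element of the kernel is a splitting of zero, hence zero by
        \<open>rel_zero_unique\<close>.\<close>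
      have "smooth_at (prod_atlas (base A) (base P)) ?T (total_atlas A) x m0 \<and> smooth_at (prod_atlas (base A) (base P)) ?T (total_atlas P) y m0"
      proof (rule conjI; rule rel_smooth(2,3)[of "prod_atlas (base A) (base P)" m0 ?T z x y U1 \<tau>1 U2 \<tau>2 U3 \<tau>3 "\<lambda>v. v" "\<lambda>v. v - \<pi>2 v" "\<lambda>v. v - \<pi>3 v",
            OF sAP m0T rT(1) b f1(1) f2(1) f3(1) _ _ _ linear_ident linear_complement[OF p2(1)] linear_complement[OF p3(1)] _ k1 k2 k3])
        show "proj P (z m0) \<in> U1" "proj P (z m0) \<in> U1" "proj A (x m0) \<in> U2" "proj A (x m0) \<in> U2" "proj P (y m0) \<in> U3" "proj P (y m0) \<in> U3"
          unfolding pj0 using hn f1(2) f2(2) f3(2) by auto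
        fix z' x' y'
        assume a: "(z', (x', y')) \<in> Act" "x' \<in> fiber A (proj A (x m0))" "y' \<in> fiber P (proj P (y m0))"
          "\<tau>1 z' = 0" "\<tau>2 x' - \<pi>2 (\<tau>2 x') = 0" "\<tau>3 y' - \<pi>3 (\<tau>3 y') = 0"
        have xf: "x' \<in> fiber A h" and yf: "y' \<in> fiber P n" using a(2,3) pj0 hn(1) by simp_all
        have zf: "z' \<in> fiber P (act m0)" using rel_fiber[OF a(1) xf yf] hn(1) by simp
        have z0: "z' = vzero P (act m0)" using triv_zero_iff[OF vP f1(1,2) zf] a(4) by simp
        have "x' \<in> E" using flat_complement_iff[OF vA f2(1,2) xf f2(4) p2(2,3)] f2(2) hn(2) a(5) by simp
        moreover have "y' \<in> L" using flat_complement_iff[OF vP f3(1,2) yf f3(4) p3(2,3)] f3(2) hn(3) a(6) by simp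
        ultimately have "x' = vzero A h" "y' = vzero P n"
          using rel_zero_unique[OF hn(2,3), of x' y'] xf yf a(1) z0 hn(1) by auto
        then show "z' = vzero P (act (proj A (x m0), proj P (y m0))) \<and> x' = vzero A (proj A (x m0)) \<and> y' = vzero P (proj P (y m0))"
          "z' = vzero P (act (proj A (x m0), proj P (y m0))) \<and> x' = vzero A (proj A (x m0)) \<and> y' = vzero P (proj P (y m0))"
          unfolding pj0 using z0 hn(1) by auto
      qed
      then have sx: "smooth_at (prod_atlas (base A) (base P)) ?T (total_atlas A) x m0"
        and sy: "smooth_at (prod_atlas (base A) (base P)) ?T (total_atlas P) y m0" by auto
      have "smooth_fun_at (prod_atlas (base A) (base P)) ?T (\<lambda>m. \<tau>2 (x m)) m0"
        by (rule smooth_fun_triv[OF vA f2(1) linear_ident sx]) (use pj0 hn f2(2) in simp)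
      moreover have "smooth_fun_at (prod_atlas (base A) (base P)) ?T (\<lambda>m. \<tau>3 (y m)) m0"
        by (rule smooth_fun_triv[OF vP f3(1) linear_ident sy]) (use pj0 hn f3(2) in simp)
      ultimately have "smooth_fun_at (prod_atlas (base A) (base P)) ?T (\<lambda>m. (\<tau>2 (x m), \<tau>3 (y m))) m0"
        by (rule smooth_fun_at_Pair[OF sAP])
      then have "smooth_fun_at (prod_atlas (base A) (base P)) ?T (\<lambda>m. map_prod \<tau>2 \<tau>3 (\<rho> m (z m))) m0"
        unfolding x_def y_def by (simp add: map_prod_def case_prod_beta)
      then show "smooth_fun_at (base (prod_bundle ?E ?L)) ?T (\<lambda>m. map_prod \<tau>2 \<tau>3 (\<rho> m (inv_into (fiber ?L (act m)) \<tau>1 w))) m0"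
        unfolding z_def fs prod_bundle_simps bs by (rule smooth_at_max_atlas[OF eqAP[symmetric] refl, THEN iffD1])
    qed
  qed
  moreover have "{(z, \<rho> p z) | p z. p \<in> points (base (prod_bundle ?E ?L)) \<and> z \<in> fiber ?L (act p)} = Act \<inter> (L \<times> (E \<times> L))"
  proof (intro subset_antisym subsetI)
    fix w assume "w \<in> {(z, \<rho> p z) | p z. p \<in> points (base (prod_bundle ?E ?L)) \<and> z \<in> fiber ?L (act p)}"
    then obtain p z where w: "w = (z, \<rho> p z)" "p \<in> points (base A) \<times> points (base P)" "z \<in> L \<inter> fiber P (act p)"
      unfolding ptsEL fs by blast
    show "w \<in> Act \<inter> (L \<times> (E \<times> L))" using rho[OF w(2,3)] w(3) unfolding w(1) by auto
  next
    fix w assume w: "w \<in> Act \<inter> (L \<times> (E \<times> L))"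
    obtain z x y where e: "w = (z, (x, y))" by (metis surj_pair)
    have a: "(z, (x, y)) \<in> Act" "z \<in> L" "x \<in> E" "y \<in> L" using w unfolding e by auto
    let ?p = "(proj A x, proj P y)"
    have p: "?p \<in> points (base A) \<times> points (base P)" and z: "z \<in> L \<inter> fiber P (act ?p)"
      and xy: "(x, y) \<in> (E \<inter> fiber A (fst ?p)) \<times> (L \<inter> fiber P (snd ?p))"
      using rel_base[OF a(1)] a by (auto simp: fiber_def)
    have "w = (z, \<rho> ?p z)" using rhoI[OF p xy a(1)] unfolding e by simp
    then show "w \<in> {(z, \<rho> p z) | p z. p \<in> points (base (prod_bundle ?E ?L)) \<and> z \<in> fiber ?L (act p)}"
      unfolding ptsEL fs using p z by blast
  qed
  ultimately show ?thesis by simp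
qed

end

section \<open>Transfer to submanifolds and to maximal atlases\<close>

lemma fiber_linear_vdiff:
  assumes V: "vector_bundle V" and m: "m \<in> points (base V)" and K: "fiber_linear V m K"
    and f: "x \<in> fiber V m" "y \<in> fiber V m"
  shows "K (vdiff V x y) = K x - K y"
  using K fiber_ops(2)[OF V m f(2,2), of "- 1"] f unfolding vdiff_def fiber_linear_def by simp

text \<open>Lets the full bundle and its subbundle be treated by the same statements about
  subatlases.\<close>

lemma subatlas_refl: "smooth_atlas \<A> \<Longrightarrow> subatlas \<A> (points \<A>) \<A>"
  unfolding subatlas_def using chart_at max_atlas_dom by (metis Int_absorb2)

lemma subatlas_prod:
  assumes "subatlas \<A> S \<A>'" "subatlas \<B> T \<B>'"
  shows "subatlas (prod_atlas \<A> \<B>) (S \<times> T) (prod_atlas \<A>' \<B>')"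
  unfolding subatlas_def
proof (intro conjI ballI)
  have s: "smooth_atlas \<A>" "smooth_atlas \<A>'" "smooth_atlas \<B>" "smooth_atlas \<B>'" and p: "points \<A>' = S" "points \<B>' = T"
    using assms unfolding subatlas_def by auto
  show "smooth_atlas (prod_atlas \<A> \<B>)" "smooth_atlas (prod_atlas \<A>' \<B>')" using s by (auto intro: smooth_atlas_prod)
  show "points (prod_atlas \<A>' \<B>') = S \<times> T" using p by (simp add: points_prod_atlas)
  fix q assume "q \<in> S \<times> T"
  then have q: "fst q \<in> S" "snd q \<in> T" by auto
  obtain U \<phi> where U: "(U, \<phi>) \<in> max_atlas \<A>" "fst q \<in> U" "(U \<inter> S, \<phi>) \<in> max_atlas \<A>'" by (rule subatlasE[OF assms(1) q(1)])
  obtain X \<psi> where X: "(X, \<psi>) \<in> max_atlas \<B>" "snd q \<in> X" "(X \<inter> T, \<psi>) \<in> max_atlas \<B>'" by (rule subatlasE[OF assms(2) q(2)])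
  have e: "(U \<times> X) \<inter> (S \<times> T) = (U \<inter> S) \<times> (X \<inter> T)" by blast
  show "\<exists>U \<phi>. (U, \<phi>) \<in> max_atlas (prod_atlas \<A> \<B>) \<and> q \<in> U \<and> (U \<inter> S \<times> T, \<phi>) \<in> max_atlas (prod_atlas \<A>' \<B>')"
  proof (intro exI conjI)
    show "(U \<times> X, map_prod \<phi> \<psi>) \<in> max_atlas (prod_atlas \<A> \<B>)" by (rule prod_max_atlas[OF s(1,3) U(1) X(1)])
    show "q \<in> U \<times> X" using U(2) X(2) by (simp add: mem_Times_iff)
    show "(U \<times> X \<inter> S \<times> T, map_prod \<phi> \<psi>) \<in> max_atlas (prod_atlas \<A>' \<B>')"
      unfolding e by (rule prod_max_atlas[OF s(2,4) U(3) X(3)])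
  qed
qed

text \<open>The base atlas of \<open>E\<close>, as a bundle over the whole group, is the maximal
  one, and the subgroupoid must be a groupoid over that presentation of the Lie group.\<close>

lemma lie_group_max_atlas:
  assumes "lie_group H \<A>" shows "lie_group H (max_atlas \<A>)"
proof -
  have M: "smooth_manifold \<A>" and s: "smooth_atlas \<A>" using assms unfolding lie_group_def smooth_manifold_def by auto
  note m = smooth_atlas_max_atlas[OF s] and i = max_atlas_idem[OF s] and p = points_max_atlas[OF s]
  have "smooth_manifold (max_atlas \<A>)"
    using M m manifold_topology_max_atlas[OF s m i[symmetric]] unfolding smooth_manifold_def by simp
  moreover have "smooth_map (prod_atlas (max_atlas \<A>) (max_atlas \<A>)) (max_atlas \<A>) (\<lambda>(g, h). g \<otimes>\<^bsub>H\<^esub> h)"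
    using smooth_map_on_max_atlas[OF smooth_atlas_prod[OF s s] smooth_atlas_prod[OF m m] s m
        prod_atlas_max_atlas_eq[OF s s m m i i, symmetric] i[symmetric], of "points (prod_atlas \<A> \<A>)" "\<lambda>(g, h). g \<otimes>\<^bsub>H\<^esub> h"] assms
    unfolding lie_group_def by (simp add: points_prod_atlas p)
  moreover have "smooth_map (max_atlas \<A>) (max_atlas \<A>) (\<lambda>g. inv\<^bsub>H\<^esub> g)"
    using smooth_map_on_max_atlas[OF s m s m i[symmetric] i[symmetric], of "points \<A>" "\<lambda>g. inv\<^bsub>H\<^esub> g"] assms
    unfolding lie_group_def by (simp add: p)
  ultimately show ?thesis using assms unfolding lie_group_def p by simp
qed

lemma smooth_action_max_atlas:
  assumes s: "smooth_atlas \<A>" "smooth_atlas \<B>" and a: "smooth_action H \<A> \<B> act"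
  shows "smooth_action H (max_atlas \<A>) (max_atlas \<B>) act"
proof -
  note m = smooth_atlas_max_atlas[OF s(1)] smooth_atlas_max_atlas[OF s(2)] and i = max_atlas_idem[OF s(1)] max_atlas_idem[OF s(2)]
    and p = points_max_atlas[OF s(1)] points_max_atlas[OF s(2)]
  have "smooth_map (prod_atlas (max_atlas \<A>) (max_atlas \<B>)) (max_atlas \<B>) act"
    using smooth_map_on_max_atlas[OF smooth_atlas_prod[OF s] smooth_atlas_prod[OF m] s(2) m(2)
        prod_atlas_max_atlas_eq[OF s m i, symmetric] i(2)[symmetric], of "points (prod_atlas \<A> \<B>)" act] a
    unfolding smooth_action_def by (simp add: points_prod_atlas p)
  then show ?thesis using a unfolding smooth_action_def p by simp
qed

section \<open>Smoothness of the moment map and of the action\<close>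

context dirac_act begin

lemma flat_units:
  obtains U \<tau> W \<pi> where "(U, \<tau>) \<in> max_triv A" "e \<in> U" "subspace W"
    "\<And>m. m \<in> U \<inter> points (base A) \<Longrightarrow> \<tau> ` (E \<inter> fiber A m) = W"
    "linear \<pi>" "\<And>v. \<pi> v \<in> W" "\<And>w. w \<in> W \<Longrightarrow> \<pi> w = w"
proof -
  obtain U \<tau> W where f: "(U, \<tau>) \<in> max_triv A" "e \<in> U" "subspace W"
    "\<And>m. m \<in> U \<inter> points (base A) \<Longrightarrow> \<tau> ` (E \<inter> fiber A m) = W"
    using vector_subbundleD(5)[OF dirac_structureD(2)[OF mul.dA] e_in] by blast
  obtain \<pi> where "linear \<pi>" "\<And>v. \<pi> v \<in> W" "\<And>w. w \<in> W \<Longrightarrow> \<pi> w = w" by (rule linear_projection[OF f(3)]) blast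
  with f show ?thesis by (rule that)
qed

lemma u_smooth:
  assumes p: "p \<in> total P" shows "smooth_at (total_atlas P) (total P) (total_atlas A) u p"
proof -
  let ?m = "proj P p"
  have m: "?m \<in> points (base P)" "p \<in> fiber P ?m" using p vector_bundleD(4)[OF ac.vP] by (auto simp: fiber_def)
  have sP: "smooth_atlas (total_atlas P)" by (rule vector_bundleD(3)[OF ac.vP])
  have pp: "p \<in> points (total_atlas P)" using p points_total_atlas[OF ac.vP] by simp
  obtain U1 \<tau>1 where t: "(U1, \<tau>1) \<in> max_triv P" "?m \<in> U1" by (rule max_triv_at[OF ac.vP m(1)])
  obtain U2 \<tau>2 W \<pi> where f: "(U2, \<tau>2) \<in> max_triv A" "e \<in> U2" "subspace W"
    "\<And>m. m \<in> U2 \<inter> points (base A) \<Longrightarrow> \<tau>2 ` (E \<inter> fiber A m) = W"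
    "linear \<pi>" "\<And>v. \<pi> v \<in> W" "\<And>w. w \<in> W \<Longrightarrow> \<pi> w = w" by (rule flat_units) blast
  have We: "\<tau>2 ` (E \<inter> fiber A e) = W" using f(2) e_in by (intro f(4)) simp
  have pu: "proj A (u q) = e" if "q \<in> total P" for q using u_in(1)[OF that] by (auto simp: fiber_def)
  have c: "smooth_fun_at (total_atlas P) (total P) (\<lambda>_. k) p" for k :: "'k::euclidean_space"
    by (rule smooth_at_const[OF sP smooth_atlas_euc p pp]) simp
  have b: "smooth_at (total_atlas P) (total P) (base A) (\<lambda>q. proj A (u q)) p"
    by (rule smooth_at_cong[OF smooth_at_const[OF sP vector_bundleD(2)[OF mul.vA] p pp e_in]]) (simp add: pu)
  have bP: "smooth_at (total_atlas P) (total P) (base P) (\<lambda>q. proj P q) p" by (rule smooth_at_proj[OF ac.vP p p])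
  have k1: "smooth_fun_at (total_atlas P) (total P) (\<lambda>q. \<tau>1 q) p" by (rule smooth_at_triv[OF ac.vP t(1) p t(2) p])
  have k2: "smooth_fun_at (total_atlas P) (total P) (\<lambda>q. \<tau>2 (u q) - \<pi> (\<tau>2 (u q))) p"
  proof (rule smooth_at_cong[OF c[of 0]])
    fix q assume "q \<in> total P"
    then show "0 = \<tau>2 (u q) - \<pi> (\<tau>2 (u q))"
      using flat_complement_iff[OF mul.vA f(1,2) _ We f(6,7), of "u q"] u_in(1) by simp
  qed
  show ?thesis
  \<comment> \<open>Solve \<open>q = (u q) q\<close> with the first \<open>q\<close> prescribed and
    the unit constrained to \<open>E\<close>; the last component is left free.\<close>
  proof (rule ac.rel_smooth(2)[of "total_atlas P" p "total P" "\<lambda>q. q" u "\<lambda>q. q" U1 \<tau>1 U2 \<tau>2 U1 \<tau>1 "\<lambda>v. v" "\<lambda>v. v - \<pi> v" "\<lambda>_. 0",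
        OF sP p u_in(2) b bP t(1) f(1) t(1) t(2) _ t(2) linear_ident linear_complement[OF f(5)] linear_zero _ k1 k2 c])
    show "proj A (u p) \<in> U2" using f(2) pu[OF p] by simp
    fix z' x' y' assume a: "(z', (x', y')) \<in> Act" "x' \<in> fiber A (proj A (u p))" "y' \<in> fiber P ?m" "\<tau>1 z' = 0"
      "\<tau>2 x' - \<pi> (\<tau>2 x') = 0"
    have x: "x' \<in> fiber A e" using a(2) pu[OF p] by simp
    have x': "x' \<in> E \<inter> fiber A e" using flat_complement_iff[OF mul.vA f(1,2) x We f(6,7)] a(5) x by simp
    \<comment> \<open>An element of \<open>E\<close> over \<open>e\<close> acts trivially, so in the
      kernel \<open>z' = 0\<close> gives \<open>y' = 0\<close>, and then \<open>x'\<close> vanishes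
      because the splitting of zero is unique.\<close>
    have zy: "z' = y'" by (rule unit_act[OF a(1) x'])
    then have y0: "y' = vzero P ?m" using triv_zero_iff[OF ac.vP t a(3)] a(4) by simp
    have "x' = vzero A e"
      using ac.rel_zero_unique(1)[OF e_in m(1) x', of y'] y0 ac.zero_in_sub(2)[OF m(1)] a(1,3) zy act_e[OF m(1)] by simp
    then show "z' = vzero P (act (proj A (u p), ?m)) \<and> x' = vzero A (proj A (u p)) \<and> y' = vzero P ?m"
      using y0 zy pu[OF p] act_e[OF m(1)] by simp
  qed
qed

lemma op_smooth:
  fixes T defines "T \<equiv> {(x, y). x \<in> total A \<and> y \<in> total P \<and> s x = u y}"
  assumes p: "p \<in> T"
  shows "smooth_at (prod_atlas (total_atlas A) (total_atlas P)) T (total_atlas P) (\<lambda>(x, y). rel_app Act x y) p"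
proof -
  let ?C = "prod_atlas (total_atlas A) (total_atlas P)"
  note sA = vector_bundleD(3)[OF mul.vA] and sP = vector_bundleD(3)[OF ac.vP]
  note sC = smooth_atlas_prod[OF sA sP]
  have pt: "fst p \<in> total A" "snd p \<in> total P" using p unfolding T_def by auto
  have pp: "p \<in> points (total_atlas A) \<times> points (total_atlas P)"
    using pt points_total_atlas[OF mul.vA] points_total_atlas[OF ac.vP] by (simp add: mem_Times_iff)
  define z where "z q = rel_app Act (fst q) (snd q)" for q
  have R: "(z q, (fst q, snd q)) \<in> Act" if "q \<in> T" for q using that act_iff[of "z q" "fst q" "snd q"] unfolding T_def z_def by auto
  have f: "smooth_at ?C T (total_atlas A) fst p" "smooth_at ?C T (total_atlas P) snd p"
    by (rule smooth_at_fst_snd[OF sA sP p pp])+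
  have h: "proj A (fst p) \<in> points (base A)" "proj P (snd p) \<in> points (base P)" using ac.rel_base(5,6)[OF R[OF p]] by auto
  have zp: "proj P (z p) \<in> points (base P)" using ac.rel_base(3)[OF R[OF p]] vector_bundleD(4)[OF ac.vP] by simp
  obtain U1 \<tau>1 where t1: "(U1, \<tau>1) \<in> max_triv P" "proj P (z p) \<in> U1" by (rule max_triv_at[OF ac.vP zp])
  obtain U2 \<tau>2 where t2: "(U2, \<tau>2) \<in> max_triv A" "proj A (fst p) \<in> U2" by (rule max_triv_at[OF mul.vA h(1)])
  obtain U3 \<tau>3 where t3: "(U3, \<tau>3) \<in> max_triv P" "proj P (snd p) \<in> U3" by (rule max_triv_at[OF ac.vP h(2)])
  \<comment> \<open>Both factors are prescribed and the product is left free; the kernel vanishes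
    because products are unique.\<close>
  have "smooth_at ?C T (total_atlas P) z p"
  proof (rule ac.rel_smooth(1)[of ?C p T z fst snd U1 \<tau>1 U2 \<tau>2 U3 \<tau>3 "\<lambda>_. 0" "\<lambda>v. v" "\<lambda>v. v",
        OF sC p R smooth_at_proj_compose[OF mul.vA f(1)] smooth_at_proj_compose[OF ac.vP f(2)] t1(1) t2(1) t3(1) t1(2) t2(2) t3(2)
        linear_zero linear_ident linear_ident])
    show "smooth_fun_at ?C T (\<lambda>q. 0) p" by (rule smooth_at_const[OF sC smooth_atlas_euc p]) (use pp in \<open>simp_all add: points_prod_atlas\<close>)
    show "smooth_fun_at ?C T (\<lambda>q. \<tau>2 (fst q)) p" by (rule smooth_fun_triv[OF mul.vA t2(1) linear_ident f(1) t2(2)])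
    show "smooth_fun_at ?C T (\<lambda>q. \<tau>3 (snd q)) p" by (rule smooth_fun_triv[OF ac.vP t3(1) linear_ident f(2) t3(2)])
    fix z' x' y' assume a: "(z', (x', y')) \<in> Act" "x' \<in> fiber A (proj A (fst p))" "y' \<in> fiber P (proj P (snd p))"
      "\<tau>2 x' = 0" "\<tau>3 y' = 0"
    have "x' = vzero A (proj A (fst p))" "y' = vzero P (proj P (snd p))"
      using triv_zero_iff[OF mul.vA t2 a(2)] triv_zero_iff[OF ac.vP t3 a(3)] a(4,5) by auto
    then show "z' = vzero P (act (proj A (fst p), proj P (snd p))) \<and> x' = vzero A (proj A (fst p)) \<and> y' = vzero P (proj P (snd p))"
      using act_unique[OF a(1)] ac.rel_zero[OF h] by simp
  qed
  then show ?thesis unfolding z_def by (simp add: case_prod_beta')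
qed

lemma u_linear:
  assumes "x \<in> fiber P m" "y \<in> fiber P m"
  shows "u (vadd P x y) = vadd A (u x) (u y)" "u (vscale P c x) = vscale A c (u x)"
proof -
  have t: "x \<in> total P" "y \<in> total P" "proj P x = proj P y" using assms by (auto simp: fiber_def)
  note sE = dirac_structureD(2)[OF mul.dA]
  have ux: "u x \<in> E" "u x \<in> fiber A e" "u y \<in> E" "u y \<in> fiber A e" using u_in(1) t by auto
  have pr: "proj A (u x) = proj A (u y)" using ux by (simp add: fiber_def)
  show "u (vadd P x y) = vadd A (u x) (u y)"
    using u_eqI[OF _ ac.rel_add[OF u_in(2)[OF t(1)] u_in(2)[OF t(2)] pr t(3)]] vector_subbundleD(6)[OF sE ux(1,3) pr]
      fiber_ops(1)[OF mul.vA e_in ux(2,4)] by simp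
  show "u (vscale P c x) = vscale A c (u x)"
    using u_eqI[OF _ ac.rel_scale[OF u_in(2)[OF t(1)]]] vector_subbundleD(7)[OF sE ux(1)] fiber_ops(2)[OF mul.vA e_in ux(2,2)] by simp
qed

end

section \<open>Source, target and inversion on \<open>E\<close>; submersions\<close>

context dirac_group begin

interpretation self: dirac_act H A E Mul \<epsilon> A E "\<lambda>(g, h). g \<otimes>\<^bsub>H\<^esub> h" Mul
  by unfold_locales (rule self_action)

lemmas t_smooth = self.u_smooth and mul_smooth = self.op_smooth and t_linear = self.u_linear

lemma s_linear:
  assumes "x \<in> fiber A m" "y \<in> fiber A m"
  shows "s (vadd A x y) = vadd A (s x) (s y)" "s (vscale A c x) = vscale A c (s x)"
proof -
  have t: "x \<in> total A" "y \<in> total A" "proj A x = proj A y" using assms by (auto simp: fiber_def)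
  note sE = dirac_structureD(2)[OF mul.dA]
  have ux: "s x \<in> E" "s x \<in> fiber A e" "s y \<in> E" "s y \<in> fiber A e" using s_in(1) t by auto
  have pr: "proj A (s x) = proj A (s y)" using ux by (simp add: fiber_def)
  show "s (vadd A x y) = vadd A (s x) (s y)"
    using s_eqI[OF _ mul.rel_add[OF s_in(2)[OF t(1)] s_in(2)[OF t(2)] t(3) pr]] vector_subbundleD(6)[OF sE ux(1,3) pr]
      fiber_ops(1)[OF mul.vA e_in ux(2,4)] by simp
  show "s (vscale A c x) = vscale A c (s x)"
    using s_eqI[OF _ mul.rel_scale[OF s_in(2)[OF t(1)]]] vector_subbundleD(7)[OF sE ux(1)] fiber_ops(2)[OF mul.vA e_in ux(2,2)] by simp
qed

lemma mul_E: "(z, (x, y)) \<in> Mul \<Longrightarrow> x \<in> E \<Longrightarrow> y \<in> E \<Longrightarrow> z \<in> E"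
  by (rule mul.rel_forward)

text \<open>Choose \<open>c\<close> in \<open>E\<close> over the inverse with target
  \<open>s a\<close>. The product lies in \<open>E\<close> over \<open>e\<close>, so it is a unit,
  and a unit equals its own target, here \<open>t a\<close>.\<close>

lemma E_decomp:
  assumes g: "g \<in> points (base A)" and a: "a \<in> E \<inter> fiber A g"
  shows "\<exists>c\<in>E \<inter> fiber A (inv\<^bsub>H\<^esub> g). (t a, (a, c)) \<in> Mul"
proof -
  interpret G: group H by (rule group)
  have at: "a \<in> total A" using a by (simp add: fiber_def)
  obtain c d where c: "c \<in> E \<inter> fiber A (inv\<^bsub>H\<^esub> g)" "(s a, (c, d)) \<in> Mul"
    by (rule split_unit[OF s_in(1)[OF at] inv_in[OF g]])
  have tc: "t c = s a" using t_mul[OF c(2)] t_unit[OF s_in(1)[OF at]] by simp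
  then obtain p where p: "(p, (a, c)) \<in> Mul" using mul_exists[OF at, of c] mul.rel_base(1)[OF c(2)] by auto
  have "g \<otimes>\<^bsub>H\<^esub> inv\<^bsub>H\<^esub> g = e" using g carrier by simp
  then have "p \<in> E \<inter> fiber A e" using mul_E[OF p] mul.rel_fiber[OF p, of g "inv\<^bsub>H\<^esub> g"] a c(1) by auto
  then have "p = t a" using t_unit[of p] t_mul[OF p] by simp
  then show ?thesis using p c(1) by blast
qed

text \<open>\<open>E_decomp\<close> supplies a right inverse inside \<open>E\<close>, and left
  cancellation identifies it with the chosen inverse \<open>vinv x\<close>.\<close>

lemma E_vinv: assumes "x \<in> E" shows "vinv x \<in> E"
proof -
  have x: "x \<in> total A" using assms vector_subbundleD(2)[OF dirac_structureD(2)[OF mul.dA]] by blast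
  have g: "proj A x \<in> points (base A)" by (rule vector_bundleD(4)[OF mul.vA x])
  obtain c where c: "c \<in> E" "(t x, (x, c)) \<in> Mul" using E_decomp[OF g, of x] assms x by (auto simp: fiber_def)
  then show ?thesis using mul_left_cancel[OF c(2)] vinv[OF x] by blast
qed

text \<open>Elements of \<open>E\<close> over \<open>g\<close> with the same target \<open>v\<close>
  are first factors of splittings of \<open>v\<close> over \<open>g g^-1 = e\<close>, and such
  splittings are unique. Every unit in \<open>E\<close> has such a splitting, which gives
  surjectivity.\<close>

lemma t_bij: assumes g: "g \<in> points (base A)" shows "bij_betw t (E \<inter> fiber A g) (E \<inter> fiber A e)"
proof (rule bij_betwI')
  have ge: "g \<otimes>\<^bsub>H\<^esub> inv\<^bsub>H\<^esub> g = e" using g carrier group.r_inv[OF group] by simp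
  fix a b assume ab: "a \<in> E \<inter> fiber A g" "b \<in> E \<inter> fiber A g"
  have at: "a \<in> total A" using ab by (simp add: fiber_def)
  show "(t a = t b) = (a = b)"
  proof
    assume eq: "t a = t b"
    obtain c d where cd: "c \<in> E \<inter> fiber A (inv\<^bsub>H\<^esub> g)" "(t a, (a, c)) \<in> Mul" "d \<in> E \<inter> fiber A (inv\<^bsub>H\<^esub> g)" "(t b, (b, d)) \<in> Mul"
      using E_decomp[OF g ab(1)] E_decomp[OF g ab(2)] by blast
    have "t a \<in> E" "t a \<in> fiber A ((\<lambda>(g, h). g \<otimes>\<^bsub>H\<^esub> h) (g, inv\<^bsub>H\<^esub> g))" using t_in(1)[OF at] ge by auto
    from mul.rel_split_unique[OF g inv_in[OF g] this] have "(a, c) = (b, d)" using cd ab eq by (auto 0 0)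
    then show "a = b" by simp
  qed simp
  show "t a \<in> E \<inter> fiber A e" by (rule t_in(1)[OF at])
next
  fix v assume v: "v \<in> E \<inter> fiber A e"
  obtain a b where "a \<in> E \<inter> fiber A g" "(v, (a, b)) \<in> Mul" by (rule split_unit[OF v g])
  then show "\<exists>a\<in>E \<inter> fiber A g. v = t a" using t_mul t_unit[OF v] by metis
qed

lemma vinv_fiber: assumes "x \<in> fiber A g" "g \<in> points (base A)" shows "vinv x \<in> fiber A (inv\<^bsub>H\<^esub> g)"
proof -
  interpret G: group H by (rule group)
  have x: "x \<in> total A" using assms by (simp add: fiber_def)
  have r: "(t x, (x, vinv x)) \<in> Mul" using vinv[OF x] by blast
  have "e = g \<otimes>\<^bsub>H\<^esub> proj A (vinv x)" using mul.rel_base(4)[OF r] t_in(1)[OF x] assms by (simp add: fiber_def)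
  moreover have "proj A (vinv x) \<in> carrier H" "g \<in> carrier H" using mul.rel_base(6)[OF r] assms carrier by auto
  ultimately have "proj A (vinv x) = inv\<^bsub>H\<^esub> g" using G.inv_solve_left[of g e] by (metis G.inv_closed G.inv_equality G.inv_inv)
  then show ?thesis using vinv[OF x] by (simp add: fiber_def)
qed

text \<open>Injectivity is transported from the target map by inversion, which preserves
  \<open>E\<close> and exchanges source and target.\<close>

lemma s_bij: assumes g: "g \<in> points (base A)" shows "bij_betw s (E \<inter> fiber A g) (E \<inter> fiber A e)"
proof (rule bij_betwI')
  fix a b assume ab: "a \<in> E \<inter> fiber A g" "b \<in> E \<inter> fiber A g"
  have at: "a \<in> total A" "b \<in> total A" using ab by (auto simp: fiber_def)
  show "(s a = s b) = (a = b)"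
  proof
    assume eq: "s a = s b"
    have "vinv a \<in> E \<inter> fiber A (inv\<^bsub>H\<^esub> g)" "vinv b \<in> E \<inter> fiber A (inv\<^bsub>H\<^esub> g)" using ab E_vinv vinv_fiber g by blast+
    moreover have "t (vinv a) = t (vinv b)" using vinv[OF at(1)] vinv[OF at(2)] eq by simp
    ultimately have "vinv a = vinv b" using t_bij[OF inv_in[OF g]] unfolding bij_betw_def inj_on_def by blast
    then show "a = b" using vinv[OF at(1)] vinv[OF at(2)] eq mul_left_cancel[of "s a" "vinv a" a b] by simp
  qed simp
  show "s a \<in> E \<inter> fiber A e" by (rule s_in(1)[OF at(1)])
next
  fix v assume v: "v \<in> E \<inter> fiber A e"
  interpret G: group H by (rule group)
  have i: "inv\<^bsub>H\<^esub> (inv\<^bsub>H\<^esub> g) = g" using g carrier by simp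
  obtain a b where "b \<in> E \<inter> fiber A (inv\<^bsub>H\<^esub> (inv\<^bsub>H\<^esub> g))" "s b = v" by (rule split_unit[OF v inv_in[OF g]])
  then show "\<exists>a\<in>E \<inter> fiber A g. v = s a" unfolding i by blast
qed

lemma vinv_smooth:
  assumes p: "p \<in> total A" shows "smooth_at (total_atlas A) (total A) (total_atlas A) vinv p"
proof -
  let ?g = "proj A p"
  have g: "?g \<in> points (base A)" by (rule vector_bundleD(4)[OF mul.vA p])
  note sA = vector_bundleD(3)[OF mul.vA] and bA = vector_bundleD(2)[OF mul.vA]
  have pv: "proj A (vinv q) = inv\<^bsub>H\<^esub> (proj A q)" if "q \<in> total A" for q
    using vinv_fiber[of q "proj A q"] that vector_bundleD(4)[OF mul.vA that] by (simp add: fiber_def)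
  have R: "(t q, (q, vinv q)) \<in> Mul" if "q \<in> total A" for q using vinv[OF that] by blast
  have b: "smooth_at (total_atlas A) (total A) (base A) (\<lambda>q. proj A q) p" by (rule smooth_at_proj[OF mul.vA p p])
  have "smooth_at (base A) (points (base A)) (base A) (\<lambda>g. inv\<^bsub>H\<^esub> g) ?g"
    using smooth_map_onD[OF _ bA bA g] lie unfolding lie_group_def by blast
  from smooth_at_compose[OF bA b this] have "smooth_at (total_atlas A) (total A) (base A) (\<lambda>q. inv\<^bsub>H\<^esub> (proj A q)) p" by simp
  then have b2: "smooth_at (total_atlas A) (total A) (base A) (\<lambda>q. proj A (vinv q)) p"
    by (rule smooth_at_cong) (simp add: pv)
  have tp: "proj A (t p) = e" using t_in(1)[OF p] by (simp add: fiber_def)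
  obtain U1 \<tau>1 where t1: "(U1, \<tau>1) \<in> max_triv A" "e \<in> U1" by (rule max_triv_at[OF mul.vA e_in])
  obtain U2 \<tau>2 where t2: "(U2, \<tau>2) \<in> max_triv A" "?g \<in> U2" by (rule max_triv_at[OF mul.vA g])
  have vp: "proj A (vinv p) \<in> points (base A)" using pv[OF p] inv_in[OF g] by simp
  obtain U3 \<tau>3 where t3: "(U3, \<tau>3) \<in> max_triv A" "proj A (vinv p) \<in> U3" by (rule max_triv_at[OF mul.vA vp])
  have k1: "smooth_fun_at (total_atlas A) (total A) (\<lambda>q. \<tau>1 (t q)) p"
    by (rule smooth_fun_triv[OF mul.vA t1(1) linear_ident t_smooth[OF p]]) (simp add: tp t1(2))
  have k2: "smooth_fun_at (total_atlas A) (total A) (\<lambda>q. \<tau>2 q) p" by (rule smooth_at_triv[OF mul.vA t2(1) p t2(2) p])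
  have k3: "smooth_fun_at (total_atlas A) (total A) (\<lambda>q. 0) p"
    by (rule smooth_at_const[OF sA smooth_atlas_euc p]) (use p points_total_atlas[OF mul.vA] in auto)
  have pU: "proj A (t p) \<in> U1" using tp t1(2) by simp
  show ?thesis
  \<comment> \<open>Solve \<open>t q = q (vinv q)\<close> with the product and the first factor
    prescribed; the kernel vanishes by left cancellation.\<close>
  proof (rule mul.rel_smooth(3)[of "total_atlas A" p "total A" t "\<lambda>q. q" vinv U1 \<tau>1 U2 \<tau>2 U3 \<tau>3 "\<lambda>v. v" "\<lambda>v. v" "\<lambda>_. 0",
        OF sA p R b b2 t1(1) t2(1) t3(1) pU t2(2) t3(2) linear_ident linear_ident linear_zero _ k1 k2 k3])
    fix z' x' y' assume a: "(z', (x', y')) \<in> Mul" "x' \<in> fiber A ?g" "y' \<in> fiber A (proj A (vinv p))" "\<tau>1 z' = 0" "\<tau>2 x' = 0"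
    let ?k = "(\<lambda>(g, h). g \<otimes>\<^bsub>H\<^esub> h) (?g, proj A (vinv p))"
    have ke: "?k = e" using mul.rel_base(4)[OF R[OF p]] tp by simp
    have z: "z' = vzero A ?k" using triv_zero_iff[OF mul.vA t1, of z'] mul.rel_fiber[OF a(1-3)] a(4) ke by simp
    have x: "x' = vzero A ?g" using triv_zero_iff[OF mul.vA t2 a(2)] a(5) by simp
    have "y' = vzero A (proj A (vinv p))"
      using a(1) mul.rel_zero[OF g vp] mul_left_cancel[of "vzero A ?k" "vzero A ?g" y'] unfolding z x by blast
    then show "z' = vzero A ?k \<and> x' = vzero A ?g \<and> y' = vzero A (proj A (vinv p))" using z x by simp
  qed
qed

text \<open>Obtained as the target of the inverse, since the moment map lemma covers left
  units.\<close>

lemma s_smooth: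
  assumes p: "p \<in> total A" shows "smooth_at (total_atlas A) (total A) (total_atlas A) s p"
proof -
  have vp: "vinv p \<in> total A" using vinv[OF p] by blast
  have "smooth_at (total_atlas A) (total A) (total_atlas A) (\<lambda>q. t (vinv q)) p"
    by (rule smooth_at_compose[OF vector_bundleD(3)[OF mul.vA] vinv_smooth[OF p] t_smooth[OF vp]]) (use vinv in blast)
  then show ?thesis by (rule smooth_at_cong) (use vinv in simp)
qed

text \<open>Covers four cases at once: \<open>f\<close> is the source or the target map, and
  \<open>F\<close> is \<open>total A\<close> or \<open>E\<close>. As \<open>F\<close> is closed
  under adding elements of \<open>E\<close>, the section through a point of \<open>F\<close> stays
  in \<open>F\<close>.\<close>

lemma fiber_section_submersion:
  assumes sub: "subatlas (total_atlas A) F \<B>" and emb: "embedded_submanifold \<B> (E \<inter> fiber A e)"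
    and F: "E \<inter> fiber A e \<subseteq> F" "F \<subseteq> total A" "\<And>x y. x \<in> F \<Longrightarrow> y \<in> E \<Longrightarrow> proj A x = proj A y \<Longrightarrow> vadd A x y \<in> F"
    and sm: "\<And>x. x \<in> total A \<Longrightarrow> smooth_at (total_atlas A) (total A) (total_atlas A) f x"
    and f: "\<And>x. x \<in> total A \<Longrightarrow> f x \<in> E \<inter> fiber A e"
    and add: "\<And>g x y. x \<in> fiber A g \<Longrightarrow> y \<in> fiber A g \<Longrightarrow> f (vadd A x y) = vadd A (f x) (f y)"
    and sc: "\<And>g x y c. x \<in> fiber A g \<Longrightarrow> y \<in> fiber A g \<Longrightarrow> f (vscale A c x) = vscale A c (f x)"
    and bij: "\<And>g. g \<in> points (base A) \<Longrightarrow> bij_betw f (E \<inter> fiber A g) (E \<inter> fiber A e)"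
  shows "submersion \<B> (restrict_atlas \<B> (E \<inter> fiber A e)) f"
proof -
  let ?U = "E \<inter> fiber A e" and ?R = "restrict_atlas \<B> (E \<inter> fiber A e)"
  note sE = dirac_structureD(2)[OF mul.dA] and sA = vector_bundleD(3)[OF mul.vA]
  have sB: "smooth_atlas \<B>" and pB: "points \<B> = F" using sub unfolding subatlas_def by auto
  have sR: "smooth_atlas ?R" and pR: "points ?R = ?U" using emb unfolding embedded_submanifold_def by auto
  note subR = subatlas_restrict[OF sB emb]
  show ?thesis
  proof (rule submersionI[OF sB sR])
    show "smooth_map \<B> ?R f"
    proof (rule smooth_map_onI[OF sB sR])
      fix p assume "p \<in> points \<B>"
      then have p: "p \<in> F" using pB by simp
      have "smooth_at (total_atlas A) F (total_atlas A) f p" using sm p F(2) by (intro smooth_at_mono[OF sm F(2) p]) blast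
      then have "smooth_at \<B> F (total_atlas A) f p" using smooth_at_subatlas_dom[OF sub subset_refl p sA] by simp
      then have "smooth_at \<B> F \<B> f p" using smooth_at_subatlas_cod[OF sub _ sB, of F f] f F(1,2) by blast
      then show "smooth_at \<B> (points \<B>) ?R f p" unfolding pB using smooth_at_subatlas_cod[OF subR _ sB, of F f] f F(2) by blast
    qed
    fix p assume "p \<in> points \<B>"
    then have p: "p \<in> F" "p \<in> total A" using pB F(2) by auto
    let ?g = "proj A p"
    have g: "?g \<in> points (base A)" "p \<in> fiber A ?g" using vector_bundleD(4)[OF mul.vA p(2)] p(2) by (auto simp: fiber_def)
    define \<sigma> where "\<sigma> = inv_into (E \<inter> fiber A ?g) f"
    have s1: "\<sigma> v \<in> E" "\<sigma> v \<in> fiber A ?g" "f (\<sigma> v) = v" if "v \<in> ?U" for v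
    proof -
      have "v \<in> f ` (E \<inter> fiber A ?g)" using bij[OF g(1)] that unfolding bij_betw_def by blast
      then show "\<sigma> v \<in> E" "\<sigma> v \<in> fiber A ?g" "f (\<sigma> v) = v"
        unfolding \<sigma>_def using inv_into_into[of v f "E \<inter> fiber A ?g"] f_inv_into_f[of v f "E \<inter> fiber A ?g"] by auto
    qed
    have s2: "\<sigma> (f x) = x" if "x \<in> E \<inter> fiber A ?g" for x
      unfolding \<sigma>_def using bij[OF g(1)] that by (intro inv_into_f_f) (auto simp: bij_betw_def)
    define S where "S v = vadd A p (vdiff A (\<sigma> v) (\<sigma> (f p)))" for v
    note fp = f[OF p(2)]
    have df: "vdiff A (\<sigma> v) (\<sigma> (f p)) \<in> E \<inter> fiber A ?g" if "v \<in> ?U" for v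
      using E_diff s1 that fp by blast
    have SF: "S v \<in> F" "S v \<in> fiber A ?g" if "v \<in> ?U" for v
      using F(3)[OF p(1), of "vdiff A (\<sigma> v) (\<sigma> (f p))"] df[OF that] fiber_ops(1)[OF mul.vA g(1,2), of "vdiff A (\<sigma> v) (\<sigma> (f p))"]
      unfolding S_def by (auto simp: fiber_def)
    show "\<exists>\<sigma>. smooth_map ?R \<B> \<sigma> \<and> \<sigma> (f p) = p \<and> (\<forall>b\<in>points ?R. f (\<sigma> b) = b)"
    proof (intro exI[of _ S] conjI ballI)
      show "S (f p) = p"
        unfolding S_def using fiber_ops(8)[OF mul.vA g(1) s1(2)[OF fp] s1(2)[OF fp]] fiber_ops(6)[OF mul.vA g(1,2,2)] by simp
      fix b assume "b \<in> points ?R"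
      then have b: "b \<in> ?U" using pR by simp
      have neg: "vscale A (- 1) (\<sigma> (f p)) \<in> fiber A ?g" using fiber_ops(2)[OF mul.vA g(1)] s1(2)[OF fp] by blast
      have "f (vdiff A (\<sigma> b) (\<sigma> (f p))) = vdiff A b (f p)"
        unfolding vdiff_def using add[OF s1(2)[OF b] neg] sc[OF s1(2)[OF fp] s1(2)[OF fp]] s1(3)[OF b] s1(3)[OF fp] by simp
      then show "f (S b) = b"
        unfolding S_def using add[OF g(2), of "vdiff A (\<sigma> b) (\<sigma> (f p))"] df[OF b] fiber_ops(12)[OF mul.vA e_in, of "f p" b] fp b by simp
    next
      show "smooth_map ?R \<B> S"
      proof (rule smooth_map_onI[OF sR sB])
        fix v assume "v \<in> points ?R"
        then have v: "v \<in> ?U" using pR by simp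
        obtain U \<tau> W where t: "(U, \<tau>) \<in> max_triv A" "e \<in> U" "subspace W"
          "\<And>m. m \<in> U \<inter> points (base A) \<Longrightarrow> \<tau> ` (E \<inter> fiber A m) = W" using vector_subbundleD(5)[OF sE e_in] by blast
        obtain X \<tau>' where x: "(X, \<tau>') \<in> max_triv A" "?g \<in> X" by (rule max_triv_at[OF mul.vA g(1)])
        obtain k where k: "trivialization A k (X, \<tau>')" using max_trivD(1)[OF mul.vA x(1)] by blast
        have fl: "fiber_linear A ?g \<tau>'" by (rule trivializationD(2)[OF k x(2)])
        let ?E = "sub_bundle A (points (base A)) E"
        have ut: "(U \<inter> points (base A), \<tau>) \<in> triv ?E" by (rule triv_sub_bundleI[OF t(1,3,4)])
        obtain r where r: "trivialization ?E r (U \<inter> points (base A), \<tau>)"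
          using vector_bundleD(5)[OF vector_subbundleD(3)[OF sE]] ut by blast
        have fE: "fiber ?E e = ?U" using vector_subbundleD(2)[OF sE] by (auto simp: sub_bundle_def fiber_def)
        have \<sigma>l: "\<sigma> (vadd A v w) = vadd A (\<sigma> v) (\<sigma> w)" "\<sigma> (vscale A c v) = vscale A c (\<sigma> v)" if vw: "v \<in> ?U" "w \<in> ?U" for v w c
        proof -
          have pr: "proj A (\<sigma> v) = proj A (\<sigma> w)" using s1(2)[OF vw(1)] s1(2)[OF vw(2)] by (simp add: fiber_def)
          have "vadd A (\<sigma> v) (\<sigma> w) \<in> E \<inter> fiber A ?g"
            using vector_subbundleD(6)[OF sE s1(1)[OF vw(1)] s1(1)[OF vw(2)] pr] fiber_ops(1)[OF mul.vA g(1) s1(2)[OF vw(1)] s1(2)[OF vw(2)]] by blast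
          from s2[OF this] show "\<sigma> (vadd A v w) = vadd A (\<sigma> v) (\<sigma> w)"
            using add[OF s1(2)[OF vw(1)] s1(2)[OF vw(2)]] s1(3) vw by simp
          have "vscale A c (\<sigma> v) \<in> E \<inter> fiber A ?g"
            using vector_subbundleD(7)[OF sE s1(1)[OF vw(1)]] fiber_ops(2)[OF mul.vA g(1) s1(2)[OF vw(1)] s1(2)[OF vw(1)]] by blast
          from s2[OF this] show "\<sigma> (vscale A c v) = vscale A c (\<sigma> v)"
            using sc[OF s1(2)[OF vw(1)] s1(2)[OF vw(1)]] s1(3) vw by simp
        qed
        have "fiber_linear ?E e (\<lambda>v. \<tau>' (\<sigma> v))"
          unfolding fiber_linear_def fE
          using \<sigma>l fl s1(2) by (simp add: sub_bundle_def fiber_linear_def)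
        from fiber_linear_rep[OF r _ this] obtain Lm where Lm: "linear Lm" "\<And>v. v \<in> ?U \<Longrightarrow> \<tau>' (\<sigma> v) = Lm (\<tau> v)"
          unfolding fE using t(2) e_in by blast
        \<comment> \<open>All values lie in the fiber through \<open>p\<close> and all arguments in
          the fiber over \<open>e\<close>. In coordinates the section is a constant plus a linear
          map, which exists because \<open>\<sigma>\<close> inverts a linear bijection.\<close>
        have aff: "\<tau>' (S v) = (\<tau>' p - \<tau>' (\<sigma> (f p))) + Lm (\<tau> v)" if "v \<in> ?U" for v
        proof -
          have "\<tau>' (S v) = \<tau>' p + \<tau>' (vdiff A (\<sigma> v) (\<sigma> (f p)))"
            unfolding S_def using fl g(2) df[OF that] by (simp add: fiber_linear_def)
          also have "\<tau>' (vdiff A (\<sigma> v) (\<sigma> (f p))) = \<tau>' (\<sigma> v) - \<tau>' (\<sigma> (f p))"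
            by (rule fiber_linear_vdiff[OF mul.vA g(1) fl s1(2)[OF that] s1(2)[OF fp]])
          finally show ?thesis using Lm(2)[OF that] by simp
        qed
        have "smooth_at (total_atlas A) ?U (total_atlas A) S v"
          by (rule smooth_at_fiber_affine[OF mul.vA t(1,2) _ x SF(2) Lm(1) aff v]) (blast | assumption)+
        then have "smooth_at (total_atlas A) ?U \<B> S v" using smooth_at_subatlas_cod[OF sub _ sA, of ?U S] SF(1) by blast
        then have "smooth_at \<B> ?U \<B> S v" using smooth_at_subatlas_dom[OF sub F(1) v sB] by simp
        then show "smooth_at ?R (points ?R) \<B> S v" unfolding pR using smooth_at_subatlas_dom[OF subR subset_refl v sB] by simp
      qed
    qed
  qed
qed

end

section \<open>The groupoid and its modules\<close>

context dirac_group begin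

interpretation self: dirac_act H A E Mul \<epsilon> A E "\<lambda>(g, h). g \<otimes>\<^bsub>H\<^esub> h" Mul
  by unfold_locales (rule self_action)

definition Gd where
  "Gd = \<lparr>gunits = E \<inter> fiber A e, gsrc = s, gtgt = t, gmult = rel_app Mul, ginv = vinv\<rparr>"

lemma Gd_simps [simp]:
  "gunits Gd = E \<inter> fiber A e" "gsrc Gd = s" "gtgt Gd = t" "gmult Gd = rel_app Mul" "ginv Gd = vinv"
  by (simp_all add: Gd_def)

text \<open>The units already lie in \<open>E\<close>, so restriction changes none of the
  data.\<close>

lemma sub_groupoid_Gd: "sub_groupoid Gd E = Gd"
  unfolding sub_groupoid_def Gd_def by auto

abbreviation "EE \<equiv> sub_bundle A (points (base A)) E"

lemma sub_E: "vector_subbundle A (points (base A)) E"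
  by (rule dirac_structureD(2)[OF mul.dA])

lemma E_total: "E \<subseteq> total A"
  by (rule vector_subbundleD(2)[OF sub_E])

lemma EE_simps: "total EE = E" "base EE = max_atlas (base A)" "fiber EE g = E \<inter> fiber A g"
  using E_total by (auto simp: sub_bundle_def restrict_atlas_points fiber_def)

text \<open>Stated for any \<open>F\<close> closed under product and inversion, to serve both
  \<open>A\<close> and \<open>E\<close>. Relational associativity only yields some intermediate
  product; its uniqueness turns this into the equation.\<close>

lemma groupoid_on:
  assumes F: "F \<subseteq> total A" "E \<inter> fiber A e \<subseteq> F" and mul: "\<And>x y z. (z, (x, y)) \<in> Mul \<Longrightarrow> x \<in> F \<Longrightarrow> y \<in> F \<Longrightarrow> z \<in> F"
    and inv: "\<And>x. x \<in> F \<Longrightarrow> vinv x \<in> F"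
  shows "groupoid F Gd"
  unfolding groupoid_def Gd_simps
proof (intro conjI ballI impI)
  show "E \<inter> fiber A e \<subseteq> F" by (rule F(2))
  show "s u = u" "t u = u" if "u \<in> E \<inter> fiber A e" for u using s_unit[OF that] t_unit[OF that] by auto
  fix x assume "x \<in> F"
  then have x: "x \<in> F" "x \<in> total A" using F(1) by auto
  show "s x \<in> E \<inter> fiber A e" "t x \<in> E \<inter> fiber A e" by (rule s_in(1)[OF x(2)], rule t_in(1)[OF x(2)])
  show "rel_app Mul (t x) x = x" "rel_app Mul x (s x) = x"
    by (rule self.rel_app_eq[OF t_in(2)[OF x(2)]], rule self.rel_app_eq[OF s_in(2)[OF x(2)]])
  note v = vinv[OF x(2)]
  show "vinv x \<in> F" by (rule inv[OF x(1)])
  show "s (vinv x) = t x" "t (vinv x) = s x" using v by auto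
  show "rel_app Mul (vinv x) x = s x" "rel_app Mul x (vinv x) = t x" by (rule self.rel_app_eq, use v in blast)+
  fix y assume "y \<in> F"
  then have y: "y \<in> F" "y \<in> total A" using F(1) by auto
  have r: "(rel_app Mul x y, (x, y)) \<in> Mul" if "s x = t y" using that mul_iff x(2) y(2) by blast
  show "rel_app Mul x y \<in> F" "s (rel_app Mul x y) = s y" "t (rel_app Mul x y) = t x" if "s x = t y"
    using mul[OF r[OF that] x(1) y(1)] s_mul[OF r[OF that]] t_mul[OF r[OF that]] by auto
  fix z assume "z \<in> F" and c: "s x = t y" "s y = t z"
  then have z: "z \<in> F" "z \<in> total A" using F(1) by auto
  have yz: "(rel_app Mul y z, (y, z)) \<in> Mul" using c(2) mul_iff y(2) z(2) by blast
  have sz: "s (rel_app Mul x y) = t z" using s_mul[OF r[OF c(1)]] c(2) by simp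
  have xy_z: "(rel_app Mul (rel_app Mul x y) z, (rel_app Mul x y, z)) \<in> Mul"
    using sz mul_iff[of _ "rel_app Mul x y" z] mul.rel_base(3)[OF r[OF c(1)]] z(2) by blast
  then obtain v where v: "(rel_app Mul (rel_app Mul x y) z, (x, v)) \<in> Mul" "(v, (y, z)) \<in> Mul" using assocM r[OF c(1)] by blast
  have "v = rel_app Mul y z" by (rule mul_unique[OF v(2) yz])
  then show "rel_app Mul (rel_app Mul x y) z = rel_app Mul x (rel_app Mul y z)" using self.rel_app_eq[OF v(1)] by simp
qed

text \<open>All structure maps are smooth on the ambient total space; the subatlas restricts domain
  and codomain together to \<open>F\<close>.\<close>

lemma lie_groupoid_on:
  assumes sub: "subatlas (total_atlas A) F \<B>" and emb: "embedded_submanifold \<B> (E \<inter> fiber A e)"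
    and F: "E \<inter> fiber A e \<subseteq> F" "F \<subseteq> total A"
    and mul: "\<And>x y z. (z, (x, y)) \<in> Mul \<Longrightarrow> x \<in> F \<Longrightarrow> y \<in> F \<Longrightarrow> z \<in> F" and inv: "\<And>x. x \<in> F \<Longrightarrow> vinv x \<in> F"
    and add: "\<And>x y. x \<in> F \<Longrightarrow> y \<in> E \<Longrightarrow> proj A x = proj A y \<Longrightarrow> vadd A x y \<in> F"
  shows "lie_groupoid \<B> Gd"
  unfolding lie_groupoid_def Gd_simps
proof (intro conjI)
  note sA = vector_bundleD(3)[OF mul.vA]
  have sB: "smooth_atlas \<B>" and pB: "points \<B> = F" using sub unfolding subatlas_def by auto
  show "smooth_manifold \<B>" by (rule smooth_manifold_subatlas[OF sub smooth_manifold_total[OF mul.vA]])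
  show "groupoid (points \<B>) Gd" unfolding pB using F(2,1) mul inv by (rule groupoid_on)
  show "embedded_submanifold \<B> (E \<inter> fiber A e)" by (rule emb)
  show "submersion \<B> (restrict_atlas \<B> (E \<inter> fiber A e)) s"
    by (rule fiber_section_submersion[OF sub emb F add s_smooth s_in(1) s_linear(1) s_linear(2) s_bij])
  show "submersion \<B> (restrict_atlas \<B> (E \<inter> fiber A e)) t"
    by (rule fiber_section_submersion[OF sub emb F add t_smooth t_in(1) t_linear(1) t_linear(2) t_bij])
  show "smooth_map \<B> \<B> vinv"
  proof (rule smooth_map_onI[OF sB sB])
    fix p assume "p \<in> points \<B>"
    then have p: "p \<in> F" using pB by simp
    then have "smooth_at (total_atlas A) F (total_atlas A) vinv p" using F(2) by (intro smooth_at_mono[OF vinv_smooth F(2) p]) blast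
    then have "smooth_at \<B> F (total_atlas A) vinv p" using smooth_at_subatlas_dom[OF sub subset_refl p sA] by simp
    then show "smooth_at \<B> (points \<B>) \<B> vinv p" unfolding pB using smooth_at_subatlas_cod[OF sub _ sB, of F vinv] inv by blast
  qed
  let ?T = "{(x, y). x \<in> points \<B> \<and> y \<in> points \<B> \<and> s x = t y}" and ?S = "{(x, y). x \<in> total A \<and> y \<in> total A \<and> s x = t y}"
  show "smooth_map_on (prod_atlas \<B> \<B>) ?T \<B> (\<lambda>(x, y). rel_app Mul x y)"
  proof (rule smooth_map_onI[OF smooth_atlas_prod[OF sB sB] sB])
    fix p assume p: "p \<in> ?T"
    have TT: "?T \<subseteq> ?S" "?T \<subseteq> F \<times> F" using F(2) unfolding pB by auto
    have "smooth_at (prod_atlas (total_atlas A) (total_atlas A)) ?S (total_atlas A) (\<lambda>(x, y). rel_app Mul x y) p"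
      using TT(1) p by (intro mul_smooth) blast
    then have "smooth_at (prod_atlas (total_atlas A) (total_atlas A)) ?T (total_atlas A) (\<lambda>(x, y). rel_app Mul x y) p"
      by (rule smooth_at_mono[OF _ TT(1) p])
    then have "smooth_at (prod_atlas \<B> \<B>) ?T (total_atlas A) (\<lambda>(x, y). rel_app Mul x y) p"
      using smooth_at_subatlas_dom[OF subatlas_prod[OF sub sub] TT(2) p sA] by blast
    moreover have "(\<lambda>(x, y). rel_app Mul x y) q \<in> F" if "q \<in> ?T" for q
    proof -
      from that obtain x y where q: "q = (x, y)" "x \<in> F" "y \<in> F" "s x = t y" unfolding pB by blast
      have "(rel_app Mul x y, (x, y)) \<in> Mul" using mul_iff q F(2) by blast
      then show ?thesis using mul q by simp
    qed
    ultimately show "smooth_at (prod_atlas \<B> \<B>) ?T \<B> (\<lambda>(x, y). rel_app Mul x y) p"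
      using smooth_at_subatlas_cod[OF sub _ smooth_atlas_prod[OF sB sB], of ?T "\<lambda>(x, y). rel_app Mul x y"] by blast
  qed
qed

lemma units_embedded: "embedded_submanifold (total_atlas A) (E \<inter> fiber A e)" "embedded_submanifold (total_atlas EE) (E \<inter> fiber A e)"
proof -
  obtain U \<tau> W where f: "(U, \<tau>) \<in> max_triv A" "e \<in> U" "subspace W"
    "\<And>m. m \<in> U \<inter> points (base A) \<Longrightarrow> \<tau> ` (E \<inter> fiber A m) = W"
    using vector_subbundleD(5)[OF sub_E e_in] by blast
  have W: "\<tau> ` (E \<inter> fiber A e) = W" using f(2) e_in by (intro f(4)) simp
  show "embedded_submanifold (total_atlas A) (E \<inter> fiber A e)"
    by (rule embedded_fiber_subspace[OF mul.vA f(1,2) _ W f(3)]) simp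
  have vE: "vector_bundle EE" by (rule vector_subbundleD(3)[OF sub_E])
  have "(U \<inter> points (base A), \<tau>) \<in> max_triv EE" using triv_subset_max_triv[OF vE] triv_sub_bundleI[OF f(1,3,4)] by blast
  then show "embedded_submanifold (total_atlas EE) (E \<inter> fiber A e)"
    by (rule embedded_fiber_subspace[OF vE _ _ _ W f(3)]) (use f(2) e_in in \<open>auto simp: EE_simps\<close>)
qed

lemma subatlas_A: "subatlas (total_atlas A) (total A) (total_atlas A)"
  using subatlas_refl[OF vector_bundleD(3)[OF mul.vA]] points_total_atlas[OF mul.vA] by simp

lemma vb_groupoid_A: "vb_groupoid H A Gd"
  unfolding vb_groupoid_def Gd_simps
proof (intro conjI lie mul.vA)
  have cl: "vadd A x y \<in> total A" if "x \<in> total A" "y \<in> E" "proj A x = proj A y" for x y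
  proof -
    have "x \<in> fiber A (proj A x)" "y \<in> fiber A (proj A x)" using that E_total by (auto simp: fiber_def)
    from fiber_ops(1)[OF mul.vA vector_bundleD(4)[OF mul.vA that(1)] this] show ?thesis by (simp add: fiber_def)
  qed
  show "lie_groupoid (total_atlas A) Gd"
    by (rule lie_groupoid_on[OF subatlas_A units_embedded(1) _ subset_refl mul.rel_base(3) _ cl])
      (use vinv in \<open>auto simp: fiber_def\<close>)
  \<comment> \<open>The graph of the multiplication is the Lagrangian relation itself, so its being
    a subbundle is part of the data.\<close>
  have "{(rel_app Mul x y, (x, y)) | x y. x \<in> total A \<and> y \<in> total A \<and> s x = t y} = Mul"
    using mul_iff by auto
  then show "vector_subbundle (prod_bundle A (prod_bundle A A)) {(g \<otimes>\<^bsub>H\<^esub> h, (g, h)) | g h. g \<in> carrier H \<and> h \<in> carrier H}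
    {(rel_app Mul x y, (x, y)) | x y. x \<in> total A \<and> y \<in> total A \<and> s x = t y}"
    using mul.sub unfolding carrier by simp
qed

lemma vb_groupoid_E: "vb_groupoid H EE Gd"
  unfolding vb_groupoid_def Gd_simps
proof (intro conjI)
  show "lie_group H (base EE)" unfolding EE_simps by (rule lie_group_max_atlas[OF lie])
  show "vector_bundle EE" by (rule vector_subbundleD(3)[OF sub_E])
  show "lie_groupoid (total_atlas EE) Gd"
  proof (rule lie_groupoid_on[OF subatlas_sub_bundle[OF mul.vA sub_E] units_embedded(2) _ E_total])
    show "z \<in> E" if "(z, (x, y)) \<in> Mul" "x \<in> E" "y \<in> E" for x y z by (rule mul_E[OF that])
    show "vadd A x y \<in> E" if "x \<in> E" "y \<in> E" "proj A x = proj A y" for x y by (rule vector_subbundleD(6)[OF sub_E that])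
  qed (use E_vinv in auto)
  \<comment> \<open>For \<open>E\<close> the graph is the intersection treated by
    \<open>sub_graph\<close>: products of elements of \<open>E\<close> stay in
    \<open>E\<close>.\<close>
  have "{(rel_app Mul x y, (x, y)) | x y. x \<in> total EE \<and> y \<in> total EE \<and> s x = t y} = Mul \<inter> (E \<times> (E \<times> E))"
    unfolding EE_simps
  proof (intro subset_antisym subsetI)
    fix w assume "w \<in> {(rel_app Mul x y, (x, y)) | x y. x \<in> E \<and> y \<in> E \<and> s x = t y}"
    then obtain x y where w: "w = (rel_app Mul x y, (x, y))" "x \<in> E" "y \<in> E" "s x = t y" by blast
    then have "(rel_app Mul x y, (x, y)) \<in> Mul" using mul_iff E_total by blast
    then show "w \<in> Mul \<inter> (E \<times> (E \<times> E))" using w mul_E by blast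
  next
    fix w assume "w \<in> Mul \<inter> (E \<times> (E \<times> E))"
    then obtain z x y where w: "w = (z, (x, y))" "(z, (x, y)) \<in> Mul" "x \<in> E" "y \<in> E" by blast
    then show "w \<in> {(rel_app Mul x y, (x, y)) | x y. x \<in> E \<and> y \<in> E \<and> s x = t y}" using mul_iff[of z x y] by blast
  qed
  then show "vector_subbundle (prod_bundle EE (prod_bundle EE EE)) {(g \<otimes>\<^bsub>H\<^esub> h, (g, h)) | g h. g \<in> carrier H \<and> h \<in> carrier H}
    {(rel_app Mul x y, (x, y)) | x y. x \<in> total EE \<and> y \<in> total EE \<and> s x = t y}"
    using mul.sub_graph unfolding carrier by simp
qed

end

section \<open>The modules \<open>P\<close> and \<open>L\<close>\<close>

context dirac_act begin

text \<open>One statement for \<open>P\<close> over \<open>A\<close> and for \<open>L\<close> over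
  \<open>E\<close>; what differs, namely the presentation of the action on the base and the graph,
  enters as a hypothesis.\<close>

lemma module_on:
  fixes V :: "('h, 'b, 'a, 'f, 'v) vbundle_scheme" and Q :: "('m, 'c, 'p, 'g, 'w) vbundle_scheme"
  assumes vb: "vb_groupoid H V Gd" and V: "subatlas (total_atlas A) F (total_atlas V)" "total V = F"
    and Q: "vector_bundle Q" "subatlas (total_atlas P) K (total_atlas Q)" "total Q = K"
    and FK: "F \<subseteq> total A" "E \<inter> fiber A e \<subseteq> F" "K \<subseteq> total P" "\<And>x y z. (z, (x, y)) \<in> Act \<Longrightarrow> x \<in> F \<Longrightarrow> y \<in> K \<Longrightarrow> z \<in> K"
    and a: "smooth_action H (base V) (base Q) act"
    and gr: "vector_subbundle (prod_bundle Q (prod_bundle V Q)) {(act (h, m), (h, m)) | h m. h \<in> carrier H \<and> m \<in> points (base Q)}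
       {(rel_app Act x y, (x, y)) | x y. x \<in> F \<and> y \<in> K \<and> s x = u y}"
  shows "vb_module H V Gd Q act u (rel_app Act)"
  unfolding vb_module_def Gd_simps V(2) Q(3)
proof (intro conjI vb Q(1) a gr ballI impI)
  note sA = vector_bundleD(3)[OF mul.vA] and sP = vector_bundleD(3)[OF ac.vP]
  have sV: "smooth_atlas (total_atlas V)" and sQ: "smooth_atlas (total_atlas Q)" and pQ: "points (total_atlas Q) = K"
    using V(1) Q(2) unfolding subatlas_def by auto
  have emb: "embedded_submanifold (total_atlas V) (E \<inter> fiber A e)" using vb unfolding vb_groupoid_def lie_groupoid_def by simp
  have sR: "smooth_atlas (restrict_atlas (total_atlas V) (E \<inter> fiber A e))" using emb unfolding embedded_submanifold_def by blast
  note subR = subatlas_restrict[OF sV emb]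
  have r: "(rel_app Act x y, (x, y)) \<in> Act" if "x \<in> F" "y \<in> K" "s x = u y" for x y
    using act_iff that FK(1,3) by blast
  have uF: "u y \<in> E \<inter> fiber A e" "u y \<in> F" if "y \<in> K" for y using u_in(1) FK that by blast+
  show "smooth_map (total_atlas Q) (restrict_atlas (total_atlas V) (E \<inter> fiber A e)) u"
  proof (rule smooth_map_onI[OF sQ sR])
    fix p assume "p \<in> points (total_atlas Q)"
    then have p: "p \<in> K" using pQ by simp
    then have "smooth_at (total_atlas P) K (total_atlas A) u p" using FK(3) by (intro smooth_at_mono[OF u_smooth FK(3) p]) blast
    then have "smooth_at (total_atlas Q) K (total_atlas A) u p" using smooth_at_subatlas_dom[OF Q(2) subset_refl p sA] by simp
    then have "smooth_at (total_atlas Q) K (total_atlas V) u p" using smooth_at_subatlas_cod[OF V(1) uF(2) sQ, of K] by simp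
    then show "smooth_at (total_atlas Q) (points (total_atlas Q)) (restrict_atlas (total_atlas V) (E \<inter> fiber A e)) u p"
      unfolding pQ using smooth_at_subatlas_cod[OF subR uF(1) sQ, of K] by simp
  qed
  let ?T = "{(x, y). x \<in> F \<and> y \<in> K \<and> s x = u y}" and ?S = "{(x, y). x \<in> total A \<and> y \<in> total P \<and> s x = u y}"
  show "smooth_map_on (prod_atlas (total_atlas V) (total_atlas Q)) ?T (total_atlas Q) (\<lambda>(x, y). rel_app Act x y)"
  proof (rule smooth_map_onI[OF smooth_atlas_prod[OF sV sQ] sQ])
    fix p assume p: "p \<in> ?T"
    have TT: "?T \<subseteq> ?S" "?T \<subseteq> F \<times> K" using FK(1,3) by auto
    have "smooth_at (prod_atlas (total_atlas A) (total_atlas P)) ?S (total_atlas P) (\<lambda>(x, y). rel_app Act x y) p"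
      using TT(1) p by (intro op_smooth) blast
    then have "smooth_at (prod_atlas (total_atlas A) (total_atlas P)) ?T (total_atlas P) (\<lambda>(x, y). rel_app Act x y) p"
      by (rule smooth_at_mono[OF _ TT(1) p])
    then have "smooth_at (prod_atlas (total_atlas V) (total_atlas Q)) ?T (total_atlas P) (\<lambda>(x, y). rel_app Act x y) p"
      using smooth_at_subatlas_dom[OF subatlas_prod[OF V(1) Q(2)] TT(2) p sP] by blast
    moreover have "(\<lambda>(x, y). rel_app Act x y) q \<in> K" if "q \<in> ?T" for q
    proof -
      from that obtain x y where q: "q = (x, y)" "x \<in> F" "y \<in> K" "s x = u y" by blast
      show ?thesis using FK(4)[OF r[OF q(2-4)] q(2,3)] q(1) by simp
    qed
    ultimately show "smooth_at (prod_atlas (total_atlas V) (total_atlas Q)) ?T (total_atlas Q) (\<lambda>(x, y). rel_app Act x y) p"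
      using smooth_at_subatlas_cod[OF Q(2) _ smooth_atlas_prod[OF sV sQ], of ?T "\<lambda>(x, y). rel_app Act x y"] by blast
  qed
  show "u (rel_app Act x y) = t x" if "x \<in> F" "y \<in> K" "s x = u y" for x y
    by (rule u_act[OF r[OF that]])
  show "rel_app Act (u y) y = y" if "y \<in> K" for y
    by (rule rel_app_eq[OF u_in(2)]) (use that FK(3) in blast)
  fix x x' y assume x: "x \<in> F" "x' \<in> F" "y \<in> K" "s x = t x'" "s x' = u y"
  have m: "(rel_app Mul x x', (x, x')) \<in> Mul" using mul_iff x FK(1) by blast
  have "s (rel_app Mul x x') = u y" using s_mul[OF m] x(5) by simp
  then have "(rel_app Act (rel_app Mul x x') y, (rel_app Mul x x', y)) \<in> Act"
    using act_iff[of _ "rel_app Mul x x'" y] mul.rel_base(3)[OF m] x(3) FK(3) by blast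
  then obtain v where v: "(rel_app Act (rel_app Mul x x') y, (x, v)) \<in> Act" "(v, (x', y)) \<in> Act" using assocP m by blast
  show "rel_app Act (rel_app Mul x x') y = rel_app Act x (rel_app Act x' y)"
    using rel_app_eq[OF v(1)] rel_app_eq[OF v(2)] by simp
qed

abbreviation "LL \<equiv> sub_bundle P (points (base P)) L"

lemma sub_L: "vector_subbundle P (points (base P)) L"
  by (rule dirac_structureD(2)[OF ac.dP])

lemma module_P: "vb_module H A Gd P act u (rel_app Act)"
proof (rule module_on[OF vb_groupoid_A subatlas_A refl ac.vP _ refl subset_refl _ subset_refl])
  show "subatlas (total_atlas P) (total P) (total_atlas P)"
    using subatlas_refl[OF vector_bundleD(3)[OF ac.vP]] points_total_atlas[OF ac.vP] by simp
  show "E \<inter> fiber A e \<subseteq> total A" by (auto simp: fiber_def)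
  show "z \<in> total P" if "(z, (x, y)) \<in> Act" for x y z by (rule ac.rel_base(3)[OF that])
  show "smooth_action H (base A) (base P) act" by (rule smooth_act)
  have "{(rel_app Act x y, (x, y)) | x y. x \<in> total A \<and> y \<in> total P \<and> s x = u y} = Act" using act_iff by auto
  then show "vector_subbundle (prod_bundle P (prod_bundle A P)) {(act (h, m), (h, m)) | h m. h \<in> carrier H \<and> m \<in> points (base P)}
    {(rel_app Act x y, (x, y)) | x y. x \<in> total A \<and> y \<in> total P \<and> s x = u y}"
    using ac.sub unfolding carrier by simp
qed

lemma module_L: "vb_module H EE Gd LL act u (rel_app Act)"
proof (rule module_on[OF vb_groupoid_E subatlas_sub_bundle[OF mul.vA sub_E] _ vector_subbundleD(3)[OF sub_L]
      subatlas_sub_bundle[OF ac.vP sub_L] _ E_total _ vector_subbundleD(2)[OF sub_L]])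
  have bL: "base LL = max_atlas (base P)" by (simp add: sub_bundle_def restrict_atlas_points)
  have sb: "smooth_atlas (base A)" "smooth_atlas (base P)" using vector_bundleD(2)[OF mul.vA] vector_bundleD(2)[OF ac.vP] by auto
  show "total EE = E" "total LL = L" by (simp_all add: sub_bundle_def)
  show "E \<inter> fiber A e \<subseteq> E" by blast
  show "z \<in> L" if "(z, (x, y)) \<in> Act" "x \<in> E" "y \<in> L" for x y z by (rule ac.rel_forward[OF that])
  show "smooth_action H (base EE) (base LL) act"
    unfolding EE_simps bL by (rule smooth_action_max_atlas[OF sb smooth_act])
  have "{(rel_app Act x y, (x, y)) | x y. x \<in> E \<and> y \<in> L \<and> s x = u y} = Act \<inter> (L \<times> (E \<times> L))"
  proof (intro subset_antisym subsetI)
    fix w assume "w \<in> {(rel_app Act x y, (x, y)) | x y. x \<in> E \<and> y \<in> L \<and> s x = u y}"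
    then obtain x y where w: "w = (rel_app Act x y, (x, y))" "x \<in> E" "y \<in> L" "s x = u y" by blast
    then have "(rel_app Act x y, (x, y)) \<in> Act" using act_iff E_total vector_subbundleD(2)[OF sub_L] by blast
    then show "w \<in> Act \<inter> (L \<times> (E \<times> L))" using w ac.rel_forward by blast
  next
    fix w assume "w \<in> Act \<inter> (L \<times> (E \<times> L))"
    then obtain z x y where w: "w = (z, (x, y))" "(z, (x, y)) \<in> Act" "x \<in> E" "y \<in> L" by blast
    then show "w \<in> {(rel_app Act x y, (x, y)) | x y. x \<in> E \<and> y \<in> L \<and> s x = u y}" using act_iff[of z x y] by blast
  qed
  then show "vector_subbundle (prod_bundle LL (prod_bundle EE LL)) {(act (h, m), (h, m)) | h m. h \<in> carrier H \<and> m \<in> points (base LL)}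
    {(rel_app Act x y, (x, y)) | x y. x \<in> E \<and> y \<in> L \<and> s x = u y}"
    using ac.sub_graph unfolding carrier bL points_max_atlas[OF sb(2)] by simp
qed

end

theorem theoremA:
  fixes H :: "('h, 'z) monoid_scheme"
    and A :: "('h, 'b::euclidean_space, 'a, 'f::euclidean_space) courant"
    and E :: "'a set"
    and Mul :: "('a \<times> ('a \<times> 'a)) set"
    and \<epsilon> :: "('a \<times> unit) set"
  assumes "dirac_lie_group H A E Mul \<epsilon>"
  shows "\<exists>G. vb_groupoid H A G \<and>
      gunits G = E \<inter> fiber A \<one>\<^bsub>H\<^esub> \<and>
      (\<forall>x x\<^sub>1 x\<^sub>2. (x, (x\<^sub>1, x\<^sub>2)) \<in> Mul \<longleftrightarrow>
         x\<^sub>1 \<in> total A \<and> x\<^sub>2 \<in> total A \<and> gsrc G x\<^sub>1 = gtgt G x\<^sub>2 \<and> x = gmult G x\<^sub>1 x\<^sub>2) \<and>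
      vb_subgroupoid H A G E \<and>
      vacant H (sub_bundle A (points (base A)) E) (sub_groupoid G E) \<and>
      gunits (sub_groupoid G E) = E \<inter> fiber A \<one>\<^bsub>H\<^esub> \<and>
      (\<forall>(P :: ('m, 'c::euclidean_space, 'p, 'g::euclidean_space) courant) L act Act.
         dirac_action H A E Mul \<epsilon> P L act Act \<longrightarrow>
         (\<exists>u op. vb_module H A G P act u op \<and>
            (\<forall>y' x y. (y', (x, y)) \<in> Act \<longleftrightarrow>
               x \<in> total A \<and> y \<in> total P \<and> gsrc G x = u y \<and> y' = op x y) \<and>
            vb_submodule H A G E P L act u op))"
proof -
  interpret dg: dirac_group H A E Mul \<epsilon> by unfold_locales (rule assms)
  \<comment> \<open>The groupoid is fixed before any action is considered, so the same structure on
    \<open>A\<close> serves all of its modules.\<close>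
  show ?thesis
  proof (intro exI[of _ dg.Gd] conjI allI impI)
    show "vb_groupoid H A dg.Gd" by (rule dg.vb_groupoid_A)
    show "gunits dg.Gd = E \<inter> fiber A \<one>\<^bsub>H\<^esub>" by simp
    show "(x, (x1, x2)) \<in> Mul \<longleftrightarrow> x1 \<in> total A \<and> x2 \<in> total A \<and> gsrc dg.Gd x1 = gtgt dg.Gd x2 \<and> x = gmult dg.Gd x1 x2" for x x1 x2
      unfolding dg.Gd_simps by (rule dg.mul_iff)
    show sg: "vb_subgroupoid H A dg.Gd E"
      unfolding vb_subgroupoid_def dg.sub_groupoid_Gd using dg.sub_E dg.vb_groupoid_E by blast
    show "vacant H (sub_bundle A (points (base A)) E) (sub_groupoid dg.Gd E)"
      unfolding vacant_def dg.sub_groupoid_Gd dg.EE_simps by simp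
    show "gunits (sub_groupoid dg.Gd E) = E \<inter> fiber A \<one>\<^bsub>H\<^esub>" unfolding dg.sub_groupoid_Gd by simp
    fix P :: "('m, 'c, 'p, 'g) courant" and L act Act
    assume "dirac_action H A E Mul \<epsilon> P L act Act"
    then interpret da: dirac_act H A E Mul \<epsilon> P L act Act by unfold_locales
    show "\<exists>u op. vb_module H A dg.Gd P act u op \<and>
            (\<forall>y' x y. (y', (x, y)) \<in> Act \<longleftrightarrow> x \<in> total A \<and> y \<in> total P \<and> gsrc dg.Gd x = u y \<and> y' = op x y) \<and>
            vb_submodule H A dg.Gd E P L act u op"
    proof (intro exI conjI allI)
      show "vb_module H A dg.Gd P act da.u (rel_app Act)" by (rule da.module_P)
      show "(y', (x, y)) \<in> Act \<longleftrightarrow> x \<in> total A \<and> y \<in> total P \<and> gsrc dg.Gd x = da.u y \<and> y' = rel_app Act x y" for y' x y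
        unfolding dg.Gd_simps by (rule da.act_iff)
      show "vb_submodule H A dg.Gd E P L act da.u (rel_app Act)"
        unfolding vb_submodule_def dg.sub_groupoid_Gd using sg da.sub_L da.module_L by blast
    qed
  qed
qed

end
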